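(* Let $M$ be a $\mathrm{II}_1$ factor and let $N$ be a singular subfactor of $M$. Then $N$ is $\frac{1}{13}$-strongly singular in $M$; that is, for every unitary $u\in M$, $$\tfrac{1}{13}\,\Vert u-\mathbb{E}_N(u)\Vert_2\le \Vert \mathbb{E}_N-\mathbb{E}_{uNu^*}\Vert_{\infty,2}.$$
   Context: $M$ is a $\mathrm{II}_1$ factor with its unique normal faithful tracial state $\tau$, $\Vert x\Vert_2=\tau(x^*x)^{1/2}$, and $\Vert x\Vert$ is the operator norm. A subfactor $N\subseteq M$ is singular if every unitary $u\in M$ with $uNu^*=N$ belongs to $N$. For a von Neumann subalgebra $B\subseteq M$, $\mathbb{E}_B$ denotes the unique normal faithful $\tau$-preserving conditional expectation of $M$ onto $B$. For a linear map $T:M\to M$, $\Vert T\Vert_{\infty,2}=\sup\{\Vert T(x)\Vert_2 : x\in M,\ \Vert x\Vert\le 1\}$. For $0<\alpha\le 1$, $B$ is $\alpha$-strongly singular in $M$ if $\alpha\Vert u-\mathbb{E}_B(u)\Vert_2\le \Vert \mathbb{E}_B-\mathbb{E}_{uBu^*}\Vert_{\infty,2}$ for all unitaries $u\in M$. *)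

theory Defs
  imports "HOL-Analysis.Analysis"
begin

section \<open>Complex Hilbert spaces and their bounded operators\<close>

text \<open>
  The inner product is linear in the first argument. The axiom \<open>cinner_self\<close> says that
  \<open>cinner x x\<close> is real and equals the squared norm; positivity and definiteness follow.
\<close>

class chilbert_space = banach +
  fixes scaleC :: "complex \<Rightarrow> 'a \<Rightarrow> 'a" (infixr "*\<^sub>C" 75)
    and cinner :: "'a \<Rightarrow> 'a \<Rightarrow> complex"
  assumes scaleC_add_right: "c *\<^sub>C (x + y) = c *\<^sub>C x + c *\<^sub>C y"
    and scaleC_add_left: "(c + d) *\<^sub>C x = c *\<^sub>C x + d *\<^sub>C x"
    and scaleC_scaleC: "c *\<^sub>C d *\<^sub>C x = (c * d) *\<^sub>C x"
    and scaleC_of_real: "complex_of_real r *\<^sub>C x = r *\<^sub>R x"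
    and cinner_add_left: "cinner (x + y) z = cinner x z + cinner y z"
    and cinner_scaleC_left: "cinner (c *\<^sub>C x) y = c * cinner x y"
    and cinner_commute: "cinner y x = cnj (cinner x y)"
    and cinner_self: "cinner x x = complex_of_real ((norm x)\<^sup>2)"

lemma norm_scaleC: "norm (c *\<^sub>C x) = cmod c * norm (x :: 'a::chilbert_space)"
proof -
  have "cinner (c *\<^sub>C x) (c *\<^sub>C x) = c * cnj (cinner (c *\<^sub>C x) x)"
    by (metis cinner_scaleC_left cinner_commute)
  also have "\<dots> = (c * cnj c) * complex_of_real ((norm x)\<^sup>2)"
    by (simp add: cinner_scaleC_left cinner_self)
  also have "\<dots> = complex_of_real ((cmod c)\<^sup>2 * (norm x)\<^sup>2)"
    by (simp flip: complex_norm_square)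
  finally have "(norm (c *\<^sub>C x))\<^sup>2 = (cmod c * norm x)\<^sup>2"
    by (metis cinner_self of_real_eq_iff power_mult_distrib)
  then show ?thesis
    by (simp add: power2_eq_iff_nonneg)
qed

lemma bounded_linear_scaleC: "bounded_linear (\<lambda>x::'a::chilbert_space. c *\<^sub>C x)"
proof (rule bounded_linear_intro[where K = "cmod c"])
  show "c *\<^sub>C (x + y) = c *\<^sub>C x + c *\<^sub>C y" for x y :: 'a
    by (rule scaleC_add_right)
  show "c *\<^sub>C (r *\<^sub>R x) = r *\<^sub>R (c *\<^sub>C x)" for r and x :: 'a
    by (simp add: scaleC_of_real[symmetric] scaleC_scaleC mult.commute)
  show "norm (c *\<^sub>C x) \<le> norm x * cmod c" for x :: 'a
    by (simp add: norm_scaleC)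
qed

text \<open>
  The type \<open>'h \<Rightarrow>\<^sub>L 'h\<close> consists of the bounded \<^emph>\<open>real\<close>-linear operators, with the operator norm;
  \<open>B(H)\<close> is the subset \<open>bounded_ops\<close> of the complex-linear ones. Multiplication of an operator
  by a complex scalar is written as composition with \<open>scalar_op c\<close>.
\<close>

definition scalar_op :: "complex \<Rightarrow> 'h::chilbert_space \<Rightarrow>\<^sub>L 'h"
  where "scalar_op c = Blinfun (\<lambda>x. c *\<^sub>C x)"

lemma scalar_op_apply [simp]: "blinfun_apply (scalar_op c) x = c *\<^sub>C x"
  by (simp add: scalar_op_def bounded_linear_Blinfun_apply bounded_linear_scaleC)

definition bounded_ops :: "('h::chilbert_space \<Rightarrow>\<^sub>L 'h) set"
  where "bounded_ops = {T. \<forall>c x. blinfun_apply T (c *\<^sub>C x) = c *\<^sub>C blinfun_apply T x}"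

definition adj :: "('h::chilbert_space \<Rightarrow>\<^sub>L 'h) \<Rightarrow> 'h \<Rightarrow>\<^sub>L 'h"
  where "adj T = (THE S. \<forall>x y. cinner (blinfun_apply T x) y = cinner x (blinfun_apply S y))"

definition nonneg_op :: "('h::chilbert_space \<Rightarrow>\<^sub>L 'h) \<Rightarrow> bool"
  where "nonneg_op T \<longleftrightarrow>
    T \<in> bounded_ops \<and>
    (\<forall>x. Im (cinner (blinfun_apply T x) x) = 0 \<and> 0 \<le> Re (cinner (blinfun_apply T x) x))"

definition op_le :: "('h::chilbert_space \<Rightarrow>\<^sub>L 'h) \<Rightarrow> ('h \<Rightarrow>\<^sub>L 'h) \<Rightarrow> bool"
  where "op_le S T \<longleftrightarrow> nonneg_op (T - S)"

definition commutant :: "('h::chilbert_space \<Rightarrow>\<^sub>L 'h) set \<Rightarrow> ('h \<Rightarrow>\<^sub>L 'h) set"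
  where "commutant S = {T \<in> bounded_ops. \<forall>A\<in>S. T o\<^sub>L A = A o\<^sub>L T}"

section \<open>Von Neumann algebras and \<open>II\<^sub>1\<close> factors\<close>

definition von_neumann_algebra :: "('h::chilbert_space \<Rightarrow>\<^sub>L 'h) set \<Rightarrow> bool"
  where "von_neumann_algebra M \<longleftrightarrow>
    M \<subseteq> bounded_ops \<and> id_blinfun \<in> M \<and>
    (\<forall>x\<in>M. \<forall>y\<in>M. x + y \<in> M \<and> x o\<^sub>L y \<in> M) \<and>
    (\<forall>c. \<forall>x\<in>M. scalar_op c o\<^sub>L x \<in> M) \<and>
    (\<forall>x\<in>M. adj x \<in> M) \<and>
    commutant (commutant M) = M"

definition factor :: "('h::chilbert_space \<Rightarrow>\<^sub>L 'h) set \<Rightarrow> bool"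
  where "factor M \<longleftrightarrow>
    von_neumann_algebra M \<and> id_blinfun \<noteq> (0 :: 'h \<Rightarrow>\<^sub>L 'h) \<and> M \<inter> commutant M = range scalar_op"

definition unitaries :: "('h::chilbert_space \<Rightarrow>\<^sub>L 'h) set \<Rightarrow> ('h \<Rightarrow>\<^sub>L 'h) set"
  where "unitaries M = {u \<in> M. adj u o\<^sub>L u = id_blinfun \<and> u o\<^sub>L adj u = id_blinfun}"

definition projections :: "('h::chilbert_space \<Rightarrow>\<^sub>L 'h) set \<Rightarrow> ('h \<Rightarrow>\<^sub>L 'h) set"
  where "projections M = {p \<in> M. adj p = p \<and> p o\<^sub>L p = p}"

definition minimal_projection ::
    "('h::chilbert_space \<Rightarrow>\<^sub>L 'h) set \<Rightarrow> ('h \<Rightarrow>\<^sub>L 'h) \<Rightarrow> bool"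
  where "minimal_projection M p \<longleftrightarrow>
    p \<in> projections M \<and> p \<noteq> 0 \<and> (\<forall>q\<in>projections M. op_le q p \<longrightarrow> q = 0 \<or> q = p)"

text \<open>
  Murray--von Neumann classification: a factor is of type \<open>II\<^sub>1\<close> if it has no minimal projection
  (not type I) and its identity is a finite projection, i.e. every isometry in it is unitary.
\<close>

definition II1_factor :: "('h::chilbert_space \<Rightarrow>\<^sub>L 'h) set \<Rightarrow> bool"
  where "II1_factor M \<longleftrightarrow>
    factor M \<and>
    (\<nexists>p. minimal_projection M p) \<and>
    (\<forall>v\<in>M. adj v o\<^sub>L v = id_blinfun \<longrightarrow> v o\<^sub>L adj v = id_blinfun)"

section \<open>Subfactors and singularity\<close>

text \<open>Subalgebras are unital: both algebras contain the identity operator of the same space.\<close>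

definition von_neumann_subalgebra ::
    "('h::chilbert_space \<Rightarrow>\<^sub>L 'h) set \<Rightarrow> ('h \<Rightarrow>\<^sub>L 'h) set \<Rightarrow> bool"
  where "von_neumann_subalgebra B M \<longleftrightarrow>
    von_neumann_algebra M \<and> von_neumann_algebra B \<and> B \<subseteq> M"

definition subfactor :: "('h::chilbert_space \<Rightarrow>\<^sub>L 'h) set \<Rightarrow> ('h \<Rightarrow>\<^sub>L 'h) set \<Rightarrow> bool"
  where "subfactor N M \<longleftrightarrow> von_neumann_subalgebra N M \<and> factor N"

definition unitary_conj ::
    "('h::chilbert_space \<Rightarrow>\<^sub>L 'h) \<Rightarrow> ('h \<Rightarrow>\<^sub>L 'h) set \<Rightarrow> ('h \<Rightarrow>\<^sub>L 'h) set"
  where "unitary_conj u B = (\<lambda>b. u o\<^sub>L b o\<^sub>L adj u) ` B"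

definition singular :: "('h::chilbert_space \<Rightarrow>\<^sub>L 'h) set \<Rightarrow> ('h \<Rightarrow>\<^sub>L 'h) set \<Rightarrow> bool"
  where "singular M N \<longleftrightarrow> (\<forall>u\<in>unitaries M. unitary_conj u N = N \<longrightarrow> u \<in> N)"

section \<open>Traces and conditional expectations\<close>

text \<open>
  Normality of a positive map is stated through suprema of increasing nets, here in the form
  of nonempty upward directed sets of self-adjoint elements.
\<close>

definition self_adjoints :: "('h::chilbert_space \<Rightarrow>\<^sub>L 'h) set \<Rightarrow> ('h \<Rightarrow>\<^sub>L 'h) set"
  where "self_adjoints M = {x \<in> M. adj x = x}"

definition directed_in ::
    "('h::chilbert_space \<Rightarrow>\<^sub>L 'h) set \<Rightarrow> ('h \<Rightarrow>\<^sub>L 'h) set \<Rightarrow> bool"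
  where "directed_in M D \<longleftrightarrow>
    D \<noteq> {} \<and> D \<subseteq> self_adjoints M \<and> (\<forall>x\<in>D. \<forall>y\<in>D. \<exists>z\<in>D. op_le x z \<and> op_le y z)"

definition is_op_sup ::
    "('h::chilbert_space \<Rightarrow>\<^sub>L 'h) set \<Rightarrow> ('h \<Rightarrow>\<^sub>L 'h) set \<Rightarrow> ('h \<Rightarrow>\<^sub>L 'h) \<Rightarrow> bool"
  where "is_op_sup M D s \<longleftrightarrow>
    s \<in> self_adjoints M \<and> (\<forall>x\<in>D. op_le x s) \<and>
    (\<forall>t\<in>self_adjoints M. (\<forall>x\<in>D. op_le x t) \<longrightarrow> op_le s t)"

definition normal_faithful_tracial_state ::
    "('h::chilbert_space \<Rightarrow>\<^sub>L 'h) set \<Rightarrow> (('h \<Rightarrow>\<^sub>L 'h) \<Rightarrow> complex) \<Rightarrow> bool"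
  where "normal_faithful_tracial_state M \<tau> \<longleftrightarrow>
    (\<forall>x\<in>M. \<forall>y\<in>M. \<tau> (x + y) = \<tau> x + \<tau> y) \<and>
    (\<forall>c. \<forall>x\<in>M. \<tau> (scalar_op c o\<^sub>L x) = c * \<tau> x) \<and>
    (\<forall>x\<in>M. Im (\<tau> (adj x o\<^sub>L x)) = 0 \<and> 0 \<le> Re (\<tau> (adj x o\<^sub>L x))) \<and>
    \<tau> id_blinfun = 1 \<and>
    (\<forall>x\<in>M. \<forall>y\<in>M. \<tau> (x o\<^sub>L y) = \<tau> (y o\<^sub>L x)) \<and>
    (\<forall>x\<in>M. \<tau> (adj x o\<^sub>L x) = 0 \<longrightarrow> x = 0) \<and>
    (\<forall>D s. directed_in M D \<longrightarrow> is_op_sup M D s \<longrightarrow> Re (\<tau> s) = (SUP x\<in>D. Re (\<tau> x)))"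

text \<open>
  Maps on \<open>M\<close> are represented by functions that are \<open>undefined\<close> outside \<open>M\<close>, so that the
  conditional expectation is unique as a function on the ambient type.
\<close>

definition is_cond_exp ::
    "('h::chilbert_space \<Rightarrow>\<^sub>L 'h) set \<Rightarrow> (('h \<Rightarrow>\<^sub>L 'h) \<Rightarrow> complex) \<Rightarrow> ('h \<Rightarrow>\<^sub>L 'h) set \<Rightarrow>
      (('h \<Rightarrow>\<^sub>L 'h) \<Rightarrow> ('h \<Rightarrow>\<^sub>L 'h)) \<Rightarrow> bool"
  where "is_cond_exp M \<tau> B E \<longleftrightarrow>
    E \<in> M \<rightarrow>\<^sub>E B \<and>
    (\<forall>x\<in>M. \<forall>y\<in>M. E (x + y) = E x + E y) \<and>
    (\<forall>c. \<forall>x\<in>M. E (scalar_op c o\<^sub>L x) = scalar_op c o\<^sub>L E x) \<and>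
    (\<forall>x\<in>M. nonneg_op (E (adj x o\<^sub>L x))) \<and>
    (\<forall>b\<in>B. E b = b) \<and>
    (\<forall>x\<in>M. \<forall>a\<in>B. \<forall>b\<in>B. E (a o\<^sub>L x o\<^sub>L b) = a o\<^sub>L E x o\<^sub>L b) \<and>
    (\<forall>x\<in>M. E (adj x o\<^sub>L x) = 0 \<longrightarrow> x = 0) \<and>
    (\<forall>D s. directed_in M D \<longrightarrow> is_op_sup M D s \<longrightarrow> is_op_sup B (E ` D) (E s)) \<and>
    (\<forall>x\<in>M. \<tau> (E x) = \<tau> x)"

definition cond_exp ::
    "('h::chilbert_space \<Rightarrow>\<^sub>L 'h) set \<Rightarrow> (('h \<Rightarrow>\<^sub>L 'h) \<Rightarrow> complex) \<Rightarrow> ('h \<Rightarrow>\<^sub>L 'h) set \<Rightarrow>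
      ('h \<Rightarrow>\<^sub>L 'h) \<Rightarrow> ('h \<Rightarrow>\<^sub>L 'h)"
  where "cond_exp M \<tau> B = (THE E. is_cond_exp M \<tau> B E)"

section \<open>Strong singularity\<close>

definition norm2 :: "(('h::chilbert_space \<Rightarrow>\<^sub>L 'h) \<Rightarrow> complex) \<Rightarrow> ('h \<Rightarrow>\<^sub>L 'h) \<Rightarrow> real"
  where "norm2 \<tau> x = sqrt (Re (\<tau> (adj x o\<^sub>L x)))"

text \<open>The supremum is taken in the extended reals, so no boundedness of \<open>T\<close> is presupposed.\<close>

definition norm_inf2 ::
    "('h::chilbert_space \<Rightarrow>\<^sub>L 'h) set \<Rightarrow> (('h \<Rightarrow>\<^sub>L 'h) \<Rightarrow> complex) \<Rightarrow>
      (('h \<Rightarrow>\<^sub>L 'h) \<Rightarrow> ('h \<Rightarrow>\<^sub>L 'h)) \<Rightarrow> ereal"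
  where "norm_inf2 M \<tau> T = (SUP x\<in>{x \<in> M. norm x \<le> 1}. ereal (norm2 \<tau> (T x)))"

definition strongly_singular ::
    "('h::chilbert_space \<Rightarrow>\<^sub>L 'h) set \<Rightarrow> (('h \<Rightarrow>\<^sub>L 'h) \<Rightarrow> complex) \<Rightarrow> real \<Rightarrow>
      ('h \<Rightarrow>\<^sub>L 'h) set \<Rightarrow> bool"
  where "strongly_singular M \<tau> \<alpha> B \<longleftrightarrow>
    0 < \<alpha> \<and> \<alpha> \<le> 1 \<and>
    (\<forall>u\<in>unitaries M.
      ereal (\<alpha> * norm2 \<tau> (u - cond_exp M \<tau> B u))
        \<le> norm_inf2 M \<tau> (\<lambda>x. cond_exp M \<tau> B x - cond_exp M \<tau> (unitary_conj u B) x))"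

end

theory Submission
  imports Defs
begin

text \<open>
  Write \<open>\<delta> = d / 13\<close>, where \<open>d\<close> is the distance from \<open>u\<close> to \<open>N\<close> in the trace norm. If the inequality
  failed, every unitary \<open>w\<close> of \<open>N\<close> would satisfy \<open>\<parallel>x - E(x)\<parallel>\<^sub>2 \<le> \<delta>\<close> for \<open>x = u w u\<^sup>*\<close> and for
  \<open>x = u\<^sup>* w u\<close>, and this already forces \<open>d \<le> \<delta>\<close>.

  Put \<open>a = u\<^sup>*\<close>. In the convex hull of the maps \<open>y \<mapsto> w a E(a\<^sup>* w\<^sup>* y)\<close>, \<open>w\<close> a unitary of \<open>N\<close>, a minimising
  sequence for the Hilbert--Schmidt norm converges to a positive contraction \<open>k\<close> of \<open>M\<close> that commutes
  with \<open>N\<close> on both sides, and \<open>\<langle>k a, a\<rangle> \<ge> 1 - \<delta>\<^sup>2\<close>. Its norm \<open>s\<close> is an eigenvalue, and the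
  eigenprojection \<open>g\<close> satisfies \<open>\<parallel>g a\<parallel>\<^sub>2\<^sup>2 \<ge> s\<close>. Since \<open>N' \<inter> M\<close> is trivial, \<open>g 1\<close> is \<open>1\<close> or \<open>0\<close>. In the
  first case \<open>\<parallel>E(u)\<parallel>\<^sub>2\<^sup>2 = s\<close>, which is the claim. In the second case the image \<open>K\<close> of \<open>g\<close> is an
  \<open>N\<close>-bimodule orthogonal to \<open>N\<close>; it is generated by \<open>f = g a\<close> on the right, and, by the same argument
  for \<open>u\<close>, on the left, and the product of its left and right dimensions is less than \<open>2\<close>. A
  Pimsner--Popa estimate then gives \<open>K K\<^sup>* \<subseteq> N\<close> and \<open>K\<^sup>* K \<subseteq> N\<close>, so a maximal partial isometry in \<open>K\<close>
  is a unitary that normalises \<open>N\<close>, contradicting singularity.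
\<close>

section \<open>Minimising sequences\<close>

text \<open>The natural home of the argument is the basic construction of \<open>N\<close> in
  \<open>M\<close>, that is, operators on the Hilbert space completion of \<open>M\<close>. No such
  space is formed here: every operator is a map from \<open>M\<close> to \<open>M\<close>. The
  obstacle is then that each limit must be a bounded element again. This is why operator norm
  estimates accompany the trace norm ones, \<open>kernel_norm_le\<close> above all, and why
  completeness of norm balls in the trace norm is an axiom of the abstract setting. Let
  \<open>c\<close> be the squared trace norm of \<open>f\<close>. The canonical trace of the basic
  construction takes the value \<open>c\<close> on \<open>k\<close> composed with \<open>g\<close>,
  and also the value \<open>s\<close> times the right dimension of \<open>K\<close>; this is the
  origin of \<open>c / s\<close>. Closeness enters twice: \<open>c < 2 * s\<close> makes
  \<open>K\<close> irreducible, so that the left kernel compressed to \<open>K\<close> is a scalar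
  \<open>t\<close>, and \<open>c\<^sup>2 < 2 * (s * t)\<close> says that the product of the
  dimensions is below 2. Since \<open>c\<close> is at most 1, \<open>s\<close> at least
  \<open>1 - \<delta>\<^sup>2\<close> and \<open>t * c\<close> at least
  \<open>1 - 5 * \<delta>\<^sup>2\<close>, a distance \<delta> of at most 1/13 satisfies both with
  room to spare.\<close>

lemma minimising_sequence:
  fixes q :: "'b \<Rightarrow> real" and d :: "'b \<Rightarrow> 'b \<Rightarrow> real"
  assumes ne: "C \<noteq> {}" and pos: "\<And>x. x \<in> C \<Longrightarrow> 0 \<le> q x"
    and mid: "\<And>x y. x \<in> C \<Longrightarrow> y \<in> C \<Longrightarrow> \<exists>z\<in>C. q z \<le> (q x + q y) / 2 - d x y / 4"
  obtains X m where "\<And>n. X n \<in> C" "\<And>n. q (X n) \<le> m + 1 / real (Suc n)"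
    "\<And>y. y \<in> C \<Longrightarrow> m \<le> q y"
    "\<And>x y. x \<in> C \<Longrightarrow> y \<in> C \<Longrightarrow> d x y \<le> 2 * (q x - m) + 2 * (q y - m)"
proof -
  define m where "m = Inf (q ` C)"
  have bdd: "bdd_below (q ` C)"
    using pos by (auto intro!: bdd_belowI[of _ 0])
  have low: "m \<le> q y" if "y \<in> C" for y
    unfolding m_def using that bdd by (auto intro: cInf_lower)
  have "\<exists>x\<in>C. q x \<le> m + 1 / real (Suc n)" for n
  proof -
    have "m < m + 1 / real (Suc n)" by simp
    then obtain v where "v \<in> q ` C" "v < m + 1 / real (Suc n)"
      unfolding m_def using cInf_lessD[of "q ` C"] ne by blast
    then show ?thesis by (auto intro: less_imp_le)
  qed
  then obtain X where X: "\<And>n. X n \<in> C" "\<And>n. q (X n) \<le> m + 1 / real (Suc n)"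
    by metis
  \<comment> \<open>Here \<open>d\<close> stands for a squared distance. The midpoint of two
    near-minimisers cannot fall below the infimum \<open>m\<close>, so the parallelogram law forces
    them close together.\<close>
  have "d x y \<le> 2 * (q x - m) + 2 * (q y - m)" if xy: "x \<in> C" "y \<in> C" for x y
  proof -
    obtain z where "z \<in> C" "q z \<le> (q x + q y) / 2 - d x y / 4"
      using mid[OF xy] by auto
    with low[of z] show ?thesis by (simp add: field_simps)
  qed
  with X low that show thesis by blast
qed

text \<open>The discriminant criterion. All Cauchy-Schwarz inequalities below come from it,
  including those for forms that are only semidefinite; hence the separate case
  \<open>C = 0\<close>.\<close>

lemma quadratic_nonneg_imp:
  fixes A B C :: real
  assumes "\<And>t. 0 \<le> A + 2 * t * B + t\<^sup>2 * C" "0 \<le> C"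
  shows "B\<^sup>2 \<le> A * C"
proof (cases "C = 0")
  case True
  have "B = 0"
  proof (rule ccontr)
    assume "B \<noteq> 0"
    have "0 \<le> A + 2 * (- (A + 1) / (2 * B)) * B"
      using assms(1)[of "- (A + 1) / (2 * B)"] True by simp
    also have "\<dots> = -1" using \<open>B \<noteq> 0\<close> by (simp add: field_simps)
    finally show False by simp
  qed
  then show ?thesis using True by simp
next
  case False
  with assms have "C > 0" by simp
  have "0 \<le> (A + 2 * (- B / C) * B + (- B / C)\<^sup>2 * C) * C"
    using assms(1)[of "- B / C"] \<open>C > 0\<close> by simp
  also have "\<dots> = A * C - B\<^sup>2"
    using \<open>C > 0\<close> by (simp add: field_simps power2_eq_square)
  finally show ?thesis by simp
qed

section \<open>Abstract side: the argument for a tracial star algebra with an expectation onto a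
  subalgebra\<close>

section \<open>Star algebras with a trace\<close>

text \<open>Scalars are real, so all inner products below are real; the complex structure reappears
  as a central element \<open>j\<close>. Isometry of \<open>star\<close> is derived on the tracial
  part in \<open>norm_star_M\<close>.\<close>

class star_algebra = real_normed_algebra + monoid_mult +
  fixes star :: "'a \<Rightarrow> 'a"
  assumes star_star [simp]: "star (star x) = x"
    and star_add [simp]: "star (x + y) = star x + star y"
    and star_mult [simp]: "star (x * y) = star y * star x"
    and star_scaleR [simp]: "star (r *\<^sub>R x) = r *\<^sub>R star x"

lemma star_zero [simp]: "star (0 :: 'a::star_algebra) = 0"
  using star_scaleR[of 0 "0 :: 'a"] by simp

lemma star_one [simp]: "star (1 :: 'a::star_algebra) = 1"
  by (metis star_mult star_star mult_1_left mult_1_right)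

lemma star_minus [simp]: "star (- x) = - star (x :: 'a::star_algebra)"
  using star_scaleR[of "-1" x] by simp

lemma star_diff [simp]: "star (x - y) = star x - star (y :: 'a::star_algebra)"
  using star_add[of x "- y"] by simp

text \<open>\<open>norm_bound\<close> and \<open>norm_leI\<close> identify the norm with that of
  left multiplication for the trace norm. \<open>ball_complete\<close> replaces every appeal to weak
  closedness of a von Neumann algebra.\<close>

locale tracial =
  fixes M :: "'a::star_algebra set" and tr :: "'a \<Rightarrow> real"
  assumes one_M [simp]: "1 \<in> M"
    and add_M [simp]: "x \<in> M \<Longrightarrow> y \<in> M \<Longrightarrow> x + y \<in> M"
    and mult_M [simp]: "x \<in> M \<Longrightarrow> y \<in> M \<Longrightarrow> x * y \<in> M"
    and scaleR_M [simp]: "x \<in> M \<Longrightarrow> r *\<^sub>R x \<in> M"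
    and star_M [simp]: "x \<in> M \<Longrightarrow> star x \<in> M"
    and tr_add [simp]: "x \<in> M \<Longrightarrow> y \<in> M \<Longrightarrow> tr (x + y) = tr x + tr y"
    and tr_scaleR [simp]: "x \<in> M \<Longrightarrow> tr (r *\<^sub>R x) = r * tr x"
    and tr_commute: "x \<in> M \<Longrightarrow> y \<in> M \<Longrightarrow> tr (x * y) = tr (y * x)"
    and tr_star [simp]: "x \<in> M \<Longrightarrow> tr (star x) = tr x"
    and tr_one [simp]: "tr 1 = 1"
    and tr_pos: "x \<in> M \<Longrightarrow> 0 \<le> tr (star x * x)"
    and tr_faithful: "x \<in> M \<Longrightarrow> tr (star x * x) = 0 \<Longrightarrow> x = 0"
    and norm_bound: "x \<in> M \<Longrightarrow> y \<in> M \<Longrightarrow>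
      tr (star (x * y) * (x * y)) \<le> (norm x)\<^sup>2 * tr (star y * y)"
    and norm_leI: "x \<in> M \<Longrightarrow> 0 \<le> C \<Longrightarrow>
      (\<And>y. y \<in> M \<Longrightarrow> tr (star (x * y) * (x * y)) \<le> C\<^sup>2 * tr (star y * y)) \<Longrightarrow> norm x \<le> C"
    and ball_complete: "(\<And>n. X n \<in> M) \<Longrightarrow> (\<And>n. norm (X n) \<le> C) \<Longrightarrow>
      (\<And>e. e > 0 \<Longrightarrow> \<exists>k. \<forall>m\<ge>k. \<forall>n\<ge>k. tr (star (X m - X n) * (X m - X n)) \<le> e) \<Longrightarrow>
      \<exists>x\<in>M. norm x \<le> C \<and> (\<lambda>n. tr (star (X n - x) * (X n - x))) \<longlonglongrightarrow> 0"
begin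

lemma zero_M [simp]: "0 \<in> M"
  using scaleR_M[OF one_M, of 0] by simp

lemma minus_M [simp]: "x \<in> M \<Longrightarrow> - x \<in> M"
  using scaleR_M[of x "-1"] by simp

lemma diff_M [simp]: "x \<in> M \<Longrightarrow> y \<in> M \<Longrightarrow> x - y \<in> M"
  using add_M[of x "- y"] by simp

lemma tr_zero [simp]: "tr 0 = 0"
  using tr_scaleR[OF one_M, of 0] by simp

lemma tr_minus [simp]: "x \<in> M \<Longrightarrow> tr (- x) = - tr x"
  using tr_scaleR[of x "-1"] by simp

lemma tr_diff [simp]: "x \<in> M \<Longrightarrow> y \<in> M \<Longrightarrow> tr (x - y) = tr x - tr y"
  using tr_add[of x "- y"] by simp

definition ip :: "'a \<Rightarrow> 'a \<Rightarrow> real"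
  where "ip x y = tr (star y * x)"

definition n2 :: "'a \<Rightarrow> real"
  where "n2 x = sqrt (ip x x)"

lemma ip_nonneg [simp]: "x \<in> M \<Longrightarrow> 0 \<le> ip x x"
  by (simp add: ip_def tr_pos)

lemma ip_commute: "x \<in> M \<Longrightarrow> y \<in> M \<Longrightarrow> ip x y = ip y x"
  unfolding ip_def using tr_star[of "star y * x"] by simp

lemma n2_nonneg [simp]: "x \<in> M \<Longrightarrow> 0 \<le> n2 x"
  by (simp add: n2_def)

lemma n2_sq: "x \<in> M \<Longrightarrow> (n2 x)\<^sup>2 = ip x x"
  by (simp add: n2_def)

lemma ip_add_left [simp]: "x \<in> M \<Longrightarrow> y \<in> M \<Longrightarrow> z \<in> M \<Longrightarrow> ip (x + y) z = ip x z + ip y z"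
  by (simp add: ip_def algebra_simps)

lemma ip_diff_left [simp]: "x \<in> M \<Longrightarrow> y \<in> M \<Longrightarrow> z \<in> M \<Longrightarrow> ip (x - y) z = ip x z - ip y z"
  by (simp add: ip_def algebra_simps)

lemma ip_scaleR_left [simp]: "x \<in> M \<Longrightarrow> z \<in> M \<Longrightarrow> ip (r *\<^sub>R x) z = r * ip x z"
  by (simp add: ip_def)

lemma ip_add_right [simp]: "x \<in> M \<Longrightarrow> y \<in> M \<Longrightarrow> z \<in> M \<Longrightarrow> ip z (x + y) = ip z x + ip z y"
  by (simp add: ip_def algebra_simps)

lemma ip_diff_right [simp]: "x \<in> M \<Longrightarrow> y \<in> M \<Longrightarrow> z \<in> M \<Longrightarrow> ip z (x - y) = ip z x - ip z y"
  by (simp add: ip_def algebra_simps)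

lemma ip_scaleR_right [simp]: "x \<in> M \<Longrightarrow> z \<in> M \<Longrightarrow> ip z (r *\<^sub>R x) = r * ip z x"
  by (simp add: ip_def)

lemma ip_minus_left [simp]: "x \<in> M \<Longrightarrow> z \<in> M \<Longrightarrow> ip (- x) z = - ip x z"
  by (simp add: ip_def)

lemma ip_minus_right [simp]: "x \<in> M \<Longrightarrow> z \<in> M \<Longrightarrow> ip z (- x) = - ip z x"
  by (simp add: ip_def)

lemma ip_zero [simp]: "ip 0 z = 0" "ip z 0 = 0"
  by (simp_all add: ip_def)

lemma ip_mult_left: "x \<in> M \<Longrightarrow> y \<in> M \<Longrightarrow> z \<in> M \<Longrightarrow> ip (x * y) z = ip y (star x * z)"
  by (simp add: ip_def mult.assoc)

lemma ip_mult_right: "x \<in> M \<Longrightarrow> y \<in> M \<Longrightarrow> z \<in> M \<Longrightarrow> ip (x * y) z = ip x (z * star y)"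
  using tr_commute[of "star z * x" y] by (simp add: ip_def mult.assoc)

lemma ip_star: "x \<in> M \<Longrightarrow> y \<in> M \<Longrightarrow> ip (star x) (star y) = ip x y"
  using tr_commute[of y "star x"] ip_commute[of x y] by (simp add: ip_def)

lemma ip_self_zero: "x \<in> M \<Longrightarrow> ip x x = 0 \<Longrightarrow> x = 0"
  by (simp add: ip_def tr_faithful)

lemma ip_eqI:
  assumes "x \<in> M" "y \<in> M" "\<And>z. z \<in> M \<Longrightarrow> ip x z = ip y z"
  shows "x = y"
proof -
  have "ip (x - y) (x - y) = 0" using assms by simp
  then show ?thesis using ip_self_zero[of "x - y"] assms by simp
qed

lemma n2_star [simp]: "x \<in> M \<Longrightarrow> n2 (star x) = n2 x"
  by (simp add: n2_def ip_star)

lemma cauchy_schwarz_sq: "x \<in> M \<Longrightarrow> y \<in> M \<Longrightarrow> (ip x y)\<^sup>2 \<le> ip x x * ip y y"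
proof (rule quadratic_nonneg_imp)
  fix t assume xy: "x \<in> M" "y \<in> M"
  have "0 \<le> ip (x + t *\<^sub>R y) (x + t *\<^sub>R y)" using xy by (intro ip_nonneg) simp
  also have "\<dots> = ip x x + 2 * t * ip x y + t\<^sup>2 * ip y y"
    using xy ip_commute[of x y] by (simp add: algebra_simps power2_eq_square)
  finally show "0 \<le> ip x x + 2 * t * ip x y + t\<^sup>2 * ip y y" .
qed simp

lemma cauchy_schwarz: "x \<in> M \<Longrightarrow> y \<in> M \<Longrightarrow> \<bar>ip x y\<bar> \<le> n2 x * n2 y"
  using cauchy_schwarz_sq[of x y]
  by (metis n2_def real_sqrt_abs real_sqrt_le_mono real_sqrt_mult)

lemma n2_triangle: "x \<in> M \<Longrightarrow> y \<in> M \<Longrightarrow> n2 (x + y) \<le> n2 x + n2 y"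
proof (rule power2_le_imp_le)
  assume xy: "x \<in> M" "y \<in> M"
  have "(n2 (x + y))\<^sup>2 = ip x x + 2 * ip x y + ip y y"
    using xy ip_commute[of x y] by (simp add: n2_sq)
  also have "\<dots> \<le> ip x x + 2 * (n2 x * n2 y) + ip y y"
    using cauchy_schwarz[OF xy] by simp
  finally show "(n2 (x + y))\<^sup>2 \<le> (n2 x + n2 y)\<^sup>2"
    using xy by (simp add: power2_sum n2_sq)
qed simp

lemma n2_scaleR [simp]: "x \<in> M \<Longrightarrow> n2 (r *\<^sub>R x) = \<bar>r\<bar> * n2 x"
  by (simp add: n2_def real_sqrt_mult flip: mult.assoc)

lemma n2_minus [simp]: "x \<in> M \<Longrightarrow> n2 (- x) = n2 x"
  using n2_scaleR[of x "-1"] by simp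

lemma n2_minus_commute: "x \<in> M \<Longrightarrow> y \<in> M \<Longrightarrow> n2 (x - y) = n2 (y - x)"
  using n2_minus[of "x - y"] by simp

lemma n2_triangle3: "x \<in> M \<Longrightarrow> y \<in> M \<Longrightarrow> z \<in> M \<Longrightarrow> n2 (x - z) \<le> n2 (x - y) + n2 (y - z)"
  using n2_triangle[of "x - y" "y - z"] by simp

lemma n2_zero_iff [simp]: "x \<in> M \<Longrightarrow> n2 x = 0 \<longleftrightarrow> x = 0"
  using ip_self_zero[of x] by (auto simp: n2_def)

lemma n2_zero [simp]: "n2 0 = 0"
  by simp

lemma n2_one [simp]: "n2 1 = 1"
  by (simp add: n2_def ip_def)

lemma n2_mult_le: "x \<in> M \<Longrightarrow> y \<in> M \<Longrightarrow> n2 (x * y) \<le> norm x * n2 y"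
proof (rule power2_le_imp_le)
  assume "x \<in> M" "y \<in> M"
  then show "(n2 (x * y))\<^sup>2 \<le> (norm x * n2 y)\<^sup>2"
    using norm_bound[of x y] by (simp add: n2_sq power_mult_distrib ip_def)
qed simp

lemma norm_le_n2: "x \<in> M \<Longrightarrow> 0 \<le> C \<Longrightarrow> (\<And>y. y \<in> M \<Longrightarrow> n2 (x * y) \<le> C * n2 y) \<Longrightarrow> norm x \<le> C"
proof (rule norm_leI)
  fix y assume a: "x \<in> M" "0 \<le> C" "\<And>y. y \<in> M \<Longrightarrow> n2 (x * y) \<le> C * n2 y" "y \<in> M"
  have "(n2 (x * y))\<^sup>2 \<le> (C * n2 y)\<^sup>2" using a by (intro power_mono) auto
  then show "tr (star (x * y) * (x * y)) \<le> C\<^sup>2 * tr (star y * y)"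
    using a by (simp add: n2_sq power_mult_distrib ip_def)
qed simp_all

text \<open>Left multiplication by \<open>star x\<close> is the adjoint of left multiplication by
  \<open>x\<close>, so the squared trace norm of \<open>star x * y\<close> is the inner product of
  \<open>y\<close> with \<open>x * (star x * y)\<close>; one factor cancels.\<close>

lemma norm_star_M [simp]:
  assumes x: "x \<in> M" shows "norm (star x) = norm x"
proof -
  have le: "norm (star x) \<le> norm x" if x: "x \<in> M" for x
  proof (rule norm_le_n2)
    fix y assume y: "y \<in> M"
    have "(n2 (star x * y))\<^sup>2 = ip y (x * (star x * y))"
      using x y by (simp add: n2_sq ip_mult_left)
    also have "\<dots> \<le> n2 y * n2 (x * (star x * y))"
      using cauchy_schwarz[of y "x * (star x * y)"] x y by simp
    also have "\<dots> \<le> n2 y * (norm x * n2 (star x * y))"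
      using x y by (intro mult_left_mono n2_mult_le) auto
    finally have "n2 (star x * y) * n2 (star x * y) \<le> (norm x * n2 y) * n2 (star x * y)"
      by (simp add: power2_eq_square algebra_simps)
    then show "n2 (star x * y) \<le> norm x * n2 y"
      using x y n2_nonneg[of "star x * y"] mult_nonneg_nonneg[OF norm_ge_zero[of x] n2_nonneg[of y]]
      by (cases "n2 (star x * y) = 0") (simp_all add: mult_le_cancel_right del: n2_nonneg n2_zero_iff)
  qed (use x in auto)
  show ?thesis using le[of x] le[of "star x"] x by simp
qed

lemma n2_mult_le': "x \<in> M \<Longrightarrow> y \<in> M \<Longrightarrow> n2 (x * y) \<le> n2 x * norm y"
  using n2_mult_le[of "star y" "star x"] n2_star[of "x * y"] by (simp add: mult.commute)

lemma n2_le_norm: "x \<in> M \<Longrightarrow> n2 x \<le> norm x"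
  using n2_mult_le[of x 1] by simp

lemma norm_le_ip:
  assumes x: "x \<in> M" and C: "0 \<le> C"
    and le: "\<And>y z. y \<in> M \<Longrightarrow> z \<in> M \<Longrightarrow> ip (x * y) z \<le> C * (n2 y * n2 z)"
  shows "norm x \<le> C"
proof (rule norm_le_n2[OF x C])
  fix y assume y: "y \<in> M"
  have "n2 (x * y) * n2 (x * y) \<le> (C * n2 y) * n2 (x * y)"
    using le[of y "x * y"] x y n2_sq[of "x * y"] by (simp add: power2_eq_square mult.assoc)
  then show "n2 (x * y) \<le> C * n2 y"
    using x y C n2_nonneg[of "x * y"] mult_nonneg_nonneg[OF C n2_nonneg[of y]]
    by (cases "n2 (x * y) = 0") (simp_all add: mult_le_cancel_right del: n2_nonneg n2_zero_iff)
qed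

subsection \<open>Convergence in the trace norm\<close>

definition conv2 :: "(nat \<Rightarrow> 'a) \<Rightarrow> 'a \<Rightarrow> bool"
  where "conv2 X x \<longleftrightarrow> (\<forall>n. X n \<in> M) \<and> x \<in> M \<and> (\<lambda>n. n2 (X n - x)) \<longlonglongrightarrow> 0"

lemma conv2I:
  assumes "\<And>n. X n \<in> M" "x \<in> M" "\<And>n. n2 (X n - x) \<le> Y n" "Y \<longlonglongrightarrow> 0"
  shows "conv2 X x"
proof -
  have "(\<lambda>n. n2 (X n - x)) \<longlonglongrightarrow> 0"
    by (rule Lim_null_comparison[OF _ assms(4)])
      (intro always_eventually allI, use assms(1-3) in simp)
  then show ?thesis using assms(1,2) by (simp add: conv2_def)
qed

lemma conv2_const: "x \<in> M \<Longrightarrow> conv2 (\<lambda>_. x) x"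
  by (simp add: conv2_def)

lemma conv2_ip:
  assumes "conv2 X x" and y: "y \<in> M"
  shows "(\<lambda>n. ip (X n) y) \<longlonglongrightarrow> ip x y"
proof (rule Lim_null[THEN iffD2], rule Lim_null_comparison)
  have X: "X n \<in> M" "x \<in> M" "(\<lambda>n. n2 (X n - x)) \<longlonglongrightarrow> 0" for n
    using assms by (auto simp: conv2_def)
  show "\<forall>\<^sub>F n in sequentially. norm (ip (X n) y - ip x y) \<le> n2 (X n - x) * n2 y"
    using cauchy_schwarz[of "X _ - x" y] X y by (intro always_eventually) simp
  show "(\<lambda>n. n2 (X n - x) * n2 y) \<longlonglongrightarrow> 0"
    using tendsto_mult_left_zero[OF X(3)] by simp
qed

lemma conv2_n2:
  assumes "conv2 X x"
  shows "(\<lambda>n. n2 (X n)) \<longlonglongrightarrow> n2 x"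
proof (rule Lim_null[THEN iffD2], rule Lim_null_comparison)
  have X: "X n \<in> M" "x \<in> M" "(\<lambda>n. n2 (X n - x)) \<longlonglongrightarrow> 0" for n
    using assms by (auto simp: conv2_def)
  show "\<forall>\<^sub>F n in sequentially. norm (n2 (X n) - n2 x) \<le> n2 (X n - x)"
  proof (intro always_eventually allI)
    fix n
    have "n2 (X n) \<le> n2 (X n - x) + n2 x" "n2 x \<le> n2 (x - X n) + n2 (X n)"
      using n2_triangle[of "X n - x" x] n2_triangle[of "x - X n" "X n"] X by simp_all
    then show "norm (n2 (X n) - n2 x) \<le> n2 (X n - x)"
      using X n2_minus_commute[of x "X n"] by simp
  qed
  show "(\<lambda>n. n2 (X n - x)) \<longlonglongrightarrow> 0" by (rule X(3))
qed

lemma conv2_unique: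
  assumes "conv2 X x" "conv2 X y" shows "x = y"
proof (rule ip_eqI)
  show "x \<in> M" "y \<in> M" using assms by (auto simp: conv2_def)
  fix z assume "z \<in> M"
  then show "ip x z = ip y z"
    using LIMSEQ_unique[OF conv2_ip[OF assms(1)] conv2_ip[OF assms(2)]] by simp
qed

lemma conv2_add:
  assumes "conv2 X x" "conv2 Y y" shows "conv2 (\<lambda>n. X n + Y n) (x + y)"
proof -
  have X: "X n \<in> M" "x \<in> M" "(\<lambda>n. n2 (X n - x)) \<longlonglongrightarrow> 0"
    and Y: "Y n \<in> M" "y \<in> M" "(\<lambda>n. n2 (Y n - y)) \<longlonglongrightarrow> 0" for n
    using assms by (auto simp: conv2_def)
  have "n2 (X n + Y n - (x + y)) \<le> n2 (X n - x) + n2 (Y n - y)" for n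
    using n2_triangle[of "X n - x" "Y n - y"] X Y by (simp add: algebra_simps)
  moreover have "(\<lambda>n. n2 (X n - x) + n2 (Y n - y)) \<longlonglongrightarrow> 0"
    using tendsto_add[OF X(3) Y(3)] by simp
  ultimately show ?thesis
    using X Y by (intro conv2I[where Y = "\<lambda>n. n2 (X n - x) + n2 (Y n - y)"]) simp_all
qed

lemma conv2_bounded_map:
  assumes "conv2 X x"
    and T: "\<And>y. y \<in> M \<Longrightarrow> T y \<in> M"
    and Td: "\<And>y z. y \<in> M \<Longrightarrow> z \<in> M \<Longrightarrow> n2 (T y - T z) \<le> C * n2 (y - z)"
  shows "conv2 (\<lambda>n. T (X n)) (T x)"
proof -
  have X: "X n \<in> M" "x \<in> M" "(\<lambda>n. n2 (X n - x)) \<longlonglongrightarrow> 0" for n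
    using assms by (auto simp: conv2_def)
  have "(\<lambda>n. C * n2 (X n - x)) \<longlonglongrightarrow> 0"
    using tendsto_mult_right_zero[OF X(3)] by simp
  then show ?thesis
    by (rule conv2I[rotated 3]) (simp_all add: X T Td)
qed

lemma conv2_mult_left: "conv2 X x \<Longrightarrow> y \<in> M \<Longrightarrow> conv2 (\<lambda>n. y * X n) (y * x)"
  by (rule conv2_bounded_map[where C = "norm y"])
    (auto simp: n2_mult_le simp flip: right_diff_distrib)

lemma conv2_mult_right: "conv2 X x \<Longrightarrow> y \<in> M \<Longrightarrow> conv2 (\<lambda>n. X n * y) (x * y)"
  by (rule conv2_bounded_map[where C = "norm y"])
    (auto simp: n2_mult_le' mult.commute[of "norm y"] simp flip: left_diff_distrib)

lemma conv2_star: "conv2 X x \<Longrightarrow> conv2 (\<lambda>n. star (X n)) (star x)"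
  by (rule conv2_bounded_map[where C = 1]) (auto simp flip: star_diff)

lemma conv2_scaleR: "conv2 X x \<Longrightarrow> conv2 (\<lambda>n. r *\<^sub>R X n) (r *\<^sub>R x)"
  by (rule conv2_bounded_map[where C = "\<bar>r\<bar>"]) (auto simp flip: scaleR_diff_right)

lemma conv2_diff: "conv2 X x \<Longrightarrow> conv2 Y y \<Longrightarrow> conv2 (\<lambda>n. X n - Y n) (x - y)"
  using conv2_add[of X x "\<lambda>n. -1 *\<^sub>R Y n" "-1 *\<^sub>R y"] conv2_scaleR[of Y y "-1"] by simp

lemma conv2_complete:
  assumes X: "\<And>n. X n \<in> M" "\<And>n. norm (X n) \<le> C"
    and cau: "\<And>e. e > 0 \<Longrightarrow> \<exists>k. \<forall>m\<ge>k. \<forall>n\<ge>k. n2 (X m - X n) \<le> e"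
  obtains x where "conv2 X x" "norm x \<le> C"
proof -
  have "\<exists>x\<in>M. norm x \<le> C \<and> (\<lambda>n. tr (star (X n - x) * (X n - x))) \<longlonglongrightarrow> 0"
  proof (rule ball_complete[OF X])
    fix e :: real assume "e > 0"
    then obtain k where k: "\<forall>m\<ge>k. \<forall>n\<ge>k. n2 (X m - X n) \<le> sqrt e"
      using cau[of "sqrt e"] by auto
    have "tr (star (X m - X n) * (X m - X n)) \<le> e" if "m \<ge> k" "n \<ge> k" for m n
    proof -
      have "n2 (X m - X n) \<le> sqrt e" using k that by blast
      then show ?thesis by (simp add: n2_def ip_def)
    qed
    then show "\<exists>k. \<forall>m\<ge>k. \<forall>n\<ge>k. tr (star (X m - X n) * (X m - X n)) \<le> e" by blast
  qed
  then obtain x where x: "x \<in> M" "norm x \<le> C" "(\<lambda>n. ip (X n - x) (X n - x)) \<longlonglongrightarrow> 0"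
    unfolding ip_def by blast
  have "(\<lambda>n. n2 (X n - x)) \<longlonglongrightarrow> 0"
    using tendsto_real_sqrt[OF x(3)] by (simp add: n2_def)
  then have "conv2 X x" using x(1) X(1) by (simp add: conv2_def)
  then show thesis using x(2) by (rule that)
qed

definition unitary :: "'a \<Rightarrow> bool"
  where "unitary w \<longleftrightarrow> star w * w = 1 \<and> w * star w = 1"

lemma unitaryI: "star w * w = 1 \<Longrightarrow> w * star w = 1 \<Longrightarrow> unitary w"
  by (simp add: unitary_def)

lemma unitary_simps [simp]:
  assumes "unitary w"
  shows "star w * w = 1" "w * star w = 1" "star w * (w * x) = x" "w * (star w * x) = x"
    "x * w * star w = x" "x * star w * w = x"
proof -
  have w: "star w * w = 1" "w * star w = 1" using assms by (simp_all add: unitary_def)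
  then show "star w * w = 1" "w * star w = 1" by simp_all
  show "star w * (w * x) = x" "w * (star w * x) = x"
    using w by (simp_all flip: mult.assoc)
  show "x * w * star w = x" "x * star w * w = x"
    using w by (simp_all add: mult.assoc)
qed

lemma unitary_star [simp]: "unitary w \<Longrightarrow> unitary (star w)"
  by (rule unitaryI) simp_all

lemma unitary_mult [simp]: "unitary v \<Longrightarrow> unitary w \<Longrightarrow> unitary (v * w)"
  by (rule unitaryI) (simp_all add: mult.assoc)

lemma unitary_one [simp]: "unitary 1"
  by (rule unitaryI) simp_all

lemma ip_unitary_left: "w \<in> M \<Longrightarrow> unitary w \<Longrightarrow> x \<in> M \<Longrightarrow> y \<in> M \<Longrightarrow> ip (w * x) (w * y) = ip x y"
  by (simp add: ip_mult_left)

lemma n2_unitary_left [simp]: "w \<in> M \<Longrightarrow> unitary w \<Longrightarrow> x \<in> M \<Longrightarrow> n2 (w * x) = n2 x"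
  by (simp add: n2_def ip_unitary_left)

lemma n2_unitary_right [simp]: "w \<in> M \<Longrightarrow> unitary w \<Longrightarrow> x \<in> M \<Longrightarrow> n2 (x * w) = n2 x"
  using n2_unitary_left[of "star w" "star x"] n2_star[of "x * w"] by simp

lemma norm_unitary_le: "w \<in> M \<Longrightarrow> unitary w \<Longrightarrow> norm w \<le> 1"
  by (rule norm_le_n2) auto

end

section \<open>Finite weighted families\<close>

definition wsum :: "(real \<times> 'a) list \<Rightarrow> ('a \<Rightarrow> 'b::real_vector) \<Rightarrow> 'b"
  where "wsum F \<phi> = (\<Sum>p\<leftarrow>F. fst p *\<^sub>R \<phi> (snd p))"

lemma wsum_Nil [simp]: "wsum [] \<phi> = 0"
  by (simp add: wsum_def)

lemma wsum_Cons [simp]: "wsum (p # F) \<phi> = fst p *\<^sub>R \<phi> (snd p) + wsum F \<phi>"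
  by (simp add: wsum_def)

lemma wsum_append [simp]: "wsum (F @ G) \<phi> = wsum F \<phi> + wsum G \<phi>"
  by (simp add: wsum_def)

lemma wsum_add: "wsum F (\<lambda>w. \<phi> w + \<psi> w) = wsum F \<phi> + wsum F \<psi>"
  by (induction F) (auto simp: algebra_simps)

lemma wsum_scaleR: "wsum F (\<lambda>w. r *\<^sub>R \<phi> w) = r *\<^sub>R wsum F \<phi>"
  by (induction F) (auto simp: algebra_simps)

lemma wsum_diff: "wsum F (\<lambda>w. \<phi> w - \<psi> w) = wsum F \<phi> - wsum F \<psi>"
  by (induction F) (auto simp: algebra_simps)

lemma wsum_mult: "wsum F (\<lambda>w. r * \<phi> w) = r * wsum F \<phi>" for r :: real
  using wsum_scaleR[of F r \<phi>] by simp

lemma wsum_const: "wsum F (\<lambda>_. x) = sum_list (map fst F) *\<^sub>R x"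
  by (induction F) (auto simp: algebra_simps)

lemma wsum_cong: "(\<And>w. w \<in> snd ` set F \<Longrightarrow> \<phi> w = \<psi> w) \<Longrightarrow> wsum F \<phi> = wsum F \<psi>"
  by (induction F) auto

lemma wsum_mono:
  fixes \<phi> \<psi> :: "'a \<Rightarrow> real"
  assumes "\<And>l. l \<in> fst ` set F \<Longrightarrow> 0 \<le> l" "\<And>w. w \<in> snd ` set F \<Longrightarrow> \<phi> w \<le> \<psi> w"
  shows "wsum F \<phi> \<le> wsum F \<psi>"
  using assms by (induction F) (auto intro!: add_mono mult_left_mono)

lemma wsum_mult_algebra_left: "wsum F (\<lambda>w. x * \<phi> w) = x * wsum F \<phi>"
  for x :: "'b::real_algebra"
  by (induction F) (auto simp: algebra_simps)

lemma wsum_mult_algebra_right: "wsum F (\<lambda>w. \<phi> w * x) = wsum F \<phi> * x"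
  for x :: "'b::real_algebra"
  by (induction F) (auto simp: algebra_simps)

lemma star_wsum: "star (wsum F \<phi>) = wsum F (\<lambda>w. star (\<phi> w))"
  for \<phi> :: "'a \<Rightarrow> 'b::star_algebra"
  by (induction F) auto

text \<open>Convolution of weighted families: averaging over \<open>G\<close> and then over
  \<open>F\<close> is averaging over the products.\<close>

definition wprod :: "(real \<times> 'a::times) list \<Rightarrow> (real \<times> 'a) list \<Rightarrow> (real \<times> 'a) list"
  where "wprod F G = concat (map (\<lambda>p. map (\<lambda>q. (fst p * fst q, snd p * snd q)) G) F)"

lemma wsum_map: "wsum (map (\<lambda>q. (r * fst q, f (snd q))) G) \<phi> = r *\<^sub>R wsum G (\<lambda>v. \<phi> (f v))"
  by (induction G) (auto simp: algebra_simps)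

lemma wsum_wprod: "wsum (wprod F G) \<phi> = wsum F (\<lambda>w. wsum G (\<lambda>v. \<phi> (w * v)))"
  by (induction F) (auto simp: wprod_def wsum_map)

definition wneg :: "(real \<times> 'a) list \<Rightarrow> (real \<times> 'a) list"
  where "wneg G = map (\<lambda>q. (- 1 * fst q, snd q)) G"

lemma wsum_wneg [simp]: "wsum (wneg G) \<phi> = - wsum G \<phi>"
  using wsum_map[of "-1" "\<lambda>x. x" G \<phi>] by (simp add: wneg_def)

definition convex_family :: "'a set \<Rightarrow> (real \<times> 'a) list \<Rightarrow> bool"
  where "convex_family U F \<longleftrightarrow>
    (\<forall>p\<in>set F. 0 \<le> fst p \<and> snd p \<in> U) \<and> sum_list (map fst F) = 1"

lemma convex_family_singleton: "w \<in> U \<Longrightarrow> convex_family U [(1, w)]"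
  by (simp add: convex_family_def)

lemma convex_family_const: "convex_family U F \<Longrightarrow> wsum F (\<lambda>_. x) = x"
  by (simp add: wsum_const convex_family_def)

lemma convex_family_wprod:
  assumes "convex_family U F" "convex_family U G"
    and "\<And>v w. v \<in> U \<Longrightarrow> w \<in> U \<Longrightarrow> v * w \<in> U"
  shows "convex_family U (wprod F G)"
proof -
  have s: "sum_list (map fst (wprod F G)) = sum_list (map fst F) * sum_list (map fst G)"
    by (induction F) (auto simp: wprod_def sum_list_mult_const[symmetric] comp_def
        sum_list_const_mult algebra_simps)
  have "0 \<le> fst p \<and> snd p \<in> U" if "p \<in> set (wprod F G)" for p
  proof -
    from that obtain a b where "a \<in> set F" "b \<in> set G" "p = (fst a * fst b, snd a * snd b)"
      by (auto simp: wprod_def)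
    with assms show ?thesis by (auto simp: convex_family_def)
  qed
  with s assms show ?thesis by (auto simp: convex_family_def)
qed

text \<open>An obtained property cannot stay polymorphic, so the midpoint identity is delivered at
  two types: for operator averages and for real ones.\<close>

lemma convex_family_mid:
  assumes "convex_family U F" "convex_family U G"
  obtains H where "convex_family U H"
    "\<And>\<phi> :: 'a \<Rightarrow> 'b::real_vector. wsum H \<phi> = (1/2) *\<^sub>R (wsum F \<phi> + wsum G \<phi>)"
    "\<And>\<phi> :: 'a \<Rightarrow> real. wsum H \<phi> = (wsum F \<phi> + wsum G \<phi>) / 2"
proof
  let ?H = "map (\<lambda>q. (1/2 * fst q, snd q)) (F @ G)"
  have w: "wsum ?H \<phi> = (1/2) *\<^sub>R (wsum F \<phi> + wsum G \<phi>)" for \<phi> :: "'a \<Rightarrow> 'c::real_vector"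
    unfolding wsum_map[of "1/2" "\<lambda>x. x"] wsum_append ..
  show "wsum ?H \<phi> = (1/2) *\<^sub>R (wsum F \<phi> + wsum G \<phi>)" for \<phi> :: "'a \<Rightarrow> 'b" by (rule w)
  show "wsum ?H \<phi> = (wsum F \<phi> + wsum G \<phi>) / 2" for \<phi> :: "'a \<Rightarrow> real"
    unfolding w by simp
  have "sum_list (map fst ?H) = (sum_list (map fst F) + sum_list (map fst G)) / 2"
    using w[of "\<lambda>_. 1 :: real"] by (simp add: wsum_const)
  then show "convex_family U ?H"
    using assms by (auto simp: convex_family_def)
qed

lemma convex_family_mono:
  fixes \<phi> \<psi> :: "'a \<Rightarrow> real"
  assumes "convex_family U F" "\<And>w. w \<in> U \<Longrightarrow> \<phi> w \<le> \<psi> w"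
  shows "wsum F \<phi> \<le> wsum F \<psi>"
  using assms by (intro wsum_mono) (auto simp: convex_family_def)

lemma convex_family_le:
  fixes \<phi> :: "'a \<Rightarrow> real"
  assumes "convex_family U F" "\<And>w. w \<in> U \<Longrightarrow> \<phi> w \<le> c"
  shows "wsum F \<phi> \<le> c"
  using convex_family_mono[OF assms] convex_family_const[OF assms(1), of c] by simp

lemma convex_family_ge:
  fixes \<phi> :: "'a \<Rightarrow> real"
  assumes "convex_family U F" "\<And>w. w \<in> U \<Longrightarrow> c \<le> \<phi> w"
  shows "c \<le> wsum F \<phi>"
  using convex_family_mono[OF assms(1), of "\<lambda>_. c" \<phi>] assms(2)
    convex_family_const[OF assms(1), of c] by simp

lemma convex_family_cong:
  assumes "convex_family U F" "\<And>w. w \<in> U \<Longrightarrow> \<phi> w = \<psi> w"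
  shows "wsum F \<phi> = wsum F \<psi>"
  using assms by (intro wsum_cong) (auto simp: convex_family_def)

lemma norm_wsum_le:
  fixes \<phi> :: "'a \<Rightarrow> 'b::real_normed_vector"
  assumes "convex_family U F" "\<And>w. w \<in> U \<Longrightarrow> norm (\<phi> w) \<le> c"
  shows "norm (wsum F \<phi>) \<le> c"
proof -
  have "norm (wsum F \<phi>) \<le> wsum F (\<lambda>w. norm (\<phi> w))"
    if "\<forall>p\<in>set F. 0 \<le> fst p" for F
    using that by (induction F) (auto intro!: order_trans[OF norm_triangle_ineq])
  then have "norm (wsum F \<phi>) \<le> wsum F (\<lambda>w. norm (\<phi> w))"
    using assms(1) by (simp add: convex_family_def)
  also have "\<dots> \<le> c" using assms by (rule convex_family_le)
  finally show ?thesis .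
qed

context tracial
begin

lemma wsum_M [simp]: "(\<And>w. w \<in> snd ` set F \<Longrightarrow> \<phi> w \<in> M) \<Longrightarrow> wsum F \<phi> \<in> M"
  by (induction F) auto

lemma tr_wsum: "(\<And>w. w \<in> snd ` set F \<Longrightarrow> \<phi> w \<in> M) \<Longrightarrow> tr (wsum F \<phi>) = wsum F (\<lambda>w. tr (\<phi> w))"
  by (induction F) auto

lemma ip_wsum_left:
  "(\<And>w. w \<in> snd ` set F \<Longrightarrow> \<phi> w \<in> M) \<Longrightarrow> y \<in> M \<Longrightarrow> ip (wsum F \<phi>) y = wsum F (\<lambda>w. ip (\<phi> w) y)"
  by (induction F) auto

lemma n2_wsum_le:
  assumes "convex_family U F" "\<And>w. w \<in> U \<Longrightarrow> \<phi> w \<in> M \<and> n2 (\<phi> w) \<le> c"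
  shows "n2 (wsum F \<phi>) \<le> c"
proof -
  have "n2 (wsum F \<phi>) \<le> wsum F (\<lambda>w. n2 (\<phi> w))"
    if "\<forall>p\<in>set F. 0 \<le> fst p \<and> \<phi> (snd p) \<in> M" for F
    using that
  proof (induction F)
    case (Cons p F)
    have "wsum F \<phi> \<in> M" by (rule wsum_M) (use Cons.prems in auto)
    moreover have "\<phi> (snd p) \<in> M" "0 \<le> fst p" using Cons.prems by auto
    ultimately show ?case
      using Cons n2_triangle[of "fst p *\<^sub>R \<phi> (snd p)" "wsum F \<phi>"] by simp
  qed simp
  then have "n2 (wsum F \<phi>) \<le> wsum F (\<lambda>w. n2 (\<phi> w))"
    using assms by (auto simp: convex_family_def)
  also have "\<dots> \<le> c" using assms by (intro convex_family_le) auto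
  finally show ?thesis .
qed

lemma wsum_ip_cauchy_schwarz:
  assumes F: "convex_family U F" and M: "\<And>w. w \<in> U \<Longrightarrow> \<phi> w \<in> M" "\<And>w. w \<in> U \<Longrightarrow> \<psi> w \<in> M"
  shows "(wsum F (\<lambda>w. ip (\<phi> w) (\<psi> w)))\<^sup>2 \<le> wsum F (\<lambda>w. ip (\<phi> w) (\<phi> w)) * wsum F (\<lambda>w. ip (\<psi> w) (\<psi> w))"
proof (rule quadratic_nonneg_imp)
  fix t :: real
  have "0 \<le> wsum F (\<lambda>w. ip (\<phi> w + t *\<^sub>R \<psi> w) (\<phi> w + t *\<^sub>R \<psi> w))"
    using M by (intro convex_family_ge[OF F] ip_nonneg) simp
  also have "\<dots> = wsum F (\<lambda>w. ip (\<phi> w) (\<phi> w) + 2 * t * ip (\<phi> w) (\<psi> w) + t\<^sup>2 * ip (\<psi> w) (\<psi> w))"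
  proof (rule convex_family_cong[OF F])
    fix w assume "w \<in> U"
    then show "ip (\<phi> w + t *\<^sub>R \<psi> w) (\<phi> w + t *\<^sub>R \<psi> w) =
      ip (\<phi> w) (\<phi> w) + 2 * t * ip (\<phi> w) (\<psi> w) + t\<^sup>2 * ip (\<psi> w) (\<psi> w)"
      using M ip_commute[of "\<phi> w" "\<psi> w"] by (simp add: algebra_simps power2_eq_square)
  qed
  finally show "0 \<le> wsum F (\<lambda>w. ip (\<phi> w) (\<phi> w)) + 2 * t * wsum F (\<lambda>w. ip (\<phi> w) (\<psi> w)) +
      t\<^sup>2 * wsum F (\<lambda>w. ip (\<psi> w) (\<psi> w))"
    by (simp only: wsum_add wsum_mult)
next
  show "0 \<le> wsum F (\<lambda>w. ip (\<psi> w) (\<psi> w))" using F M by (intro convex_family_ge) auto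
qed

end

section \<open>Irreducible inclusions\<close>

text \<open>
  The element \<open>j\<close> plays the role of the imaginary unit. Positivity of \<open>m\<close> is expressed through the
  trace, as \<open>tr (z\<^sup>* m z) \<ge> 0\<close> for all \<open>z\<close>.
\<close>

locale irreducible_inclusion = tracial M tr
  for M :: "'a::star_algebra set" and tr +
  fixes N :: "'a set" and E :: "'a \<Rightarrow> 'a" and j :: 'a
  assumes N_M [simp]: "x \<in> N \<Longrightarrow> x \<in> M"
    and one_N [simp]: "1 \<in> N"
    and add_N [simp]: "x \<in> N \<Longrightarrow> y \<in> N \<Longrightarrow> x + y \<in> N"
    and mult_N [simp]: "x \<in> N \<Longrightarrow> y \<in> N \<Longrightarrow> x * y \<in> N"
    and scaleR_N [simp]: "x \<in> N \<Longrightarrow> r *\<^sub>R x \<in> N"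
    and star_N [simp]: "x \<in> N \<Longrightarrow> star x \<in> N"
    and sqrt_N: "m \<in> N \<Longrightarrow> star m = m \<Longrightarrow> (\<And>z. z \<in> N \<Longrightarrow> 0 \<le> tr (star z * (m * z))) \<Longrightarrow>
      \<exists>h\<in>N. star h = h \<and> h * h = m \<and> (\<forall>z\<in>M. 0 \<le> tr (star z * (h * z))) \<and>
        (\<forall>c. c * m = m * c \<longrightarrow> c * h = h * c)"
    and inverse_N: "m \<in> N \<Longrightarrow> star m = m \<Longrightarrow> (\<And>z. z \<in> N \<Longrightarrow> 0 \<le> tr (star z * (m * z))) \<Longrightarrow>
      0 < e \<Longrightarrow> \<exists>h\<in>N. h * (m + e *\<^sub>R 1) = 1 \<and> (m + e *\<^sub>R 1) * h = 1"
    and span_unitaries: "x \<in> N \<Longrightarrow> x \<in> span {w \<in> N. star w * w = 1 \<and> w * star w = 1}"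
    and irreducible: "x \<in> M \<Longrightarrow> (\<And>y. y \<in> N \<Longrightarrow> y * x = x * y) \<Longrightarrow> \<exists>c d. x = c *\<^sub>R 1 + d *\<^sub>R j"
    and j_N [simp]: "j \<in> N"
    and j_star [simp]: "star j = - j"
    and j_square: "j * j = - 1"
    and j_commute: "x \<in> M \<Longrightarrow> j * x = x * j"
    and E_N [simp]: "x \<in> M \<Longrightarrow> E x \<in> N"
    and E_tr: "x \<in> M \<Longrightarrow> y \<in> N \<Longrightarrow> tr (star y * E x) = tr (star y * x)"
begin

lemma zero_N [simp]: "0 \<in> N"
  using scaleR_N[OF one_N, of 0] by simp

lemma minus_N [simp]: "x \<in> N \<Longrightarrow> - x \<in> N"
  using scaleR_N[of x "-1"] by simp

lemma diff_N [simp]: "x \<in> N \<Longrightarrow> y \<in> N \<Longrightarrow> x - y \<in> N"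
  using add_N[of x "- y"] by simp

lemma ip_E: "x \<in> M \<Longrightarrow> y \<in> N \<Longrightarrow> ip (E x) y = ip x y"
  by (simp add: ip_def E_tr)

lemma ip_E': "x \<in> M \<Longrightarrow> y \<in> N \<Longrightarrow> ip y (E x) = ip y x"
  using ip_E[of x y] ip_commute[of y "E x"] ip_commute[of y x] by simp

lemma E_unique:
  assumes "x \<in> M" "e \<in> N" "\<And>y. y \<in> N \<Longrightarrow> ip e y = ip x y"
  shows "E x = e"
proof -
  have "ip (E x - e) (E x - e) = 0"
    using assms by (simp add: ip_E)
  then show ?thesis using ip_self_zero[of "E x - e"] assms by simp
qed

lemma E_id [simp]: "x \<in> N \<Longrightarrow> E x = x"
  by (rule E_unique) auto

lemma E_add [simp]: "x \<in> M \<Longrightarrow> y \<in> M \<Longrightarrow> E (x + y) = E x + E y"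
  by (rule E_unique) (auto simp: ip_E)

lemma E_scaleR [simp]: "x \<in> M \<Longrightarrow> E (r *\<^sub>R x) = r *\<^sub>R E x"
  by (rule E_unique) (auto simp: ip_E)

lemma E_diff [simp]: "x \<in> M \<Longrightarrow> y \<in> M \<Longrightarrow> E (x - y) = E x - E y"
  by (rule E_unique) (auto simp: ip_E)

lemma E_zero [simp]: "E 0 = 0"
  by (rule E_id) simp

lemma E_mult_left [simp]: "x \<in> M \<Longrightarrow> y \<in> N \<Longrightarrow> E (y * x) = y * E x"
  by (rule E_unique) (auto simp: ip_E ip_mult_left)

lemma E_mult_right [simp]: "x \<in> M \<Longrightarrow> y \<in> N \<Longrightarrow> E (x * y) = E x * y"
  by (rule E_unique) (auto simp: ip_E ip_mult_right)

lemma E_star [simp]: "x \<in> M \<Longrightarrow> E (star x) = star (E x)"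
proof (rule E_unique)
  fix y assume "x \<in> M" "y \<in> N"
  then show "ip (star (E x)) y = ip (star x) y"
    using ip_star[of "E x" "star y"] ip_star[of "x" "star y"] by (simp add: ip_E)
qed auto

lemma E_wsum: "(\<And>w. w \<in> snd ` set F \<Longrightarrow> \<phi> w \<in> M) \<Longrightarrow> E (wsum F \<phi>) = wsum F (\<lambda>w. E (\<phi> w))"
  by (induction F) auto

lemma E_pythagoras: "x \<in> M \<Longrightarrow> ip (x - E x) (x - E x) = ip x x - ip (E x) (E x)"
  using ip_E[of x "E x"] ip_E'[of x "E x"] by simp

lemma n2_E_le: "x \<in> M \<Longrightarrow> n2 (E x) \<le> n2 x"
  using E_pythagoras[of x] ip_nonneg[of "x - E x"] by (simp add: n2_def del: ip_nonneg)

lemma ip_E_E: "x \<in> M \<Longrightarrow> y \<in> M \<Longrightarrow> ip (E x) (E y) = ip x (E y)"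
  by (simp add: ip_E)

text \<open>Only vectors of \<open>N\<close> are tested, because a form such as that of
  \<open>E (star x * x)\<close> can be evaluated directly only there. Positivity on all of
  \<open>M\<close> follows in \<open>pos_ip\<close> by writing \<open>m\<close> as the square of a
  self-adjoint element.\<close>

definition pos :: "'a \<Rightarrow> bool"
  where "pos m \<longleftrightarrow> m \<in> N \<and> star m = m \<and> (\<forall>z\<in>N. 0 \<le> ip (m * z) z)"

lemma pos_sqrt:
  assumes "pos m"
  obtains h where "pos h" "h \<in> N" "star h = h" "h * h = m" "\<And>c. c * m = m * c \<Longrightarrow> c * h = h * c"
proof -
  from assms have "m \<in> N" "star m = m" "\<And>z. z \<in> N \<Longrightarrow> 0 \<le> tr (star z * (m * z))"
    by (auto simp: pos_def ip_def)
  from sqrt_N[OF this] obtain h where h: "h \<in> N" "star h = h" "h * h = m"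
      "\<forall>z\<in>M. 0 \<le> tr (star z * (h * z))" "\<forall>c. c * m = m * c \<longrightarrow> c * h = h * c"
    by blast
  have "pos h" unfolding pos_def ip_def using h(1,2,4) by simp
  then show thesis using that h by blast
qed

lemma pos_ip:
  assumes "pos m" "z \<in> M" shows "0 \<le> ip (m * z) z"
proof -
  obtain h where h: "h \<in> N" "star h = h" "h * h = m" using pos_sqrt[OF assms(1)] by metis
  have "ip (h * h * z) z = ip (h * z) (h * z)"
    using assms h(1,2) ip_mult_left[of h "h * z" z] by (simp add: mult.assoc)
  then show ?thesis using h assms by simp
qed

lemma ip_E_star_mult:
  assumes "x \<in> M" "z \<in> N" shows "ip (E (star x * x) * z) z = ip (x * z) (x * z)"
proof -
  have "ip (E (star x * x) * z) z = ip (E (star x * x * z)) z" using assms by simp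
  also have "\<dots> = ip (star x * x * z) z" using assms by (intro ip_E) auto
  also have "\<dots> = ip (x * z) (x * z)"
    using assms ip_mult_left[of "star x" "x * z" z] by (simp add: mult.assoc)
  finally show ?thesis .
qed

lemma pos_E: "x \<in> M \<Longrightarrow> pos (E (star x * x))"
proof -
  assume x: "x \<in> M"
  have "ip (E (star x * x) * z) z = ip (x * z) (x * z)" if "z \<in> N" for z
    using ip_E_star_mult[OF x that] .
  moreover have "star (E (star x * x)) = E (star x * x)"
    using E_star[of "star x * x"] x by simp
  ultimately show ?thesis using x by (simp add: pos_def ip_nonneg)
qed

text \<open>The inequality holds on vectors of \<open>N\<close>, where \<open>E\<close> drops out of
  the form. Read as \<open>pos\<close> of a difference, it passes to vectors of \<open>M\<close> by
  \<open>pos_ip\<close>.\<close>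

lemma ip_E_star_mult_le:
  assumes x: "x \<in> M" and z: "z \<in> M"
  shows "ip (E (star x * x) * z) z \<le> (norm x)\<^sup>2 * ip z z"
proof -
  have "star (E (star x * x)) = E (star x * x)"
    using E_star[of "star x * x"] x by simp
  moreover have "0 \<le> ip (((norm x)\<^sup>2 *\<^sub>R 1 - E (star x * x)) * y) y" if "y \<in> N" for y
  proof -
    have "ip (x * y) (x * y) \<le> (norm x)\<^sup>2 * ip y y"
      using x that norm_bound[of x y] by (simp add: ip_def)
    then show ?thesis
      using x that ip_E_star_mult[OF x that] by (simp add: left_diff_distrib)
  qed
  ultimately have "pos ((norm x)\<^sup>2 *\<^sub>R 1 - E (star x * x))"
    using x by (simp add: pos_def)
  from pos_ip[OF this z] show ?thesis
    using x z by (simp add: left_diff_distrib)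
qed

text \<open>Take \<open>h\<close> as the square root of \<open>E (y * star y)\<close>: the trace of
  \<open>n * y * star y * star n\<close> sees \<open>y * star y\<close> only through its
  expectation. Under left multiplication by \<open>N\<close>, a vector of \<open>M\<close> thus
  behaves like one of \<open>N\<close>.\<close>

lemma left_norm_transfer:
  assumes y: "y \<in> M"
  obtains h where "h \<in> N" "star h = h" "\<And>n. n \<in> N \<Longrightarrow> n2 (n * y) = n2 (n * h)"
proof -
  obtain h where h: "h \<in> N" "star h = h" "h * h = E (y * star y)"
    using pos_sqrt[OF pos_E[of "star y"]] y by (metis star_M star_star)
  have "n2 (n * y) = n2 (n * h)" if "n \<in> N" for n
  proof -
    have "ip (n * y) (n * y) = ip n (n * (y * star y))"
      using that y by (simp add: ip_mult_right mult.assoc)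
    also have "\<dots> = ip (star n * n) (y * star y)"
      using that y ip_mult_left[of "star n" n "y * star y"] by simp
    also have "\<dots> = ip (star n * n) (h * h)"
      using that y h ip_E'[of "y * star y" "star n * n"] by simp
    also have "\<dots> = ip n (n * (h * h))"
      using that h y ip_mult_left[of "star n" n "h * h"] by simp
    also have "\<dots> = ip (n * h) (n * h)"
      using that h by (simp add: ip_mult_right mult.assoc)
    finally show ?thesis by (simp add: n2_def)
  qed
  with h(1,2) show thesis by (rule that)
qed

text \<open>On a vector \<open>h\<close> of \<open>N\<close> the product \<open>E x * h\<close> is
  \<open>E (x * h)\<close>, and \<open>E\<close> contracts the trace norm;
  \<open>left_norm_transfer\<close> reduces arbitrary vectors to this case.\<close>

lemma norm_E_le:
  assumes x: "x \<in> M" shows "norm (E x) \<le> norm x"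
proof (rule norm_le_n2)
  fix y assume y: "y \<in> M"
  obtain h where h: "h \<in> N" and ym: "\<And>n. n \<in> N \<Longrightarrow> n2 (n * y) = n2 (n * h)"
    using left_norm_transfer[OF y] by metis
  have "n2 (E x * h) \<le> n2 (x * h)"
    using n2_E_le[of "x * h"] x h by simp
  also have "\<dots> \<le> norm x * n2 h" using x h by (intro n2_mult_le) auto
  also have "n2 h = n2 y" using ym[of 1] by simp
  also have "n2 (E x * h) = n2 (E x * y)" using ym[of "E x"] x by simp
  finally show "n2 (E x * y) \<le> norm x * n2 y" .
qed (use x in auto)

end

context tracial
begin

lemma conv2_complete_rate:
  assumes X: "\<And>n. X n \<in> M" "\<And>n. norm (X n) \<le> C"
    and rate: "\<And>m n. ip (X m - X n) (X m - X n) \<le> K * (1 / real (Suc m) + 1 / real (Suc n))"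
  obtains x where "conv2 X x" "norm x \<le> C"
proof (rule conv2_complete[OF X])
  fix e :: real assume "e > 0"
  define L where "L = max K 1"
  have "L > 0" "K \<le> L" by (auto simp: L_def)
  obtain k where k: "2 * L / e\<^sup>2 < real k"
    using reals_Archimedean2 by blast
  have "n2 (X m - X n) \<le> e" if "m \<ge> k" "n \<ge> k" for m n
  proof -
    have "real (Suc m) > 2 * L / e\<^sup>2" "real (Suc n) > 2 * L / e\<^sup>2"
      using k that by linarith+
    then have "1 / real (Suc m) \<le> e\<^sup>2 / (2 * L)" "1 / real (Suc n) \<le> e\<^sup>2 / (2 * L)"
      using \<open>L > 0\<close> \<open>e > 0\<close> by (simp_all add: field_simps)
    then have "L * (1 / real (Suc m) + 1 / real (Suc n)) \<le> L * (e\<^sup>2 / (2 * L) + e\<^sup>2 / (2 * L))"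
      using \<open>L > 0\<close> by (intro mult_left_mono add_mono) auto
    also have "\<dots> = e\<^sup>2" using \<open>L > 0\<close> by simp
    finally have "ip (X m - X n) (X m - X n) \<le> e\<^sup>2"
      using rate[of m n] mult_right_mono[OF \<open>K \<le> L\<close>, of "1 / real (Suc m) + 1 / real (Suc n)"]
      by (smt (verit) divide_nonneg_nonneg of_nat_0_le_iff)
    then show ?thesis using \<open>e > 0\<close> unfolding n2_def by (simp add: real_le_lsqrt)
  qed
  then show "\<exists>k. \<forall>m\<ge>k. \<forall>n\<ge>k. n2 (X m - X n) \<le> e" by blast
qed (rule that)

text \<open>Used for invariance: translating a minimising sequence by a unitary of \<open>N\<close>
  gives another one, hence one with the same limit.\<close>

lemma conv2_close:
  assumes X: "conv2 X x" and Y: "\<And>n. Y n \<in> M"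
    and close: "\<And>n. ip (X n - Y n) (X n - Y n) \<le> K / real (Suc n)"
  shows "conv2 Y x"
proof -
  have XM: "X n \<in> M" "x \<in> M" "(\<lambda>n. n2 (X n - x)) \<longlonglongrightarrow> 0" for n
    using X by (auto simp: conv2_def)
  have "(\<lambda>n. K * (1 / real (Suc n))) \<longlonglongrightarrow> K * 0"
    by (intro tendsto_intros LIMSEQ_Suc[OF lim_1_over_n])
  then have "(\<lambda>n. sqrt (K / real (Suc n))) \<longlonglongrightarrow> sqrt 0"
    by (intro tendsto_real_sqrt) simp
  then have lim: "(\<lambda>n. sqrt (K / real (Suc n)) + n2 (X n - x)) \<longlonglongrightarrow> 0"
    using tendsto_add[OF _ XM(3)] by fastforce
  show ?thesis
  proof (rule conv2I[OF Y XM(2) _ lim])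
    fix n
    have "n2 (X n - Y n) \<le> sqrt (K / real (Suc n))"
      using close[of n] by (simp add: n2_def)
    then show "n2 (Y n - x) \<le> sqrt (K / real (Suc n)) + n2 (X n - x)"
      using n2_triangle3[of "Y n" "X n" x] n2_minus_commute[of "X n" "Y n"] XM Y by auto
  qed
qed

lemma conv2_ip2:
  assumes "conv2 X x" "conv2 Y y"
  shows "(\<lambda>n. ip (X n) (Y n)) \<longlonglongrightarrow> ip x y"
proof -
  have X: "X n \<in> M" "x \<in> M" "(\<lambda>n. n2 (X n - x)) \<longlonglongrightarrow> 0"
    and Y: "Y n \<in> M" "y \<in> M" "(\<lambda>n. n2 (Y n - y)) \<longlonglongrightarrow> 0" for n
    using assms by (auto simp: conv2_def)
  have "(\<lambda>n. ip (X n) (Y n - y)) \<longlonglongrightarrow> 0"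
  proof (rule Lim_null_comparison)
    show "\<forall>\<^sub>F n in sequentially. norm (ip (X n) (Y n - y)) \<le> n2 (X n) * n2 (Y n - y)"
      by (intro always_eventually allI) (simp del: ip_diff_right add: cauchy_schwarz X Y)
    show "(\<lambda>n. n2 (X n) * n2 (Y n - y)) \<longlonglongrightarrow> 0"
      using tendsto_mult[OF conv2_n2[OF assms(1)] Y(3)] by simp
  qed
  then have "(\<lambda>n. ip (X n) (Y n - y) + ip (X n) y) \<longlonglongrightarrow> 0 + ip x y"
    using conv2_ip[OF assms(1) Y(2)] by (intro tendsto_add)
  moreover have "ip (X n) (Y n - y) + ip (X n) y = ip (X n) (Y n)" for n
    using X Y by simp
  ultimately show ?thesis by simp
qed

lemma conv2_ip_self: "conv2 X x \<Longrightarrow> (\<lambda>n. ip (X n) (X n)) \<longlonglongrightarrow> ip x x"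
  by (rule conv2_ip2)

lemma conv2_tr: "conv2 X x \<Longrightarrow> (\<lambda>n. tr (X n)) \<longlonglongrightarrow> tr x"
  using conv2_ip[of X x 1] by (simp add: ip_def)

end

section \<open>Averages over the unitaries of \<open>N\<close>\<close>

context irreducible_inclusion
begin

definition Uni :: "'a set" where "Uni = {w \<in> N. unitary w}"

lemma Uni_eq: "Uni = {w \<in> N. star w * w = 1 \<and> w * star w = 1}"
  unfolding Uni_def unitary_def ..

lemma Uni_closed [simp]: "v \<in> Uni \<Longrightarrow> w \<in> Uni \<Longrightarrow> v * w \<in> Uni" "w \<in> Uni \<Longrightarrow> star w \<in> Uni" "1 \<in> Uni"
  by (simp_all add: Uni_def)

lemma Uni_D [simp]: "w \<in> Uni \<Longrightarrow> w \<in> N" "w \<in> Uni \<Longrightarrow> unitary w"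
  by (simp_all add: Uni_def)

lemma Uni_induct:
  assumes "y \<in> N" and "\<And>w. w \<in> Uni \<Longrightarrow> P w"
    and "P 0" "\<And>x y. x \<in> N \<Longrightarrow> y \<in> N \<Longrightarrow> P x \<Longrightarrow> P y \<Longrightarrow> P (x + y)"
    and "\<And>r x. x \<in> N \<Longrightarrow> P x \<Longrightarrow> P (r *\<^sub>R x)"
  shows "P y"
proof -
  have "y \<in> span Uni"
    using span_unitaries[OF assms(1)] unfolding Uni_eq .
  then have "y \<in> N \<and> P y"
  proof (rule span_induct)
    show "subspace {y. y \<in> N \<and> P y}"
      using assms(3-5) by (auto simp: subspace_def)
  qed (use assms(2) in auto)
  then show ?thesis by simp
qed

text \<open>Irreducibility leaves a real combination of 1 and \<open>j\<close>. As \<open>j\<close>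
  is skew, self-adjointness removes its contribution, and the trace then determines the remaining
  coefficient.\<close>

lemma central_scalar:
  assumes x: "x \<in> M" and sa: "star x = x" and comm: "\<And>w. w \<in> Uni \<Longrightarrow> w * x = x * w"
  shows "x = tr x *\<^sub>R 1"
proof -
  have "y * x = x * y" if "y \<in> N" for y
    using that by (rule Uni_induct) (auto simp: comm algebra_simps)
  then obtain c d where cd: "x = c *\<^sub>R 1 + d *\<^sub>R j"
    using irreducible[OF x] by blast
  have trj: "tr j = 0" using tr_star[of j] by simp
  from sa cd have "d *\<^sub>R j = - (d *\<^sub>R j)" by simp
  then have "d *\<^sub>R j = 0"
    by (metis add.right_inverse scaleR_half_double scaleR_zero_right)
  with cd have "x = c *\<^sub>R 1" by simp
  then show ?thesis by simp
qed

definition avg :: "(real \<times> 'a) list \<Rightarrow> 'a \<Rightarrow> 'a"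
  where "avg F x = wsum F (\<lambda>w. w * x * star w)"

lemma family_Uni: "convex_family Uni F \<Longrightarrow> w \<in> snd ` set F \<Longrightarrow> w \<in> Uni"
  by (auto simp: convex_family_def)

lemma avg_M [simp]: "convex_family Uni F \<Longrightarrow> x \<in> M \<Longrightarrow> avg F x \<in> M"
  unfolding avg_def by (rule wsum_M) (auto dest: family_Uni)

lemma tr_avg: "convex_family Uni F \<Longrightarrow> x \<in> M \<Longrightarrow> tr (avg F x) = tr x"
proof -
  assume a: "convex_family Uni F" "x \<in> M"
  have "tr (avg F x) = wsum F (\<lambda>w. tr (w * x * star w))"
    unfolding avg_def using a by (intro tr_wsum) (auto dest: family_Uni)
  also have "\<dots> = wsum F (\<lambda>w. tr x)"
    by (rule convex_family_cong[OF a(1)]) (use a tr_commute[of "_ * x" "star _"] in \<open>simp flip: mult.assoc\<close>)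
  finally show ?thesis using a by (simp add: convex_family_const)
qed

lemma norm_conj_le: "w \<in> Uni \<Longrightarrow> x \<in> M \<Longrightarrow> norm (w * x * star w) \<le> norm x"
proof -
  assume w: "w \<in> Uni" and x: "x \<in> M"
  have "norm (w * x * star w) \<le> norm w * norm x * norm (star w)"
    by (meson norm_mult_ineq order_trans mult_right_mono norm_ge_zero)
  also have "\<dots> \<le> 1 * norm x * 1"
    using w norm_unitary_le[of w] norm_unitary_le[of "star w"] by (intro mult_mono) auto
  finally show ?thesis by simp
qed

lemma norm_avg_le: "convex_family Uni F \<Longrightarrow> x \<in> M \<Longrightarrow> norm (avg F x) \<le> norm x"
  unfolding avg_def by (rule norm_wsum_le) (auto simp: norm_conj_le)

lemma avg_wprod: "avg (wprod F G) x = avg F (avg G x)"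
  unfolding avg_def wsum_wprod
  by (simp add: wsum_mult_algebra_left wsum_mult_algebra_right flip: mult.assoc)
    (simp add: mult.assoc wsum_mult_algebra_left wsum_mult_algebra_right)

text \<open>Dixmier averaging in the trace norm: the element of least norm in the closed convex hull
  of the conjugates of \<open>x\<close> is unique, hence fixed by conjugation, hence a scalar; the
  trace is constant on the hull.\<close>

lemma average_to_trace:
  assumes x: "x \<in> M" and sa: "star x = x"
  obtains F where "\<And>n. convex_family Uni (F n)" "conv2 (\<lambda>n. avg (F n) x) (tr x *\<^sub>R 1)"
proof -
  define q where "q F = ip (avg F x) (avg F x)" for F
  define d where "d F G = ip (avg F x - avg G x) (avg F x - avg G x)" for F G
  obtain F m where F: "\<And>n. F n \<in> Collect (convex_family Uni)"
    "\<And>n. q (F n) \<le> m + 1 / real (Suc n)"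
    "\<And>G. G \<in> Collect (convex_family Uni) \<Longrightarrow> m \<le> q G"
    "\<And>F G. F \<in> Collect (convex_family Uni) \<Longrightarrow> G \<in> Collect (convex_family Uni) \<Longrightarrow>
      d F G \<le> 2 * (q F - m) + 2 * (q G - m)"
  proof (rule minimising_sequence[of "Collect (convex_family Uni)" q d])
    show "Collect (convex_family Uni) \<noteq> {}"
      using convex_family_singleton[of 1 Uni] by auto
    show "0 \<le> q F" if "F \<in> Collect (convex_family Uni)" for F
      using that x by (simp add: q_def)
    fix F G assume FG: "F \<in> Collect (convex_family Uni)" "G \<in> Collect (convex_family Uni)"
    then obtain H where H: "convex_family Uni H"
      "\<And>\<phi> :: 'a \<Rightarrow> 'a. wsum H \<phi> = (1/2) *\<^sub>R (wsum F \<phi> + wsum G \<phi>)"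
      by (auto elim: convex_family_mid)
    have "avg H x = (1/2) *\<^sub>R (avg F x + avg G x)" by (simp add: avg_def H(2))
    then have "q H = (q F + q G) / 2 - d F G / 4"
      using x FG ip_commute[of "avg F x" "avg G x"] by (simp add: q_def d_def field_simps)
    then show "\<exists>H\<in>Collect (convex_family Uni). q H \<le> (q F + q G) / 2 - d F G / 4"
      using H(1) by auto
  qed (use that in blast)
  have Fc: "convex_family Uni (F n)" for n using F(1) by simp
  have rate: "d (F m) (F n) \<le> 2 * (1 / real (Suc m) + 1 / real (Suc n))" for m n
    using F(4)[OF F(1) F(1), of m n] F(2)[of m] F(2)[of n] by simp
  obtain z where z: "conv2 (\<lambda>n. avg (F n) x) z"
    by (rule conv2_complete_rate[of "\<lambda>n. avg (F n) x" "norm x" 2])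
      (use rate Fc x in \<open>simp_all add: norm_avg_le d_def del: ip_diff_left ip_diff_right\<close>)
  then have zM: "z \<in> M" by (simp add: conv2_def)
  \<comment> \<open>Conjugation preserves \<open>q\<close>, so the conjugated averages minimise as
    well and stay within a vanishing distance of the original ones.\<close>
  have inv: "w * z * star w = z" if w: "w \<in> Uni" for w
  proof -
    have cw: "convex_family Uni (wprod [(1, w)] (F n))" for n
      by (rule convex_family_wprod[OF convex_family_singleton[OF w] Fc]) auto
    have aw: "avg (wprod [(1, w)] (F n)) x = w * avg (F n) x * star w" for n
      unfolding avg_wprod by (simp add: avg_def)
    have "q (wprod [(1, w)] (F n)) = q (F n)" for n
      unfolding q_def aw using w x Fc[of n]
      by (simp flip: n2_sq)
    then have "d (F n) (wprod [(1, w)] (F n)) \<le> 4 / real (Suc n)" for n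
      using F(4)[OF F(1), of "wprod [(1, w)] (F n)" n] cw[of n] F(2)[of n] by simp
    then have "conv2 (\<lambda>n. w * avg (F n) x * star w) z"
      using z w x Fc by (intro conv2_close[where K = 4, OF z]) (simp_all add: d_def aw)
    moreover have "conv2 (\<lambda>n. w * avg (F n) x * star w) (w * z * star w)"
      using w z by (intro conv2_mult_left conv2_mult_right) auto
    ultimately show ?thesis by (metis conv2_unique)
  qed
  have "star (avg (F n) x) = avg (F n) x" for n
    by (simp add: avg_def star_wsum sa mult.assoc)
  then have "conv2 (\<lambda>n. avg (F n) x) (star z)" using conv2_star[OF z] by simp
  then have "star z = z" using z conv2_unique by blast
  moreover have "w * z = z * w" if "w \<in> Uni" for w
    using inv[OF that] that by (metis Uni_D(2) unitary_simps(6))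
  ultimately have zz: "z = tr z *\<^sub>R 1" by (rule central_scalar[OF zM])
  have trz: "tr z = tr x"
    using LIMSEQ_unique[OF conv2_tr[OF z], of "tr x"] Fc x by (simp add: tr_avg)
  have "tr x *\<^sub>R 1 = z" using zz unfolding trz by (rule sym)
  with z have "conv2 (\<lambda>n. avg (F n) x) (tr x *\<^sub>R 1)" by simp
  with Fc show thesis by (rule that)
qed

end

context irreducible_inclusion
begin

subsection \<open>Positivity of the Hilbert--Schmidt form\<close>

text \<open>
  A family of pairs \<open>(p, q)\<close> stands for the operator \<open>\<Sum> p e q\<close> in the basic construction, and
  \<open>hs\<close> is the square of its Hilbert--Schmidt norm.
\<close>

definition hs :: "(real \<times> ('a \<times> 'a)) list \<Rightarrow> real"
  where "hs F = wsum F (\<lambda>u. wsum F (\<lambda>v. ip (E (star (fst u) * fst v) * snd v) (snd u)))"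

text \<open>The row of the Gram matrix of the left components that belongs to \<open>p\<close>,
  applied to the column of right components. It is the off-diagonal contribution when
  \<open>p\<close> joins the family.\<close>

definition row :: "'a \<Rightarrow> (real \<times> ('a \<times> 'a)) list \<Rightarrow> 'a"
  where "row p F = wsum F (\<lambda>v. E (star p * fst v) * snd v)"

definition pairs_in_M :: "(real \<times> ('a \<times> 'a)) list \<Rightarrow> bool"
  where "pairs_in_M F \<longleftrightarrow> (\<forall>u\<in>snd ` set F. fst u \<in> M \<and> snd u \<in> M)"

lemma pairs_in_M_Cons [simp]:
  "pairs_in_M ((l, (p, q)) # F) \<longleftrightarrow> p \<in> M \<and> q \<in> M \<and> pairs_in_M F"
  by (auto simp: pairs_in_M_def)

lemma pairs_in_M_D [simp]:
  assumes "pairs_in_M F" "u \<in> snd ` set F" shows "fst u \<in> M" "snd u \<in> M"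
  using assms by (auto simp only: pairs_in_M_def)

lemma row_M: "p \<in> M \<Longrightarrow> pairs_in_M F \<Longrightarrow> row p F \<in> M"
  unfolding row_def by (rule wsum_M) simp

lemma hs_Cons:
  assumes F: "pairs_in_M F" and pq: "p \<in> M" "q \<in> M"
  shows "hs ((l, (p, q)) # F) = l\<^sup>2 * ip (E (star p * p) * q) q + 2 * l * ip (row p F) q + hs F"
proof -
  have sym: "ip (E (star (fst u) * p) * q) (snd u) = ip (E (star p * fst u) * snd u) q"
    if "u \<in> snd ` set F" for u
  proof -
    have u: "fst u \<in> M" "snd u \<in> M" using that F by simp_all
    have "ip (E (star (fst u) * p) * q) (snd u) = ip q (star (E (star (fst u) * p)) * snd u)"
      using u pq by (simp add: ip_mult_left)
    also have "star (E (star (fst u) * p)) = E (star p * fst u)"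
      using u pq E_star[of "star (fst u) * p"] by simp
    finally show ?thesis using u pq by (simp add: ip_commute)
  qed
  have "wsum F (\<lambda>u. ip (E (star (fst u) * p) * q) (snd u)) = ip (row p F) q"
    unfolding row_def using F pq sym by (subst ip_wsum_left) (simp_all cong: wsum_cong)
  moreover have "wsum F (\<lambda>v. ip (E (star p * fst v) * snd v) q) = ip (row p F) q"
    unfolding row_def using F pq by (subst ip_wsum_left) simp_all
  ultimately show ?thesis
    by (simp add: hs_def wsum_add wsum_mult algebra_simps power2_eq_square)
qed

text \<open>
  The Schur complement of the first diagonal entry, perturbed to make it invertible, is
  again a Gram matrix up to a positive term.
\<close>

lemma hs_nonneg:
  "pairs_in_M F \<Longrightarrow> 0 \<le> hs F"
proof (induction "length F" arbitrary: F)
  case 0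
  then show ?case by (simp add: hs_def)
next
  case (Suc n)
  then obtain u G where "F = u # G" by (cases F) auto
  moreover obtain l p q' where "u = (l, (p, q'))" by (cases u) auto
  ultimately have F: "F = (l, (p, q')) # G" by simp
  have pM: "p \<in> M" "q' \<in> M" and G: "pairs_in_M G"
    using Suc.prems unfolding F by simp_all
  define q where "q = l *\<^sub>R q'"
  have qM: "q \<in> M" using pM by (simp add: q_def)
  define m where "m = E (star p * p)"
  define S where "S = row p G"
  have mN: "m \<in> N" "star m = m" and SM: "S \<in> M"
    using pM G E_star[of "star p * p"] by (auto simp: m_def S_def row_M)
  have hsF: "hs F = ip (m * q) q + 2 * ip S q + hs G"
    unfolding F using pM G SM
    by (simp add: hs_Cons q_def m_def[symmetric] S_def[symmetric] power2_eq_square mN)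
  have "0 \<le> hs F + e * ip q q" if e: "e > 0" for e
  proof -
    have mpos: "pos m" unfolding m_def using pM by (intro pos_E)
    obtain h where h: "h \<in> N" "h * (m + e *\<^sub>R 1) = 1" "(m + e *\<^sub>R 1) * h = 1"
      using inverse_N[OF mN _ e] mpos by (auto simp: pos_def ip_def)
    have hs: "star h = h"
    proof -
      have "star h * (m + e *\<^sub>R 1) = 1"
        using arg_cong[OF h(3), of star] mN by simp
      then have "star h * ((m + e *\<^sub>R 1) * h) = h" by (simp flip: mult.assoc)
      then show ?thesis using h(3) by simp
    qed
    \<comment> \<open>This is \<open>h + h - h * m * h\<close>: as \<open>h\<close> inverts
      \<open>m\<close> plus \<open>e\<close>, the product \<open>h * m * h\<close> equals
      \<open>h\<close> minus \<open>e\<close> times \<open>h * h\<close>.\<close>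
    define k where "k = h + e *\<^sub>R (h * h)"
    have k: "k \<in> N" "star k = k" using h hs by (auto simp: k_def)
    \<comment> \<open>Each left component loses its part along \<open>p\<close>, computed with the
      regularised inverse \<open>h\<close> of \<open>m\<close>. Exact orthogonality is lost, and
      \<open>k\<close> in place of \<open>h\<close> records the defect.\<close>
    define f where "f u = (fst u - p * (h * E (star p * fst u)), snd u)" for u :: "'a \<times> 'a"
    define G' where "G' = map (\<lambda>u. (1 * fst u, f (snd u))) G"
    have G': "pairs_in_M G'" 
      using G pM h unfolding pairs_in_M_def G'_def f_def by auto
    have "0 \<le> hs G'" using Suc.hyps(1)[of G'] G' Suc.hyps(2) F by (simp add: G'_def)
    have w: "wsum G' \<phi> = wsum G (\<lambda>v. \<phi> (f v))" for \<phi> :: "'a \<times> 'a \<Rightarrow> real"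
      unfolding G'_def wsum_map by simp
    have entry: "ip (E (star (fst (f u)) * fst (f v)) * snd (f v)) (snd (f u)) =
        ip (E (star (fst u) * fst v) * snd v) (snd u) -
        ip (k * (E (star p * fst v) * snd v)) (E (star p * fst u) * snd u)"
      if uv: "u \<in> snd ` set G" "v \<in> snd ` set G" for u v
    proof -
      have M: "fst u \<in> M" "snd u \<in> M" "fst v \<in> M" "snd v \<in> M" using uv G by simp_all
      define a b where "a = E (star p * fst u)" and "b = E (star p * fst v)"
      have ab: "a \<in> N" "b \<in> N" using M pM by (auto simp: a_def b_def)
      have sa: "E (star (fst u) * p) = star a"
        using E_star[of "star p * fst u"] M pM by (simp add: a_def)
      have "star (fst (f u)) * fst (f v) = star (fst u) * fst v - star (fst u) * p * (h * b)
          - star a * h * (star p * fst v) + star a * h * (star p * p) * (h * b)"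
        by (simp add: f_def a_def b_def hs algebra_simps)
      then have "E (star (fst (f u)) * fst (f v)) = E (star (fst u) * fst v) - star a * (h * b)
          - star a * h * b + star a * h * m * (h * b)"
        using M pM ab h sa by (simp add: b_def[symmetric] m_def[symmetric])
      also have "\<dots> = E (star (fst u) * fst v) - star a * (h + h - h * m * h) * b"
        by (simp add: algebra_simps)
      also have "h + h - h * m * h = k"
      proof -
        have "h * m * h + e *\<^sub>R (h * h) = h * ((m + e *\<^sub>R 1) * h)" by (simp add: algebra_simps)
        then have "h * m * h + e *\<^sub>R (h * h) = h" unfolding h(3) by simp
        then show ?thesis unfolding k_def by (metis add.commute add.assoc add_diff_cancel_right')
      qed
      finally have "ip (E (star (fst (f u)) * fst (f v)) * snd v) (snd u) =
          ip (E (star (fst u) * fst v) * snd v) (snd u) - ip (star a * k * b * snd v) (snd u)"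
        using M ab k by (simp add: left_diff_distrib)
      also have "ip (star a * k * b * snd v) (snd u) = ip (k * (b * snd v)) (a * snd u)"
        using M ab k ip_mult_left[of "star a" "k * (b * snd v)" "snd u"] by (simp add: mult.assoc)
      finally show ?thesis by (simp add: f_def a_def b_def)
    qed
    have "hs G' = wsum G (\<lambda>u. wsum G (\<lambda>v. ip (E (star (fst u) * fst v) * snd v) (snd u) -
        ip (k * (E (star p * fst v) * snd v)) (E (star p * fst u) * snd u)))"
      unfolding hs_def w by (intro wsum_cong entry)
    also have "\<dots> = hs G - wsum G (\<lambda>u. wsum G (\<lambda>v.
        ip (k * (E (star p * fst v) * snd v)) (E (star p * fst u) * snd u)))"
      by (simp add: wsum_diff hs_def)
    also have "wsum G (\<lambda>u. wsum G (\<lambda>v.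
        ip (k * (E (star p * fst v) * snd v)) (E (star p * fst u) * snd u))) = ip (k * S) S"
    proof -
      have "wsum G (\<lambda>v. ip (k * (E (star p * fst v) * snd v)) x) = ip (k * S) x" if "x \<in> M" for x
        unfolding S_def row_def wsum_mult_algebra_left[symmetric] using that G pM k
        by (subst ip_wsum_left) simp_all
      then have "wsum G (\<lambda>u. wsum G (\<lambda>v.
          ip (k * (E (star p * fst v) * snd v)) (E (star p * fst u) * snd u))) =
          wsum G (\<lambda>u. ip (k * S) (E (star p * fst u) * snd u))"
        using G pM by (intro wsum_cong) simp
      also have "\<dots> = wsum G (\<lambda>u. ip (E (star p * fst u) * snd u) (k * S))"
        using G pM k SM by (intro wsum_cong ip_commute) simp_all
      also have "\<dots> = ip S (k * S)"
        unfolding S_def row_def using G pM k SM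
        by (subst ip_wsum_left) (simp_all add: S_def[unfolded row_def])
      finally show ?thesis using k SM by (simp add: ip_commute)
    qed
    finally have hG: "hs G = hs G' + ip (k * S) S" by simp
    \<comment> \<open>Completing the square at \<open>q + h * S\<close>. What is left over is
      \<open>hs G'\<close> and \<open>e\<close> times the squared norm of \<open>h * S\<close>, both
      nonnegative.\<close>
    have "0 \<le> ip (m * (q + h * S)) (q + h * S)"
      using mpos qM h SM by (intro pos_ip) auto
    moreover have "0 \<le> e * ip (q + h * S) (q + h * S)"
      using e qM h SM by (intro mult_nonneg_nonneg ip_nonneg) auto
    moreover have "ip (m * (q + h * S)) (q + h * S) + e * ip (q + h * S) (q + h * S) =
        ip (m * q) q + e * ip q q + 2 * ip S q + ip (h * S) S"
    proof -
      have "m * (q + h * S) + e *\<^sub>R (q + h * S) = (m + e *\<^sub>R 1) * q + (m + e *\<^sub>R 1) * h * S"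
        by (simp add: algebra_simps)
      then have x: "m * (q + h * S) + e *\<^sub>R (q + h * S) = (m + e *\<^sub>R 1) * q + S"
        using h(3) by simp
      have "ip ((m + e *\<^sub>R 1) * q) (h * S) = ip (h * (m + e *\<^sub>R 1) * q) S"
        using ip_mult_left[of h "(m + e *\<^sub>R 1) * q" S] hs h(1) mN qM SM by (simp add: mult.assoc)
      then have y: "ip ((m + e *\<^sub>R 1) * q) (h * S) = ip S q"
        using h(2) qM SM by (simp add: ip_commute)
      have "ip (m * (q + h * S)) (q + h * S) + e * ip (q + h * S) (q + h * S) =
          ip (m * (q + h * S) + e *\<^sub>R (q + h * S)) (q + h * S)"
        using mN h qM SM by (simp add: distrib_left)
      also have "\<dots> = ip ((m + e *\<^sub>R 1) * q) q + ip ((m + e *\<^sub>R 1) * q) (h * S) +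
          ip S q + ip S (h * S)"
        unfolding x using mN h qM SM by simp
      also have "ip ((m + e *\<^sub>R 1) * q) q = ip (m * q) q + e * ip q q"
        using mN qM by (simp add: left_diff_distrib algebra_simps)
      finally show ?thesis using y h SM by (simp add: ip_commute)
    qed
    moreover have "ip (k * S) S = ip (h * S) S + e * ip (h * S) (h * S)"
      using h hs SM ip_mult_left[of h "h * S" S] by (simp add: k_def distrib_right mult.assoc)
    moreover have "0 \<le> e * ip (h * S) (h * S)" using e h SM by simp
    ultimately show ?thesis
      unfolding hsF hG using \<open>0 \<le> hs G'\<close> by linarith
  qed
  then have nn: "0 \<le> hs F + e * ip q q" if "e > 0" for e using that by blast
  show ?case
  proof (rule field_le_epsilon)
    fix e :: real assume e: "e > 0"
    have c: "0 \<le> ip q q" using qM by simp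
    have "0 \<le> hs F + e / (1 + ip q q) * ip q q"
      using nn[of "e / (1 + ip q q)"] e c by simp
    also have "e / (1 + ip q q) * ip q q \<le> e"
      using e c by (simp add: field_simps)
    finally show "0 \<le> hs F + e" by simp
  qed
qed

subsection \<open>The averaged kernel\<close>

text \<open>The operator sum of \<open>w a e star (w a)\<close>, where \<open>e\<close> is the
  projection of \<open>M\<close> onto \<open>N\<close>, applied to \<open>y\<close>.\<close>

definition kmap :: "'a \<Rightarrow> (real \<times> 'a) list \<Rightarrow> 'a \<Rightarrow> 'a"
  where "kmap a F y = wsum F (\<lambda>w. w * a * E (star (w * a) * y))"

text \<open>The Hilbert-Schmidt inner product of two operators \<open>kmap\<close>: the canonical
  trace of \<open>x e star x\<close> times \<open>y e star y\<close> is the squared trace norm of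
  \<open>E (star x * y)\<close>.\<close>

definition hsip :: "'a \<Rightarrow> (real \<times> 'a) list \<Rightarrow> (real \<times> 'a) list \<Rightarrow> real"
  where "hsip a F G = wsum F (\<lambda>w. wsum G (\<lambda>v.
    ip (E (star (w * a) * (v * a))) (E (star (w * a) * (v * a)))))"

text \<open>Cauchy-Schwarz in the Hilbert-Schmidt form between the operator and
  \<open>y e z\<close>, where \<open>z\<close> is the testing vector. The operator norm of
  \<open>y\<close> appears because the Hilbert-Schmidt norm of \<open>y e z\<close> involves
  \<open>E (star y * y)\<close>. Weights are arbitrary, as differences of averages are the intended
  case.\<close>

lemma n2_kmap_le_hsip:
  assumes a: "a \<in> M" and F: "snd ` set F \<subseteq> Uni" and y: "y \<in> M"
  shows "ip (kmap a F y) (kmap a F y) \<le> hsip a F F * (norm y)\<^sup>2"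
proof -
  define f where "f w = (w * a, star (w * a))" for w
  define G where "G = map (\<lambda>q. (1 * fst q, f (snd q))) F"
  have FM: "w \<in> Uni" if "w \<in> snd ` set F" for w using F that by blast
  have w: "wsum G \<phi> = wsum F (\<lambda>v. \<phi> (f v))" for \<phi> :: "'a \<times> 'a \<Rightarrow> 'b::real_vector"
    unfolding G_def wsum_map by simp
  have GM: "pairs_in_M G" using FM a unfolding pairs_in_M_def G_def f_def by auto
  have entry: "ip (E (star (fst (f w)) * fst (f v)) * snd (f v)) (snd (f w)) =
      ip (E (star (w * a) * (v * a))) (E (star (w * a) * (v * a)))"
    if "w \<in> snd ` set F" "v \<in> snd ` set F" for v w
  proof -
    have M: "w * a \<in> M" "v * a \<in> M" using FM[OF that(1)] FM[OF that(2)] a by simp_all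
    have "ip (E (star (w * a) * (v * a)) * star (v * a)) (star (w * a)) =
        ip (E (star (w * a) * (v * a))) (star (w * a) * (v * a))"
      using M ip_mult_right[of "E (star (w * a) * (v * a))" "star (v * a)" "star (w * a)"]
      by (simp del: star_mult)
    also have "\<dots> = ip (E (star (w * a) * (v * a))) (E (star (w * a) * (v * a)))"
      using M ip_E'[of "star (w * a) * (v * a)" "E (star (w * a) * (v * a))"]
      by (simp del: star_mult)
    finally show ?thesis by (simp add: f_def del: star_mult)
  qed
  have hsG: "hs G = hsip a F F"
    unfolding hs_def w hsip_def by (intro wsum_cong entry)
  have kM: "kmap a F z \<in> M" if "z \<in> M" for z
    unfolding kmap_def using that a FM by (intro wsum_M) simp
  have row: "row z G = star (kmap a F z)" if "z \<in> M" for z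
    unfolding row_def w kmap_def star_wsum
  proof (rule wsum_cong)
    fix w assume "w \<in> snd ` set F"
    then have wa: "w * a \<in> M" using FM a by simp
    have "E (star z * b) = star (E (star b * z))" if "b \<in> M" for b
      using E_star[of "star b * z"] that \<open>z \<in> M\<close> by simp
    from this[OF wa] show "E (star z * fst (f w)) * snd (f w) = star (w * a * E (star (w * a) * z))"
      by (simp add: f_def mult.assoc)
  qed
  have "(ip (kmap a F y) z)\<^sup>2 \<le> hsip a F F * ((norm y)\<^sup>2 * ip z z)" if z: "z \<in> M" for z
  proof -
    define C where "C = ip (E (star y * y) * star z) (star z)"
    have "(ip (kmap a F y) z)\<^sup>2 \<le> hsip a F F * C"
    proof (rule quadratic_nonneg_imp)
      fix t :: real
      have "0 \<le> hs ((t, (y, star z)) # G)"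
        using GM y z by (intro hs_nonneg) simp
      also have "\<dots> = t\<^sup>2 * C + 2 * t * ip (star (kmap a F y)) (star z) + hsip a F F"
        using GM y z by (simp add: hs_Cons row hsG C_def)
      finally show "0 \<le> hsip a F F + 2 * t * ip (kmap a F y) z + t\<^sup>2 * C"
        using kM[OF y] z by (simp add: ip_star)
      show "0 \<le> C" unfolding C_def using pos_ip[OF pos_E[OF y], of "star z"] z by simp
    qed
    moreover have "C \<le> (norm y)\<^sup>2 * ip z z"
      unfolding C_def using ip_E_star_mult_le[OF y, of "star z"] z by (simp add: ip_star)
    moreover have "0 \<le> hsip a F F" using hs_nonneg[OF GM] hsG by simp
    ultimately show ?thesis by (meson mult_left_mono order_trans)
  qed
  from this[OF kM[OF y]]
  have "ip (kmap a F y) (kmap a F y) * ip (kmap a F y) (kmap a F y) \<le>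
      (hsip a F F * (norm y)\<^sup>2) * ip (kmap a F y) (kmap a F y)"
    by (simp add: power2_eq_square algebra_simps)
  moreover have "0 \<le> hsip a F F * (norm y)\<^sup>2" using hs_nonneg[OF GM] hsG by simp
  moreover have "0 \<le> ip (kmap a F y) (kmap a F y)" using kM[OF y] by (rule ip_nonneg)
  ultimately show ?thesis
    by (cases "ip (kmap a F y) (kmap a F y) = 0") (simp_all add: mult_le_cancel_right)
qed

end

section \<open>The limit of the averaged kernels\<close>

context irreducible_inclusion
begin

lemma kmap_M [simp]:
  assumes "convex_family Uni F" "a \<in> M" "y \<in> M" shows "kmap a F y \<in> M"
  unfolding kmap_def using assms family_Uni[OF assms(1)] by (intro wsum_M) simp

lemma kmap_add:
  assumes "convex_family Uni F" "a \<in> M" "y \<in> M" "z \<in> M"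
  shows "kmap a F (y + z) = kmap a F y + kmap a F z"
  unfolding kmap_def wsum_add[symmetric]
  by (rule convex_family_cong[OF assms(1)]) (use assms in \<open>simp add: distrib_left\<close>)

lemma kmap_mult_right:
  assumes "convex_family Uni F" "a \<in> M" "y \<in> M" "n \<in> N"
  shows "kmap a F (y * n) = kmap a F y * n"
  unfolding kmap_def wsum_mult_algebra_right[symmetric]
proof (rule convex_family_cong[OF assms(1)])
  fix w assume w: "w \<in> Uni"
  have "E (star (w * a) * (y * n)) = E (star (w * a) * y) * n"
    using E_mult_right[of "star (w * a) * y" n] w assms by (simp add: mult.assoc del: E_mult_right)
  then show "w * a * E (star (w * a) * (y * n)) = w * a * E (star (w * a) * y) * n"
    by (simp add: mult.assoc)
qed

lemma kmap_wprod: "kmap a (wprod H F) y = wsum H (\<lambda>v. v * kmap a F (star v * y))"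
  unfolding kmap_def wsum_wprod wsum_mult_algebra_left[symmetric] by (simp add: mult.assoc)

lemma kmap_ip:
  assumes "convex_family Uni F" "a \<in> M" "y \<in> M" "z \<in> M"
  shows "ip (kmap a F y) z = wsum F (\<lambda>w. ip (E (star (w * a) * y)) (E (star (w * a) * z)))"
proof -
  have "ip (kmap a F y) z = wsum F (\<lambda>w. ip (w * a * E (star (w * a) * y)) z)"
    unfolding kmap_def using assms family_Uni[OF assms(1)] by (intro ip_wsum_left) simp_all
  also have "\<dots> = wsum F (\<lambda>w. ip (E (star (w * a) * y)) (E (star (w * a) * z)))"
  proof (rule convex_family_cong[OF assms(1)])
    fix w assume "w \<in> Uni"
    then have b: "w * a \<in> M" using assms by simp
    have "ip (b * E (star b * y)) z = ip (E (star b * y)) (E (star b * z))" if "b \<in> M" for b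
      using that assms ip_mult_left[of b "E (star b * y)" z] ip_E'[of "star b * z" "E (star b * y)"]
      by simp
    from this[OF b] show "ip (w * a * E (star (w * a) * y)) z =
      ip (E (star (w * a) * y)) (E (star (w * a) * z))" .
  qed
  finally show ?thesis .
qed

lemma unitary_family_bounds:
  assumes "w \<in> Uni" "a \<in> M" "unitary a" "y \<in> M"
  shows "norm (w * a * E (star (w * a) * y)) \<le> norm y"
    "n2 (w * a * E (star (w * a) * y)) \<le> n2 y" "w * a * E (star (w * a) * y) \<in> M"
proof -
  define b where "b = w * a"
  have b: "b \<in> M" "unitary b" using assms by (simp_all add: b_def)
  have "norm (b * E (star b * y)) \<le> norm b * norm (E (star b * y))" by (rule norm_mult_ineq)
  also have "\<dots> \<le> 1 * norm (star b * y)"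
    using b assms norm_unitary_le[of b] by (intro mult_mono norm_E_le) auto
  also have "\<dots> \<le> 1 * (norm (star b) * norm y)" by (simp add: norm_mult_ineq)
  also have "\<dots> \<le> 1 * (1 * norm y)"
    using b norm_unitary_le[of "star b"] by (intro mult_left_mono mult_right_mono) auto
  finally show "norm (w * a * E (star (w * a) * y)) \<le> norm y" by (simp add: b_def)
  have "n2 (b * E (star b * y)) \<le> n2 (star b * y)" using b assms n2_E_le[of "star b * y"] by simp
  also have "\<dots> = n2 y" using b assms by simp
  finally show "n2 (w * a * E (star (w * a) * y)) \<le> n2 y" by (simp add: b_def)
  show "w * a * E (star (w * a) * y) \<in> M" using b assms by (simp add: b_def[symmetric])
qed

lemma norm_kmap_le:
  assumes "convex_family Uni F" "a \<in> M" "unitary a" "y \<in> M"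
  shows "norm (kmap a F y) \<le> norm y"
  unfolding kmap_def by (rule norm_wsum_le[OF assms(1)]) (rule unitary_family_bounds(1)[OF _ assms(2-4)])

lemma n2_kmap_le:
  assumes "convex_family Uni F" "a \<in> M" "unitary a" "y \<in> M"
  shows "n2 (kmap a F y) \<le> n2 y"
  unfolding kmap_def
  by (rule n2_wsum_le[OF assms(1)]) (use unitary_family_bounds(2,3)[OF _ assms(2-4)] in blast)

lemma kmap_diff: "kmap a F y - kmap a G y = kmap a (F @ wneg G) y"
  by (simp add: kmap_def)

lemma hsip_diff: "hsip a (F @ wneg G) (F @ wneg G) = hsip a F F - hsip a F G - hsip a G F + hsip a G G"
  by (simp add: hsip_def wsum_diff)

definition bimodular :: "('a \<Rightarrow> 'a) \<Rightarrow> bool"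
  where "bimodular T \<longleftrightarrow> (\<forall>y\<in>M. T y \<in> M) \<and> (\<forall>y\<in>M. \<forall>z\<in>M. T (y + z) = T y + T z) \<and>
    (\<forall>n\<in>N. \<forall>y\<in>M. T (n * y) = n * T y \<and> T (y * n) = T y * n)"

lemma bimodular_M: "bimodular T \<Longrightarrow> y \<in> M \<Longrightarrow> T y \<in> M"
  and bimodular_add: "bimodular T \<Longrightarrow> y \<in> M \<Longrightarrow> z \<in> M \<Longrightarrow> T (y + z) = T y + T z"
  and bimodular_left: "bimodular T \<Longrightarrow> n \<in> N \<Longrightarrow> y \<in> M \<Longrightarrow> T (n * y) = n * T y"
  and bimodular_right: "bimodular T \<Longrightarrow> n \<in> N \<Longrightarrow> y \<in> M \<Longrightarrow> T (y * n) = T y * n"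
  by (auto simp: bimodular_def)

lemma bimodular_scaleR: "bimodular T \<Longrightarrow> y \<in> M \<Longrightarrow> T (r *\<^sub>R y) = r *\<^sub>R T y"
  using bimodular_left[of T "r *\<^sub>R 1" y] by simp

lemma bimodular_diff: "bimodular T \<Longrightarrow> y \<in> M \<Longrightarrow> z \<in> M \<Longrightarrow> T (y - z) = T y - T z"
  using bimodular_add[of T y "-1 *\<^sub>R z"] bimodular_scaleR[of T z "-1"] by simp

definition positive_contraction :: "('a \<Rightarrow> 'a) \<Rightarrow> bool"
  where "positive_contraction T \<longleftrightarrow> bimodular T \<and> (\<forall>y\<in>M. \<forall>z\<in>M. ip (T y) z = ip y (T z)) \<and>
    (\<forall>y\<in>M. 0 \<le> ip (T y) y) \<and> (\<forall>y\<in>M. n2 (T y) \<le> n2 y)"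

text \<open>The error is controlled uniformly on norm balls. This lets a further average, chosen
  differently for each index, be applied in \<open>approximates_refine\<close> without losing the
  limit.\<close>

definition approximates :: "'a \<Rightarrow> (nat \<Rightarrow> (real \<times> 'a) list) \<Rightarrow> (nat \<Rightarrow> real) \<Rightarrow> ('a \<Rightarrow> 'a) \<Rightarrow> bool"
  where "approximates a F r k \<longleftrightarrow> (\<forall>n. convex_family Uni (F n)) \<and> r \<longlonglongrightarrow> 0 \<and>
    (\<forall>n. \<forall>y\<in>M. n2 (kmap a (F n) y - k y) \<le> r n * norm y)"

text \<open>The Hilbert-Schmidt norm makes the minimiser unique; since that norm is invariant under
  translation by unitaries of \<open>N\<close>, the limit commutes with the left action. Commutation
  with the right action holds for every average already. Letting the second index tend to infinity
  in \<open>rate\<close> gives the explicit error.\<close>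

lemma averaged_kernel:
  assumes a: "a \<in> M" "unitary a"
  obtains k F r where "positive_contraction k" "\<And>y. y \<in> M \<Longrightarrow> norm (k y) \<le> norm y"
    "approximates a F r k"
proof -
  let ?C = "Collect (convex_family Uni)"
  define q where "q F = hsip a F F" for F
  define d where "d F G = hsip a (F @ wneg G) (F @ wneg G)" for F G
  obtain F m where F: "\<And>n. F n \<in> ?C" "\<And>n. q (F n) \<le> m + 1 / real (Suc n)"
    "\<And>G. G \<in> ?C \<Longrightarrow> m \<le> q G"
    "\<And>F G. F \<in> ?C \<Longrightarrow> G \<in> ?C \<Longrightarrow> d F G \<le> 2 * (q F - m) + 2 * (q G - m)"
  proof (rule minimising_sequence[of ?C q d])
    show "?C \<noteq> {}" using convex_family_singleton[of 1 Uni] by auto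
    show "0 \<le> q F" if "F \<in> ?C" for F
    proof -
      have F: "convex_family Uni F" using that by simp
      show ?thesis unfolding q_def hsip_def
        by (intro convex_family_ge[OF F]) (use a in simp)
    qed
    fix F G assume FG: "F \<in> ?C" "G \<in> ?C"
    then obtain H where H: "convex_family Uni H"
      "\<And>\<phi> :: 'a \<Rightarrow> real. wsum H \<phi> = (wsum F \<phi> + wsum G \<phi>) / 2"
      by (auto elim: convex_family_mid)
    have H': "wsum H \<phi> = (1/2) * (wsum F \<phi> + wsum G \<phi>)" for \<phi> :: "'a \<Rightarrow> real"
      by (simp add: H(2))
    have "hsip a H H = (1/2) * ((1/2) * (hsip a F F + hsip a G F + (hsip a F G + hsip a G G)))"
      unfolding hsip_def H' wsum_mult wsum_add by (simp add: algebra_simps)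
    then have "q H = (q F + q G) / 2 - d F G / 4"
      unfolding q_def d_def hsip_diff by (simp add: field_simps)
    then show "\<exists>H\<in>?C. q H \<le> (q F + q G) / 2 - d F G / 4"
      using H(1) by auto
  qed (use that in blast)
  have Fc: "convex_family Uni (F n)" for n using F(1) by simp
  have dist: "ip (kmap a F y - kmap a G y) (kmap a F y - kmap a G y) \<le> d F G * (norm y)\<^sup>2"
    if "convex_family Uni F" "convex_family Uni G" "y \<in> M" for F G y
    unfolding kmap_diff d_def
    by (rule n2_kmap_le_hsip[OF a(1)]) (use that in \<open>auto simp: convex_family_def wneg_def\<close>)
  have rate: "ip (kmap a (F m) y - kmap a (F n) y) (kmap a (F m) y - kmap a (F n) y) \<le>
      (2 * (norm y)\<^sup>2) * (1 / real (Suc m) + 1 / real (Suc n))" if "y \<in> M" for m n y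
  proof -
    have "d (F m) (F n) \<le> 2 * (1 / real (Suc m) + 1 / real (Suc n))"
      using F(4)[OF F(1) F(1), of m n] F(2)[of m] F(2)[of n] by simp
    then have "d (F m) (F n) * (norm y)\<^sup>2 \<le> 2 * (1 / real (Suc m) + 1 / real (Suc n)) * (norm y)\<^sup>2"
      by (rule mult_right_mono) simp
    also have "\<dots> = (2 * (norm y)\<^sup>2) * (1 / real (Suc m) + 1 / real (Suc n))"
      by (simp only: mult_ac)
    finally show ?thesis using dist[OF Fc Fc that, of m n] by (rule order_trans[rotated])
  qed
  have "\<exists>x. conv2 (\<lambda>n. kmap a (F n) y) x \<and> norm x \<le> norm y" if y: "y \<in> M" for y
  proof -
    obtain x where "conv2 (\<lambda>n. kmap a (F n) y) x" "norm x \<le> norm y"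
      by (rule conv2_complete_rate[OF kmap_M[OF Fc a(1) y] norm_kmap_le[OF Fc a y] rate[OF y]])
    then show ?thesis by blast
  qed
  then obtain k where k: "\<And>y. y \<in> M \<Longrightarrow> conv2 (\<lambda>n. kmap a (F n) y) (k y)"
    "\<And>y. y \<in> M \<Longrightarrow> norm (k y) \<le> norm y"
    by metis
  have kM: "k y \<in> M" if "y \<in> M" for y using k(1)[OF that] by (simp add: conv2_def)
  have kadd: "k (y + z) = k y + k z" if "y \<in> M" "z \<in> M" for y z
  proof (rule conv2_unique)
    show "conv2 (\<lambda>n. kmap a (F n) (y + z)) (k (y + z))" using k that by simp
    show "conv2 (\<lambda>n. kmap a (F n) (y + z)) (k y + k z)"
      using conv2_add[OF k(1) k(1)] that Fc a by (simp add: kmap_add)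
  qed
  have kright: "k (y * n) = k y * n" if "y \<in> M" "n \<in> N" for y n
  proof (rule conv2_unique)
    show "conv2 (\<lambda>i. kmap a (F i) (y * n)) (k (y * n))" using k that by simp
    show "conv2 (\<lambda>i. kmap a (F i) (y * n)) (k y * n)"
      using conv2_mult_right[OF k(1), of y n] that Fc a by (simp add: kmap_mult_right)
  qed
  \<comment> \<open>The families \<open>F n\<close> translated by \<open>w\<close> have the same
    Hilbert-Schmidt norm, so they minimise too and share the limit.\<close>
  have kconj: "w * k (star w * y) = k y" if w: "w \<in> Uni" and y: "y \<in> M" for w y
  proof (rule conv2_unique)
    let ?G = "\<lambda>n. wprod [(1, w)] (F n)"
    have G: "convex_family Uni (?G n)" for n
      by (rule convex_family_wprod[OF convex_family_singleton[OF w] Fc]) auto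
    have Gm: "kmap a (?G n) y = w * kmap a (F n) (star w * y)" for n
      by (simp add: kmap_wprod)
    show "conv2 (\<lambda>n. kmap a (?G n) y) (w * k (star w * y))"
      unfolding Gm using w y k(1) by (intro conv2_mult_left) auto
    have qG: "q (?G n) = q (F n)" for n
      unfolding q_def hsip_def wsum_wprod using w by (simp add: mult.assoc)
    have dG: "d (F n) (?G n) \<le> 4 / real (Suc n)" for n
      using F(4)[OF F(1), of "?G n" n] G[of n] F(2)[of n] qG[of n] by simp
    show "conv2 (\<lambda>n. kmap a (?G n) y) (k y)"
    proof (rule conv2_close[OF k(1)[OF y]])
      show "kmap a (?G n) y \<in> M" for n using G a y by simp
      show "ip (kmap a (F n) y - kmap a (?G n) y) (kmap a (F n) y - kmap a (?G n) y)
          \<le> (4 * (norm y)\<^sup>2) / real (Suc n)" for n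
        using dist[OF Fc G y, of n n] mult_right_mono[OF dG[of n], of "(norm y)\<^sup>2"] by simp
    qed
  qed
  have kleft: "k (n * y) = n * k y" if n: "n \<in> N" and y: "y \<in> M" for n y
  proof -
    have "\<forall>y\<in>M. k (n * y) = n * k y"
      using n
    proof (rule Uni_induct)
      show "\<forall>y\<in>M. k (w * y) = w * k y" if w: "w \<in> Uni" for w
      proof
        fix y assume "y \<in> M"
        then show "k (w * y) = w * k y" using kconj[OF w, of "w * y"] w by simp
      qed
      show "\<forall>y\<in>M. k (0 * y) = 0 * k y" using kright[of 0 0] by simp
      show "\<forall>y\<in>M. k ((x + x') * y) = (x + x') * k y"
        if "x \<in> N" "x' \<in> N" "\<forall>y\<in>M. k (x * y) = x * k y" "\<forall>y\<in>M. k (x' * y) = x' * k y" for x x'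
        using that by (simp add: distrib_right kadd)
      show "\<forall>y\<in>M. k (r *\<^sub>R x * y) = r *\<^sub>R x * k y"
        if "x \<in> N" "\<forall>y\<in>M. k (x * y) = x * k y" for r x
      proof
        fix y assume y: "y \<in> M"
        show "k (r *\<^sub>R x * y) = r *\<^sub>R x * k y"
          using kright[of "x * y" "r *\<^sub>R 1"] that y by simp
      qed
    qed
    then show ?thesis using y by simp
  qed
  have ksym: "ip (k y) z = ip y (k z)" if "y \<in> M" "z \<in> M" for y z
  proof (rule LIMSEQ_unique)
    show "(\<lambda>n. ip (kmap a (F n) y) z) \<longlonglongrightarrow> ip (k y) z" using k that by (intro conv2_ip) auto
    have "ip (kmap a (F n) y) z = ip (kmap a (F n) z) y" for n
      unfolding kmap_ip[OF Fc a(1) that] kmap_ip[OF Fc a(1) that(2,1)]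
      by (rule convex_family_cong[OF Fc], rule ip_commute) (use a that in simp_all)
    then show "(\<lambda>n. ip (kmap a (F n) y) z) \<longlonglongrightarrow> ip y (k z)"
      using conv2_ip[OF k(1)[OF that(2)] that(1)] kM that by (simp add: ip_commute)
  qed
  have kpos: "0 \<le> ip (k y) y" if "y \<in> M" for y
  proof (rule LIMSEQ_le_const)
    show "(\<lambda>n. ip (kmap a (F n) y) y) \<longlonglongrightarrow> ip (k y) y" using k that by (intro conv2_ip) auto
    have "0 \<le> ip (kmap a (F n) y) y" for n
      unfolding kmap_ip[OF Fc a(1) that that]
      by (rule convex_family_ge[OF Fc]) (use a that in simp)
    then show "\<exists>i. \<forall>n\<ge>i. 0 \<le> ip (kmap a (F n) y) y" by blast
  qed
  have kn2: "n2 (k y) \<le> n2 y" if "y \<in> M" for y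
  proof (rule LIMSEQ_le_const2)
    show "(\<lambda>n. n2 (kmap a (F n) y)) \<longlonglongrightarrow> n2 (k y)" using k that by (intro conv2_n2) auto
    show "\<exists>i. \<forall>n\<ge>i. n2 (kmap a (F n) y) \<le> n2 y" using n2_kmap_le[OF Fc a that] by blast
  qed
  have app: "n2 (kmap a (F n) y - k y) \<le> sqrt (2 / real (Suc n)) * norm y" if y: "y \<in> M" for n y
  proof -
    have "(\<lambda>i. n2 (kmap a (F n) y - kmap a (F i) y)) \<longlonglongrightarrow> n2 (kmap a (F n) y - k y)"
      using k(1)[OF y] Fc a y by (intro conv2_n2 conv2_diff conv2_const) auto
    then have "(\<lambda>i. (n2 (kmap a (F n) y - kmap a (F i) y))\<^sup>2) \<longlonglongrightarrow> (n2 (kmap a (F n) y - k y))\<^sup>2"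
      by (intro tendsto_intros)
    moreover have "(\<lambda>i. (2 * (norm y)\<^sup>2) * (1 / real (Suc n) + 1 / real (Suc i))) \<longlonglongrightarrow>
        (2 * (norm y)\<^sup>2) * (1 / real (Suc n) + 0)"
      by (intro tendsto_intros LIMSEQ_Suc[OF lim_1_over_n])
    moreover have "(n2 (kmap a (F n) y - kmap a (F i) y))\<^sup>2 \<le>
        (2 * (norm y)\<^sup>2) * (1 / real (Suc n) + 1 / real (Suc i))" for i
      using rate[OF y, of n i] Fc a y by (subst n2_sq) auto
    ultimately have "(n2 (kmap a (F n) y - k y))\<^sup>2 \<le> (2 * (norm y)\<^sup>2) * (1 / real (Suc n) + 0)"
      by (intro LIMSEQ_le) blast+
    also have "\<dots> = (sqrt (2 / real (Suc n)) * norm y)\<^sup>2"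
      by (simp add: power_mult_distrib)
    finally show ?thesis by (rule power2_le_imp_le) simp
  qed
  have "(\<lambda>n. 2 * (1 / real (Suc n))) \<longlonglongrightarrow> 2 * 0"
    by (intro tendsto_intros LIMSEQ_Suc[OF lim_1_over_n])
  then have "(\<lambda>n. sqrt (2 / real (Suc n))) \<longlonglongrightarrow> sqrt 0"
    by (intro tendsto_real_sqrt) simp
  then have "approximates a F (\<lambda>n. sqrt (2 / real (Suc n))) k"
    using Fc app unfolding approximates_def by simp
  moreover have "positive_contraction k"
    using kM kadd kright kleft ksym kpos kn2 by (simp add: positive_contraction_def bimodular_def)
  ultimately show thesis using that k(2) by blast
qed

text \<open>Since \<open>k\<close> commutes with \<open>N\<close>, averaging the approximants once
  more does not move their limit. The extra average can therefore be spent on bringing the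
  conjugates of a given \<open>z\<close> close to the scalar \<open>tr z\<close>.\<close>

lemma approximates_refine:
  assumes k: "approximates a F r k" "bimodular k" and a: "a \<in> M" and z: "z \<in> M" "star z = z"
  obtains G where "\<And>n. convex_family Uni (G n)"
    "\<And>y. y \<in> M \<Longrightarrow> conv2 (\<lambda>n. kmap a (G n) y) (k y)"
    "conv2 (\<lambda>n. avg (G n) z) (tr z *\<^sub>R 1)"
proof -
  have F: "convex_family Uni (F n)" and r: "r \<longlonglongrightarrow> 0"
    and app: "\<And>y. y \<in> M \<Longrightarrow> n2 (kmap a (F n) y - k y) \<le> r n * norm y" for n
    using k(1) by (auto simp: approximates_def)
  have "\<exists>H. convex_family Uni H \<and> n2 (avg H (avg (F n) z) - tr z *\<^sub>R 1) \<le> 1 / real (Suc n)" for n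
  proof -
    have "star (avg (F n) z) = avg (F n) z" by (simp add: avg_def star_wsum z mult.assoc)
    then obtain H where H: "\<And>i. convex_family Uni (H i)"
      "conv2 (\<lambda>i. avg (H i) (avg (F n) z)) (tr (avg (F n) z) *\<^sub>R 1)"
      using average_to_trace[of "avg (F n) z"] F z by auto
    then have "(\<lambda>i. n2 (avg (H i) (avg (F n) z) - tr z *\<^sub>R 1)) \<longlonglongrightarrow> 0"
      using F z by (simp add: conv2_def tr_avg)
    from LIMSEQ_D[OF this, of "1 / real (Suc n)"]
    obtain i where "\<bar>n2 (avg (H i) (avg (F n) z) - tr z *\<^sub>R 1)\<bar> < 1 / real (Suc n)"
      by auto
    then have "n2 (avg (H i) (avg (F n) z) - tr z *\<^sub>R 1) \<le> 1 / real (Suc n)" by linarith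
    then show ?thesis using H(1) by blast
  qed
  then obtain H where H: "\<And>n. convex_family Uni (H n)"
    "\<And>n. n2 (avg (H n) (avg (F n) z) - tr z *\<^sub>R 1) \<le> 1 / real (Suc n)" by metis
  define G where "G n = wprod (H n) (F n)" for n
  have G: "convex_family Uni (G n)" for n
    unfolding G_def by (rule convex_family_wprod[OF H(1) F]) auto
  have "conv2 (\<lambda>n. kmap a (G n) y) (k y)" if y: "y \<in> M" for y
  proof (rule conv2I)
    show "kmap a (G n) y \<in> M" "k y \<in> M" for n using G a y k bimodular_M by simp_all
    show "(\<lambda>n. r n * norm y) \<longlonglongrightarrow> 0" using tendsto_mult_left_zero[OF r] by simp
    fix n
    have "k y = wsum (H n) (\<lambda>v. v * k (star v * y))"
    proof -
      have "wsum (H n) (\<lambda>v. v * k (star v * y)) = wsum (H n) (\<lambda>v. k y)"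
        by (rule convex_family_cong[OF H(1)]) (use k y in \<open>simp flip: bimodular_left\<close>)
      also have "\<dots> = k y" by (rule convex_family_const[OF H(1)])
      finally show ?thesis ..
    qed
    then have "kmap a (G n) y - k y = wsum (H n) (\<lambda>v. v * (kmap a (F n) (star v * y) - k (star v * y)))"
      unfolding G_def kmap_wprod by (simp add: right_diff_distrib wsum_diff)
    also have "n2 \<dots> \<le> r n * norm y"
    proof (rule n2_wsum_le[OF H(1)])
      fix v assume v: "v \<in> Uni"
      have M: "kmap a (F n) (star v * y) \<in> M" "k (star v * y) \<in> M"
        using v F a y k bimodular_M by simp_all
      have nv: "norm (star v * y) \<le> norm y"
      proof -
        have "norm (star v * y) \<le> norm (star v) * norm y" by (rule norm_mult_ineq)
        also have "\<dots> \<le> 1 * norm y"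
          using v norm_unitary_le[of "star v"] by (intro mult_right_mono) auto
        finally show ?thesis by simp
      qed
      \<comment> \<open>The error bounds \<open>r n\<close> carry no sign assumption; the estimate
        at the vector 1 shows that they are nonnegative.\<close>
      have "0 \<le> n2 (kmap a (F n) 1 - k 1)"
        using F a k bimodular_M by (intro n2_nonneg) simp
      then have "0 \<le> r n * norm (1 :: 'a)" using app[OF one_M, of n] by linarith
      moreover have "0 < norm (1 :: 'a)" using n2_le_norm[OF one_M] by (simp del: zero_less_norm_iff)
      ultimately have "0 \<le> r n" by (simp add: zero_le_mult_iff)
      then have "r n * norm (star v * y) \<le> r n * norm y" using nv by (rule mult_left_mono[rotated])
      then show "v * (kmap a (F n) (star v * y) - k (star v * y)) \<in> M \<and>
          n2 (v * (kmap a (F n) (star v * y) - k (star v * y))) \<le> r n * norm y"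
        using app[of "star v * y" n] v y M by simp
    qed
    finally show "n2 (kmap a (G n) y - k y) \<le> r n * norm y" .
  qed
  moreover have "conv2 (\<lambda>n. avg (G n) z) (tr z *\<^sub>R 1)"
  proof (rule conv2I)
    show "avg (G n) z \<in> M" "tr z *\<^sub>R 1 \<in> M" for n using G z by auto
    show "n2 (avg (G n) z - tr z *\<^sub>R 1) \<le> 1 / real (Suc n)" for n
      unfolding G_def avg_wprod by (rule H(2))
    show "(\<lambda>n. 1 / real (Suc n)) \<longlonglongrightarrow> 0" by (rule LIMSEQ_Suc[OF lim_1_over_n])
  qed
  ultimately show thesis using that G by blast
qed

end

lemma mult_self_le_imp_le: "a * a \<le> b * a \<Longrightarrow> 0 \<le> a \<Longrightarrow> 0 \<le> b \<Longrightarrow> a \<le> b" for a b :: real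
  by (cases "a = 0") (auto simp: mult_le_cancel_right)

context irreducible_inclusion
begin

subsection \<open>Positive bimodule maps\<close>

lemma positive_contractionD:
  assumes "positive_contraction T"
  shows "bimodular T" "\<And>y z. y \<in> M \<Longrightarrow> z \<in> M \<Longrightarrow> ip (T y) z = ip y (T z)"
    "\<And>y. y \<in> M \<Longrightarrow> 0 \<le> ip (T y) y" "\<And>y. y \<in> M \<Longrightarrow> n2 (T y) \<le> n2 y"
    "\<And>y. y \<in> M \<Longrightarrow> T y \<in> M"
  using assms by (auto simp: positive_contraction_def bimodular_def)

lemma positive_form_cauchy_schwarz:
  assumes T: "bimodular T" "\<And>y z. y \<in> M \<Longrightarrow> z \<in> M \<Longrightarrow> ip (T y) z = ip y (T z)"
      "\<And>y. y \<in> M \<Longrightarrow> 0 \<le> ip (T y) y"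
    and y: "y \<in> M"
  shows "(ip (T y) (T y))\<^sup>2 \<le> ip (T y) y * ip (T (T y)) (T y)"
proof (rule quadratic_nonneg_imp)
  have TM: "T x \<in> M" if "x \<in> M" for x using T(1) that by (rule bimodular_M)
  show "0 \<le> ip (T (T y)) (T y)" using T(3) TM y by simp
  fix t :: real
  have "T (y + t *\<^sub>R T y) = T y + t *\<^sub>R T (T y)"
    using y TM by (simp add: bimodular_add[OF T(1)] bimodular_scaleR[OF T(1)])
  then have "ip (T (y + t *\<^sub>R T y)) (y + t *\<^sub>R T y) =
      ip (T y) y + t * ip (T y) (T y) + t * (ip (T (T y)) y + t * ip (T (T y)) (T y))"
    using y TM by (simp add: algebra_simps)
  moreover have "ip (T (T y)) y = ip (T y) (T y)" using y TM T(2) by simp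
  ultimately show "0 \<le> ip (T y) y + 2 * t * ip (T y) (T y) + t\<^sup>2 * ip (T (T y)) (T y)"
    using T(3)[of "y + t *\<^sub>R T y"] y TM by (simp add: algebra_simps power2_eq_square)
qed

text \<open>From form bound to norm bound without spectral theory: Cauchy-Schwarz for the form of
  \<open>T\<close> at \<open>y\<close> and \<open>T y\<close>, then the bound \<open>c\<close> at
  both vectors.\<close>

lemma positive_form_bound:
  assumes T: "bimodular T" "\<And>y z. y \<in> M \<Longrightarrow> z \<in> M \<Longrightarrow> ip (T y) z = ip y (T z)"
      "\<And>y. y \<in> M \<Longrightarrow> 0 \<le> ip (T y) y"
    and c: "\<And>y. y \<in> M \<Longrightarrow> ip (T y) y \<le> c * ip y y" and y: "y \<in> M"
  shows "ip (T y) (T y) \<le> c\<^sup>2 * ip y y"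
proof -
  have TM: "T x \<in> M" if "x \<in> M" for x using T(1) that by (rule bimodular_M)
  have c0: "0 \<le> c" using c[OF one_M] T(3)[OF one_M] by (simp add: ip_def)
  have "(ip (T y) (T y))\<^sup>2 \<le> ip (T y) y * ip (T (T y)) (T y)"
    using T y by (rule positive_form_cauchy_schwarz)
  also have "\<dots> \<le> (c * ip y y) * (c * ip (T y) (T y))"
    using c[OF y] c[OF TM[OF y]] T(3) TM y c0 by (intro mult_mono) auto
  finally have "ip (T y) (T y) * ip (T y) (T y) \<le> (c\<^sup>2 * ip y y) * ip (T y) (T y)"
    by (simp add: power2_eq_square mult_ac)
  then show ?thesis by (rule mult_self_le_imp_le) (use y TM[OF y] in simp_all)
qed

text \<open>Against a vector \<open>n\<close> of \<open>N\<close> this is the adjoint relation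
  between \<open>Z\<close> and \<open>Z'\<close> at \<open>w * a * n\<close>; bimodularity takes
  \<open>w\<close> and \<open>n\<close> out of \<open>Z'\<close>.\<close>

lemma E_adjoint:
  assumes Z': "bimodular Z'" and adj: "\<And>y z. y \<in> M \<Longrightarrow> z \<in> M \<Longrightarrow> ip (Z y) z = ip y (Z' z)"
    and M: "Z y \<in> M" "y \<in> M" "a \<in> M" and w: "w \<in> N"
  shows "E (star (w * a) * Z y) = E (star (w * Z' a) * y)"
proof (rule E_unique)
  have Z'M: "Z' x \<in> M" if "x \<in> M" for x using Z' that by (rule bimodular_M)
  show "star (w * a) * Z y \<in> M" "E (star (w * Z' a) * y) \<in> N" using M w Z'M by simp_all
  fix n assume n: "n \<in> N"
  have key: "ip (star b * x) n = ip x (b * n)" if "b \<in> M" "x \<in> M" for b x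
    using ip_mult_left[of "star b" x n] that n by simp
  have "ip (E (star (w * Z' a) * y)) n = ip (star (w * Z' a) * y) n"
    using M w Z'M n by (intro ip_E) simp_all
  also have "\<dots> = ip y (w * Z' a * n)" using M w Z'M by (intro key) simp_all
  also have "w * Z' a * n = Z' (w * a * n)"
    using Z' M w n Z'M by (simp add: bimodular_left bimodular_right)
  also have "ip y (Z' (w * a * n)) = ip (Z y) (w * a * n)" using adj M w n by simp
  also have "\<dots> = ip (star (w * a) * Z y) n" using M w by (intro key[symmetric]) simp_all
  finally show "ip (E (star (w * Z' a) * y)) n = ip (star (w * a) * Z y) n" .
qed

text \<open>Compressing \<open>a e star a\<close> by a bimodule map and its adjoint gives the same
  kind of operator, with \<open>a\<close> replaced by \<open>Z' a\<close>. Every later compression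
  rests on this.\<close>

lemma kmap_conj:
  assumes Z: "bimodular Z" "bimodular Z'"
    and adj: "\<And>y z. y \<in> M \<Longrightarrow> z \<in> M \<Longrightarrow> ip (Z y) z = ip y (Z' z)"
    and F: "convex_family Uni F" and a: "a \<in> M" "y \<in> M"
  shows "Z' (kmap a F (Z y)) = kmap (Z' a) F y"
proof -
  have M: "Z x \<in> M" "Z' x \<in> M" if "x \<in> M" for x using Z that by (auto intro: bimodular_M)
  have "Z' (wsum G \<phi>) = wsum G (\<lambda>w. Z' (\<phi> w))" if "\<And>w. w \<in> snd ` set G \<Longrightarrow> \<phi> w \<in> M"
    for G :: "(real \<times> 'a) list" and \<phi>
    using that
  proof (induction G)
    case Nil
    then show ?case using bimodular_scaleR[OF Z(2), of 0 0] by simp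
  next
    case (Cons p G)
    have "wsum G \<phi> \<in> M" by (rule wsum_M) (use Cons.prems in auto)
    moreover have "\<phi> (snd p) \<in> M" using Cons.prems by auto
    moreover have "Z' (wsum G \<phi>) = wsum G (\<lambda>w. Z' (\<phi> w))" using Cons by auto
    ultimately show ?case by (simp add: bimodular_add[OF Z(2)] bimodular_scaleR[OF Z(2)])
  qed
  then have "Z' (kmap a F (Z y)) = wsum F (\<lambda>w. Z' (w * a * E (star (w * a) * Z y)))"
    unfolding kmap_def using a M family_Uni[OF F] by simp
  also have "\<dots> = wsum F (\<lambda>w. w * Z' a * E (star (w * Z' a) * y))"
  proof (rule convex_family_cong[OF F])
    fix w assume w: "w \<in> Uni"
    have "Z' (w * a * n) = w * Z' a * n" if "n \<in> N" for n
      using Z w a that M by (simp add: bimodular_left bimodular_right)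
    then have "Z' (w * a * E (star (w * a) * Z y)) = w * Z' a * E (star (w * a) * Z y)"
      using w a M by simp
    then show "Z' (w * a * E (star (w * a) * Z y)) = w * Z' a * E (star (w * Z' a) * y)"
      using E_adjoint[OF Z(2) adj, of y a w] w a M by simp
  qed
  finally show ?thesis by (simp add: kmap_def)
qed

text \<open>
  A positive operator commuting with \<open>N\<close> on both sides is dominated by its trace, because
  \<open>b e b\<^sup>* \<le> b b\<^sup>*\<close> and averages of \<open>b b\<^sup>*\<close> over the unitaries of \<open>N\<close> tend to a scalar.
\<close>

lemma kmap_form_le:
  assumes F: "convex_family Uni F" and M: "b \<in> M" "y \<in> M"
  shows "ip (kmap b F y) y \<le> ip (avg F (b * star b) * y) y"
proof -
  have "ip (kmap b F y) y = wsum F (\<lambda>w. ip (E (star (w * b) * y)) (E (star (w * b) * y)))"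
    by (rule kmap_ip[OF F M M(2)])
  also have "\<dots> \<le> wsum F (\<lambda>w. ip (w * (b * star b) * star w * y) y)"
  proof (rule convex_family_mono[OF F])
    fix w assume w: "w \<in> Uni"
    have "ip (E (star c * y)) (E (star c * y)) \<le> ip (c * star c * y) y" if c: "c \<in> M" for c
    proof -
      have "(n2 (E (star c * y)))\<^sup>2 \<le> (n2 (star c * y))\<^sup>2"
        using c M by (intro power_mono n2_E_le) auto
      then have "ip (E (star c * y)) (E (star c * y)) \<le> ip (star c * y) (star c * y)"
        using c M by (simp add: n2_sq)
      also have "\<dots> = ip (c * star c * y) y"
        using c M ip_mult_left[of c "star c * y" y] by (simp add: mult.assoc)
      finally show ?thesis .
    qed
    from this[of "w * b"] show "ip (E (star (w * b) * y)) (E (star (w * b) * y)) \<le>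
        ip (w * (b * star b) * star w * y) y"
      using w M by (simp add: mult.assoc)
  qed
  also have "\<dots> = ip (avg F (b * star b) * y) y"
    unfolding avg_def wsum_mult_algebra_right[symmetric]
    using M family_Uni[OF F] by (subst ip_wsum_left) simp_all
  finally show ?thesis .
qed

text \<open>By \<open>kmap_conj\<close>, the compression of \<open>k\<close> is a limit of averages
  for \<open>Z' a\<close>; these are dominated by averages of \<open>Z' a * star (Z' a)\<close>,
  which can be made to converge to their trace. So the compressed operator is bounded by its own
  trace.\<close>

lemma kernel_form_le:
  assumes k: "approximates a F r k" "bimodular k" and a: "a \<in> M"
    and Z: "bimodular Z" "bimodular Z'"
    and adj: "\<And>y z. y \<in> M \<Longrightarrow> z \<in> M \<Longrightarrow> ip (Z y) z = ip y (Z' z)" and y: "y \<in> M"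
  shows "ip (k (Z y)) (Z y) \<le> ip (Z' a) (Z' a) * ip y y"
proof -
  have ZM: "Z x \<in> M" "Z' x \<in> M" if "x \<in> M" for x using Z that by (auto intro: bimodular_M)
  let ?z = "Z' a * star (Z' a)"
  obtain G where G: "\<And>n. convex_family Uni (G n)"
    "\<And>y. y \<in> M \<Longrightarrow> conv2 (\<lambda>n. kmap a (G n) y) (k y)"
    "conv2 (\<lambda>n. avg (G n) ?z) (tr ?z *\<^sub>R 1)"
    using approximates_refine[OF k a, of ?z] ZM a by auto
  have "tr ?z = ip (Z' a) (Z' a)" using tr_commute[of "Z' a" "star (Z' a)"] ZM a by (simp add: ip_def)
  then have lim: "(\<lambda>n. ip (avg (G n) ?z * y) y) \<longlonglongrightarrow> ip (Z' a) (Z' a) * ip y y"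
    using conv2_ip[OF conv2_mult_right[OF G(3) y] y] y by simp
  have "(\<lambda>n. ip (kmap a (G n) (Z y)) (Z y)) \<longlonglongrightarrow> ip (k (Z y)) (Z y)"
    using G(2) ZM y by (intro conv2_ip) auto
  moreover have "ip (kmap a (G n) (Z y)) (Z y) \<le> ip (avg (G n) ?z * y) y" for n
  proof -
    have "ip (kmap a (G n) (Z y)) (Z y) = ip (Z y) (kmap a (G n) (Z y))"
      using G(1) a ZM y by (intro ip_commute) simp_all
    also have "\<dots> = ip y (Z' (kmap a (G n) (Z y)))" using adj y ZM G(1) a by simp
    also have "\<dots> = ip y (kmap (Z' a) (G n) y)"
      using kmap_conj[OF Z adj G(1) a y] by simp
    also have "\<dots> = ip (kmap (Z' a) (G n) y) y" using G(1) a ZM y by (intro ip_commute) simp_all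
    also have "\<dots> \<le> ip (avg (G n) ?z * y) y" using G(1) a ZM y by (intro kmap_form_le) simp_all
    finally show ?thesis .
  qed
  ultimately show ?thesis using lim by (intro LIMSEQ_le) blast+
qed

text \<open>The factors are split so that the second sum depends on \<open>b\<close> only through
  averages of \<open>b * star b\<close>, which tend to a scalar even when \<open>b\<close> has large
  operator norm.\<close>

lemma kmap_cauchy_schwarz:
  assumes F: "convex_family Uni F" and M: "b \<in> M" "y \<in> M" "x \<in> M" "z \<in> M"
  shows "(ip (kmap b F y * x) z)\<^sup>2 \<le>
    wsum F (\<lambda>w. ip (E (star (w * b) * y) * x) (E (star (w * b) * y) * x)) * ip (avg F (b * star b) * z) z"
proof -
  define e where "e w = E (star (w * b) * y)" for w
  have eN: "e w \<in> N" if "w \<in> Uni" for w using that M by (simp add: e_def)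
  have "ip (kmap b F y * x) z = wsum F (\<lambda>w. ip (w * b * e w * x) z)"
    unfolding kmap_def e_def[symmetric] wsum_mult_algebra_right[symmetric]
    using M eN family_Uni[OF F] by (intro ip_wsum_left) simp_all
  also have "\<dots> = wsum F (\<lambda>w. ip (e w * x) (star (w * b) * z))"
  proof (rule convex_family_cong[OF F])
    fix w assume w: "w \<in> Uni"
    then show "ip (w * b * e w * x) z = ip (e w * x) (star (w * b) * z)"
      using ip_mult_left[of "w * b" "e w * x" z] M eN by (simp add: mult.assoc)
  qed
  finally have "(ip (kmap b F y * x) z)\<^sup>2 \<le> wsum F (\<lambda>w. ip (e w * x) (e w * x)) *
      wsum F (\<lambda>w. ip (star (w * b) * z) (star (w * b) * z))"
    using wsum_ip_cauchy_schwarz[OF F, of "\<lambda>w. e w * x" "\<lambda>w. star (w * b) * z"] eN M by simp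
  also have "wsum F (\<lambda>w. ip (star (w * b) * z) (star (w * b) * z)) = ip (avg F (b * star b) * z) z"
  proof -
    have "ip (avg F (b * star b) * z) z = wsum F (\<lambda>w. ip (w * (b * star b) * star w * z) z)"
      unfolding avg_def wsum_mult_algebra_right[symmetric]
      using M family_Uni[OF F] by (intro ip_wsum_left) simp_all
    also have "\<dots> = wsum F (\<lambda>w. ip (star (w * b) * z) (star (w * b) * z))"
    proof (rule convex_family_cong[OF F])
      fix w assume w: "w \<in> Uni"
      then show "ip (w * (b * star b) * star w * z) z = ip (star (w * b) * z) (star (w * b) * z)"
        using ip_mult_left[of "w * b" "star (w * b) * z" z] M by (simp add: mult.assoc)
    qed
    finally show ?thesis ..
  qed
  finally show ?thesis unfolding e_def .
qed

text \<open>No bound on the operator norm of \<open>Z a\<close> is available, only its trace norm,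
  which is at most 1. It suffices: one factor of \<open>kmap_cauchy_schwarz\<close> tends to the
  squared trace norm of \<open>Z a\<close>, and the other is controlled through contractivity of
  \<open>Z\<close> and of the averages for the unitary \<open>a\<close>.\<close>

lemma kernel_norm_le:
  assumes k: "approximates a F r k" "positive_contraction k" and a: "a \<in> M" "unitary a"
    and Z: "positive_contraction Z" and y: "y \<in> M"
  shows "norm (Z (k (Z y))) \<le> norm y"
proof (rule norm_le_ip)
  note kD = positive_contractionD[OF k(2)] and ZD = positive_contractionD[OF Z]
  let ?f = "Z a"
  show "Z (k (Z y)) \<in> M" using kD(5) ZD(5) y by simp
  fix z1 z2 assume z: "z1 \<in> M" "z2 \<in> M"
  let ?z = "?f * star ?f"
  have fM: "?f \<in> M" using ZD(5) a by simp
  obtain G where G: "\<And>n. convex_family Uni (G n)"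
    "\<And>y. y \<in> M \<Longrightarrow> conv2 (\<lambda>n. kmap a (G n) y) (k y)"
    "conv2 (\<lambda>n. avg (G n) ?z) (tr ?z *\<^sub>R 1)"
    using approximates_refine[OF k(1) kD(1) a(1), of ?z] fM by auto
  have "n2 a = 1" using a n2_unitary_left[of a 1] by simp
  then have "ip ?f ?f \<le> 1" using ZD(4)[OF a(1)] fM by (simp add: n2_def)
  then have trz: "tr ?z \<le> 1"
    using tr_commute[of ?f "star ?f"] fM by (simp add: ip_def)
  have conj: "Z (kmap a (G n) (Z x)) = kmap ?f (G n) x" if "x \<in> M" for x n
    using kmap_conj[OF ZD(1) ZD(1) ZD(2) G(1) a(1) that] by simp
  have "conv2 (\<lambda>n. Z (kmap a (G n) (Z y))) (Z (k (Z y)))"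
  proof (rule conv2_bounded_map[OF G(2)])
    show "Z y \<in> M" using ZD(5) y by simp
    show "Z x \<in> M" if "x \<in> M" for x using ZD(5) that .
    show "n2 (Z x - Z x') \<le> 1 * n2 (x - x')" if "x \<in> M" "x' \<in> M" for x x'
      using ZD(4)[of "x - x'"] that bimodular_diff[OF ZD(1)] by simp
  qed
  then have c: "conv2 (\<lambda>n. kmap ?f (G n) y) (Z (k (Z y)))" using conj y by simp
  have lim: "(\<lambda>n. (ip (kmap ?f (G n) y * z1) z2)\<^sup>2) \<longlonglongrightarrow> (ip (Z (k (Z y)) * z1) z2)\<^sup>2"
    using conv2_ip[OF conv2_mult_right[OF c z(1)] z(2)] by (intro tendsto_intros)
  have lim2: "(\<lambda>n. ((norm y)\<^sup>2 * ip z1 z1) * ip (avg (G n) ?z * z2) z2) \<longlonglongrightarrow>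
      ((norm y)\<^sup>2 * ip z1 z1) * (tr ?z * ip z2 z2)"
    using conv2_ip[OF conv2_mult_right[OF G(3) z(2)] z(2)] z by (intro tendsto_intros) simp
  \<comment> \<open>Exchanging \<open>z1\<close> for a vector of \<open>N\<close> lets it move
    inside the expectation, where the sum becomes a quadratic form of the averaged kernel.\<close>
  obtain h where h: "h \<in> N" "\<And>n. n \<in> N \<Longrightarrow> n2 (n * z1) = n2 (n * h)"
    using left_norm_transfer[OF z(1)] by metis
  have "(ip (kmap ?f (G n) y * z1) z2)\<^sup>2 \<le> ((norm y)\<^sup>2 * ip z1 z1) * ip (avg (G n) ?z * z2) z2" for n
  proof -
    define e where "e w = E (star (w * ?f) * y)" for w
    have eN: "e w \<in> N" if "w \<in> Uni" for w using that fM y by (simp add: e_def)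
    have "(ip (kmap ?f (G n) y * z1) z2)\<^sup>2 \<le>
        wsum (G n) (\<lambda>w. ip (e w * z1) (e w * z1)) * ip (avg (G n) ?z * z2) z2"
      unfolding e_def using kmap_cauchy_schwarz[OF G(1) fM y z] .
    moreover have "wsum (G n) (\<lambda>w. ip (e w * z1) (e w * z1)) \<le> (norm y)\<^sup>2 * ip z1 z1"
    proof -
      have "wsum (G n) (\<lambda>w. ip (e w * z1) (e w * z1)) =
          wsum (G n) (\<lambda>w. ip (E (star (w * ?f) * (y * h))) (E (star (w * ?f) * (y * h))))"
      proof (rule convex_family_cong[OF G(1)])
        fix w assume w: "w \<in> Uni"
        have "n2 (e w * z1) = n2 (e w * h)" using h(2) eN[OF w] by simp
        then have "ip (e w * z1) (e w * z1) = ip (e w * h) (e w * h)"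
          using n2_sq[of "e w * z1"] n2_sq[of "e w * h"] eN[OF w] h(1) z by simp
        moreover have "e w * h = E (star (w * ?f) * (y * h))"
          using E_mult_right[of "star (w * ?f) * y" h] w fM y h
          by (simp add: e_def mult.assoc del: E_mult_right)
        ultimately show "ip (e w * z1) (e w * z1) =
          ip (E (star (w * ?f) * (y * h))) (E (star (w * ?f) * (y * h)))" by simp
      qed
      also have "\<dots> = ip (kmap ?f (G n) (y * h)) (y * h)"
        using kmap_ip[OF G(1) fM, of "y * h" "y * h"] y h by simp
      also have "\<dots> = ip (Z (kmap a (G n) (Z (y * h)))) (y * h)" using conj y h by simp
      also have "\<dots> = ip (kmap a (G n) (Z (y * h))) (Z (y * h))"
        using ZD y h G(1) a by simp
      also have "\<dots> \<le> n2 (kmap a (G n) (Z (y * h))) * n2 (Z (y * h))"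
        using cauchy_schwarz[of "kmap a (G n) (Z (y * h))" "Z (y * h)"] ZD(5) y h G(1) a by simp
      also have "\<dots> \<le> n2 (y * h) * n2 (y * h)"
        using n2_kmap_le[OF G(1) a, of "Z (y * h)"] ZD(4)[of "y * h"] ZD(5) y h
        by (intro mult_mono order_trans[OF n2_kmap_le[OF G(1) a, of "Z (y * h)"]]) auto
      also have "\<dots> \<le> (norm y * n2 h) * (norm y * n2 h)"
        using n2_mult_le[of y h] y h by (intro mult_mono) auto
      also have "n2 h = n2 z1" using h(2)[of 1] by simp
      also have "(norm y * n2 z1) * (norm y * n2 z1) = (norm y)\<^sup>2 * ip z1 z1"
        using z n2_sq[of z1] by (simp add: power2_eq_square mult_ac)
      finally show ?thesis .
    qed
    moreover have "0 \<le> ip (avg (G n) ?z * z2) z2"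
    proof -
      have "0 \<le> ip (kmap ?f (G n) z2) z2"
        using kmap_ip[OF G(1) fM z(2) z(2)] convex_family_ge[OF G(1)] fM z by simp
      also have "\<dots> \<le> ip (avg (G n) ?z * z2) z2" by (rule kmap_form_le[OF G(1) fM z(2)])
      finally show ?thesis .
    qed
    ultimately show ?thesis by (meson mult_right_mono order_trans)
  qed
  then have "(ip (Z (k (Z y)) * z1) z2)\<^sup>2 \<le> ((norm y)\<^sup>2 * ip z1 z1) * (tr ?z * ip z2 z2)"
    using LIMSEQ_le[OF lim lim2] by blast
  also have "\<dots> \<le> ((norm y)\<^sup>2 * ip z1 z1) * (1 * ip z2 z2)"
    using trz z by (intro mult_left_mono mult_right_mono) auto
  also have "\<dots> = (norm y * (n2 z1 * n2 z2))\<^sup>2" using z by (simp add: power_mult_distrib n2_sq)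
  finally show "ip (Z (k (Z y)) * z1) z2 \<le> norm y * (n2 z1 * n2 z2)"
    by (rule power2_le_imp_le) (use z in simp)
qed simp

end

section \<open>Powers of a positive contraction and their limit\<close>

context irreducible_inclusion
begin

lemma funpow_ip:
  assumes T: "positive_contraction T" and y: "y \<in> M" "z \<in> M"
  shows "(T ^^ i) y \<in> M \<and> ip ((T ^^ i) y) z = ip y ((T ^^ i) z)"
  using y
proof (induction i arbitrary: y z)
  case (Suc i)
  note TD = positive_contractionD[OF T]
  from Suc have IH: "(T ^^ i) y \<in> M" "(T ^^ i) z \<in> M" by auto
  have "ip ((T ^^ Suc i) y) z = ip ((T ^^ i) y) (T z)" using TD(2) IH Suc.prems by simp
  also have "\<dots> = ip y ((T ^^ i) (T z))" using Suc.IH[of y "T z"] Suc.prems TD(5) by simp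
  also have "(T ^^ i) (T z) = (T ^^ Suc i) z" by (simp add: funpow_swap1)
  finally show ?case using IH(1) TD(5) by simp
qed simp

lemma funpow_M: "positive_contraction T \<Longrightarrow> y \<in> M \<Longrightarrow> (T ^^ i) y \<in> M"
  using funpow_ip by blast

lemma funpow_add_ip:
  assumes T: "positive_contraction T" and y: "y \<in> M"
  shows "ip ((T ^^ (i + l)) y) y = ip ((T ^^ i) y) ((T ^^ l) y)"
  using funpow_ip[OF T funpow_M[OF T y, of i] y, of l] by (simp add: funpow_add add.commute[of i])

lemma contraction_form_le:
  assumes T: "positive_contraction T" and y: "y \<in> M"
  shows "ip (T y) y \<le> ip y y" "ip (T y) (T y) \<le> ip (T y) y"
proof -
  note TD = positive_contractionD[OF T]
  have le: "ip (T x) x \<le> ip x x" if x: "x \<in> M" for x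
  proof -
    have "ip (T x) x \<le> n2 (T x) * n2 x" using cauchy_schwarz[of "T x" x] TD(5) x by simp
    also have "\<dots> \<le> n2 x * n2 x" using TD(4) x by (intro mult_right_mono) auto
    finally show ?thesis using n2_sq[OF x] by (simp add: power2_eq_square)
  qed
  show "ip (T y) y \<le> ip y y" using y by (rule le)
  have "(ip (T y) (T y))\<^sup>2 \<le> ip (T y) y * ip (T (T y)) (T y)"
    using TD(1-3) y by (rule positive_form_cauchy_schwarz)
  also have "\<dots> \<le> ip (T y) y * ip (T y) (T y)"
    using le[of "T y"] TD y by (intro mult_left_mono) auto
  finally have "ip (T y) (T y) * ip (T y) (T y) \<le> ip (T y) y * ip (T y) (T y)"
    by (simp add: power2_eq_square)
  then show "ip (T y) (T y) \<le> ip (T y) y"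
    by (rule mult_self_le_imp_le) (use TD(3,5) y in simp_all)
qed

lemma positive_contraction_funpow:
  assumes T: "positive_contraction T"
  shows "positive_contraction (T ^^ i)"
  unfolding positive_contraction_def
proof (intro conjI ballI)
  note TD = positive_contractionD[OF T]
  show "bimodular (T ^^ i)"
    by (induction i) (auto simp: bimodular_def bimodular_M[OF TD(1)] bimodular_add[OF TD(1)]
        bimodular_left[OF TD(1)] bimodular_right[OF TD(1)])
  show "ip ((T ^^ i) y) z = ip y ((T ^^ i) z)" if "y \<in> M" "z \<in> M" for y z
    using funpow_ip[OF T that] by blast
  show "n2 ((T ^^ i) y) \<le> n2 y" if "y \<in> M" for y
    using that by (induction i) (auto intro: order_trans[OF TD(4)] simp: funpow_M[OF T])
  show "0 \<le> ip ((T ^^ i) y) y" if y: "y \<in> M" for y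
  proof (cases "even i")
    case True
    then obtain l where "i = l + l" by (metis evenE mult_2)
    then show ?thesis using funpow_add_ip[OF T y, of l l] funpow_M[OF T y] by simp
  next
    case False
    then obtain l where "i = Suc l + l" by (metis oddE mult_2 add_Suc Suc_eq_plus1)
    then show ?thesis using funpow_add_ip[OF T y, of "Suc l" l] funpow_M[OF T y] TD(3) by simp
  qed
qed

text \<open>The step is \<open>T\<close> at most 1 at a vector \<open>(T ^^ l) y\<close> for even
  exponents and the square of \<open>T\<close> at most \<open>T\<close> for odd ones.\<close>

lemma funpow_form_decreasing:
  assumes T: "positive_contraction T" and y: "y \<in> M"
  shows "decseq (\<lambda>i. ip ((T ^^ i) y) y)"
proof (rule decseq_SucI)
  fix i
  show "ip ((T ^^ Suc i) y) y \<le> ip ((T ^^ i) y) y"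
  proof (cases "even i")
    case True
    then obtain l where "i = l + l" by (metis evenE mult_2)
    then show ?thesis
      using funpow_add_ip[OF T y, of l l] funpow_add_ip[OF T y, of "Suc l" l]
        contraction_form_le(1)[OF T funpow_M[OF T y, of l]] by simp
  next
    case False
    then obtain l where "i = Suc l + l" by (metis oddE mult_2 add_Suc Suc_eq_plus1)
    then show ?thesis
      using funpow_add_ip[OF T y, of "Suc l" l] funpow_add_ip[OF T y, of "Suc l" "Suc l"]
        contraction_form_le(2)[OF T funpow_M[OF T y, of l]] by simp
  qed
qed

text \<open>The limit is the projection onto the fixed vectors of \<open>T\<close>. Inner products
  of powers depend only on the sum of the exponents, so monotone convergence of the moments makes
  the powers Cauchy. Odd powers are used because a norm bound is at hand for an operator with
  \<open>i\<close> copies of \<open>T\<close> on each side.\<close>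

lemma power_limit:
  assumes T: "positive_contraction T"
    and bd: "\<And>i y. y \<in> M \<Longrightarrow> norm ((T ^^ Suc (i + i)) y) \<le> C * norm y"
  obtains g where "positive_contraction g" "\<And>y. y \<in> M \<Longrightarrow> T (g y) = g y"
    "\<And>y. y \<in> M \<Longrightarrow> g (T y) = g y" "\<And>y. y \<in> M \<Longrightarrow> g (g y) = g y"
    "\<And>y. y \<in> M \<Longrightarrow> conv2 (\<lambda>i. (T ^^ Suc (i + i)) y) (g y)"
    "\<And>y. y \<in> M \<Longrightarrow> norm (g y) \<le> C * norm y"
proof -
  note TD = positive_contractionD[OF T]
  let ?X = "\<lambda>y i. (T ^^ Suc (i + i)) y"
  have XM: "?X y i \<in> M" if "y \<in> M" for y i using funpow_M[OF T that] .
  have lim: "\<exists>L. (\<lambda>i. ip ((T ^^ i) y) y) \<longlonglongrightarrow> L" if y: "y \<in> M" for y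
  proof -
    have "0 \<le> ip ((T ^^ i) y) y" for i
      using positive_contractionD(3)[OF positive_contraction_funpow[OF T] y] .
    then show ?thesis
      using decseq_convergent[OF funpow_form_decreasing[OF T y], of 0] by blast
  qed
  have ex: "\<exists>x. conv2 (?X y) x \<and> norm x \<le> C * norm y" if y: "y \<in> M" for y
  proof -
    define \<theta> where "\<theta> i = ip ((T ^^ i) y) y" for i
    obtain L where L: "\<theta> \<longlonglongrightarrow> L" using lim[OF y] unfolding \<theta>_def by blast
    have dec: "\<theta> n \<le> \<theta> m" if "m \<le> n" for m n
      using funpow_form_decreasing[OF T y] that unfolding \<theta>_def by (rule decseqD)
    have L_le: "L \<le> \<theta> n" for n
      by (rule LIMSEQ_le_const2[OF L]) (use dec in blast)
    have diff: "ip (?X y m - ?X y n) (?X y m - ?X y n) \<le> \<theta> m + \<theta> n - 2 * L" for m n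
    proof -
      have X: "ip (?X y m) (?X y n) = \<theta> (Suc (m + m) + Suc (n + n))" for m n
        unfolding \<theta>_def by (rule funpow_add_ip[OF T y, symmetric])
      have "ip (?X y m - ?X y n) (?X y m - ?X y n) =
          ip (?X y m) (?X y m) - 2 * ip (?X y m) (?X y n) + ip (?X y n) (?X y n)"
        using XM[OF y] ip_commute[of "?X y m" "?X y n"] by (simp del: funpow.simps)
      also have "\<dots> = \<theta> (Suc (m + m) + Suc (m + m)) - 2 * \<theta> (Suc (m + m) + Suc (n + n))
          + \<theta> (Suc (n + n) + Suc (n + n))" by (simp only: X)
      also have "\<dots> \<le> \<theta> m - 2 * L + \<theta> n"
        using dec[of m "Suc (m + m) + Suc (m + m)"] dec[of n "Suc (n + n) + Suc (n + n)"]
          L_le[of "Suc (m + m) + Suc (n + n)"] by simp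
      finally show ?thesis by simp
    qed
    obtain x where "conv2 (?X y) x" "norm x \<le> C * norm y"
    proof (rule conv2_complete[OF XM[OF y] bd[OF y]])
      fix e :: real assume e: "e > 0"
      then obtain k where k: "\<And>n. n \<ge> k \<Longrightarrow> \<bar>\<theta> n - L\<bar> < e\<^sup>2 / 2"
        using LIMSEQ_D[OF L, of "e\<^sup>2 / 2"] by auto
      have "n2 (?X y m - ?X y n) \<le> e" if "m \<ge> k" "n \<ge> k" for m n
      proof -
        have "ip (?X y m - ?X y n) (?X y m - ?X y n) \<le> e\<^sup>2"
          using diff[of m n] k[OF that(1)] k[OF that(2)] by linarith
        then show ?thesis using e unfolding n2_def by (simp add: real_le_lsqrt)
      qed
      then show "\<exists>k. \<forall>m\<ge>k. \<forall>n\<ge>k. n2 (?X y m - ?X y n) \<le> e" by blast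
    qed
    then show ?thesis by blast
  qed
  obtain g where g: "\<And>y. y \<in> M \<Longrightarrow> conv2 (?X y) (g y)" "\<And>y. y \<in> M \<Longrightarrow> norm (g y) \<le> C * norm y"
    using ex by metis
  have gM: "g y \<in> M" if "y \<in> M" for y using g(1)[OF that] by (simp add: conv2_def)
  have P: "positive_contraction (T ^^ Suc (i + i))" for i by (rule positive_contraction_funpow[OF T])
  note PD = positive_contractionD[OF P]
  have bim: "bimodular g"
    unfolding bimodular_def
  proof (intro conjI ballI gM)
    show "g (y + z) = g y + g z" if "y \<in> M" "z \<in> M" for y z
      using conv2_unique[OF g(1)[of "y + z"]] conv2_add[OF g(1) g(1), OF that] that
      by (simp add: bimodular_add[OF PD(1)] del: funpow.simps)
    show "g (n * y) = n * g y" if "n \<in> N" "y \<in> M" for n y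
      using conv2_unique[OF g(1)[of "n * y"]] conv2_mult_left[OF g(1), of y n] that
      by (simp add: bimodular_left[OF PD(1)] del: funpow.simps)
    show "g (y * n) = g y * n" if "n \<in> N" "y \<in> M" for n y
      using conv2_unique[OF g(1)[of "y * n"]] conv2_mult_right[OF g(1), of y n] that
      by (simp add: bimodular_right[OF PD(1)] del: funpow.simps)
  qed
  have pos: "positive_contraction g"
    unfolding positive_contraction_def
  proof (intro conjI ballI bim)
    show "ip (g y) z = ip y (g z)" if "y \<in> M" "z \<in> M" for y z
    proof (rule LIMSEQ_unique)
      show "(\<lambda>i. ip (?X y i) z) \<longlonglongrightarrow> ip (g y) z" using g that by (intro conv2_ip)
      have "ip (?X y i) z = ip (?X z i) y" for i
        using PD(2)[OF that] XM[OF that(2)] that ip_commute[of y "?X z i"] by (simp del: funpow.simps)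
      then show "(\<lambda>i. ip (?X y i) z) \<longlonglongrightarrow> ip y (g z)"
        using conv2_ip[OF g(1)[OF that(2)] that(1)] ip_commute[OF that(1) gM[OF that(2)]]
        by (simp del: funpow.simps)
    qed
    show "0 \<le> ip (g y) y" if "y \<in> M" for y
      using conv2_ip[OF g(1)[OF that] that] by (rule LIMSEQ_le_const) (use PD(3)[OF that] in blast)
    show "n2 (g y) \<le> n2 y" if "y \<in> M" for y
      using conv2_n2[OF g(1)[OF that]] by (rule LIMSEQ_le_const2) (use PD(4)[OF that] in blast)
  qed
  have Tconv: "conv2 (\<lambda>i. T (?X y i)) (T (g y))" if y: "y \<in> M" for y
  proof (rule conv2_bounded_map[OF g(1)[OF y] TD(5)])
    show "n2 (T x - T x') \<le> 1 * n2 (x - x')" if "x \<in> M" "x' \<in> M" for x x'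
      using TD(4)[of "x - x'"] that bimodular_diff[OF TD(1)] by simp
  qed
  have gT: "g (T y) = T (g y)" if y: "y \<in> M" for y
  proof (rule conv2_unique[OF g(1)[OF TD(5)[OF y]]])
    show "conv2 (?X (T y)) (T (g y))" using Tconv[OF y] by (simp add: funpow_swap1)
  qed
  \<comment> \<open>The squared norm of one more step of \<open>T\<close> is a second difference of
    the moments; these converge, so it tends to 0.\<close>
  have Tg: "T (g y) = g y" if y: "y \<in> M" for y
  proof -
    obtain L where L: "(\<lambda>i. ip ((T ^^ i) y) y) \<longlonglongrightarrow> L" using lim[OF y] by blast
    have sub: "(\<lambda>i. ip ((T ^^ (4 * i + c)) y) y) \<longlonglongrightarrow> L" for c
      using LIMSEQ_subseq_LIMSEQ[OF L, of "\<lambda>i. 4 * i + c"] by (simp add: strict_mono_def comp_def)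
    have "ip (T (?X y i) - ?X y i) (T (?X y i) - ?X y i) =
        ip ((T ^^ (4 * i + 4)) y) y - 2 * ip ((T ^^ (4 * i + 3)) y) y + ip ((T ^^ (4 * i + 2)) y) y" for i
    proof -
      have X: "ip (T (?X y i)) (T (?X y i)) = ip ((T ^^ (4 * i + 4)) y) y"
        "ip (T (?X y i)) (?X y i) = ip ((T ^^ (4 * i + 3)) y) y"
        "ip (?X y i) (?X y i) = ip ((T ^^ (4 * i + 2)) y) y"
        using funpow_add_ip[OF T y, of "Suc (Suc (i + i))" "Suc (Suc (i + i))"]
          funpow_add_ip[OF T y, of "Suc (Suc (i + i))" "Suc (i + i)"]
          funpow_add_ip[OF T y, of "Suc (i + i)" "Suc (i + i)"]
        by (simp_all add: numeral_eq_Suc algebra_simps)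
      show ?thesis
        unfolding X[symmetric] using XM[OF y, of i] TD(5) ip_commute[of "T (?X y i)" "?X y i"]
        by (simp del: funpow.simps)
    qed
    moreover have "(\<lambda>i. ip ((T ^^ (4 * i + 4)) y) y - 2 * ip ((T ^^ (4 * i + 3)) y) y +
        ip ((T ^^ (4 * i + 2)) y) y) \<longlonglongrightarrow> L - 2 * L + L"
      by (intro tendsto_intros sub)
    ultimately have "(\<lambda>i. ip (T (?X y i) - ?X y i) (T (?X y i) - ?X y i)) \<longlonglongrightarrow> 0" by simp
    moreover have "(\<lambda>i. ip (T (?X y i) - ?X y i) (T (?X y i) - ?X y i)) \<longlonglongrightarrow>
        ip (T (g y) - g y) (T (g y) - g y)"
      by (intro conv2_ip_self conv2_diff Tconv g y)
    ultimately have "ip (T (g y) - g y) (T (g y) - g y) = 0" using LIMSEQ_unique by blast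
    then show ?thesis using ip_self_zero[of "T (g y) - g y"] gM TD(5) y by simp
  qed
  have gg: "g (g y) = g y" if y: "y \<in> M" for y
  proof -
    have "(T ^^ i) (g y) = g y" for i using Tg[OF y] by (induction i) auto
    then have "conv2 (?X (g y)) (g y)" using gM[OF y] by (simp add: conv2_const del: funpow.simps)
    then show ?thesis using conv2_unique g(1)[OF gM[OF y]] by blast
  qed
  show thesis
    by (rule that[of g]) (use pos Tg gT gg g in simp_all)
qed

end

context irreducible_inclusion
begin

subsection \<open>The top eigenprojection of an averaged kernel\<close>

lemma ip_self_pos: "x \<in> M \<Longrightarrow> x \<noteq> 0 \<Longrightarrow> 0 < ip x x"
  using ip_self_zero[of x] ip_nonneg[of x] by (auto simp: order_less_le simp del: ip_nonneg)

lemma ip_unitary_one: "a \<in> M \<Longrightarrow> unitary a \<Longrightarrow> ip a a = 1"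
  by (simp add: ip_def)

lemma positive_contractionI:
  assumes T: "bimodular T" "\<And>y z. y \<in> M \<Longrightarrow> z \<in> M \<Longrightarrow> ip (T y) z = ip y (T z)"
    "\<And>y. y \<in> M \<Longrightarrow> 0 \<le> ip (T y) y" and le: "\<And>y. y \<in> M \<Longrightarrow> ip (T y) y \<le> ip y y"
  shows "positive_contraction T"
proof -
  have "n2 (T y) \<le> n2 y" if "y \<in> M" for y
    using positive_form_bound[OF T, where c = 1 and y = y] le that by (simp add: n2_def)
  then show ?thesis using T by (simp add: positive_contraction_def)
qed

text \<open>That the supremum \<open>s\<close> of the form is attained is not automatic in infinite
  dimension. It follows from domination by the trace: the powers of \<open>k / s\<close> cannot
  decay at \<open>a\<close>, since their squared norms there stay above \<open>s\<close>.\<close>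

lemma top_eigenprojection:
  assumes a: "a \<in> M" "unitary a" and k: "approximates a F r k" "positive_contraction k"
    and ka: "0 < ip (k a) a"
  obtains s g where "0 < s" "s \<le> 1" "ip (k a) a \<le> s" "positive_contraction g"
    "\<And>y. y \<in> M \<Longrightarrow> norm (g y) \<le> 1 / s * norm y"
    "\<And>y. y \<in> M \<Longrightarrow> k (g y) = s *\<^sub>R g y" "\<And>y. y \<in> M \<Longrightarrow> g (k y) = s *\<^sub>R g y"
    "\<And>y. y \<in> M \<Longrightarrow> g (g y) = g y" "s \<le> ip (g a) (g a)"
proof -
  note kD = positive_contractionD[OF k(2)]
  define S where "S = {ip (k y) y | y. y \<in> M \<and> ip y y = 1}"
  define s where "s = Sup S"
  have a1: "ip a a = 1" using a by (rule ip_unitary_one)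
  have S1: "v \<le> 1" if "v \<in> S" for v
    using that contraction_form_le(1)[OF k(2)] unfolding S_def by force
  have bdd: "bdd_above S" using S1 by (rule bdd_aboveI)
  have ne: "S \<noteq> {}" using a a1 by (auto simp: S_def)
  have s1: "s \<le> 1"
    unfolding s_def using ne S1 by (rule cSup_least)
  have sa: "ip (k a) a \<le> s"
    unfolding s_def using a a1 bdd by (intro cSup_upper) (auto simp: S_def)
  have s0: "0 < s" using sa ka by simp
  have le: "ip (k y) y \<le> s * ip y y" if y: "y \<in> M" for y
  proof (cases "y = 0")
    case True
    then show ?thesis by simp
  next
    case False
    then have "n2 y \<noteq> 0" "0 < ip y y" using y ip_self_pos[of y] by simp_all
    let ?z = "(1 / n2 y) *\<^sub>R y"
    have z1: "ip ?z ?z = 1"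
      using y \<open>n2 y \<noteq> 0\<close> n2_sq[OF y] \<open>0 < ip y y\<close> by (simp add: power2_eq_square field_simps)
    have "ip (k ?z) ?z = ip (k y) y / ip y y"
      using y kD(5) bimodular_scaleR[OF kD(1) y] n2_sq[OF y] \<open>0 < ip y y\<close>
      by (simp add: power2_eq_square field_simps)
    moreover have "ip (k ?z) ?z \<in> S"
      unfolding S_def using z1 scaleR_M[OF y, of "1 / n2 y"] by blast
    then have "ip (k ?z) ?z \<le> s" unfolding s_def using bdd by (rule cSup_upper)
    ultimately have "ip (k y) y / ip y y \<le> s" by simp
    then show ?thesis using \<open>0 < ip y y\<close> by (simp add: pos_divide_le_eq)
  qed
  define T where "T y = (1 / s) *\<^sub>R k y" for y
  have T: "positive_contraction T"
  proof (rule positive_contractionI)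
    show "bimodular T"
      using kD(1) by (simp add: bimodular_def T_def scaleR_add_right)
    show "ip (T y) z = ip y (T z)" if "y \<in> M" "z \<in> M" for y z
      using kD(2)[OF that] kD(5) that by (simp add: T_def)
    show "0 \<le> ip (T y) y" if "y \<in> M" for y
      using kD(3)[OF that] kD(5) that s0 by (simp add: T_def)
    show "ip (T y) y \<le> ip y y" if "y \<in> M" for y
      using le[OF that] kD(5) that s0 by (simp add: T_def field_simps)
  qed
  have P: "positive_contraction (T ^^ i)" for i by (rule positive_contraction_funpow[OF T])
  \<comment> \<open>An odd power is a compression of \<open>k\<close> by a positive contraction,
    which is exactly what \<open>kernel_norm_le\<close> bounds.\<close>
  have mid: "(T ^^ Suc (i + i)) y = (1 / s) *\<^sub>R (T ^^ i) (k ((T ^^ i) y))" if "y \<in> M" for i y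
  proof -
    have "(T ^^ Suc (i + i)) y = (T ^^ i) (T ((T ^^ i) y))"
      using funpow_add[of i "Suc i" T] by simp
    also have "\<dots> = (1 / s) *\<^sub>R (T ^^ i) (k ((T ^^ i) y))"
      unfolding T_def[of "(T ^^ i) y"]
      using kD(5) positive_contractionD(5)[OF P] that
      by (intro bimodular_scaleR[OF positive_contractionD(1)[OF P]]) simp
    finally show ?thesis .
  qed
  have bd: "norm ((T ^^ Suc (i + i)) y) \<le> 1 / s * norm y" if "y \<in> M" for i y
    using kernel_norm_le[OF k a P[of i] that] s0 by (simp add: mid[OF that] divide_right_mono del: funpow.simps)
  obtain g where g: "positive_contraction g" "\<And>y. y \<in> M \<Longrightarrow> T (g y) = g y"
    "\<And>y. y \<in> M \<Longrightarrow> g (T y) = g y" "\<And>y. y \<in> M \<Longrightarrow> g (g y) = g y"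
    "\<And>y. y \<in> M \<Longrightarrow> conv2 (\<lambda>i. (T ^^ Suc (i + i)) y) (g y)"
    "\<And>y. y \<in> M \<Longrightarrow> norm (g y) \<le> 1 / s * norm y"
    using power_limit[OF T bd] by blast
  have kT: "k y = s *\<^sub>R T y" for y using s0 by (simp add: T_def)
  have low: "s \<le> ip ((T ^^ i) a) ((T ^^ i) a)" for i
  proof -
    define B where "B = ip ((T ^^ i) a) ((T ^^ i) a)"
    \<comment> \<open>Repeated Cauchy-Schwarz doubles the exponent and so bounds moments below only
      at powers of 2; the moments decrease, so a power of 2 beyond \<open>Suc (i + i)\<close> is
      enough.\<close>
    obtain p where p: "Suc (i + i) \<le> 2 ^ p"
      by (meson less_exp less_or_eq_imp_le)
    have step: "s * (ip (T y) y) ^ (2 ^ p) \<le> B" if y: "y \<in> M" "ip y y = 1" for y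
    proof -
      have pw: "(ip (T y) y) ^ (2 ^ q) \<le> ip ((T ^^ (2 ^ q)) y) y" for q
      proof (induction q)
        case (Suc q)
        have M: "(T ^^ (2 ^ q)) y \<in> M" by (rule funpow_M[OF T y(1)])
        have "(ip (T y) y) ^ (2 ^ Suc q) = ((ip (T y) y) ^ (2 ^ q))\<^sup>2"
          by (simp add: power_mult[symmetric] mult.commute)
        also have "\<dots> \<le> (ip ((T ^^ (2 ^ q)) y) y)\<^sup>2"
          using Suc positive_contractionD(3)[OF T y(1)] by (intro power_mono) auto
        also have "\<dots> \<le> ip ((T ^^ (2 ^ q)) y) ((T ^^ (2 ^ q)) y)"
          using cauchy_schwarz_sq[OF M y(1)] y by simp
        also have "\<dots> = ip ((T ^^ (2 ^ Suc q)) y) y"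
          using funpow_add_ip[OF T y(1), of "2 ^ q" "2 ^ q"] by (simp add: mult_2)
        finally show ?case .
      qed simp
      also have "ip ((T ^^ (2 ^ p)) y) y \<le> ip ((T ^^ Suc (i + i)) y) y"
        using funpow_form_decreasing[OF T y(1)] p by (rule decseqD)
      finally have "s * (ip (T y) y) ^ (2 ^ p) \<le> s * ip ((T ^^ Suc (i + i)) y) y"
        using s0 by (simp del: funpow.simps)
      also have "\<dots> = ip ((T ^^ i) (k ((T ^^ i) y))) y"
        using s0 mid[OF y(1), of i] positive_contractionD(5)[OF P] kD(5) y
        by (simp del: funpow.simps)
      also have "\<dots> = ip (k ((T ^^ i) y)) ((T ^^ i) y)"
        using positive_contractionD(2,5)[OF P] kD(5) y by simp
      also have "\<dots> \<le> ip ((T ^^ i) a) ((T ^^ i) a) * ip y y"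
        using positive_contractionD(1,2)[OF P] a y kD(1) by (intro kernel_form_le[OF k(1)]) auto
      finally show ?thesis using y by (simp add: B_def)
    qed
    \<comment> \<open>The form of \<open>T\<close> has supremum 1 on unit vectors, so every
      \<open>x\<close> below 1 is reached; letting \<open>x\<close> tend to 1 leaves
      \<open>s\<close> as the lower bound.\<close>
    have "s * x ^ (2 ^ p) \<le> B" if x: "0 \<le> x" "x < 1" for x
    proof -
      have "s * x < s" using x s0 by simp
      then obtain v where "v \<in> S" "s * x < v" unfolding s_def using less_cSupD[OF ne] by blast
      then obtain y where y: "y \<in> M" "ip y y = 1" "s * x < ip (k y) y" by (auto simp: S_def)
      have "x \<le> ip (T y) y" using y kD(5) s0 by (simp add: T_def field_simps)
      then have "s * x ^ (2 ^ p) \<le> s * (ip (T y) y) ^ (2 ^ p)"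
        using x s0 by (intro mult_left_mono power_mono) auto
      also have "\<dots> \<le> B" using y by (intro step) auto
      finally show ?thesis .
    qed
    then have "\<exists>m. \<forall>n\<ge>m. s * (1 - 1 / real (Suc n)) ^ (2 ^ p) \<le> B" by simp
    moreover have "(\<lambda>n. s * (1 - 1 / real (Suc n)) ^ (2 ^ p)) \<longlonglongrightarrow> s * (1 - 0) ^ (2 ^ p)"
      by (intro tendsto_intros LIMSEQ_Suc[OF lim_1_over_n])
    ultimately have "s * (1 - 0) ^ (2 ^ p) \<le> B" by (rule LIMSEQ_le_const2[rotated])
    then show ?thesis by (simp add: B_def)
  qed
  have "s \<le> ip (g a) (g a)"
    by (rule LIMSEQ_le_const[OF conv2_ip_self[OF g(5)[OF a(1)]]]) (use low in blast)
  moreover have "k (g y) = s *\<^sub>R g y" if "y \<in> M" for y using g(2)[OF that] kT by simp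
  moreover have "g (k y) = s *\<^sub>R g y" if "y \<in> M" for y
    using g(3)[OF that] that kT positive_contractionD(5)[OF T]
      bimodular_scaleR[OF positive_contractionD(1)[OF g(1)]] by simp
  ultimately show thesis using that[of s g] s0 s1 sa g(1,4,6) by blast
qed

definition frame :: "'a set \<Rightarrow> 'a \<Rightarrow> real \<Rightarrow> bool"
  where "frame K f s \<longleftrightarrow> f \<in> M \<and> (\<exists>G. (\<forall>n. convex_family Uni (G n)) \<and>
    (\<forall>y\<in>K. conv2 (\<lambda>n. kmap f (G n) y) (s *\<^sub>R y)) \<and>
    conv2 (\<lambda>n. avg (G n) (f * star f)) (ip f f *\<^sub>R 1))"

text \<open>Compression by \<open>g\<close> turns the averages for \<open>a\<close> into averages
  for \<open>g a\<close> and their limit into multiplication by \<open>s\<close> on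
  \<open>K\<close>.\<close>

lemma frameI:
  assumes a: "a \<in> M" and k: "approximates a F r k" "bimodular k" and g: "positive_contraction g"
    and K: "\<And>y. y \<in> K \<Longrightarrow> y \<in> M \<and> g y = y" and gk: "\<And>y. y \<in> K \<Longrightarrow> g (k y) = s *\<^sub>R y"
  shows "frame K (g a) s"
proof -
  note gD = positive_contractionD[OF g]
  let ?f = "g a"
  have fM: "?f \<in> M" using gD(5) a .
  obtain G where G: "\<And>n. convex_family Uni (G n)"
    "\<And>y. y \<in> M \<Longrightarrow> conv2 (\<lambda>n. kmap a (G n) y) (k y)"
    "conv2 (\<lambda>n. avg (G n) (?f * star ?f)) (tr (?f * star ?f) *\<^sub>R 1)"
    using approximates_refine[OF k a, of "?f * star ?f"] fM by auto
  have "conv2 (\<lambda>n. kmap ?f (G n) y) (s *\<^sub>R y)" if y: "y \<in> K" for y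
  proof -
    have "conv2 (\<lambda>n. g (kmap a (G n) y)) (g (k y))"
    proof (rule conv2_bounded_map[OF G(2) gD(5)])
      show "n2 (g x - g x') \<le> 1 * n2 (x - x')" if "x \<in> M" "x' \<in> M" for x x'
        using gD(4)[of "x - x'"] that bimodular_diff[OF gD(1)] by simp
    qed (use K[OF y] in simp_all)
    moreover have "g (kmap a (G n) y) = kmap ?f (G n) y" for n
      using kmap_conj[OF gD(1) gD(1) gD(2) G(1) a, of y] K[OF y] by simp
    ultimately show ?thesis using gk[OF y] by simp
  qed
  moreover have "tr (?f * star ?f) = ip ?f ?f"
    using tr_commute[of ?f "star ?f"] fM by (simp add: ip_def)
  ultimately show ?thesis using G fM unfolding frame_def by auto
qed

text \<open>If the form of \<open>X\<close> were not constant on the range of \<open>g\<close>,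
  rescaling it to fill the interval from 0 to 1 would give positive \<open>A\<close> and
  \<open>B\<close> with sum \<open>g\<close>, each with form supremum 1. Each then has value at
  least \<open>s\<close> at \<open>g a\<close>, although the two values add up to less than
  \<open>2 * s\<close>.\<close>

lemma eigenprojection_minimal:
  assumes a: "a \<in> M" "unitary a" and k: "approximates a F r k" "positive_contraction k"
    and g: "positive_contraction g" "\<And>y. y \<in> M \<Longrightarrow> g (g y) = g y"
      "\<And>y. y \<in> M \<Longrightarrow> k (g y) = s *\<^sub>R g y"
    and s: "0 < s" "ip (g a) (g a) < 2 * s" "g a \<noteq> 0"
    and X: "positive_contraction X" and y: "y \<in> M" "g y = y"
  shows "g (X y) = (ip (X (g a)) (g a) / ip (g a) (g a)) *\<^sub>R y"
proof -
  note kD = positive_contractionD[OF k(2)] and gD = positive_contractionD[OF g(1)]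
    and XD = positive_contractionD[OF X]
  let ?f = "g a"
  have fM: "?f \<in> M" using gD(5) a by simp
  have key: "s \<le> ip (P ?f) ?f"
    if P: "positive_contraction P" "\<And>y. y \<in> M \<Longrightarrow> P (g y) = P y" "\<And>y. y \<in> M \<Longrightarrow> g (P y) = P y"
      and sup: "\<And>e. e > 0 \<Longrightarrow> \<exists>y\<in>M. ip y y = 1 \<and> ip (P y) y > 1 - e" for P
  proof -
    note PD = positive_contractionD[OF P(1)]
    have "s * (1 - e)\<^sup>2 \<le> ip (P ?f) ?f" if e: "0 < e" "e < 1" for e
    proof -
      obtain y where y: "y \<in> M" "ip y y = 1" "ip (P y) y > 1 - e" using sup e by blast
      have "(1 - e)\<^sup>2 \<le> (ip (P y) y)\<^sup>2" using e y by (intro power_mono) auto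
      also have "\<dots> \<le> ip (P y) (P y)" using cauchy_schwarz_sq[of "P y" y] PD(5) y by simp
      finally have "s * (1 - e)\<^sup>2 \<le> s * ip (P y) (P y)" using s by simp
      also have "\<dots> = ip (k (P y)) (P y)" using g(3)[of "P y"] P(3) PD(5) y by simp
      also have "\<dots> \<le> ip (P a) (P a) * ip y y"
        using PD(1,2) kD(1) a y by (intro kernel_form_le[OF k(1)]) auto
      also have "\<dots> \<le> ip (P ?f) ?f"
        using contraction_form_le(2)[OF P(1) fM] P(2)[OF a(1)] y by simp
      finally show ?thesis .
    qed
    then have "\<exists>m. \<forall>n\<ge>m. s * (1 - 1 / real (Suc n))\<^sup>2 \<le> ip (P ?f) ?f"
      by (intro exI[of _ 1]) auto
    moreover have "(\<lambda>n. s * (1 - 1 / real (Suc n))\<^sup>2) \<longlonglongrightarrow> s * (1 - 0)\<^sup>2"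
      by (intro tendsto_intros LIMSEQ_Suc[OF lim_1_over_n])
    ultimately have "s * (1 - 0)\<^sup>2 \<le> ip (P ?f) ?f" by (rule LIMSEQ_le_const2[rotated])
    then show ?thesis by simp
  qed
  define S where "S = {ip (X y) y | y. y \<in> M \<and> g y = y \<and> ip y y = 1}"
  define \<alpha> \<beta> where "\<alpha> = Inf S" and "\<beta> = Sup S"
  have bdd: "bdd_above S" "bdd_below S"
  proof -
    have "0 \<le> v \<and> v \<le> 1" if "v \<in> S" for v
      using that contraction_form_le(1)[OF X] XD(3) unfolding S_def by force
    then show "bdd_above S" "bdd_below S"
      by (auto intro!: bdd_aboveI[of _ 1] bdd_belowI[of _ 0])
  qed
  have scaled: "\<exists>z. z \<in> M \<and> g z = z \<and> ip z z = 1 \<and> ip (X z) z = ip (X y) y / ip y y"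
    if "y \<in> M" "g y = y" "y \<noteq> 0" for y
  proof -
    have n: "n2 y \<noteq> 0" using that by simp
    let ?z = "(1 / n2 y) *\<^sub>R y"
    have "ip ?z ?z = 1" using that n n2_sq[of y] ip_self_pos[of y] by (simp add: power2_eq_square field_simps)
    moreover have "ip (X ?z) ?z = ip (X y) y / ip y y"
      using that XD(5) bimodular_scaleR[OF XD(1)] n2_sq[of y] ip_self_pos[of y]
      by (simp add: power2_eq_square field_simps)
    moreover have "g ?z = ?z" using that bimodular_scaleR[OF gD(1)] by simp
    moreover have "?z \<in> M" using that by simp
    ultimately show ?thesis by blast
  qed
  have ne: "S \<noteq> {}" using scaled[OF fM g(2)[OF a(1)] s(3)] by (auto simp: S_def)
  have bounds: "\<alpha> * ip y y \<le> ip (X y) y" "ip (X y) y \<le> \<beta> * ip y y" if y: "y \<in> M" "g y = y" for y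
  proof -
    have "\<alpha> * ip y y \<le> ip (X y) y \<and> ip (X y) y \<le> \<beta> * ip y y"
    proof (cases "y = 0")
      case False
      then have "0 < ip y y" using y ip_self_pos[of y] by simp
      have "ip (X y) y / ip y y \<in> S" using scaled[OF y False] by (force simp: S_def)
      then have "\<alpha> \<le> ip (X y) y / ip y y" "ip (X y) y / ip y y \<le> \<beta>"
        unfolding \<alpha>_def \<beta>_def using bdd by (auto intro: cInf_lower cSup_upper)
      then show ?thesis using \<open>0 < ip y y\<close> by (simp add: field_simps)
    qed simp
    then show "\<alpha> * ip y y \<le> ip (X y) y" "ip (X y) y \<le> \<beta> * ip y y" by auto
  qed
  have "\<alpha> \<le> \<beta>"
    unfolding \<alpha>_def \<beta>_def using bdd ne by (meson cInf_le_cSup)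
  define Z where "Z y = g (X (g y)) - \<alpha> *\<^sub>R g y" for y
  have ZM: "Z y \<in> M" if "y \<in> M" for y using that gD(5) XD(5) by (simp add: Z_def)
  have gZ: "g (Z y) = Z y" "Z (g y) = Z y" if "y \<in> M" for y
    using that gD(5) XD(5) g(2) bimodular_diff[OF gD(1)] bimodular_scaleR[OF gD(1)]
    by (simp_all add: Z_def)
  have Zb: "bimodular Z"
    unfolding bimodular_def
  proof (intro conjI ballI)
    show "Z (y + z) = Z y + Z z" if "y \<in> M" "z \<in> M" for y z
      using that gD(5) XD(5) by (simp add: Z_def bimodular_add[OF gD(1)] bimodular_add[OF XD(1)] scaleR_add_right)
    show "Z (n * y) = n * Z y" if "n \<in> N" "y \<in> M" for n y
      using that gD(5) XD(5)
      by (simp add: Z_def bimodular_left[OF gD(1)] bimodular_left[OF XD(1)] right_diff_distrib)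
    show "Z (y * n) = Z y * n" if "n \<in> N" "y \<in> M" for n y
      using that gD(5) XD(5)
      by (simp add: Z_def bimodular_right[OF gD(1)] bimodular_right[OF XD(1)] left_diff_distrib)
  qed (rule ZM)
  have Zsym: "ip (Z y) z = ip y (Z z)" if "y \<in> M" "z \<in> M" for y z
    using that gD XD(2,5) by (simp add: Z_def)
  have Zform: "ip (Z y) y = ip (X (g y)) (g y) - \<alpha> * ip (g y) (g y)" if "y \<in> M" for y
  proof -
    have "ip (g (X (g y))) y = ip (X (g y)) (g y)" using that gD(2,5) XD(5) by simp
    moreover have "ip (g y) y = ip (g y) (g y)" using that gD(2)[of "g y" y] gD(5) g(2) by simp
    ultimately show ?thesis using that gD(5) XD(5) by (simp add: Z_def)
  qed
  have Zpos: "0 \<le> ip (Z y) y" if "y \<in> M" for y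
    using bounds(1)[of "g y"] that gD(5) g(2) by (simp add: Zform)
  have gle: "ip (g y) (g y) \<le> ip y y" if "y \<in> M" for y
    using contraction_form_le[OF g(1) that] by simp
  have Zle: "ip (Z y) y \<le> (\<beta> - \<alpha>) * ip (g y) (g y)" if "y \<in> M" for y
    using bounds(2)[of "g y"] that gD(5) g(2) by (simp add: Zform algebra_simps)
  have "\<alpha> = \<beta>"
  proof (rule ccontr)
    assume "\<alpha> \<noteq> \<beta>"
    with \<open>\<alpha> \<le> \<beta>\<close> have \<gamma>: "0 < \<beta> - \<alpha>" by simp
    define A where "A y = (1 / (\<beta> - \<alpha>)) *\<^sub>R Z y" for y
    define B where "B y = g y - A y" for y
    have AM: "A y \<in> M" "B y \<in> M" if "y \<in> M" for y using that ZM gD(5) by (simp_all add: A_def B_def)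
    have Ale: "ip (A y) y \<le> ip (g y) (g y)" if "y \<in> M" for y
      using Zle[OF that] ZM that \<gamma> by (simp add: A_def field_simps)
    have Ab: "bimodular A" using Zb by (simp add: bimodular_def A_def scaleR_add_right)
    have A: "positive_contraction A"
    proof (rule positive_contractionI[OF Ab])
      show "ip (A y) z = ip y (A z)" if "y \<in> M" "z \<in> M" for y z
        using Zsym[OF that] ZM that by (simp add: A_def)
      show "0 \<le> ip (A y) y" if "y \<in> M" for y using Zpos[OF that] ZM that \<gamma> by (simp add: A_def)
      show "ip (A y) y \<le> ip y y" if "y \<in> M" for y using Ale[OF that] gle[OF that] by simp
    qed
    note AD = positive_contractionD[OF A]
    have gy: "ip (g y) y = ip (g y) (g y)" if "y \<in> M" for y
      using that gD(2)[of "g y" y] gD(5) g(2) by simp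
    have B: "positive_contraction B"
    proof (rule positive_contractionI)
      show "bimodular B"
        unfolding bimodular_def
      proof (intro conjI ballI)
        show "B (y + z) = B y + B z" if "y \<in> M" "z \<in> M" for y z
          using that by (simp add: B_def bimodular_add[OF gD(1)] bimodular_add[OF Ab])
        show "B (n * y) = n * B y" if "n \<in> N" "y \<in> M" for n y
          using that by (simp add: B_def bimodular_left[OF gD(1)] bimodular_left[OF Ab] right_diff_distrib)
        show "B (y * n) = B y * n" if "n \<in> N" "y \<in> M" for n y
          using that by (simp add: B_def bimodular_right[OF gD(1)] bimodular_right[OF Ab] left_diff_distrib)
      qed (rule AM(2))
      show "ip (B y) z = ip y (B z)" if "y \<in> M" "z \<in> M" for y z
        using gD(2)[OF that] AD(2)[OF that] gD(5) AM that by (simp add: B_def)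
      show "0 \<le> ip (B y) y" if "y \<in> M" for y
        using Ale[OF that] gy[OF that] gD(5) AM that by (simp add: B_def)
      show "ip (B y) y \<le> ip y y" if "y \<in> M" for y
        using AD(3)[OF that] gle[OF that] gy[OF that] gD(5) AM that by (simp add: B_def)
    qed
    have Ag: "A (g y) = A y" "g (A y) = A y" if "y \<in> M" for y
      using that gZ ZM bimodular_scaleR[OF gD(1)] by (simp_all add: A_def)
    have Bg: "B (g y) = B y" "g (B y) = B y" if "y \<in> M" for y
      using that Ag g(2) gD(5) AM bimodular_diff[OF gD(1)] by (simp_all add: B_def)
    have Aform: "ip (A y) y = (ip (X y) y - \<alpha>) / (\<beta> - \<alpha>)" if "y \<in> M" "g y = y" "ip y y = 1" for y
      using that Zform[of y] ZM by (simp add: A_def)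
    have "s \<le> ip (A ?f) ?f"
    proof (rule key[OF A Ag])
      fix e :: real assume "e > 0"
      then have "\<beta> - e * (\<beta> - \<alpha>) < Sup S" using \<gamma> by (simp add: \<beta>_def[symmetric])
      then obtain v where "v \<in> S" "\<beta> - e * (\<beta> - \<alpha>) < v" using less_cSupD[OF ne] by blast
      then obtain y where y: "y \<in> M" "g y = y" "ip y y = 1" "\<beta> - e * (\<beta> - \<alpha>) < ip (X y) y"
        by (auto simp: S_def)
      then have "(1 - e) * (\<beta> - \<alpha>) < ip (X y) y - \<alpha>" by (simp add: algebra_simps)
      then have "1 - e < ip (A y) y"
        unfolding Aform[OF y(1-3)] using \<gamma> by (simp add: pos_less_divide_eq)
      then show "\<exists>y\<in>M. ip y y = 1 \<and> ip (A y) y > 1 - e" using y by blast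
    qed
    moreover have "s \<le> ip (B ?f) ?f"
    proof (rule key[OF B Bg])
      fix e :: real assume "e > 0"
      then have "Inf S < \<alpha> + e * (\<beta> - \<alpha>)" using \<gamma> by (simp add: \<alpha>_def[symmetric])
      then obtain v where "v \<in> S" "v < \<alpha> + e * (\<beta> - \<alpha>)" using cInf_lessD[OF ne] by blast
      then obtain y where y: "y \<in> M" "g y = y" "ip y y = 1" "ip (X y) y < \<alpha> + e * (\<beta> - \<alpha>)"
        by (auto simp: S_def)
      then have "ip (X y) y - \<alpha> < e * (\<beta> - \<alpha>)" by (simp add: algebra_simps)
      then have "ip (A y) y < e"
        unfolding Aform[OF y(1-3)] using \<gamma> by (simp add: pos_divide_less_eq)
      moreover have "ip (B y) y = 1 - ip (A y) y" using y AM by (simp add: B_def)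
      ultimately show "\<exists>y\<in>M. ip y y = 1 \<and> ip (B y) y > 1 - e" using y by force
    qed
    moreover have "ip (A ?f) ?f + ip (B ?f) ?f = ip ?f ?f"
      using AM fM gD(5) g(2)[OF a(1)] by (simp add: B_def)
    ultimately show False using s by simp
  qed
  have "ip (Z y) (Z y) \<le> 0\<^sup>2 * ip y y"
    using Zle \<open>\<alpha> = \<beta>\<close> by (intro positive_form_bound[OF Zb Zsym Zpos _ y(1)]) simp_all
  then have "Z y = 0" using ip_self_zero[OF ZM[OF y(1)]] ip_nonneg[OF ZM[OF y(1)]] by simp
  then have "g (X y) = \<alpha> *\<^sub>R y" using y by (simp add: Z_def)
  moreover have "ip (X ?f) ?f = \<alpha> * ip ?f ?f"
    using bounds[OF fM g(2)[OF a(1)]] \<open>\<alpha> = \<beta>\<close> by simp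
  moreover have "ip ?f ?f \<noteq> 0" using ip_self_zero[OF fM] s(3) by auto
  ultimately show ?thesis by simp
qed

end

context irreducible_inclusion
begin

subsection \<open>Bimodules with tight frames on both sides\<close>

lemma frameE:
  assumes "frame K f s"
  obtains G where "f \<in> M" "\<And>n. convex_family Uni (G n)"
    "\<And>y. y \<in> K \<Longrightarrow> conv2 (\<lambda>n. kmap f (G n) y) (s *\<^sub>R y)"
    "conv2 (\<lambda>n. avg (G n) (f * star f)) (ip f f *\<^sub>R 1)"
  using assms unfolding frame_def by blast

lemma conv2_E: "conv2 X x \<Longrightarrow> conv2 (\<lambda>n. E (X n)) (E x)"
  by (rule conv2_bounded_map[where C = 1]) (auto simp: n2_E_le simp flip: E_diff)

text \<open>Expand \<open>star y\<close> in the left frame and apply Cauchy-Schwarz: one factor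
  rebuilds \<open>E (y * star y)\<close>, the other is a scalar. So \<open>y * star y\<close> is
  dominated by its expectation times the left dimension.\<close>

lemma frame_pimsner_popa:
  assumes fr: "frame (star ` K) (star f) t" and t: "0 < t" and f: "f \<in> M"
    and y: "y \<in> K" "y \<in> M" and x: "x \<in> M"
  shows "t * ip (star y * x) (star y * x) \<le> ip f f * ip (E (y * star y) * x) x"
proof -
  obtain G where G: "\<And>n. convex_family Uni (G n)"
    "\<And>z. z \<in> star ` K \<Longrightarrow> conv2 (\<lambda>n. kmap (star f) (G n) z) (t *\<^sub>R z)"
    "conv2 (\<lambda>n. avg (G n) (star f * star (star f))) (ip (star f) (star f) *\<^sub>R 1)"
  proof (rule frameE[OF fr])
    fix G
    assume "\<And>n. convex_family Uni (G n)"
      "\<And>z. z \<in> star ` K \<Longrightarrow> conv2 (\<lambda>n. kmap (star f) (G n) z) (t *\<^sub>R z)"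
      "conv2 (\<lambda>n. avg (G n) (star f * star (star f))) (ip (star f) (star f) *\<^sub>R 1)"
    then show thesis by (rule that)
  qed
  let ?z = "star y * x"
  let ?e = "\<lambda>w. E (star (w * star f) * star y)"
  have zM: "?z \<in> M" using y x by simp
  have c: "conv2 (\<lambda>n. kmap (star f) (G n) (star y)) (t *\<^sub>R star y)" using G(2) y by blast
  have first: "wsum (G n) (\<lambda>w. ip (?e w * x) (?e w * x)) =
      ip (E (y * kmap (star f) (G n) (star y)) * x) x" for n
  proof -
    have "E (y * kmap (star f) (G n) (star y)) * x =
        wsum (G n) (\<lambda>w. E (y * (w * star f * ?e w)) * x)"
      unfolding kmap_def wsum_mult_algebra_left[symmetric]
      by (subst E_wsum) (use y f family_Uni[OF G(1)] in \<open>simp_all add: wsum_mult_algebra_right\<close>)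
    then have "ip (E (y * kmap (star f) (G n) (star y)) * x) x =
        wsum (G n) (\<lambda>w. ip (E (y * (w * star f * ?e w)) * x) x)"
      using y x f family_Uni[OF G(1)] by (simp add: ip_wsum_left)
    also have "\<dots> = wsum (G n) (\<lambda>w. ip (?e w * x) (?e w * x))"
    proof (rule convex_family_cong[OF G(1)])
      fix w assume w: "w \<in> Uni"
      have "ip (E (y * (b * E (star b * star y))) * x) x =
          ip (E (star b * star y) * x) (E (star b * star y) * x)" if b: "b \<in> M" for b
      proof -
        have "E (y * (b * E (star b * star y))) = E (y * b) * E (star b * star y)"
          using E_mult_right[of "y * b" "E (star b * star y)"] y b by (simp add: mult.assoc)
        also have "E (y * b) = star (E (star b * star y))"
          using E_star[of "star b * star y"] y b by simp
        finally show ?thesis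
          using ip_mult_left[of "star (E (star b * star y))" "E (star b * star y) * x" x] x y b
          by (simp add: mult.assoc)
      qed
      from this[of "w * star f"] show "ip (E (y * (w * star f * ?e w)) * x) x = ip (?e w * x) (?e w * x)"
        using w f by simp
    qed
    finally show ?thesis ..
  qed
  have "(ip (t *\<^sub>R star y * x) ?z)\<^sup>2 \<le>
      ip (E (y * (t *\<^sub>R star y)) * x) x * ip (ip (star f) (star f) *\<^sub>R 1 * ?z) ?z"
  proof (rule LIMSEQ_le)
    show "(\<lambda>n. (ip (kmap (star f) (G n) (star y) * x) ?z)\<^sup>2) \<longlonglongrightarrow> (ip (t *\<^sub>R star y * x) ?z)\<^sup>2"
      by (intro tendsto_power conv2_ip conv2_mult_right c x zM)
    show "(\<lambda>n. ip (E (y * kmap (star f) (G n) (star y)) * x) x *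
        ip (avg (G n) (star f * star (star f)) * ?z) ?z) \<longlonglongrightarrow>
      ip (E (y * (t *\<^sub>R star y)) * x) x * ip (ip (star f) (star f) *\<^sub>R 1 * ?z) ?z"
      by (intro tendsto_mult conv2_ip conv2_mult_right conv2_E conv2_mult_left c x zM y G(3))
    show "\<exists>m. \<forall>n\<ge>m. (ip (kmap (star f) (G n) (star y) * x) ?z)\<^sup>2 \<le>
      ip (E (y * kmap (star f) (G n) (star y)) * x) x *
        ip (avg (G n) (star f * star (star f)) * ?z) ?z"
      unfolding first[symmetric]
      by (intro exI allI impI kmap_cauchy_schwarz[OF G(1)]) (use f y x zM in simp_all)
  qed
  moreover have "ip (star f) (star f) = ip f f" using f by (simp add: ip_star)
  ultimately have "(t * ip ?z ?z)\<^sup>2 \<le> (t * ip (E (y * star y) * x) x) * (ip f f * ip ?z ?z)"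
    using y x f by simp
  then have le: "(t * ip ?z ?z) * (t * ip ?z ?z) \<le> (ip f f * ip (E (y * star y) * x) x) * (t * ip ?z ?z)"
    by (simp add: power2_eq_square mult_ac)
  have "0 \<le> ip (E (y * star y) * x) x"
    using pos_ip[OF pos_E[of "star y"] x] y by simp
  then have "0 \<le> ip f f * ip (E (y * star y) * x) x"
    using f by (intro mult_nonneg_nonneg ip_nonneg)
  moreover have "0 \<le> t * ip ?z ?z"
    using t zM by (intro mult_nonneg_nonneg ip_nonneg) auto
  ultimately show ?thesis using le by (intro mult_self_le_imp_le[OF le])
qed

text \<open>\<open>V w\<close> is the image of the frame vector \<open>w * f\<close> under the
  operator \<open>p\<close> plus \<open>x E (star v * _)\<close>. The limit is thus a
  Hilbert-Schmidt norm over \<open>K\<close>, relative to the frame, with mixed terms evaluated by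
  the reconstruction formula.\<close>

lemma frame_sum:
  assumes f: "f \<in> M" and G: "\<And>n. convex_family Uni (G n)"
    and v: "v \<in> M" "conv2 (\<lambda>n. kmap f (G n) v) (s *\<^sub>R v)"
    and fa: "conv2 (\<lambda>n. avg (G n) (f * star f)) (c *\<^sub>R 1)" and px: "p \<in> N" "x \<in> M"
  defines "V \<equiv> \<lambda>w. p * (w * f) + x * star (E (star (w * f) * v))"
  shows "(\<lambda>n. wsum (G n) (\<lambda>w. ip (V w) (V w))) \<longlonglongrightarrow>
    c * ip p p + 2 * (s * ip x (p * v)) + s * ip (E (star v * v)) (star x * x)"
proof -
  have "wsum (G n) (\<lambda>w. ip (V w) (V w)) = ip (p * avg (G n) (f * star f)) p +
      2 * ip x (p * kmap f (G n) v) + ip (E (star v * kmap f (G n) v)) (star x * x)" for n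
  proof -
    define e where "e w = E (star (w * f) * v)" for w
    have eN: "e w \<in> N" if "w \<in> Uni" for w using that f v by (simp add: e_def)
    have "wsum (G n) (\<lambda>w. ip (V w) (V w)) = wsum (G n) (\<lambda>w. ip (p * (w * (f * star f) * star w)) p +
        2 * ip (p * (w * f * e w)) x + ip (E (star v * (w * f * e w))) (star x * x))"
    proof (rule convex_family_cong[OF G])
      fix w assume w: "w \<in> Uni"
      define b where "b = w * f"
      have b: "b \<in> M" using w f by (simp add: b_def)
      have e: "e w \<in> N" "e w = E (star b * v)" using eN[OF w] by (simp_all add: e_def b_def)
      have Vw: "V w = p * b + x * star (e w)" unfolding V_def e_def b_def ..
      have "ip (V w) (V w) = ip (p * b) (p * b) + 2 * ip (x * star (e w)) (p * b) +
          ip (x * star (e w)) (x * star (e w))"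
        unfolding Vw using px b e(1) ip_commute[of "p * b" "x * star (e w)"] by simp
      moreover have "ip (p * b) (p * b) = ip (p * (b * star b)) p"
        using ip_mult_right[of "p * b" "star b" p] px b by (simp add: mult.assoc)
      moreover have "ip (x * star (e w)) (p * b) = ip (p * (b * e w)) x"
        using ip_mult_right[of x "star (e w)" "p * b"] ip_commute[of x "p * b * e w"] px b e(1)
        by (simp add: mult.assoc)
      moreover have "ip (x * star (e w)) (x * star (e w)) = ip (E (star v * (b * e w))) (star x * x)"
      proof -
        have "E (star v * (b * e w)) = E (star v * b) * e w"
          using E_mult_right[of "star v * b" "e w"] v b e(1) by (simp add: mult.assoc)
        also have "E (star v * b) = star (e w)" using E_star[of "star b * v"] v b e(2) by simp
        finally have "ip (E (star v * (b * e w))) (star x * x) = ip (star (e w) * e w) (star x * x)"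
          by simp
        also have "\<dots> = ip (star (e w)) (star x * x * star (e w))"
          using ip_mult_right[of "star (e w)" "e w" "star x * x"] px e(1) by simp
        also have "\<dots> = ip (x * star (e w)) (x * star (e w))"
          using ip_mult_left[of x "star (e w)" "x * star (e w)"]
            ip_commute[of "x * star (e w)" "x * star (e w)"] px e(1) by (simp add: mult.assoc)
        finally show ?thesis ..
      qed
      ultimately show "ip (V w) (V w) = ip (p * (w * (f * star f) * star w)) p +
        2 * ip (p * (w * f * e w)) x + ip (E (star v * (w * f * e w))) (star x * x)"
        by (simp add: b_def mult.assoc)
    qed
    also have "\<dots> = wsum (G n) (\<lambda>w. ip (p * (w * (f * star f) * star w)) p) +
        2 * wsum (G n) (\<lambda>w. ip (p * (w * f * e w)) x) +
        wsum (G n) (\<lambda>w. ip (E (star v * (w * f * e w))) (star x * x))"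
      by (simp only: wsum_add wsum_mult)
    also have "wsum (G n) (\<lambda>w. ip (p * (w * (f * star f) * star w)) p) = ip (p * avg (G n) (f * star f)) p"
      unfolding avg_def wsum_mult_algebra_left[symmetric]
      using f px family_Uni[OF G] by (subst ip_wsum_left) simp_all
    also have "wsum (G n) (\<lambda>w. ip (p * (w * f * e w)) x) = ip (p * kmap f (G n) v) x"
      unfolding kmap_def wsum_mult_algebra_left[symmetric] e_def[symmetric]
      using f px eN family_Uni[OF G] by (subst ip_wsum_left) simp_all
    also have "wsum (G n) (\<lambda>w. ip (E (star v * (w * f * e w))) (star x * x)) =
        ip (E (star v * kmap f (G n) v)) (star x * x)"
    proof -
      have "E (star v * kmap f (G n) v) = wsum (G n) (\<lambda>w. E (star v * (w * f * e w)))"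
        unfolding kmap_def wsum_mult_algebra_left[symmetric] e_def[symmetric]
        using f v eN family_Uni[OF G] by (intro E_wsum) simp_all
      then show ?thesis
        using f v px eN family_Uni[OF G] by (simp add: ip_wsum_left)
    qed
    also have "ip (p * kmap f (G n) v) x = ip x (p * kmap f (G n) v)"
      using f v px G by (intro ip_commute) simp_all
    finally show ?thesis .
  qed
  moreover have "(\<lambda>n. ip (p * avg (G n) (f * star f)) p + 2 * ip (p * kmap f (G n) v) x +
      ip (E (star v * kmap f (G n) v)) (star x * x)) \<longlonglongrightarrow>
    ip (p * (c *\<^sub>R 1)) p + 2 * ip (p * (s *\<^sub>R v)) x + ip (E (star v * (s *\<^sub>R v))) (star x * x)"
    using px v(1) by (intro tendsto_add tendsto_mult_left conv2_ip conv2_E conv2_mult_left v(2) fa) simp_all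
  moreover have "ip (p * kmap f (G n) v) x = ip x (p * kmap f (G n) v)" for n
    using f v px G by (intro ip_commute) simp_all
  moreover have "ip (p * v) x = ip x (p * v)" using px v by (intro ip_commute) simp_all
  ultimately show ?thesis using px v by simp
qed

definition bimodule :: "'a set \<Rightarrow> bool"
  where "bimodule K \<longleftrightarrow> K \<subseteq> M \<and> (\<forall>y\<in>K. \<forall>z\<in>K. y + z \<in> K) \<and>
    (\<forall>n\<in>N. \<forall>y\<in>K. n * y \<in> K \<and> y * n \<in> K)"

lemma bimoduleD:
  assumes "bimodule K"
  shows "y \<in> K \<Longrightarrow> y \<in> M" "y \<in> K \<Longrightarrow> z \<in> K \<Longrightarrow> y + z \<in> K"
    "n \<in> N \<Longrightarrow> y \<in> K \<Longrightarrow> n * y \<in> K" "n \<in> N \<Longrightarrow> y \<in> K \<Longrightarrow> y * n \<in> K"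
    "y \<in> K \<Longrightarrow> r *\<^sub>R y \<in> K" "y \<in> K \<Longrightarrow> z \<in> K \<Longrightarrow> y - z \<in> K"
proof -
  show *: "y \<in> K \<Longrightarrow> y \<in> M" "y \<in> K \<Longrightarrow> z \<in> K \<Longrightarrow> y + z \<in> K"
    "n \<in> N \<Longrightarrow> y \<in> K \<Longrightarrow> n * y \<in> K" "n \<in> N \<Longrightarrow> y \<in> K \<Longrightarrow> y * n \<in> K" for y z n
    using assms by (auto simp: bimodule_def)
  show **: "y \<in> K \<Longrightarrow> r *\<^sub>R y \<in> K" for y r using *(3)[of "r *\<^sub>R 1" y] by simp
  show "y \<in> K \<Longrightarrow> z \<in> K \<Longrightarrow> y - z \<in> K" using *(2)[of y "-1 *\<^sub>R z"] **[of z "-1"] by simp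
qed

text \<open>
  Let \<open>r = c / s\<close> and \<open>l = c / t\<close> be the right and left dimensions of \<open>K\<close>. The commutant of
  the right action of \<open>N\<close> on \<open>K\<close> contains \<open>N\<close> with index \<open>r l < 2\<close>, so equality holds; this is
  seen by applying the Pimsner--Popa inequality to the square of \<open>b \<plusminus> D\<close>, where \<open>D\<close> is an
  operator of norm \<open>b\<close> with zero expectation.
\<close>

lemma square_in_N:
  assumes K: "bimodule K" and fK: "f \<in> K" "f \<noteq> 0"
    and fr: "frame K f s" and fl: "frame (star ` K) (star f) t"
    and st: "0 < s" "0 < t" "(ip f f)\<^sup>2 < 2 * (s * t)" and yK: "y \<in> K"
  shows "y * star y \<in> N"
proof -
  note KD = bimoduleD[OF K]
  define c where "c = ip f f"
  have fM: "f \<in> M" and yM: "y \<in> M" using KD(1) fK yK by auto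
  have c0: "0 < c" unfolding c_def using fM fK by (intro ip_self_pos)
  obtain G where G: "\<And>n. convex_family Uni (G n)"
    "\<And>y. y \<in> K \<Longrightarrow> conv2 (\<lambda>n. kmap f (G n) y) (s *\<^sub>R y)"
    "conv2 (\<lambda>n. avg (G n) (f * star f)) (c *\<^sub>R 1)"
    using fr by (elim frameE) (rule that[unfolded c_def])
  \<comment> \<open>The expectation onto \<open>N\<close> of the operator \<open>y e star y\<close>
    on \<open>K\<close>: the expectation of \<open>y * star y\<close> divided by the right dimension
    \<open>c / s\<close>.\<close>
  define n where "n = (s / c) *\<^sub>R E (y * star y)"
  have nN: "n \<in> N" "star n = n"
    using yM E_star[of "y * star y"] by (simp_all add: n_def)
  \<comment> \<open>The operator \<open>y e star y\<close> minus its expectation. The goal becomes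
    \<open>D = 0\<close> on \<open>K\<close>, that is, \<open>b = 0\<close> for its norm
    \<open>b\<close>.\<close>
  define D where "D k = y * E (star y * k) - n * k" for k
  have DM: "D k \<in> M" if "k \<in> M" for k using that yM nN by (simp add: D_def)
  have DK: "D k \<in> K" if "k \<in> K" for k
    using that yM nN yK KD by (simp add: D_def)
  have Dsym: "ip (D k) k' = ip k (D k')" if "k \<in> M" "k' \<in> M" for k k'
  proof -
    have "ip (y * E (star y * k)) k' = ip (E (star y * k)) (E (star y * k'))"
      using that yM ip_E'[of "star y * k'" "E (star y * k)"] by (simp add: ip_mult_left)
    also have "\<dots> = ip (star y * k) (E (star y * k'))" using that yM by (intro ip_E_E) simp_all
    also have "\<dots> = ip k (y * E (star y * k'))" using that yM by (simp add: ip_mult_left)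
    finally show ?thesis
      using that yM nN by (simp add: D_def ip_mult_left[of n])
  qed
  have Dadd: "D (k + k') = D k + D k'" if "k \<in> M" "k' \<in> M" for k k'
    using that yM by (simp add: D_def algebra_simps)
  have Dscale: "D (r *\<^sub>R k) = r *\<^sub>R D k" if "k \<in> M" for k r
    using that yM by (simp add: D_def algebra_simps)
  have Dright: "D (k * m) = D k * m" if "k \<in> M" "m \<in> N" for k m
  proof -
    have "E (star y * (k * m)) = E (star y * k) * m"
      using E_mult_right[of "star y * k" m] that yM by (simp add: mult.assoc)
    then show ?thesis by (simp add: D_def mult.assoc left_diff_distrib)
  qed
  define S where "S = {\<bar>ip (D k) k\<bar> | k. k \<in> K \<and> ip k k = 1}"
  define b where "b = Sup S"
  have bddS: "bdd_above S"
  proof (rule bdd_aboveI)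
    fix v assume "v \<in> S"
    then obtain k where k: "k \<in> M" "ip k k = 1" "v = \<bar>ip (D k) k\<bar>" using KD(1) by (auto simp: S_def)
    have n1: "n2 k = 1" using k by (simp add: n2_def)
    have "n2 (D k) \<le> n2 (y * E (star y * k)) + n2 (- (n * k))"
      unfolding D_def using n2_triangle[of "y * E (star y * k)" "- (n * k)"] k yM nN by simp
    also have "\<dots> \<le> norm y * (norm (star y) * n2 k) + norm n * n2 k"
    proof (rule add_mono)
      have "n2 (y * E (star y * k)) \<le> norm y * n2 (E (star y * k))" using k yM by (intro n2_mult_le) auto
      also have "\<dots> \<le> norm y * (norm (star y) * n2 k)"
        using k yM order_trans[OF n2_E_le[of "star y * k"] n2_mult_le[of "star y" k]]
        by (intro mult_left_mono) auto
      finally show "n2 (y * E (star y * k)) \<le> norm y * (norm (star y) * n2 k)" .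
      show "n2 (- (n * k)) \<le> norm n * n2 k" using k nN n2_mult_le[of n k] by simp
    qed
    finally have "n2 (D k) \<le> norm y * norm (star y) + norm n" using n1 by simp
    then show "v \<le> norm y * norm (star y) + norm n"
      using cauchy_schwarz[of "D k" k] k n1 DM by simp
  qed
  have neS: "S \<noteq> {}"
  proof -
    let ?k = "(1 / sqrt c) *\<^sub>R f"
    have "ip ?k ?k = 1" using fM c0 by (simp add: c_def[symmetric])
    then show ?thesis using KD(5)[OF fK(1), of "1 / sqrt c"] by (auto simp: S_def)
  qed
  have form: "\<bar>ip (D k) k\<bar> \<le> b * ip k k" if k: "k \<in> K" for k
  proof (cases "k = 0")
    case True
    then show ?thesis using DM[of 0] by simp
  next
    case False
    have kM: "k \<in> M" using k KD(1) by simp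
    have p: "0 < ip k k" using ip_self_pos[OF kM False] .
    let ?k = "(1 / sqrt (ip k k)) *\<^sub>R k"
    have e1: "ip ?k ?k = 1" using kM p by simp
    have e2: "ip (D ?k) ?k = ip (D k) k / ip k k"
      using kM DM[OF kM] p by (simp add: Dscale)
    have "\<bar>ip (D k) k / ip k k\<bar> \<in> S"
      unfolding S_def mem_Collect_eq
      by (intro exI[of _ ?k] conjI KD(5)[OF k] e1) (simp only: e2)
    then have "\<bar>ip (D k) k / ip k k\<bar> \<le> b" unfolding b_def using bddS by (rule cSup_upper)
    then show ?thesis using p by (simp add: abs_divide pos_divide_le_eq)
  qed
  have b0: "0 \<le> b" using form[OF fK(1)] c0 unfolding c_def by (smt (verit) mult_neg_pos)
  have norm_D: "ip (D k) (D k) \<le> b\<^sup>2 * ip k k" if k: "k \<in> K" for k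
  proof (cases "D k = 0")
    case True
    then show ?thesis using k KD(1) by simp
  next
    case False
    have kM: "k \<in> M" and dM: "D k \<in> M" using k KD(1) DM by auto
    have M2: "D (D k) \<in> M" using dM by (rule DM)
    \<comment> \<open>Polarisation with \<open>k\<close> plus and minus a multiple of
      \<open>D k\<close>. A bound on the form of a symmetric operator of no definite sign becomes a
      norm bound once \<open>r\<close> is optimised.\<close>
    have pol: "4 * (r * ip (D k) (D k)) \<le> b * (2 * (ip k k + r\<^sup>2 * ip (D k) (D k)))" for r
    proof -
      let ?p = "k + r *\<^sub>R D k" and ?q = "k - r *\<^sub>R D k"
      have pq: "?p \<in> K" "?q \<in> K" using k KD DK by auto
      have Dq: "D ?q = D k - r *\<^sub>R D (D k)"
        using Dadd[OF kM, of "(- r) *\<^sub>R D k"] Dscale[OF dM, of "- r"] dM by simp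
      have s: "ip (D (D k)) k = ip (D k) (D k)" using Dsym[OF dM kM] .
      have "ip (D ?p) ?p - ip (D ?q) ?q = 4 * (r * ip (D k) (D k))"
        using kM dM M2 s by (simp add: Dq Dadd Dscale algebra_simps)
      moreover have "ip ?p ?p + ip ?q ?q = 2 * (ip k k + r\<^sup>2 * ip (D k) (D k))"
        using kM dM by (simp add: algebra_simps power2_eq_square)
      moreover have "ip (D ?p) ?p - ip (D ?q) ?q \<le> b * (ip ?p ?p + ip ?q ?q)"
        unfolding distrib_left using form[OF pq(1)] form[OF pq(2)] by linarith
      ultimately show ?thesis by (simp only:)
    qed
    have "(ip (D k) (D k))\<^sup>2 \<le> (b * ip k k) * (b * ip (D k) (D k))"
    proof (rule quadratic_nonneg_imp)
      fix r show "0 \<le> b * ip k k + 2 * r * ip (D k) (D k) + r\<^sup>2 * (b * ip (D k) (D k))"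
        using pol[of "- r"] by (simp add: algebra_simps)
      show "0 \<le> b * ip (D k) (D k)" using b0 dM by simp
    qed
    then have "ip (D k) (D k) * ip (D k) (D k) \<le> (b\<^sup>2 * ip k k) * ip (D k) (D k)"
      by (simp add: power2_eq_square mult_ac)
    then show ?thesis by (rule mult_self_le_imp_le) (use kM dM in simp_all)
  qed
  define \<Psi> where "\<Psi> h = ip (E (star (h * y) * (h * y))) (star y * y)" for h
  \<comment> \<open>The sum over the frame of the squared norms of \<open>D (h * g)\<close>, bounded
    termwise by \<open>norm_D\<close>. Because \<open>D\<close> has expectation zero, the mixed term
    leaves exactly \<open>- c * ip (n * h) (n * h)\<close>.\<close>
  have lower: "s * \<Psi> h - c * ip (n * h) (n * h) \<le> b\<^sup>2 * (c * ip h h)" if h: "h \<in> N" "star h = h" for h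
  proof -
    have hyK: "h * y \<in> K" using KD(3) h yK by simp
    have lim1: "(\<lambda>i. wsum (G i) (\<lambda>w. ip (- (n * h) * (w * f) + y * star (E (star (w * f) * (h * y))))
        (- (n * h) * (w * f) + y * star (E (star (w * f) * (h * y)))))) \<longlonglongrightarrow>
      c * ip (- (n * h)) (- (n * h)) + 2 * (s * ip y (- (n * h) * (h * y))) + s * \<Psi> h"
      unfolding \<Psi>_def using nN h yM hyK KD(1)
      by (intro frame_sum[OF fM G(1) _ G(2) G(3)]) simp_all
    have lim2: "(\<lambda>i. wsum (G i) (\<lambda>w. b\<^sup>2 * ip (h * (w * f)) (h * (w * f)))) \<longlonglongrightarrow> b\<^sup>2 * (c * ip h h)"
    proof -
      have "(\<lambda>i. wsum (G i) (\<lambda>w. ip (h * (w * f) + 0 * star (E (star (w * f) * y)))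
          (h * (w * f) + 0 * star (E (star (w * f) * y))))) \<longlonglongrightarrow>
        c * ip h h + 2 * (s * ip 0 (h * y)) + s * ip (E (star y * y)) (star 0 * 0)"
        using h yM by (intro frame_sum[OF fM G(1) _ G(2)[OF yK] G(3)]) simp_all
      then show ?thesis unfolding wsum_mult by (intro tendsto_mult_left) simp
    qed
    have le: "wsum (G i) (\<lambda>w. ip (- (n * h) * (w * f) + y * star (E (star (w * f) * (h * y))))
        (- (n * h) * (w * f) + y * star (E (star (w * f) * (h * y))))) \<le>
      wsum (G i) (\<lambda>w. b\<^sup>2 * ip (h * (w * f)) (h * (w * f)))" for i
    proof (rule convex_family_mono[OF G(1)])
      fix w assume w: "w \<in> Uni"
      then have k: "h * (w * f) \<in> K" using KD(3) h fK by simp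
      define g where "g = w * f"
      have gM: "g \<in> M" using w fM by (simp add: g_def)
      have "star (E (star g * (h * y))) = E (star y * (h * g))"
        using E_star[of "star g * (h * y)"] gM h yM by (simp add: mult.assoc)
      then have "- (n * h) * g + y * star (E (star g * (h * y))) = D (h * g)"
        by (simp add: D_def mult.assoc)
      then show "ip (- (n * h) * (w * f) + y * star (E (star (w * f) * (h * y))))
          (- (n * h) * (w * f) + y * star (E (star (w * f) * (h * y)))) \<le>
        b\<^sup>2 * ip (h * (w * f)) (h * (w * f))"
        using norm_D[OF k] unfolding g_def by simp
    qed
    have "c * ip (- (n * h)) (- (n * h)) + 2 * (s * ip y (- (n * h) * (h * y))) + s * \<Psi> h
        \<le> b\<^sup>2 * (c * ip h h)"
      by (rule LIMSEQ_le[OF lim1 lim2]) (use le in blast)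
    moreover have "s * ip y (n * h * (h * y)) = c * ip (n * h) (n * h)"
    proof -
      have "ip y (n * h * (h * y)) = ip (y * star y) (n * h * h)"
        using ip_mult_right[of y "star y" "n * h * h"] yM nN h by (simp add: mult.assoc)
      also have "\<dots> = ip (E (y * star y)) (n * h * h)" using yM nN h by (intro ip_E[symmetric]) simp_all
      finally have "s * ip y (n * h * (h * y)) = c * ip n (n * h * h)"
        using yM nN h c0 by (simp add: n_def)
      also have "ip n (n * h * h) = ip (n * h) (n * h)"
        using ip_mult_right[of n h "n * h"] nN h by simp
      finally show ?thesis .
    qed
    ultimately show ?thesis using nN h yM by (simp add: mult.assoc)
  qed
  \<comment> \<open>The Pimsner-Popa estimate for \<open>A\<close>, the operator \<open>b\<close>
    plus or minus \<open>D\<close>. The expectation of its square has no mixed term, so it is at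
    most \<open>2 * b\<^sup>2\<close>; hence the factor 2.\<close>
  have upper: "s * ip (b *\<^sub>R k + \<sigma> *\<^sub>R D k) (b *\<^sub>R k + \<sigma> *\<^sub>R D k) \<le> (c / t) * (2 * c * b\<^sup>2) * ip k k"
    if k: "k \<in> K" and \<sigma>: "\<sigma>\<^sup>2 = 1" for k \<sigma>
  proof -
    have kM: "k \<in> M" using k KD(1) by simp
    define A where "A k = b *\<^sub>R k + \<sigma> *\<^sub>R D k" for k
    have AK: "A k \<in> K" if "k \<in> K" for k using that DK KD by (simp add: A_def)
    have AM: "A k \<in> M" if "k \<in> M" for k using that DM by (simp add: A_def)
    have Asym: "ip (A k) k' = ip k (A k')" if "k \<in> M" "k' \<in> M" for k k'
      using that DM Dsym by (simp add: A_def)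
    have Aright: "A (k * m) = A k * m" if "k \<in> M" "m \<in> N" for k m
      using that Dright by (simp add: A_def distrib_right)
    \<comment> \<open>With \<open>h\<close> in place of \<open>k\<close>, the form of
      \<open>E (z * star z)\<close> turns into a squared norm of \<open>h * z\<close>, to which
      \<open>frame_sum\<close> applies.\<close>
    obtain h where h: "h \<in> N" "star h = h" "\<And>m. m \<in> N \<Longrightarrow> n2 (m * k) = n2 (m * h)"
      using left_norm_transfer[OF kM] by metis
    have hh: "ip h h = ip k k" using h(3)[of 1] n2_sq[OF kM] n2_sq[of h] h(1) by simp
    define B where "B = b *\<^sub>R 1 - \<sigma> *\<^sub>R n"
    have B: "B \<in> N" using nN by (simp add: B_def)
    define V where "V w = h * B * (w * f) + \<sigma> *\<^sub>R (h * y) * star (E (star (w * f) * y))" for w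
    have VA: "V w = h * A (w * f)" if "w \<in> Uni" for w
    proof -
      have "star (E (star g * y)) = E (star y * g)" if "g \<in> M" for g
        using E_star[of "star g * y"] that yM by simp
      from this[of "w * f"] show ?thesis
        using that fM by (simp add: V_def A_def D_def B_def algebra_simps)
    qed
    have lim: "(\<lambda>i. wsum (G i) (\<lambda>w. ip (V w) (V w))) \<longlonglongrightarrow>
        c * ip (h * B) (h * B) + 2 * (s * ip (\<sigma> *\<^sub>R (h * y)) (h * B * y)) +
        s * ip (E (star y * y)) (star (\<sigma> *\<^sub>R (h * y)) * (\<sigma> *\<^sub>R (h * y)))"
      unfolding V_def using h(1) B yM by (intro frame_sum[OF fM G(1) yM G(2)[OF yK] G(3)]) simp_all
    have val: "c * ip (h * B) (h * B) + 2 * (s * ip (\<sigma> *\<^sub>R (h * y)) (h * B * y)) +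
        s * ip (E (star y * y)) (star (\<sigma> *\<^sub>R (h * y)) * (\<sigma> *\<^sub>R (h * y))) =
        c * (b\<^sup>2 * ip h h) - c * ip (n * h) (n * h) + s * \<Psi> h"
    proof -
      have "ip (E (star y * y)) (star (h * y) * (h * y)) = ip (E (star y * y)) (E (star (h * y) * (h * y)))"
        using yM h(1) ip_E'[of "star (h * y) * (h * y)" "E (star y * y)"] by simp
      also have "\<dots> = ip (E (star (h * y) * (h * y))) (E (star y * y))"
        using yM h(1) by (intro ip_commute) simp_all
      also have "\<dots> = \<Psi> h"
        unfolding \<Psi>_def using yM h(1) ip_E'[of "star y * y" "E (star (h * y) * (h * y))"] by simp
      finally have psi: "ip (E (star y * y)) (star (\<sigma> *\<^sub>R (h * y)) * (\<sigma> *\<^sub>R (h * y))) = \<Psi> h"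
        using yM h(1) \<sigma> by (simp add: power2_eq_square flip: mult.assoc)
      have "ip (h * y) (h * B * y) = ip (h * (y * star y)) (h * B)"
        using ip_mult_right[of "h * y" "star y" "h * B"] yM h(1) B by (simp add: mult.assoc)
      also have "\<dots> = ip (E (h * (y * star y))) (h * B)"
        using yM h(1) B by (intro ip_E[symmetric]) simp_all
      finally have cross: "s * ip (\<sigma> *\<^sub>R (h * y)) (h * B * y) = c * (\<sigma> * ip (h * n) (h * B))"
        using yM h(1) B c0 by (simp add: n_def)
      have nh: "ip (n * h) (n * h) = ip (h * n) (h * n)"
        using ip_star[of "h * n" "h * n"] nN h by simp
      have hB: "h * B = b *\<^sub>R h - \<sigma> *\<^sub>R (h * n)" by (simp add: B_def right_diff_distrib)
      have E1: "ip (h * B) (h * B) + 2 * (\<sigma> * ip (h * n) (h * B)) =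
          b\<^sup>2 * ip h h - \<sigma>\<^sup>2 * ip (h * n) (h * n)"
        unfolding hB using h(1) nN ip_commute[of h "h * n"]
        by (simp add: algebra_simps power2_eq_square)
      have "c * ip (h * B) (h * B) + 2 * (c * (\<sigma> * ip (h * n) (h * B))) =
          c * (ip (h * B) (h * B) + 2 * (\<sigma> * ip (h * n) (h * B)))" by (simp only: algebra_simps)
      also have "\<dots> = c * (b\<^sup>2 * ip h h - ip (h * n) (h * n))" unfolding E1 \<sigma> by simp
      finally have "c * ip (h * B) (h * B) + 2 * (c * (\<sigma> * ip (h * n) (h * B))) =
          c * (b\<^sup>2 * ip h h - ip (h * n) (h * n))" .
      then show ?thesis unfolding cross psi nh by (simp add: algebra_simps)
    qed
    have step: "ip (kmap f (G i) (A k)) (A k) \<le> (c / t) * wsum (G i) (\<lambda>w. ip (V w) (V w))" for i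
    proof -
      have "ip (kmap f (G i) (A k)) (A k) =
          wsum (G i) (\<lambda>w. ip (E (star (w * f) * A k)) (E (star (w * f) * A k)))"
        using kM AM by (intro kmap_ip[OF G(1) fM]) simp_all
      also have "\<dots> \<le> wsum (G i) (\<lambda>w. (c / t) * ip (V w) (V w))"
      proof (rule convex_family_mono[OF G(1)])
        fix w assume w: "w \<in> Uni"
        define g where "g = w * f"
        have gK: "g \<in> K" using w fK KD(3) by (simp add: g_def)
        then have gM: "g \<in> M" by (rule KD(1))
        let ?z = "A g"
        have zK: "?z \<in> K" and zM: "?z \<in> M" using AK gK AM gM by auto
        have "E (star g * A k) = E (star ?z * k)"
        proof (rule E_unique)
          fix m assume m: "m \<in> N"
          have "ip (E (star ?z * k)) m = ip (star ?z * k) m" using zM kM m by (intro ip_E) simp_all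
          also have "\<dots> = ip k (?z * m)" using ip_mult_left[of "star ?z" k m] zM kM m by simp
          also have "?z * m = A (g * m)" using Aright gM m by simp
          also have "ip k (A (g * m)) = ip (A k) (g * m)" using Asym kM gM m by simp
          also have "\<dots> = ip (star g * A k) m" using ip_mult_left[of "star g" "A k" m] gM kM m AM by simp
          finally show "ip (E (star ?z * k)) m = ip (star g * A k) m" .
        qed (use gM kM zM AM in simp_all)
        then have "ip (E (star g * A k)) (E (star g * A k)) = (n2 (E (star ?z * k)))\<^sup>2"
          using zM kM by (simp add: n2_sq)
        also have "\<dots> \<le> (n2 (star ?z * k))\<^sup>2" using zM kM by (intro power_mono n2_E_le) simp_all
        also have "\<dots> = ip (star ?z * k) (star ?z * k)" using zM kM by (simp add: n2_sq)
        also have "\<dots> \<le> (c / t) * ip (E (?z * star ?z) * k) k"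
          using frame_pimsner_popa[OF fl st(2) fM zK zM kM] st(2)
          by (simp add: c_def[symmetric] field_simps)
        also have "ip (E (?z * star ?z) * k) k = ip (h * ?z) (h * ?z)"
        proof -
          obtain q where q: "q \<in> N" "star q = q" "q * q = E (?z * star ?z)"
            using pos_sqrt[OF pos_E[of "star ?z"]] zM by (metis star_M star_star)
          have qq: "ip (q * q * x) x = ip (q * x) (q * x)" if "x \<in> M" for x
            using ip_mult_left[of q "q * x" x] q(1,2) that by (simp add: mult.assoc)
          have "ip (E (?z * star ?z) * k) k = ip (q * k) (q * k)" using qq[OF kM] q(3) by simp
          also have "\<dots> = ip (q * h) (q * h)"
            using h(3)[OF q(1)] n2_sq[of "q * k"] n2_sq[of "q * h"] q(1) kM h(1) by simp
          also have "\<dots> = ip (E (?z * star ?z) * h) h" using qq[of h] h(1) q(3) by simp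
          also have "\<dots> = ip (E (?z * star ?z)) (h * h)"
            using ip_mult_right[of "E (?z * star ?z)" h h] h(1,2) zM by simp
          also have "\<dots> = ip (?z * star ?z) (h * h)" using zM h(1) by (intro ip_E) simp_all
          also have "\<dots> = ip ?z (h * h * ?z)" using ip_mult_right[of ?z "star ?z" "h * h"] zM h(1) by simp
          also have "\<dots> = ip (h * ?z) (h * ?z)"
            using ip_mult_left[of h ?z "h * ?z"] h(1,2) zM by (simp add: mult.assoc)
          finally show ?thesis .
        qed
        also have "h * ?z = V w" using VA[OF w] by (simp add: g_def)
        finally show "ip (E (star (w * f) * A k)) (E (star (w * f) * A k)) \<le> (c / t) * ip (V w) (V w)"
          unfolding g_def .
      qed
      finally show ?thesis unfolding wsum_mult .
    qed
    have "ip (s *\<^sub>R A k) (A k) \<le> (c / t) * (c * (b\<^sup>2 * ip h h) - c * ip (n * h) (n * h) + s * \<Psi> h)"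
    proof (rule LIMSEQ_le)
      show "(\<lambda>i. ip (kmap f (G i) (A k)) (A k)) \<longlonglongrightarrow> ip (s *\<^sub>R A k) (A k)"
        using G(2) AK k AM kM by (intro conv2_ip) auto
      show "(\<lambda>i. (c / t) * wsum (G i) (\<lambda>w. ip (V w) (V w))) \<longlonglongrightarrow>
          (c / t) * (c * (b\<^sup>2 * ip h h) - c * ip (n * h) (n * h) + s * \<Psi> h)"
        using lim unfolding val by (rule tendsto_mult_left)
    qed (use step in blast)
    also have "\<dots> \<le> (c / t) * (2 * c * b\<^sup>2 * ip h h)"
      using lower[OF h(1,2)] c0 st by (intro mult_left_mono) (simp_all add: algebra_simps)
    finally show ?thesis using hh AM kM by (simp add: A_def mult.assoc)
  qed
  have "b = 0"
  proof (rule ccontr)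
    assume "b \<noteq> 0"
    with b0 have bp: "0 < b" by simp
    \<comment> \<open>Choose \<open>k\<close> where the form of \<open>D\<close> nearly reaches
      \<open>b\<close> in absolute value and give \<open>D\<close> the sign that makes the two terms
      of \<open>A\<close> add up: \<open>A\<close> then has norm close to
      \<open>2 * b\<close>.\<close>
    have small: "s * t * (2 * b - e)\<^sup>2 \<le> 2 * c\<^sup>2 * b\<^sup>2" if e: "0 < e" "e < b" for e
    proof -
      have "b - e < Sup S" using e by (simp add: b_def[symmetric])
      then obtain v where "v \<in> S" "b - e < v" using less_cSupD[OF neS] by blast
      then obtain k where k: "k \<in> K" "ip k k = 1" "b - e < \<bar>ip (D k) k\<bar>" by (auto simp: S_def)
      define \<sigma> :: real where "\<sigma> = (if ip (D k) k \<ge> 0 then 1 else -1)"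
      have \<sigma>: "\<sigma>\<^sup>2 = 1" "\<sigma> * ip (D k) k = \<bar>ip (D k) k\<bar>" by (auto simp: \<sigma>_def)
      have kM: "k \<in> M" using k KD(1) by simp
      let ?A = "b *\<^sub>R k + \<sigma> *\<^sub>R D k"
      have AM: "?A \<in> M" using kM DM by simp
      have "ip ?A k = b + \<bar>ip (D k) k\<bar>" using kM DM k \<sigma>(2) by simp
      then have "(2 * b - e)\<^sup>2 \<le> (ip ?A k)\<^sup>2" using k e by (intro power_mono) auto
      also have "\<dots> \<le> ip ?A ?A" using cauchy_schwarz_sq[OF AM kM] k by simp
      finally have "s * (2 * b - e)\<^sup>2 \<le> s * ip ?A ?A" using st by simp
      also have "\<dots> \<le> (c / t) * (2 * c * b\<^sup>2)" using upper[OF k(1) \<sigma>(1)] k by simp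
      finally show ?thesis using st by (simp add: field_simps power2_eq_square)
    qed
    \<comment> \<open>The double successor keeps the defect strictly below \<open>b\<close>, already
      for \<open>i = 0\<close>.\<close>
    have "s * t * (2 * b - b * (1 / real (Suc (Suc i))))\<^sup>2 \<le> 2 * c\<^sup>2 * b\<^sup>2" for i
      by (rule small) (use bp in \<open>simp_all add: field_simps add_pos_nonneg\<close>)
    then have ev: "\<exists>m. \<forall>i\<ge>m. s * t * (2 * b - b * (1 / real (Suc (Suc i))))\<^sup>2 \<le> 2 * c\<^sup>2 * b\<^sup>2"
      by blast
    have "(\<lambda>i. s * t * (2 * b - b * (1 / real (Suc (Suc i))))\<^sup>2) \<longlonglongrightarrow> s * t * (2 * b - b * 0)\<^sup>2"
      by (intro tendsto_intros LIMSEQ_Suc[OF LIMSEQ_Suc[OF lim_1_over_n]])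
    then have "s * t * (2 * b - b * 0)\<^sup>2 \<le> 2 * c\<^sup>2 * b\<^sup>2"
      using ev by (rule LIMSEQ_le_const2)
    then have "(2 * (s * t)) * b\<^sup>2 \<le> c\<^sup>2 * b\<^sup>2" by (simp add: power2_eq_square mult_ac)
    then have "2 * (s * t) \<le> c\<^sup>2" using bp by (simp add: mult_le_cancel_right)
    then show False using st by (simp add: c_def)
  qed
  then have D0: "D k = 0" if "k \<in> K" for k
    using norm_D[OF that] ip_self_zero[of "D k"] ip_nonneg[of "D k"] DM KD(1) that by fastforce
  \<comment> \<open>\<open>D = 0\<close> reads \<open>y * E (star y * g) = n * g\<close> at each
    frame vector \<open>g\<close>. Multiplying by \<open>star g\<close> and summing gives
    \<open>y * star (s y)\<close> on one side and \<open>c n\<close> on the other.\<close>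
  have "conv2 (\<lambda>i. n * avg (G i) (f * star f)) (n * (c *\<^sub>R 1))"
    using G(3) nN by (intro conv2_mult_left) simp_all
  moreover have "conv2 (\<lambda>i. y * star (kmap f (G i) y)) (y * star (s *\<^sub>R y))"
    using G(2)[OF yK] yM by (intro conv2_mult_left conv2_star)
  moreover have "y * star (kmap f (G i) y) = n * avg (G i) (f * star f)" for i
  proof -
    have "y * star (kmap f (G i) y) = wsum (G i) (\<lambda>w. y * star (E (star (w * f) * y)) * star (w * f))"
      unfolding kmap_def star_wsum wsum_mult_algebra_left[symmetric] by (simp add: mult.assoc)
    also have "\<dots> = wsum (G i) (\<lambda>w. n * (w * (f * star f) * star w))"
    proof (rule convex_family_cong[OF G(1)])
      fix w assume w: "w \<in> Uni"
      define g where "g = w * f"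
      have g: "g \<in> K" "g \<in> M" using w fK KD by (auto simp: g_def)
      have "star (E (star g * y)) = E (star y * g)" using E_star[of "star g * y"] g yM by simp
      then have "y * star (E (star g * y)) * star g = n * g * star g"
        using D0[OF g(1)] by (simp add: D_def)
      then show "y * star (E (star (w * f) * y)) * star (w * f) = n * (w * (f * star f) * star w)"
        by (simp add: g_def mult.assoc)
    qed
    also have "\<dots> = n * avg (G i) (f * star f)" by (simp add: avg_def wsum_mult_algebra_left)
    finally show ?thesis .
  qed
  ultimately have "n * (c *\<^sub>R 1) = y * star (s *\<^sub>R y)" using conv2_unique by fastforce
  then have "s *\<^sub>R (y * star y) = c *\<^sub>R n" by simp
  then have "y * star y = (1 / s) *\<^sub>R (c *\<^sub>R n)"
    using st by (metis divide_self_if less_irrefl scaleR_one scaleR_scaleR times_divide_eq_left mult_1)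
  then show ?thesis using nN by simp
qed

end

context irreducible_inclusion
begin

subsection \<open>Unitaries in a bimodule\<close>

lemma conv2_M: "conv2 X x \<Longrightarrow> X n \<in> M" "conv2 X x \<Longrightarrow> x \<in> M"
  by (auto simp: conv2_def)

lemma conv2_mult:
  assumes X: "conv2 X x" and Y: "conv2 Y y" and bd: "\<And>n. norm (X n) \<le> C"
  shows "conv2 (\<lambda>n. X n * Y n) (x * y)"
proof -
  note M = conv2_M[OF X] conv2_M[OF Y]
  have "conv2 (\<lambda>n. X n * (Y n - y)) 0"
  proof (rule conv2I)
    show "n2 (X n * (Y n - y) - 0) \<le> C * n2 (Y n - y)" for n
    proof -
      have "n2 (X n * (Y n - y)) \<le> norm (X n) * n2 (Y n - y)" using M by (intro n2_mult_le) auto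
      also have "\<dots> \<le> C * n2 (Y n - y)" using bd M by (intro mult_right_mono) auto
      finally show ?thesis by simp
    qed
    show "(\<lambda>n. C * n2 (Y n - y)) \<longlonglongrightarrow> 0"
      using Y unfolding conv2_def by (intro tendsto_mult_right_zero) blast
  qed (use M in auto)
  from conv2_add[OF this conv2_mult_right[OF X M(4)]] show ?thesis
    by (simp add: algebra_simps)
qed

lemma pos_commuting_product:
  assumes a: "pos a" and r: "pos r" and comm: "a * r = r * a"
  shows "pos (a * r)"
proof -
  obtain h where h: "h \<in> N" "star h = h" "h * h = r" "\<And>c. c * r = r * c \<Longrightarrow> c * h = h * c"
    using pos_sqrt[OF r] by metis
  have aN: "a \<in> N" "star a = a" and rN: "r \<in> N" "star r = r" using a r by (auto simp: pos_def)
  have e: "a * r = h * (a * h)" using h(4)[OF comm] h(3) by (metis mult.assoc)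
  have "0 \<le> ip (h * (a * h) * z) z" if "z \<in> M" for z
    using ip_mult_left[of h "a * (h * z)" z] pos_ip[OF a, of "h * z"] h(1,2) aN that
    by (simp add: mult.assoc)
  moreover have "star (h * (a * h)) = h * (a * h)" using h(2) aN by (simp add: mult.assoc)
  ultimately show ?thesis
    unfolding e pos_def using aN h(1) by simp
qed

lemma pos_inverse:
  assumes a: "pos a" and e: "0 < e"
  obtains r where "pos r" "r * (a + e *\<^sub>R 1) = 1" "(a + e *\<^sub>R 1) * r = 1" "a * r = r * a"
proof -
  have aN: "a \<in> N" "star a = a" using a by (auto simp: pos_def)
  obtain r where r: "r \<in> N" "r * (a + e *\<^sub>R 1) = 1" "(a + e *\<^sub>R 1) * r = 1"
    using inverse_N[OF aN _ e] a by (auto simp: pos_def ip_def)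
  have rs: "star r = r"
  proof -
    have "star r * (a + e *\<^sub>R 1) = 1"
      using arg_cong[OF r(3), of star] aN by simp
    then have "star r * ((a + e *\<^sub>R 1) * r) = r" by (simp flip: mult.assoc)
    then show ?thesis using r(3) by simp
  qed
  have "0 \<le> ip (r * z) z" if z: "z \<in> N" for z
  proof -
    have "z = (a + e *\<^sub>R 1) * (r * z)" using r(3) by (simp flip: mult.assoc)
    then have "ip (r * z) z = ip (r * z) (a * (r * z)) + e * ip (r * z) (r * z)"
      using r(1) z aN by (metis (no_types, lifting) N_M distrib_right ip_add_right ip_scaleR_right
          mult_M mult_1 mult_scaleR_left scaleR_M)
    also have "ip (r * z) (a * (r * z)) = ip (a * (r * z)) (r * z)"
      using r(1) z aN by (intro ip_commute) simp_all
    finally show ?thesis using pos_ip[OF a, of "r * z"] r(1) z e by simp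
  qed
  then have "pos r" using r rs by (simp add: pos_def)
  moreover have "a * r = r * a"
  proof -
    have "r * a + e *\<^sub>R r = a * r + e *\<^sub>R r"
      using r(2,3) by (simp add: distrib_left distrib_right)
    then show ?thesis by simp
  qed
  ultimately show thesis using that r by blast
qed

text \<open>Closedness is for sequences that converge in trace norm to an element of
  \<open>M\<close>. The product conditions keep the moduli of elements of \<open>K\<close> inside
  \<open>N\<close>, so polar decomposition can be carried out with square roots and resolvents of
  \<open>N\<close>.\<close>

definition closed_bimodule :: "'a set \<Rightarrow> bool"
  where "closed_bimodule K \<longleftrightarrow> bimodule K \<and> (\<forall>y\<in>K. \<forall>z\<in>K. y * star z \<in> N \<and> star y * z \<in> N) \<and>
    (\<forall>X x. (\<forall>n. X n \<in> K) \<longrightarrow> conv2 X x \<longrightarrow> x \<in> K)"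

text \<open>The partial isometry is the limit of \<open>y\<close> times the inverse of
  \<open>a\<close> plus \<epsilon>, with \<open>a\<close> the modulus of \<open>y\<close>. The last
  two conclusions say that it inherits the left and right supports of \<open>y\<close>.\<close>

lemma polar_part:
  assumes K: "closed_bimodule K" and y: "y \<in> K" "y \<noteq> 0"
  obtains v where "v \<in> K" "v \<noteq> 0" "v * star v * v = v"
    "\<And>q. q \<in> N \<Longrightarrow> q * y = y \<Longrightarrow> q * v = v"
    "\<And>p. p \<in> N \<Longrightarrow> star p = p \<Longrightarrow> y * p = y \<Longrightarrow> v * p = v"
proof -
  have B: "bimodule K" using K by (simp add: closed_bimodule_def)
  note KD = bimoduleD[OF B]
  have yM: "y \<in> M" using KD(1) y by simp
  have hN: "star y * y \<in> N" using K y by (simp add: closed_bimodule_def)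
  have hpos: "pos (star y * y)" using pos_E[OF yM] hN by simp
  obtain a where apos: "pos a" and aN: "a \<in> N" "star a = a" and asq: "a * a = star y * y"
    and acomm: "\<And>c. c * (star y * y) = star y * y * c \<Longrightarrow> c * a = a * c"
    using hpos by (erule pos_sqrt)
  note a = apos asq acomm
  define \<epsilon> where "\<epsilon> n = 1 / real (Suc n)" for n
  have \<epsilon>: "0 < \<epsilon> n" for n by (simp add: \<epsilon>_def)
  have "\<exists>r. pos r \<and> r * (a + \<epsilon> n *\<^sub>R 1) = 1 \<and> (a + \<epsilon> n *\<^sub>R 1) * r = 1 \<and> a * r = r * a" for n
    using pos_inverse[OF a(1) \<epsilon>[of n]] by metis
  then obtain r where r: "\<And>n. pos (r n)" "\<And>n. r n * (a + \<epsilon> n *\<^sub>R 1) = 1"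
    "\<And>n. (a + \<epsilon> n *\<^sub>R 1) * r n = 1" "\<And>n. a * r n = r n * a" by metis
  have rN: "r n \<in> N" "star (r n) = r n" for n using r(1)[of n] by (auto simp: pos_def)
  have comm: "c * r n = r n * c" if "c * a = a * c" for c n
  proof -
    have "r n * (c * (a + \<epsilon> n *\<^sub>R 1)) * r n = r n * ((a + \<epsilon> n *\<^sub>R 1) * c) * r n"
      using that by (simp add: distrib_left distrib_right)
    then have "r n * c * ((a + \<epsilon> n *\<^sub>R 1) * r n) = (r n * (a + \<epsilon> n *\<^sub>R 1)) * c * r n"
      by (simp only: mult.assoc)
    then show ?thesis using r(2,3)[of n] by simp
  qed
  define p where "p n = a * r n" for n
  have pN: "p n \<in> N" for n using aN rN by (simp add: p_def)
  have p_eq: "p n = 1 - \<epsilon> n *\<^sub>R r n" for n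
    using r(3)[of n] by (simp add: p_def distrib_right algebra_simps)
  have p_star: "star (p n) = p n" for n using rN by (simp add: p_eq)
  define v where "v n = y * r n" for n
  have vK: "v n \<in> K" for n using KD(4) rN y by (simp add: v_def)
  have vM: "v n \<in> M" for n using vK KD(1) by simp
  have vv: "star (v n) * v m = p n * p m" for n m
  proof -
    have "star (v n) * v m = r n * (a * a) * r m" by (simp add: v_def rN a(2) mult.assoc)
    also have "\<dots> = (r n * a) * (a * r m)" by (simp only: mult.assoc)
    finally show ?thesis by (simp add: p_def r(4)[of n])
  qed
  have ple: "ip (p n * z) z \<le> ip z z" if "z \<in> M" for n z
    using pos_ip[OF r(1) that, of n] \<epsilon>[of n] rN that by (simp add: p_eq left_diff_distrib)
  have ppos: "pos (p n)" for n unfolding p_def using a(1) r(1) r(4) by (rule pos_commuting_product)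
  have pp_le: "ip (p n * p n * z) z \<le> ip z z" if z: "z \<in> M" for n z
  proof -
    obtain h where h: "h \<in> N" "star h = h" "h * h = p n" using pos_sqrt[OF ppos[of n]] by metis
    have s: "ip (h * x) (h * x) = ip (p n * x) x" if "x \<in> M" for x
      using ip_mult_left[of h "h * x" x] h(1,2) that by (simp add: mult.assoc flip: h(3))
    have "ip (p n * p n * z) z = ip (p n * (h * z)) (h * z)"
      using ip_mult_left[of h "p n * (h * z)" z] h(1,2) pN z by (simp add: mult.assoc flip: h(3))
    also have "\<dots> \<le> ip (h * z) (h * z)" using ple h(1) z by simp
    also have "\<dots> \<le> ip z z" using s[OF z] ple[OF z] by simp
    finally show ?thesis .
  qed
  have v_norm: "norm (v n) \<le> 1" for n
  proof (rule norm_le_n2[OF vM])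
    fix z assume z: "z \<in> M"
    have "ip (v n * z) (v n * z) = ip (p n * p n * z) z"
      using ip_mult_left[of "star (v n)" "v n * z" z] vM z
      by (simp add: vv[symmetric] mult.assoc)
    then show "n2 (v n * z) \<le> 1 * n2 z" using pp_le[OF z] by (simp add: n2_def)
  qed simp
  \<comment> \<open>The resolvent identity: the elements \<open>p n\<close> increase towards the
    support projection of \<open>a\<close>.\<close>
  have diff: "p m - p n = (\<epsilon> n - \<epsilon> m) *\<^sub>R (a * r n * r m)" for n m
  proof -
    have "r n = r n * ((a + \<epsilon> m *\<^sub>R 1) * r m)" using r(3) by simp
    also have "\<dots> = a * r n * r m + \<epsilon> m *\<^sub>R (r n * r m)"
      by (simp add: algebra_simps r(4))
    finally have 1: "r n = a * r n * r m + \<epsilon> m *\<^sub>R (r n * r m)" .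
    have "r m = (r n * (a + \<epsilon> n *\<^sub>R 1)) * r m" using r(2) by simp
    also have "\<dots> = a * r n * r m + \<epsilon> n *\<^sub>R (r n * r m)" by (simp add: algebra_simps r(4))
    finally have 2: "r m = a * r n * r m + \<epsilon> n *\<^sub>R (r n * r m)" .
    have "p m - p n = \<epsilon> n *\<^sub>R r n - \<epsilon> m *\<^sub>R r m" by (simp add: p_eq)
    also have "\<dots> = \<epsilon> n *\<^sub>R (a * r n * r m + \<epsilon> m *\<^sub>R (r n * r m)) -
        \<epsilon> m *\<^sub>R (a * r n * r m + \<epsilon> n *\<^sub>R (r n * r m))" using 1 2 by simp
    finally show ?thesis by (simp add: algebra_simps)
  qed
  \<comment> \<open>The difference \<open>d\<close> lies between 0 and 1, so the trace of
    \<open>d * d\<close> is at most that of \<open>d\<close>; the monotone bounded traces of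
    \<open>p n\<close> therefore make \<open>v\<close> Cauchy.\<close>
  have dist: "ip (v m - v n) (v m - v n) \<le> tr (p m - p n)" if nm: "n \<le> m" for n m
  proof -
    define d where "d = p m - p n"
    have dN: "d \<in> N" "star d = d" using pN p_star by (simp_all add: d_def)
    have "pos (a * r n * r m)"
    proof (intro pos_commuting_product r(1) a(1) r(4))
      have "r m * r n = r n * r m" using comm[of "r m" n] r(4)[of m] by simp
      then show "a * r n * r m = r m * (a * r n)" using r(4)[of m] by (metis mult.assoc)
    qed
    moreover have "\<epsilon> m \<le> \<epsilon> n" using nm by (simp add: \<epsilon>_def frac_le)
    ultimately have dpos: "pos d"
      using diff[of m n] dN by (simp add: pos_def d_def[symmetric])
    obtain h where h: "h \<in> N" "star h = h" "h * h = d" using pos_sqrt[OF dpos] by metis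
    have "ip (d * h) h \<le> ip h h"
    proof -
      have "ip (d * h) h = ip (p m * h) h - ip (p n * h) h"
        using h(1) pN by (simp add: d_def left_diff_distrib)
      then show ?thesis using ple[of h m] pos_ip[OF ppos[of n], of h] h(1) by simp
    qed
    moreover have "ip (d * h) h = tr (d * d)"
    proof -
      have "ip (d * h) h = tr (h * d * h)" using h(2) by (simp add: ip_def mult.assoc)
      also have "\<dots> = tr (h * (h * d))" using h(1) dN by (intro tr_commute) simp_all
      also have "h * (h * d) = d * d" unfolding mult.assoc[symmetric] h(3) ..
      finally show ?thesis .
    qed
    moreover have "ip h h = tr d" using h by (simp add: ip_def)
    ultimately have "tr (d * d) \<le> tr d" by simp
    moreover have "ip (v m - v n) (v m - v n) = tr (d * d)"
    proof -
      have "star (v m - v n) * (v m - v n) = d * d"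
        by (simp add: algebra_simps vv d_def)
      then show ?thesis by (simp add: ip_def)
    qed
    ultimately show ?thesis by (simp add: d_def)
  qed
  have "incseq (\<lambda>n. tr (p n))"
  proof (rule incseq_SucI)
    fix n
    have "0 \<le> ip (v (Suc n) - v n) (v (Suc n) - v n)" by (intro ip_nonneg diff_M vM)
    then have "0 \<le> tr (p (Suc n) - p n)" using dist[of n "Suc n"] by simp
    then show "tr (p n) \<le> tr (p (Suc n))" using pN by simp
  qed
  moreover have "tr (p n) \<le> 1" for n
    using ple[of 1 n] pN by (simp add: ip_def)
  ultimately obtain L where L: "(\<lambda>n. tr (p n)) \<longlonglongrightarrow> L" "\<And>n. tr (p n) \<le> L"
    using incseq_convergent[of "\<lambda>n. tr (p n)" 1] by blast
  have vcau: "\<exists>k. \<forall>m\<ge>k. \<forall>n\<ge>k. n2 (v m - v n) \<le> e" if e: "e > 0" for e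
  proof -
    obtain k where k: "\<And>n. n \<ge> k \<Longrightarrow> \<bar>tr (p n) - L\<bar> < e\<^sup>2"
      using LIMSEQ_D[OF L(1), of "e\<^sup>2"] e by auto
    have *: "n2 (v m - v n) \<le> e" if "n \<ge> k" "n \<le> m" for m n
    proof -
      have "ip (v m - v n) (v m - v n) \<le> tr (p m) - tr (p n)" using dist[OF that(2)] pN by simp
      also have "\<dots> \<le> e\<^sup>2" using k[OF that(1)] L(2)[of m] by linarith
      finally show ?thesis using e unfolding n2_def by (simp add: real_le_lsqrt)
    qed
    have "n2 (v m - v n) \<le> e" if "m \<ge> k" "n \<ge> k" for m n
      using *[of n m] *[of m n] that n2_minus_commute[of "v m" "v n"] vM by (cases "n \<le> m") auto
    then show ?thesis by blast
  qed
  obtain w where w: "conv2 v w" "norm w \<le> 1"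
    using conv2_complete[OF vM v_norm vcau] by blast
  have wK: "w \<in> K" using K w vK unfolding closed_bimodule_def by blast
  have wM: "w \<in> M" using wK KD(1) by simp
  have ww: "conv2 (\<lambda>n. p n * p n) (star w * w)"
    using conv2_mult[OF conv2_star[OF w(1)] w(1), of 1] v_norm vM by (simp add: vv)
  \<comment> \<open>This yields \<open>y * (star w * w) = y\<close>, which shows that the limit
    \<open>w\<close> is nonzero and that \<open>star w * w\<close> is its initial
    projection.\<close>
  have ypp: "conv2 (\<lambda>n. y * (p n * p n)) y"
  proof (rule conv2I)
    have yp: "n2 (y * p n - y) \<le> \<epsilon> n" for n
    proof -
      have "y * p n - y = - (\<epsilon> n *\<^sub>R v n)" by (simp add: p_eq v_def right_diff_distrib)
      then have "n2 (y * p n - y) = \<epsilon> n * n2 (v n)" using vM \<epsilon>[of n] by simp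
      also have "\<dots> \<le> \<epsilon> n * 1"
        using n2_le_norm[OF vM, of n] v_norm[of n] \<epsilon>[of n] by (intro mult_left_mono) auto
      finally show ?thesis by simp
    qed
    have pn1: "norm (p n) \<le> 1" for n
    proof (rule norm_le_n2)
      fix z assume z: "z \<in> M"
      have "ip (p n * z) (p n * z) = ip (p n * p n * z) z"
        using ip_mult_left[of "p n" "p n * z" z] pN p_star z by (simp add: mult.assoc)
      then show "n2 (p n * z) \<le> 1 * n2 z" using pp_le[OF z] by (simp add: n2_def)
    qed (use pN in simp_all)
    show "n2 (y * (p n * p n) - y) \<le> 2 * \<epsilon> n" for n
    proof -
      have "y * (p n * p n) - y = (y * p n - y) * p n + (y * p n - y)"
        by (simp add: algebra_simps)
      also have "n2 \<dots> \<le> n2 ((y * p n - y) * p n) + n2 (y * p n - y)"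
        using yM pN by (intro n2_triangle) simp_all
      also have "n2 ((y * p n - y) * p n) \<le> n2 (y * p n - y) * norm (p n)"
        using yM pN by (intro n2_mult_le') simp_all
      also have "\<dots> \<le> n2 (y * p n - y) * 1"
        using yM pN pn1 by (intro mult_left_mono n2_nonneg) simp_all
      finally show ?thesis using yp[of n] by simp
    qed
    have "(\<lambda>n. 2 * (1 / real (Suc n))) \<longlonglongrightarrow> 2 * 0"
      by (intro tendsto_intros LIMSEQ_Suc[OF lim_1_over_n])
    then show "(\<lambda>n. 2 * \<epsilon> n) \<longlonglongrightarrow> 0" by (simp add: \<epsilon>_def)
  qed (use yM pN in simp_all)
  have yww: "y * (star w * w) = y"
    using conv2_unique[OF conv2_mult_left[OF ww yM] ypp] .
  have rww: "r n * (star w * w) = star w * w * r n" for n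
  proof (rule conv2_unique)
    show "conv2 (\<lambda>i. r n * (p i * p i)) (r n * (star w * w))"
      using rN by (intro conv2_mult_left ww) simp
    have "r n * p i = p i * r n" for i
      using comm[of "r n" i] r(4)[of n] by (simp add: p_eq algebra_simps)
    then have "r n * (p i * p i) = p i * p i * r n" for i by (metis mult.assoc)
    then show "conv2 (\<lambda>i. r n * (p i * p i)) (star w * w * r n)"
      using conv2_mult_right[OF ww, of "r n"] rN by simp
  qed
  have "v n * (star w * w) = v n" for n
    using rww[of n] yww by (simp add: v_def mult.assoc) (metis mult.assoc)
  then have "w * (star w * w) = w"
    using conv2_unique[OF conv2_mult_right[OF w(1), of "star w * w"]] w(1) wM by simp
  then have part: "w * star w * w = w" by (simp add: mult.assoc)
  show thesis
  proof (rule that[OF wK _ part])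
    show "w \<noteq> 0" using yww y by auto
    show "q * w = w" if q: "q \<in> N" "q * y = y" for q
    proof (rule conv2_unique)
      have "q * v n = v n" for n using q by (simp add: v_def flip: mult.assoc)
      then show "conv2 v (q * w)" using conv2_mult_left[OF w(1), of q] q by simp
    qed (rule w(1))
    \<comment> \<open>On the right \<open>p'\<close> must pass the resolvents: fixing
      \<open>y\<close> and being self-adjoint, it commutes with \<open>star y * y\<close>, hence
      with each \<open>r n\<close>.\<close>
    show "w * p' = w" if q: "p' \<in> N" "star p' = p'" "y * p' = y" for p'
    proof (rule conv2_unique)
      have "p' * star y = star y" using arg_cong[OF q(3), of star] q(2) by simp
      then have "p' * (star y * y) = star y * y * p'" using q(3) by (simp flip: mult.assoc) (simp add: mult.assoc q(3))
      then have "p' * r n = r n * p'" for n using comm a(3) by blast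
      then have "v n * p' = v n" for n using q(3) by (metis v_def mult.assoc)
      then show "conv2 v (w * p')" using conv2_mult_right[OF w(1), of p'] q by simp
    qed (rule w(1))
  qed
qed

end

context irreducible_inclusion
begin

text \<open>If \<open>q * K * p\<close> vanished, so would every conjugate of \<open>q\<close> by a
  unitary of \<open>N\<close> times \<open>K * p\<close>; averaging replaces \<open>q\<close> by the
  nonzero scalar \<open>tr q\<close>. Doing the same for \<open>p\<close> kills
  \<open>f\<close>.\<close>

lemma corner_nonzero:
  assumes K: "bimodule K" and f: "f \<in> K" "f \<noteq> 0"
    and p: "p \<in> N" "star p = p" "tr p \<noteq> 0" and q: "q \<in> N" "star q = q" "tr q \<noteq> 0"
  shows "\<exists>y\<in>K. q * y * p \<noteq> 0"
proof (rule ccontr)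
  note KD = bimoduleD[OF K]
  assume "\<not> (\<exists>y\<in>K. q * y * p \<noteq> 0)"
  then have z: "q * y * p = 0" if "y \<in> K" for y using that by blast
  have yp: "y * p = 0" if y: "y \<in> K" for y
  proof -
    have yM: "y \<in> M" using KD(1) y .
    obtain F where F: "\<And>n. convex_family Uni (F n)" "conv2 (\<lambda>n. avg (F n) q) (tr q *\<^sub>R 1)"
      using average_to_trace[of q] q by auto
    have "avg (F n) q * (y * p) = wsum (F n) (\<lambda>w. 0)" for n
      unfolding avg_def wsum_mult_algebra_right[symmetric]
    proof (rule convex_family_cong[OF F(1)])
      fix w assume "w \<in> Uni"
      then have "q * (star w * y) * p = 0" using z KD(3) y by simp
      then show "w * q * star w * (y * p) = 0" by (simp add: mult.assoc)
    qed
    then have "conv2 (\<lambda>n. 0) (tr q *\<^sub>R 1 * (y * p))"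
      using conv2_mult_right[OF F(2), of "y * p"] yM p by (simp add: wsum_const)
    then have "tr q *\<^sub>R 1 * (y * p) = 0" using conv2_unique conv2_const[OF zero_M] by blast
    then show ?thesis using q(3) by simp
  qed
  have fM: "f \<in> M" using KD(1) f by simp
  obtain F where F: "\<And>n. convex_family Uni (F n)" "conv2 (\<lambda>n. avg (F n) p) (tr p *\<^sub>R 1)"
    using average_to_trace[of p] p by auto
  have "f * avg (F n) p = wsum (F n) (\<lambda>w. 0)" for n
    unfolding avg_def wsum_mult_algebra_left[symmetric]
  proof (rule convex_family_cong[OF F(1)])
    fix w assume "w \<in> Uni"
    then have "f * w * p = 0" using yp KD(4) f by simp
    then show "f * (w * p * star w) = 0" by (simp flip: mult.assoc)
  qed
  then have "conv2 (\<lambda>n. 0) (f * (tr p *\<^sub>R 1))"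
    using conv2_mult_left[OF F(2), of f] fM by (simp add: wsum_const)
  then have "f * (tr p *\<^sub>R 1) = 0" using conv2_unique conv2_const[OF zero_M] by blast
  then show False using p(3) f(2) by simp
qed

definition partial_isometries :: "'a set \<Rightarrow> 'a set"
  where "partial_isometries K = {v \<in> K. v * star v * v = v}"

lemma partial_isometry_facts:
  assumes "v \<in> partial_isometries K" "K \<subseteq> M"
  shows "v \<in> K" "v \<in> M" "v * (star v * v) = v" "star v * (v * star v) = star v" "norm v \<le> 1" "ip v v \<le> 1"
proof -
  show vK: "v \<in> K" and vM: "v \<in> M" using assms by (auto simp: partial_isometries_def)
  show v: "v * (star v * v) = v" using assms by (simp add: partial_isometries_def mult.assoc)
  show v': "star v * (v * star v) = star v" using arg_cong[OF v, of star] by (simp add: mult.assoc)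
  have le: "ip (v * z) (v * z) \<le> ip z z" if z: "z \<in> M" for z
  proof -
    have "0 \<le> ip (z - star v * (v * z)) (z - star v * (v * z))"
      using z vM by (intro ip_nonneg) simp
    also have "\<dots> = ip z z - 2 * ip (star v * (v * z)) z + ip (star v * (v * z)) (star v * (v * z))"
      using z vM ip_commute[of "star v * (v * z)" z] by simp
    also have "ip (star v * (v * z)) (star v * (v * z)) = ip (v * z) (v * z)"
    proof -
      have "v * (star v * (v * z)) = v * z" using v by (metis mult.assoc)
      then show ?thesis using ip_mult_left[of "star v" "v * z" "star v * (v * z)"] z vM by simp
    qed
    also have "ip (star v * (v * z)) z = ip (v * z) (v * z)"
      using ip_mult_left[of "star v" "v * z" z] z vM by simp
    finally show ?thesis by simp
  qed
  show "norm v \<le> 1"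
    by (rule norm_le_n2[OF vM]) (use le in \<open>simp_all add: n2_def\<close>)
  show "ip v v \<le> 1" using le[of 1] by (simp add: ip_def)
qed

text \<open>Greedy exhaustion: orthogonal partial isometries of \<open>K\<close> are added, each of
  at least half the possible size. Their sizes sum to at most 1, so the limit \<open>x\<close> is
  maximal. If \<open>x\<close> were not unitary, its two defect projections would have equal nonzero
  trace and a corner of \<open>K\<close> would supply a further piece.\<close>

lemma exists_unitary:
  assumes K: "closed_bimodule K" and f: "f \<in> K" "f \<noteq> 0"
  obtains v where "v \<in> K" "unitary v"
proof -
  have B: "bimodule K" using K by (simp add: closed_bimodule_def)
  note KD = bimoduleD[OF B]
  have KM: "K \<subseteq> M" using KD(1) by blast
  define P where "P = partial_isometries K"
  note PF = partial_isometry_facts[OF _ KM, folded P_def]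
  define A where "A v = {u \<in> P. star v * u = 0 \<and> u * star v = 0}" for v
  have zeroP: "0 \<in> P" using KD(5)[OF f(1), of 0] by (simp add: P_def partial_isometries_def)
  \<comment> \<open>The supremum of the sizes need not be attained; half of it always is, which is
    enough for exhaustion.\<close>
  have "\<exists>u\<in>A v. \<forall>u'\<in>A v. ip u' u' \<le> 2 * ip u u" for v
  proof (cases "\<exists>u\<in>A v. ip u u \<noteq> 0")
    case False
    moreover have "0 \<in> A v" using zeroP by (simp add: A_def)
    ultimately show ?thesis by force
  next
    case True
    define S where "S = (\<lambda>u. ip u u) ` A v"
    have "bdd_above S" using PF(6) by (auto simp: S_def A_def intro!: bdd_aboveI[of _ 1])
    then have up: "ip u u \<le> Sup S" if "u \<in> A v" for u
      using that unfolding S_def by (intro cSup_upper) auto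
    obtain u0 where u0: "u0 \<in> A v" "ip u0 u0 \<noteq> 0" using True by blast
    then have "0 < ip u0 u0" using PF(2) ip_nonneg[of u0] by (simp add: A_def order_less_le)
    then have "Sup S / 2 < Sup S" using up[OF u0(1)] by simp
    then obtain u where "u \<in> A v" "Sup S / 2 < ip u u"
      using less_cSupD[of S "Sup S / 2"] u0(1) unfolding S_def by blast
    then show ?thesis using up by force
  qed
  then obtain pick where pick: "\<And>v. pick v \<in> A v" "\<And>v u. u \<in> A v \<Longrightarrow> ip u u \<le> 2 * ip (pick v) (pick v)"
    by metis
  define v where "v = rec_nat 0 (\<lambda>_ x. x + pick x)"
  have v0: "v 0 = 0" and vS: "v (Suc n) = v n + pick (v n)" for n by (simp_all add: v_def)
  have orth: "star x * pick x = 0" "pick x * star x = 0" "star (pick x) * x = 0" "x * star (pick x) = 0"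
    "pick x \<in> P" for x
  proof -
    show 1: "star x * pick x = 0" "pick x * star x = 0" "pick x \<in> P" using pick(1)[of x] by (simp_all add: A_def)
    show "star (pick x) * x = 0" using arg_cong[OF 1(1), of star] by simp
    show "x * star (pick x) = 0" using arg_cong[OF 1(2), of star] by simp
  qed
  have orth': "star x * (pick x * z) = 0" "pick x * (star x * z) = 0" "star (pick x) * (x * z) = 0"
    "x * (star (pick x) * z) = 0" for x z
    using orth[of x] by (simp_all flip: mult.assoc)
  have vP: "v n \<in> P" for n
  proof (induction n)
    case 0
    then show ?case using zeroP v0 by simp
  next
    case (Suc n)
    have "v n + pick (v n) \<in> K" using KD(2) PF(1)[OF Suc] PF(1)[OF orth(5)] by simp
    moreover have "(v n + pick (v n)) * star (v n + pick (v n)) * (v n + pick (v n)) = v n + pick (v n)"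
      using PF(3)[OF Suc] PF(3)[OF orth(5), of "v n"] orth[of "v n"]
      by (simp add: distrib_left distrib_right mult.assoc orth')
    ultimately show ?case by (simp add: vS P_def partial_isometries_def)
  qed
  have vM: "v n \<in> M" and vK: "v n \<in> K" and v1: "norm (v n) \<le> 1" for n
    using PF[OF vP] by auto
  have ext: "v m * (star (v n) * v n) = v n \<and> v n * (star (v n) * v m) = v n" if "n \<le> m" for n m
    using that
  proof (induction m rule: dec_induct)
    case base
    then show ?case using PF(3)[OF vP] by simp
  next
    case (step m)
    have "pick (v m) * (star (v n) * v n) = 0"
    proof -
      have "star (v n) = star (v m) * (v n * star (v n))"
        using arg_cong[OF conjunct2[OF step.IH], of star] by (simp add: mult.assoc)
      then have "pick (v m) * star (v n) = 0" by (metis orth'(2))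
      then show ?thesis by (simp flip: mult.assoc)
    qed
    moreover have "star (v n) * pick (v m) = 0"
    proof -
      have "star (v n) = (star (v n) * v n) * star (v m)"
        using arg_cong[OF conjunct1[OF step.IH], of star] by (simp add: mult.assoc)
      then show ?thesis by (metis mult.assoc mult_zero_right orth(1))
    qed
    ultimately show ?case using step.IH by (simp add: vS distrib_left distrib_right)
  qed
  have ipS: "ip (v (Suc n)) (v (Suc n)) = ip (v n) (v n) + ip (pick (v n)) (pick (v n))" for n
  proof -
    have M: "pick (v n) \<in> M" using PF(2)[OF orth(5)] .
    have "ip (v n) (pick (v n)) = 0" "ip (pick (v n)) (v n) = 0" by (simp_all add: ip_def orth)
    then show ?thesis using M vM by (simp add: vS)
  qed
  have "incseq (\<lambda>n. ip (v n) (v n))"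
    using ipS PF(2)[OF orth(5)] by (intro incseq_SucI) simp
  moreover have "ip (v n) (v n) \<le> 1" for n using PF(6)[OF vP] .
  ultimately obtain L where L: "(\<lambda>n. ip (v n) (v n)) \<longlonglongrightarrow> L" "\<And>n. ip (v n) (v n) \<le> L"
    using incseq_convergent[of "\<lambda>n. ip (v n) (v n)" 1] by blast
  have pick0: "(\<lambda>n. ip (pick (v n)) (pick (v n))) \<longlonglongrightarrow> 0"
    using tendsto_diff[OF LIMSEQ_Suc[OF L(1)] L(1)] by (simp add: ipS)
  have vcau: "\<exists>k. \<forall>m\<ge>k. \<forall>n\<ge>k. n2 (v m - v n) \<le> e" if e: "e > 0" for e
  proof -
    obtain k where k: "\<And>n. n \<ge> k \<Longrightarrow> \<bar>ip (v n) (v n) - L\<bar> < e\<^sup>2"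
      using LIMSEQ_D[OF L(1), of "e\<^sup>2"] e by auto
    have *: "n2 (v m - v n) \<le> e" if "n \<ge> k" "n \<le> m" for m n
    proof -
      have "star (v n) * v m = star (v n) * v n"
      proof -
        have "star (v n) * v m = star (v n) * (v n * (star (v n) * v m))"
          using PF(4)[OF vP, of n] by (metis mult.assoc)
        then show ?thesis using ext[OF that(2)] by simp
      qed
      then have "ip (v m) (v n) = ip (v n) (v n)" by (simp add: ip_def)
      then have "ip (v m - v n) (v m - v n) = ip (v m) (v m) - ip (v n) (v n)"
        using vM ip_commute[of "v n" "v m"] by simp
      also have "\<dots> \<le> e\<^sup>2" using k[OF that(1)] L(2)[of m] by linarith
      finally show ?thesis using e unfolding n2_def by (simp add: real_le_lsqrt)
    qed
    have "n2 (v m - v n) \<le> e" if "m \<ge> k" "n \<ge> k" for m n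
      using *[of n m] *[of m n] that n2_minus_commute[of "v m" "v n"] vM by (cases "n \<le> m") auto
    then show ?thesis by blast
  qed
  obtain x where x: "conv2 v x" "norm x \<le> 1"
    using conv2_complete[OF vM v1 vcau] by blast
  have xK: "x \<in> K" using K vK x(1) unfolding closed_bimodule_def by blast
  then have xM: "x \<in> M" using KD(1) by simp
  have nvv: "norm (v n * star (v n)) \<le> 1" for n
  proof -
    have "norm (v n * star (v n)) \<le> norm (v n) * norm (star (v n))" by (rule norm_mult_ineq)
    also have "\<dots> \<le> 1 * 1" using v1 vM by (intro mult_mono) auto
    finally show ?thesis by simp
  qed
  have xP: "x * star x * x = x"
  proof (rule conv2_unique)
    show "conv2 (\<lambda>n. v n * star (v n) * v n) (x * star x * x)"
      using nvv v1 by (intro conv2_mult[where C = 1] conv2_star x(1)) auto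
    show "conv2 (\<lambda>n. v n * star (v n) * v n) x"
      using x(1) PF(3)[OF vP] by (simp add: mult.assoc)
  qed
  have extx: "x * (star (v n) * v n) = v n" "v n * (star (v n) * x) = v n" for n
  proof -
    have sh: "conv2 (\<lambda>m. v (n + m)) x"
      using x(1) LIMSEQ_ignore_initial_segment[of "\<lambda>m. n2 (v m - x)" 0 n]
      by (simp add: conv2_def add.commute)
    have e: "v (n + m) * (star (v n) * v n) = v n" "v n * (star (v n) * v (n + m)) = v n" for m
      using ext[of n "n + m"] by auto
    show "x * (star (v n) * v n) = v n"
      using conv2_unique[OF conv2_mult_right[OF sh, of "star (v n) * v n"], of "v n"] e(1)
        conv2_const[OF vM] vM by simp
    show "v n * (star (v n) * x) = v n"
      using conv2_unique[OF conv2_mult_left[OF conv2_mult_left[OF sh, of "star (v n)"], of "v n"], of "v n"]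
        e(2) conv2_const[OF vM] vM by simp
  qed
  \<comment> \<open>A partial isometry orthogonal to \<open>x\<close> is orthogonal to every partial
    sum \<open>v n\<close>, so its size is at most twice that of each chosen piece, and these tend
    to 0.\<close>
  have maximal: "u = 0" if u: "u \<in> P" "star x * u = 0" "u * star x = 0" for u
  proof -
    have uM: "u \<in> M" using PF(2) u by simp
    have "u \<in> A (v n)" for n
    proof -
      have "star (v n) = (star (v n) * v n) * star x"
        using arg_cong[OF extx(1), of star n] by (simp add: mult.assoc)
      then have "star (v n) * u = 0" using u(2) by (metis mult.assoc mult_zero_right)
      moreover have "star (v n) = star x * (v n * star (v n))"
        using arg_cong[OF extx(2), of star n] by (simp add: mult.assoc)
      then have "u * star (v n) = 0" using u(3) by (metis mult.assoc mult_zero_left)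
      ultimately show ?thesis using u(1) by (simp add: A_def)
    qed
    then have "ip u u \<le> 2 * ip (pick (v n)) (pick (v n))" for n using pick(2) by blast
    then have "ip u u \<le> 2 * 0"
      by (intro LIMSEQ_le_const[OF tendsto_mult_left[OF pick0, of 2]]) blast
    then show ?thesis using ip_self_zero[OF uM] ip_nonneg[OF uM] by simp
  qed
  define e q where "e = 1 - star x * x" and "q = 1 - x * star x"
  have eN: "e \<in> N" "star e = e" "q \<in> N" "star q = q"
    using K xK by (auto simp: e_def q_def closed_bimodule_def)
  have xx1: "x * (star x * x) = x" using xP by (simp add: mult.assoc)
  have xx2: "star x * (x * star x) = star x" using arg_cong[OF xx1, of star] by (simp add: mult.assoc)
  note xx = xx1 xx2
  have xx': "x * (star x * (x * z)) = x * z" "star x * (x * (star x * z)) = star x * z" for z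
    using xx by (metis mult.assoc)+
  have ee: "e * e = e" "q * q = q"
    by (simp_all add: e_def q_def left_diff_distrib right_diff_distrib mult.assoc xx xx')
  \<comment> \<open>The trace makes the two defects equal in size, so both vanish or neither does.
    This is where finiteness enters.\<close>
  have tr_eq: "tr q = tr e"
    using tr_commute[of x "star x"] xM by (simp add: e_def q_def)
  have "tr e = 0"
  proof (rule ccontr)
    assume t: "tr e \<noteq> 0"
    then obtain y where y: "y \<in> K" "q * y * e \<noteq> 0"
      using corner_nonzero[OF B f, of e q] eN tr_eq by auto
    have yK: "q * y * e \<in> K" using KD eN y by simp
    obtain u where u: "u \<in> K" "u \<noteq> 0" "u * star u * u = u"
      "\<And>r. r \<in> N \<Longrightarrow> r * (q * y * e) = q * y * e \<Longrightarrow> r * u = u"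
      "\<And>p. p \<in> N \<Longrightarrow> star p = p \<Longrightarrow> q * y * e * p = q * y * e \<Longrightarrow> u * p = u"
    proof (rule polar_part[OF K yK y(2)])
      fix u
      assume "u \<in> K" "u \<noteq> 0" "u * star u * u = u"
        "\<And>r. r \<in> N \<Longrightarrow> r * (q * y * e) = q * y * e \<Longrightarrow> r * u = u"
        "\<And>p. p \<in> N \<Longrightarrow> star p = p \<Longrightarrow> q * y * e * p = q * y * e \<Longrightarrow> u * p = u"
      then show thesis by (rule that)
    qed
    have qu: "q * u = u" by (rule u(4)) (use eN ee in \<open>simp_all flip: mult.assoc\<close>)
    have ue: "u * e = u" by (rule u(5)) (use eN ee in \<open>simp_all add: mult.assoc\<close>)
    have "star x * q = 0" by (simp add: q_def right_diff_distrib xx)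
    then have xu: "star x * u = 0" using qu by (metis mult.assoc mult_zero_left)
    have "e * star x = 0" by (simp add: e_def left_diff_distrib xx mult.assoc)
    then have ux: "u * star x = 0" using ue by (metis mult.assoc mult_zero_right)
    have "u \<in> P" using u(1,3) by (simp add: P_def partial_isometries_def)
    then have "u = 0" using xu ux by (rule maximal)
    then show False using u(2) by simp
  qed
  then have "ip e e = 0" "ip q q = 0" using eN ee tr_eq by (simp_all add: ip_def)
  then have "e = 0" "q = 0" using eN by (auto intro: ip_self_zero)
  then have "unitary x" by (intro unitaryI) (simp_all add: e_def q_def)
  then show thesis using that xK by blast
qed

subsection \<open>Strong singularity of an irreducible singular inclusion\<close>

text \<open>Complex polarisation, with \<open>j\<close> as imaginary unit, passes from squares to
  all products.\<close>

lemma closed_bimoduleI: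
  assumes B: "bimodule K" and closed: "\<And>X x. (\<And>n. X n \<in> K) \<Longrightarrow> conv2 X x \<Longrightarrow> x \<in> K"
    and sq: "\<And>y. y \<in> K \<Longrightarrow> y * star y \<in> N" "\<And>y. y \<in> K \<Longrightarrow> star y * y \<in> N"
  shows "closed_bimodule K"
proof -
  note KD = bimoduleD[OF B]
  \<comment> \<open>From the sum of two products and \<open>j\<close> times their difference,
    multiplication by \<open>j\<close> and halving recover one of them.\<close>
  have pol: "z * w \<in> N" if sa: "z * w + w' * z' \<in> N" "j * (w' * z') - j * (z * w) \<in> N" for z w z' w'
  proof -
    have "j * (j * (w' * z') - j * (z * w)) = z * w - w' * z'"
      by (simp add: right_diff_distrib j_square flip: mult.assoc)
    then have "z * w - w' * z' \<in> N" using mult_N[OF j_N sa(2)] by simp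
    then have "(z * w + w' * z') + (z * w - w' * z') \<in> N" by (rule add_N[OF sa(1)])
    moreover have "(z * w + w' * z') + (z * w - w' * z') = 2 *\<^sub>R (z * w)"
      by (simp only: scaleR_2 add_diff_eq diff_add_eq) (simp add: algebra_simps)
    ultimately have "(1 / 2) *\<^sub>R (2 *\<^sub>R (z * w)) \<in> N" by (metis scaleR_N)
    then show ?thesis by simp
  qed
  have "y * star z \<in> N \<and> star y * z \<in> N" if yz: "y \<in> K" "z \<in> K" for y z
  proof
    have M: "y \<in> M" "z \<in> M" using KD(1) yz by auto
    have jz: "j * z \<in> K" using KD(3) yz by simp
    have c: "star y * j = j * star y" "star z * j = j * star z" "y * j = j * y" "z * j = j * z"
      using j_commute[of "star y"] j_commute[of "star z"] j_commute[of y] j_commute[of z] M by simp_all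
    show "y * star z \<in> N"
    proof (rule pol)
      have "y * star z + z * star y = (y + z) * star (y + z) - y * star y - z * star z"
        by (simp add: algebra_simps)
      also have "\<dots> \<in> N" by (intro diff_N sq KD(2) yz)
      finally show "y * star z + z * star y \<in> N" .
      have "j * (z * star y) - j * (y * star z) =
          (y + j * z) * star (y + j * z) - y * star y - (j * z) * star (j * z)"
        using c by (simp add: algebra_simps) (metis c(2,3) mult.assoc)
      also have "\<dots> \<in> N" by (intro diff_N sq KD(2) yz jz)
      finally show "j * (z * star y) - j * (y * star z) \<in> N" .
    qed
    have "star z * y \<in> N"
    proof (rule pol)
      have "star z * y + star y * z = star (y + z) * (y + z) - star y * y - star z * z"
        by (simp add: algebra_simps)
      also have "\<dots> \<in> N" by (intro diff_N sq KD(2) yz)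
      finally show "star z * y + star y * z \<in> N" .
      have "j * (star y * z) - j * (star z * y) =
          star (y + j * z) * (y + j * z) - star y * y - star (j * z) * (j * z)"
        using c by (simp add: algebra_simps) (metis c(1,2) mult.assoc)
      also have "\<dots> \<in> N" by (intro diff_N sq KD(2) yz jz)
      finally show "j * (star y * z) - j * (star z * y) \<in> N" .
    qed
    then show "star y * z \<in> N" using star_N[of "star z * y"] by simp
  qed
  then show ?thesis using B closed unfolding closed_bimodule_def by blast
qed

text \<open>Conjugation by \<open>star\<close> exchanges the left and right actions; it carries the
  kernel built from \<open>u\<close> over to operators on the same side as the one built from
  \<open>star u\<close>.\<close>

lemma opposite_positive_contraction:
  assumes T: "positive_contraction T"
  shows "positive_contraction (\<lambda>y. star (T (star y)))"
proof -
  note TD = positive_contractionD[OF T]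
  have ips: "ip (star y) z = ip y (star z)" if "y \<in> M" "z \<in> M" for y z
    using ip_star[of y "star z"] that by simp
  have b: "bimodular (\<lambda>y. star (T (star y)))"
    unfolding bimodular_def
    using TD(5) by (simp add: bimodular_add[OF TD(1)] bimodular_left[OF TD(1)] bimodular_right[OF TD(1)])
  have s: "ip (star (T (star y))) z = ip y (star (T (star z)))" if "y \<in> M" "z \<in> M" for y z
    using ips[of "T (star y)" z] TD(2)[of "star y" "star z"] ips[of y "T (star z)"] TD(5) that by simp
  have p: "0 \<le> ip (star (T (star y))) y" if "y \<in> M" for y
    using ips[of "T (star y)" y] TD(3)[of "star y"] TD(5) that by simp
  have n: "n2 (star (T (star y))) \<le> n2 y" if "y \<in> M" for y
    using TD(4)[of "star y"] TD(5) that by simp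
  show ?thesis unfolding positive_contraction_def using b s p n by blast
qed

theorem singular_distance:
  assumes sing: "\<And>v. v \<in> M \<Longrightarrow> unitary v \<Longrightarrow> (\<And>n. n \<in> N \<Longrightarrow> v * n * star v \<in> N) \<Longrightarrow>
      (\<And>n. n \<in> N \<Longrightarrow> star v * n * v \<in> N) \<Longrightarrow> v \<in> N"
    and u: "u \<in> M" "unitary u" and \<delta>: "0 \<le> \<delta>" "\<delta> \<le> 1 / 13"
    and close: "\<And>w. w \<in> Uni \<Longrightarrow> n2 (u * w * star u - E (u * w * star u)) \<le> \<delta>"
      "\<And>w. w \<in> Uni \<Longrightarrow> n2 (star u * w * u - E (star u * w * u)) \<le> \<delta>"
  shows "n2 (u - E u) \<le> \<delta>"
proof (rule ccontr)
  assume far: "\<not> n2 (u - E u) \<le> \<delta>"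
  have d2: "\<delta>\<^sup>2 \<le> 1 / 169" using power_mono[OF \<delta>(2,1), of 2] by (simp add: power_divide)
  \<comment> \<open>The form of the averages at \<open>a\<close> is an average of squared norms of
    expectations of the unitaries \<open>star a * star w * a\<close>; by Pythagoras each is 1 minus
    a squared distance to \<open>N\<close>.\<close>
  have low: "1 - \<delta>\<^sup>2 \<le> ip (k a) a"
    if a: "a \<in> M" "unitary a" and k: "approximates a F r k" "bimodular k"
      and cl: "\<And>w. w \<in> Uni \<Longrightarrow> n2 (star a * w * a - E (star a * w * a)) \<le> \<delta>" for a F r k
  proof -
    obtain G where G: "\<And>n. convex_family Uni (G n)" "\<And>y. y \<in> M \<Longrightarrow> conv2 (\<lambda>n. kmap a (G n) y) (k y)"
      using approximates_refine[OF k a(1) zero_M star_zero] by metis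
    have "1 - \<delta>\<^sup>2 \<le> ip (kmap a (G n) a) a" for n
      unfolding kmap_ip[OF G(1) a(1) a(1) a(1)]
    proof (rule convex_family_ge[OF G(1)])
      fix w assume w: "w \<in> Uni"
      let ?x = "star (w * a) * a"
      have x: "?x \<in> M" "?x = star a * star w * a" using w a by simp_all
      have "ip ?x ?x = 1"
        using w a n2_sq[OF x(1)] by (simp add: mult.assoc)
          (simp add: ip_def mult.assoc)
      moreover have "ip (?x - E ?x) (?x - E ?x) \<le> \<delta>\<^sup>2"
      proof -
        have "n2 (?x - E ?x) \<le> \<delta>" using cl[of "star w"] w x(2) by simp
        then have "(n2 (?x - E ?x))\<^sup>2 \<le> \<delta>\<^sup>2" using x(1) by (intro power_mono n2_nonneg) simp_all
        then show ?thesis using n2_sq[of "?x - E ?x"] x(1) by simp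
      qed
      ultimately show "1 - \<delta>\<^sup>2 \<le> ip (E ?x) (E ?x)" using E_pythagoras[OF x(1)] by simp
    qed
    then show ?thesis by (intro LIMSEQ_le_const[OF conv2_ip[OF G(2)[OF a(1)] a(1)]]) blast
  qed
  define a where "a = star u"
  have a: "a \<in> M" "unitary a" "star a = u" using u by (simp_all add: a_def)
  obtain k F r where k: "positive_contraction k" "approximates a F r k"
    using averaged_kernel[OF a(1,2)] by metis
  obtain k1 F1 r1 where k1: "positive_contraction k1" "approximates u F1 r1 k1"
    using averaged_kernel[OF u] by metis
  note kD = positive_contractionD[OF k(1)] and k1D = positive_contractionD[OF k1(1)]
  have ka: "1 - \<delta>\<^sup>2 \<le> ip (k a) a"
    using low[OF a(1,2) k(2) kD(1)] close(1) by (simp add: a_def)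
  have k1u: "1 - \<delta>\<^sup>2 \<le> ip (k1 u) u" using low[OF u k1(2) k1D(1)] close(2) by simp
  obtain s g where sg: "0 < s" "s \<le> 1" "ip (k a) a \<le> s" "positive_contraction g"
    "\<And>y. y \<in> M \<Longrightarrow> k (g y) = s *\<^sub>R g y" "\<And>y. y \<in> M \<Longrightarrow> g (k y) = s *\<^sub>R g y"
    "\<And>y. y \<in> M \<Longrightarrow> g (g y) = g y" "s \<le> ip (g a) (g a)"
    using top_eigenprojection[OF a(1,2) k(2,1)] ka d2 by (smt (verit) divide_less_eq_1_pos)
  note gD = positive_contractionD[OF sg(4)]
  have s_low: "1 - \<delta>\<^sup>2 \<le> s" using ka sg(3) by simp
  have gM1: "g 1 \<in> M" using gD(5) by simp
  have "y * g 1 = g 1 * y" if "y \<in> N" for y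
    using bimodular_left[OF gD(1) that one_M] bimodular_right[OF gD(1) that one_M] by simp
  then obtain \<alpha> \<beta> where g1: "g 1 = \<alpha> *\<^sub>R 1 + \<beta> *\<^sub>R j" using irreducible[OF gM1] by blast
  have trj: "tr j = 0" using tr_star[of j] by simp
  \<comment> \<open>The symmetry of \<open>g\<close>, tested at 1 and \<open>j\<close>, gives
    \<beta> equal to its negative.\<close>
  have "\<beta> = 0"
  proof -
    have "g j = j * g 1" using bimodular_left[OF gD(1) j_N one_M] by simp
    moreover have "ip (g 1) j = ip 1 (g j)" using gD(2) by simp
    ultimately show ?thesis by (simp add: g1 ip_def trj j_square distrib_left distrib_right)
  qed
  then have g1': "g 1 = \<alpha> *\<^sub>R 1" using g1 by simp
  have "\<alpha> * \<alpha> = \<alpha>"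
  proof -
    have "g (g 1) = (\<alpha> * \<alpha>) *\<^sub>R 1" using bimodular_scaleR[OF gD(1) one_M, of \<alpha>] g1' by simp
    then have "tr (g (g 1)) = \<alpha> * \<alpha>" by (simp only: tr_scaleR[OF one_M] tr_one)
    moreover have "tr (g (g 1)) = \<alpha>" using sg(7)[OF one_M] g1' by simp
    ultimately show ?thesis by simp
  qed
  then consider "\<alpha> = 1" | "\<alpha> = 0" by auto
  then show False
  proof cases
    case 1
    then have "k 1 = s *\<^sub>R 1" using sg(5)[OF one_M] g1' by simp
    obtain G where G: "\<And>n. convex_family Uni (G n)" "\<And>y. y \<in> M \<Longrightarrow> conv2 (\<lambda>n. kmap a (G n) y) (k y)"
      using approximates_refine[OF k(2) kD(1) a(1) zero_M star_zero] by metis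
    \<comment> \<open>At the vector 1 the unitaries of \<open>N\<close> cancel, so every average
      gives the same value and the limit does not depend on the family.\<close>
    have "ip (kmap a (G n) 1) 1 = ip (E u) (E u)" for n
    proof -
      have "ip (kmap a (G n) 1) 1 = wsum (G n) (\<lambda>w. ip (E u) (E u))"
        unfolding kmap_ip[OF G(1) a(1) one_M one_M]
      proof (rule convex_family_cong[OF G(1)])
        fix w assume w: "w \<in> Uni"
        then have "E (star (w * a) * 1) = E u * star w" using u a(3) by simp
        moreover have "n2 (E u * star w) = n2 (E u)" using w u by simp
        ultimately show "ip (E (star (w * a) * 1)) (E (star (w * a) * 1)) = ip (E u) (E u)"
          using w u n2_sq[of "E u * star w"] n2_sq[of "E u"] by simp
      qed
      then show ?thesis using convex_family_const[OF G(1)] by metis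
    qed
    then have "ip (k 1) 1 = ip (E u) (E u)"
      using LIMSEQ_unique[OF conv2_ip[OF G(2)[OF one_M] one_M]] by simp
    then have "ip (E u) (E u) = s" using \<open>k 1 = s *\<^sub>R 1\<close> by (simp add: ip_def)
    then have "ip (u - E u) (u - E u) \<le> \<delta>\<^sup>2"
      using E_pythagoras[OF u(1)] ip_unitary_one[OF u] s_low by simp
    then have "n2 (u - E u) \<le> \<delta>" unfolding n2_def using \<delta> by (simp add: real_le_lsqrt)
    then show False using far by simp
  next
    case 2
    define K where "K = {y \<in> M. g y = y}"
    define f where "f = g a"
    define c where "c = ip f f"
    have fM: "f \<in> M" using gD(5) a by (simp add: f_def)
    have fK: "f \<in> K" using fM sg(7) a by (simp add: K_def f_def)
    have cs: "s \<le> c" using sg(8) by (simp add: c_def f_def)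
    have c1: "c \<le> 1"
      using contraction_form_le[OF sg(4) a(1)] ip_unitary_one[OF a(1,2)] by (simp add: c_def f_def)
    have f0: "f \<noteq> 0" using cs sg(1) by (auto simp: c_def)
    have B: "bimodule K"
      unfolding bimodule_def K_def
      by (auto simp: bimodular_add[OF gD(1)] bimodular_left[OF gD(1)] bimodular_right[OF gD(1)])
    have Eperp: "E y = 0" if "y \<in> K" for y
    proof (rule E_unique)
      fix n assume n: "n \<in> N"
      have "ip y n = ip (g y) n" using that by (simp add: K_def)
      also have "\<dots> = ip y (g n)" using that n by (intro gD(2)) (simp_all add: K_def)
      also have "g n = n * g 1" using bimodular_left[OF gD(1) n one_M] by simp
      finally show "ip 0 n = ip y n" using g1' 2 by simp
    qed (use that in \<open>simp_all add: K_def\<close>)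
    \<comment> \<open>The kernel for the left action, moved to the side of \<open>k\<close>.
      Compressed to \<open>K\<close> it is the scalar \<open>t\<close> by
      \<open>eigenprojection_minimal\<close>.\<close>
    define X where "X y = star (k1 (star y))" for y
    have X: "positive_contraction X"
      using opposite_positive_contraction[OF k1(1)] by (simp add: X_def[abs_def])
    note XD = positive_contractionD[OF X]
    define t where "t = ip (X f) f / c"
    have gX: "g (X y) = t *\<^sub>R y" if "y \<in> K" for y
      unfolding t_def c_def f_def
      using eigenprojection_minimal[OF a(1,2) k(2,1) sg(4,7,5,1) _ _ X, of y] that c1 s_low d2 f0
      by (simp add: K_def f_def c_def)
    \<comment> \<open>With \<open>Q\<close> the form of 1 minus \<open>X\<close>, the parallelogram
      law for \<open>f\<close> as \<open>a\<close> plus \<open>f - a\<close> bounds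
      \<open>Q f\<close> by \<open>2 * \<delta>\<^sup>2 + 2 * (1 - c)\<close>. Hence the form of
      \<open>X\<close> at \<open>f\<close> is at least
      \<open>3 * c - 2 - 2 * \<delta>\<^sup>2\<close>, and \<open>c\<close> is at least
      \<open>1 - \<delta>\<^sup>2\<close>.\<close>
    have Xf: "1 - 5 * \<delta>\<^sup>2 \<le> ip (X f) f"
    proof -
      have ips: "ip (star y) z = ip y (star z)" if "y \<in> M" "z \<in> M" for y z
        using ip_star[of y "star z"] that by simp
      have "ip (X a) a = ip (k1 u) u" using ip_star[of "k1 u" u] u k1D(5) by (simp add: X_def a_def)
      then have Xa: "1 - \<delta>\<^sup>2 \<le> ip (X a) a" using k1u by simp
      have fa: "ip f a = c" "ip a f = c"
        using gD(2)[of "g a" a] gD(2)[OF a(1) fM] sg(7)[OF a(1)] a(1) fM by (simp_all add: f_def c_def)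
      let ?d = "f - a"
      have dM: "?d \<in> M" using fM a by simp
      have dd: "ip ?d ?d = 1 - c"
        using fM a(1) fa ip_unitary_one[OF a(1,2)] by (simp add: c_def[symmetric])
      define Q where "Q y = ip y y - ip (X y) y" for y
      have Qpos: "0 \<le> Q y" if "y \<in> M" for y
        using contraction_form_le(1)[OF X that] by (simp add: Q_def)
      have par: "Q f + Q (a - ?d) = 2 * Q a + 2 * Q ?d"
      proof -
        have Xd: "X ?d = X f - X a" using bimodular_diff[OF XD(1) fM a(1)] .
        have Xe: "X (a - ?d) = X a - X ?d" using bimodular_diff[OF XD(1) a(1) dM] .
        show ?thesis
          unfolding Q_def Xe Xd using fM a(1) XD(5) by (simp add: algebra_simps)
      qed
      have "Q ?d \<le> ip ?d ?d" using XD(3)[OF dM] by (simp add: Q_def)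
      then have "Q f \<le> 2 * Q a + 2 * (1 - c)" using par Qpos[of "a - ?d"] fM a(1) dd by simp
      moreover have "Q a \<le> \<delta>\<^sup>2" using Xa ip_unitary_one[OF a(1,2)] by (simp add: Q_def)
      moreover have "Q f = c - ip (X f) f" by (simp add: Q_def c_def)
      ultimately show ?thesis using cs s_low by simp
    qed
    have c0: "0 < c" using cs sg(1) by simp
    have t0: "0 < t" using Xf d2 c0 by (simp add: t_def)
    \<comment> \<open>Multiplied by \<open>c\<close> this is \<open>c * c\<^sup>2\<close> below
      \<open>2 * s * ip (X f) f\<close>; the fractions are \<open>1 - \<delta>\<^sup>2\<close> and
      \<open>1 - 5 * \<delta>\<^sup>2\<close> at \<delta> equal to 1/13.\<close>
    have cst: "c\<^sup>2 < 2 * (s * t)"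
    proof -
      have "c * c\<^sup>2 \<le> 1" using c1 c0 by (simp add: mult_le_one power_le_one)
      also have "1 < 2 * ((168 / 169) * (164 / 169 :: real))" by simp
      also have "\<dots> \<le> 2 * (s * ip (X f) f)"
        using s_low Xf d2 by (intro mult_left_mono mult_mono) auto
      also have "\<dots> = c * (2 * (s * t))" using c0 by (simp add: t_def)
      finally show ?thesis using c0 by (simp add: mult_less_cancel_left_pos)
    qed
    have fr: "frame K f s"
      unfolding f_def by (rule frameI[OF a(1) k(2) kD(1) sg(4)]) (auto simp: K_def sg(6))
    have fl: "frame (star ` K) (star f) t"
    proof -
      define h where "h y = star (g (star y))" for y
      have h: "positive_contraction h"
        using opposite_positive_contraction[OF sg(4)] by (simp add: h_def[abs_def])
      have "frame (star ` K) (h u) t"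
      proof (rule frameI[OF u(1) k1(2) k1D(1) h])
        show "y \<in> M \<and> h y = y" if "y \<in> star ` K" for y using that by (auto simp: K_def h_def)
        show "h (k1 y) = t *\<^sub>R y" if "y \<in> star ` K" for y
        proof -
          obtain z where z: "z \<in> K" "y = star z" using \<open>y \<in> star ` K\<close> by blast
          have "h (k1 y) = star (g (X z))" by (simp add: h_def X_def z)
          then show ?thesis using gX[OF z(1)] z by simp
        qed
      qed
      then show ?thesis by (simp add: h_def f_def a_def)
    qed
    have sq: "y * star y \<in> N" if "y \<in> K" for y
      using square_in_N[OF B fK f0 fr fl sg(1) t0 _ that] cst by (simp add: c_def)
    have sq': "star y * y \<in> N" if "y \<in> K" for y
    proof -
      have B': "bimodule (star ` K)"
        using B unfolding bimodule_def by (auto simp flip: star_add star_mult)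
          (metis (no_types, lifting) image_eqI star_N star_mult star_star)+
      have im: "star ` star ` K = K" by (auto simp: image_iff)
      have "star y * star (star y) \<in> N"
      proof (rule square_in_N[OF B' _ _ fl _ t0 sg(1)])
        show "star f \<in> star ` K" using fK by blast
        show "star f \<noteq> 0" using f0 by (metis star_star star_zero)
        show "frame (star ` star ` K) (star (star f)) s" using fr im by simp
        show "(ip (star f) (star f))\<^sup>2 < 2 * (t * s)" using cst fM by (simp add: ip_star c_def mult.commute)
        show "star y \<in> star ` K" using that by blast
      qed
      then show ?thesis by simp
    qed
    have closed: "closed_bimodule K"
    proof (rule closed_bimoduleI[OF B _ sq sq'])
      fix Y y assume Y: "\<And>n. Y n \<in> K" "conv2 Y y"
      have "conv2 (\<lambda>n. g (Y n)) (g y)"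
      proof (rule conv2_bounded_map[OF Y(2) gD(5)])
        show "n2 (g x - g x') \<le> 1 * n2 (x - x')" if "x \<in> M" "x' \<in> M" for x x'
          using gD(4)[of "x - x'"] that bimodular_diff[OF gD(1)] by simp
      qed
      moreover have "g (Y n) = Y n" for n using Y(1) by (simp add: K_def)
      ultimately have "conv2 Y (g y)" by simp
      from conv2_unique[OF Y(2) this] have "g y = y" ..
      then show "y \<in> K" using conv2_M(2)[OF Y(2)] by (simp add: K_def)
    qed
    obtain v where v: "v \<in> K" "unitary v" using exists_unitary[OF closed fK f0] by blast
    note KD = bimoduleD[OF B]
    have vM: "v \<in> M" using KD(1) v by simp
    have pr: "y * star z \<in> N" "star y * z \<in> N" if "y \<in> K" "z \<in> K" for y z
      using closed that by (simp_all add: closed_bimodule_def)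
    have "v \<in> N"
    proof (rule sing[OF vM v(2)])
      show "v * n * star v \<in> N" if "n \<in> N" for n
        using pr(1)[OF KD(4)[OF that v(1)] v(1)] .
      show "star v * n * v \<in> N" if "n \<in> N" for n
        using pr(2)[OF v(1) KD(3)[OF that v(1)]] by (simp add: mult.assoc)
    qed
    \<comment> \<open>Singularity puts \<open>v\<close> in \<open>N\<close>, where \<open>E\<close>
      fixes it, while \<open>E\<close> vanishes on \<open>K\<close>.\<close>
    then have "v = 0" using Eperp[OF v(1)] by simp
    then have "(1 :: 'a) = 0" using v(2) unitary_simps(1)[of v] by simp
    then have "tr 1 = tr 0" by simp
    then show False by simp
  qed
qed

end

section \<open>Concrete side: operators on a Hilbert space provide the abstract setting\<close>

section \<open>Hilbert spaces: the Riesz representation and adjoints\<close>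

lemma cinner_add_right: "cinner x (y + z) = cinner x y + cinner x (z :: 'h::chilbert_space)"
  by (metis cinner_add_left cinner_commute complex_cnj_add)

lemma cinner_scaleC_right: "cinner x (c *\<^sub>C y) = cnj c * cinner x (y :: 'h::chilbert_space)"
  by (metis cinner_scaleC_left cinner_commute complex_cnj_mult)

lemma cinner_scaleR_left: "cinner (r *\<^sub>R x) y = of_real r * cinner x (y :: 'h::chilbert_space)"
  by (metis cinner_scaleC_left scaleC_of_real)

lemma cinner_scaleR_right: "cinner x (r *\<^sub>R y) = of_real r * cinner x (y :: 'h::chilbert_space)"
  by (metis cinner_scaleC_right scaleC_of_real complex_cnj_complex_of_real)

lemma cinner_zero_left [simp]: "cinner 0 (y :: 'h::chilbert_space) = 0"
  using cinner_scaleR_left[of 0 0 y] by simp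

lemma cinner_zero_right [simp]: "cinner (y :: 'h::chilbert_space) 0 = 0"
  using cinner_scaleR_right[of y 0 0] by simp

lemma cinner_minus_left: "cinner (- x) y = - cinner x (y :: 'h::chilbert_space)"
  using cinner_scaleR_left[of "-1" x y] by simp

lemma cinner_minus_right: "cinner x (- y) = - cinner x (y :: 'h::chilbert_space)"
  using cinner_scaleR_right[of x "-1" y] by simp

lemma cinner_diff_left: "cinner (x - y) z = cinner x z - cinner y (z :: 'h::chilbert_space)"
  using cinner_add_left[of x "- y" z] by (simp add: cinner_minus_left)

lemma cinner_diff_right: "cinner x (y - z) = cinner x y - cinner x (z :: 'h::chilbert_space)"
  using cinner_add_right[of x y "- z"] by (simp add: cinner_minus_right)

lemmas cinner_simps = cinner_add_left cinner_add_right cinner_diff_left cinner_diff_right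
  cinner_scaleC_left cinner_scaleC_right cinner_scaleR_left cinner_scaleR_right
  cinner_minus_left cinner_minus_right

lemma norm_sq_cinner: "(norm (x :: 'h::chilbert_space))\<^sup>2 = Re (cinner x x)"
  by (simp add: cinner_self)

lemma Re_cinner_commute: "Re (cinner x y) = Re (cinner y (x :: 'h::chilbert_space))"
  by (subst cinner_commute) simp

lemma Re_cinner_cauchy_schwarz: "\<bar>Re (cinner x y)\<bar> \<le> norm x * norm (y :: 'h::chilbert_space)"
proof -
  have "(Re (cinner x y))\<^sup>2 \<le> (norm x)\<^sup>2 * (norm y)\<^sup>2"
  proof (rule quadratic_nonneg_imp)
    fix t :: real
    have "(norm (x + t *\<^sub>R y))\<^sup>2 = (norm x)\<^sup>2 + 2 * t * Re (cinner x y) + t\<^sup>2 * (norm y)\<^sup>2"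
      unfolding norm_sq_cinner using Re_cinner_commute[of x y]
      by (simp add: cinner_simps algebra_simps power2_eq_square)
    then show "0 \<le> (norm x)\<^sup>2 + 2 * t * Re (cinner x y) + t\<^sup>2 * (norm y)\<^sup>2"
      by (metis zero_le_power2)
  qed simp
  then have "(\<bar>Re (cinner x y)\<bar>)\<^sup>2 \<le> (norm x * norm y)\<^sup>2" by (simp add: power_mult_distrib)
  then show ?thesis by (rule power2_le_imp_le) simp
qed

lemma cinner_eqI:
  assumes "\<And>x. Re (cinner x y) = Re (cinner x z)" shows "y = (z :: 'h::chilbert_space)"
proof -
  have "Re (cinner (y - z) (y - z)) = 0"
    using assms[of "y - z"] by (simp add: cinner_diff_right)
  then have "(norm (y - z))\<^sup>2 = 0" by (simp only: norm_sq_cinner)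
  then show ?thesis by simp
qed

lemma Re_ii_scaleC: "Re (cinner (\<i> *\<^sub>C x) y) = - Im (cinner x (y :: 'h::chilbert_space))"
  by (simp add: cinner_scaleC_left)

text \<open>The representing vector minimises the squared norm of \<open>x\<close> minus twice
  \<phi>; the first variation at the minimum is the claim.\<close>

lemma riesz_representation:
  fixes \<phi> :: "'h::chilbert_space \<Rightarrow> real"
  assumes lin: "bounded_linear \<phi>"
  shows "\<exists>z. \<forall>x. \<phi> x = Re (cinner x z)"
proof -
  interpret bounded_linear \<phi> by (rule lin)
  obtain C where C: "\<And>x. norm (\<phi> x) \<le> norm x * C" using bounded by blast
  \<comment> \<open>The constant \<open>C\<^sup>2\<close> only makes \<open>q\<close>
    nonnegative.\<close>
  define q where "q x = (norm x)\<^sup>2 - 2 * \<phi> x + C\<^sup>2" for x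
  define d where "d x y = (norm (x - y))\<^sup>2" for x y :: 'h
  obtain X m where X: "\<And>n. q (X n) \<le> m + 1 / real (Suc n)" "\<And>y. m \<le> q y"
    "\<And>x y. d x y \<le> 2 * (q x - m) + 2 * (q y - m)"
  proof (rule minimising_sequence[of UNIV q d])
    show "0 \<le> q x" for x
    proof -
      have "\<phi> x \<le> norm x * C" using C[of x] by simp
      then have "0 \<le> (norm x)\<^sup>2 - 2 * \<phi> x + C\<^sup>2"
        using zero_le_power2[of "norm x - C"] by (simp add: power2_diff)
      then show ?thesis by (simp add: q_def)
    qed
    fix x y :: 'h
    have "q ((1/2) *\<^sub>R (x + y)) = (q x + q y) / 2 - d x y / 4"
      unfolding q_def d_def norm_sq_cinner
      by (simp add: cinner_simps add scaleR field_simps)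
    then show "\<exists>z\<in>UNIV. q z \<le> (q x + q y) / 2 - d x y / 4" by (metis UNIV_I order_refl)
  qed (use that in blast)+
  have "Cauchy X"
  proof (rule metric_CauchyI)
    fix e :: real assume e: "e > 0"
    obtain k where k: "4 / e\<^sup>2 < real k" using reals_Archimedean2 by blast
    have "dist (X i) (X n) < e" if "i \<ge> k" "n \<ge> k" for i n
    proof -
      have "real (Suc i) > 4 / e\<^sup>2" "real (Suc n) > 4 / e\<^sup>2" using k that by linarith+
      then have "1 / real (Suc i) < e\<^sup>2 / 4" "1 / real (Suc n) < e\<^sup>2 / 4"
        using e by (simp_all add: field_simps)
      then have "(norm (X i - X n))\<^sup>2 < e\<^sup>2"
        using X(3)[of "X i" "X n"] X(1)[of i] X(1)[of n] by (simp add: d_def)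
      then show ?thesis using e unfolding dist_norm by (rule power2_less_imp_less[OF _ less_imp_le])
    qed
    then show "\<exists>k. \<forall>i\<ge>k. \<forall>n\<ge>k. dist (X i) (X n) < e" by blast
  qed
  then obtain z where z: "X \<longlonglongrightarrow> z" using Cauchy_convergent_iff convergent_def by blast
  have "(\<lambda>n. q (X n)) \<longlonglongrightarrow> q z" unfolding q_def by (intro tendsto_intros tendsto z)
  moreover have "(\<lambda>n. m + 1 / real (Suc n)) \<longlonglongrightarrow> m + 0"
    by (intro tendsto_intros LIMSEQ_Suc[OF lim_1_over_n])
  ultimately have qz: "q z \<le> m" using LIMSEQ_le[of "\<lambda>n. q (X n)" "q z"] X(1) by fastforce
  have "\<phi> x = Re (cinner x z)" for x
  proof -
    have "(Re (cinner x z) - \<phi> x)\<^sup>2 \<le> 0 * (norm x)\<^sup>2"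
    proof (rule quadratic_nonneg_imp)
      fix t :: real
      have "q (z + t *\<^sub>R x) = q z + 2 * t * (Re (cinner x z) - \<phi> x) + t\<^sup>2 * (norm x)\<^sup>2"
        unfolding q_def norm_sq_cinner using Re_cinner_commute[of x z]
        by (simp add: cinner_simps add scaleR algebra_simps power2_eq_square)
      then show "0 \<le> 0 + 2 * t * (Re (cinner x z) - \<phi> x) + t\<^sup>2 * (norm x)\<^sup>2"
        using X(2)[of "z + t *\<^sub>R x"] qz by simp
    qed simp
    then show ?thesis by simp
  qed
  then show ?thesis by blast
qed

lemma scaleC_scaleR: "c *\<^sub>C (r *\<^sub>R x) = r *\<^sub>R (c *\<^sub>C (x :: 'h::chilbert_space))"
  by (simp flip: scaleC_of_real add: scaleC_scaleC mult.commute)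

lemma adj_exists:
  fixes T :: "'h::chilbert_space \<Rightarrow>\<^sub>L 'h"
  assumes T: "T \<in> bounded_ops"
  shows "\<exists>S\<in>bounded_ops. \<forall>x y. cinner (blinfun_apply T x) y = cinner x (blinfun_apply S y)"
proof -
  have TC: "blinfun_apply T (c *\<^sub>C x) = c *\<^sub>C blinfun_apply T x" for c x
    using T by (simp add: bounded_ops_def)
  have "\<exists>z. \<forall>x. Re (cinner (blinfun_apply T x) y) = Re (cinner x z)" for y
  proof (rule riesz_representation)
    show "bounded_linear (\<lambda>x. Re (cinner (blinfun_apply T x) y))"
    proof (rule bounded_linear_intro[where K = "norm T * norm y"])
      show "norm (Re (cinner (blinfun_apply T x) y)) \<le> norm x * (norm T * norm y)" for x
      proof -
        have "norm (Re (cinner (blinfun_apply T x) y)) \<le> norm (blinfun_apply T x) * norm y"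
          using Re_cinner_cauchy_schwarz[of "blinfun_apply T x" y] by simp
        also have "\<dots> \<le> (norm T * norm x) * norm y" by (intro mult_right_mono norm_blinfun) simp
        finally show ?thesis by (simp add: mult_ac)
      qed
    qed (simp_all add: cinner_simps blinfun.add_right blinfun.scaleR_right)
  qed
  \<comment> \<open>Only real parts are known at this point; replacing \<open>x\<close> by \<i>
    times \<open>x\<close> yields the imaginary parts.\<close>
  then obtain S where S: "\<And>x y. Re (cinner (blinfun_apply T x) y) = Re (cinner x (S y))" by metis
  have full: "cinner (blinfun_apply T x) y = cinner x (S y)" for x y
  proof (rule complex_eqI)
    show "Re (cinner (blinfun_apply T x) y) = Re (cinner x (S y))" by (rule S)
    show "Im (cinner (blinfun_apply T x) y) = Im (cinner x (S y))"
      using S[of "\<i> *\<^sub>C x" y] by (simp add: TC Re_ii_scaleC)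
  qed
  have "S (y + z) = S y + S z" for y z
    by (rule cinner_eqI) (simp add: cinner_simps flip: full)
  moreover have SC: "S (c *\<^sub>C y) = c *\<^sub>C S y" for c y
    by (rule cinner_eqI) (simp add: cinner_simps flip: full)
  moreover have "norm (S y) \<le> norm y * norm T" for y
  proof (cases "S y = 0")
    case False
    have "(norm (S y))\<^sup>2 = Re (cinner (blinfun_apply T (S y)) y)"
      by (simp add: norm_sq_cinner full)
    also have "\<dots> \<le> norm (blinfun_apply T (S y)) * norm y"
      using Re_cinner_cauchy_schwarz[of "blinfun_apply T (S y)" y] by simp
    also have "\<dots> \<le> (norm T * norm (S y)) * norm y" by (intro mult_right_mono norm_blinfun) simp
    finally have "norm (S y) * norm (S y) \<le> (norm y * norm T) * norm (S y)"
      by (simp add: power2_eq_square mult_ac)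
    then show ?thesis using False by simp
  qed simp
  ultimately have bl: "bounded_linear S"
    by (intro bounded_linear_intro[where K = "norm T"]) (auto simp flip: scaleC_of_real)
  then have "blinfun_apply (Blinfun S) = S" by (rule bounded_linear_Blinfun_apply)
  then show ?thesis using full SC by (intro bexI[of _ "Blinfun S"]) (auto simp: bounded_ops_def)
qed

lemma
  fixes T :: "'h::chilbert_space \<Rightarrow>\<^sub>L 'h"
  assumes T: "T \<in> bounded_ops"
  shows cinner_adj: "cinner (blinfun_apply T x) y = cinner x (blinfun_apply (adj T) y)"
    and adj_bounded_ops: "adj T \<in> bounded_ops"
proof -
  obtain S where S: "S \<in> bounded_ops" "\<forall>x y. cinner (blinfun_apply T x) y = cinner x (blinfun_apply S y)"
    using adj_exists[OF T] by blast
  have "adj T = S"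
    unfolding adj_def
  proof (rule the_equality)
    fix R assume R: "\<forall>x y. cinner (blinfun_apply T x) y = cinner x (blinfun_apply R y)"
    show "R = S"
      by (rule blinfun_eqI, rule cinner_eqI) (metis R S(2))
  qed (rule S(2))
  then show "cinner (blinfun_apply T x) y = cinner x (blinfun_apply (adj T) y)" "adj T \<in> bounded_ops"
    using S by auto
qed

section \<open>The star algebra of bounded operators\<close>

text \<open>The class \<open>star_algebra\<close> needs a type of its own: \<open>blinfun\<close>
  contains all real-linear operators, on which \<open>adj\<close> need not be an involution.\<close>

typedef (overloaded) 'h bop = "bounded_ops :: ('h::chilbert_space \<Rightarrow>\<^sub>L 'h) set"
  morphisms rep bop
  by (rule exI[of _ id_blinfun]) (simp add: bounded_ops_def)

lemma bounded_ops_closed: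
  fixes S T :: "'h::chilbert_space \<Rightarrow>\<^sub>L 'h"
  shows "0 \<in> (bounded_ops :: ('h \<Rightarrow>\<^sub>L 'h) set)" "id_blinfun \<in> (bounded_ops :: ('h \<Rightarrow>\<^sub>L 'h) set)"
    "S \<in> bounded_ops \<Longrightarrow> T \<in> bounded_ops \<Longrightarrow> S + T \<in> bounded_ops"
    "S \<in> bounded_ops \<Longrightarrow> T \<in> bounded_ops \<Longrightarrow> S - T \<in> bounded_ops"
    "S \<in> bounded_ops \<Longrightarrow> - S \<in> bounded_ops" "S \<in> bounded_ops \<Longrightarrow> r *\<^sub>R S \<in> bounded_ops"
    "S \<in> bounded_ops \<Longrightarrow> T \<in> bounded_ops \<Longrightarrow> S o\<^sub>L T \<in> bounded_ops"
    "scalar_op c \<in> (bounded_ops :: ('h \<Rightarrow>\<^sub>L 'h) set)"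
proof -
  have zero: "c *\<^sub>C (0 :: 'h) = 0" for c using scaleC_scaleR[of c 0 0] by simp
  have minus: "c *\<^sub>C (- x :: 'h) = - (c *\<^sub>C x)" for c x using scaleC_scaleR[of c "-1" x] by simp
  have diff: "c *\<^sub>C (x - y :: 'h) = c *\<^sub>C x - c *\<^sub>C y" for c x y
    using scaleC_add_right[of c x "- y"] minus by simp
  show "0 \<in> (bounded_ops :: ('h \<Rightarrow>\<^sub>L 'h) set)" "id_blinfun \<in> (bounded_ops :: ('h \<Rightarrow>\<^sub>L 'h) set)"
    "S \<in> bounded_ops \<Longrightarrow> T \<in> bounded_ops \<Longrightarrow> S + T \<in> bounded_ops"
    "S \<in> bounded_ops \<Longrightarrow> T \<in> bounded_ops \<Longrightarrow> S - T \<in> bounded_ops"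
    "S \<in> bounded_ops \<Longrightarrow> - S \<in> bounded_ops" "S \<in> bounded_ops \<Longrightarrow> r *\<^sub>R S \<in> bounded_ops"
    "S \<in> bounded_ops \<Longrightarrow> T \<in> bounded_ops \<Longrightarrow> S o\<^sub>L T \<in> bounded_ops"
    "scalar_op c \<in> (bounded_ops :: ('h \<Rightarrow>\<^sub>L 'h) set)"
    by (auto simp: bounded_ops_def zero minus diff blinfun.add_left blinfun.diff_left blinfun.minus_left
        blinfun.scaleR_left scaleC_add_right scaleC_scaleR scaleC_scaleC mult.commute)
qed

instantiation bop :: (chilbert_space) star_algebra
begin

definition "0 = bop 0"
definition "1 = bop id_blinfun"
definition "x + y = bop (rep x + rep y)"
definition "x - y = bop (rep x - rep y)"
definition "- x = bop (- rep x)"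
definition "r *\<^sub>R x = bop (r *\<^sub>R rep x)"
definition "x * y = bop (rep x o\<^sub>L rep y)"
definition "star x = bop (adj (rep x))"
definition "norm x = norm (rep x)"
definition "dist x y = dist (rep x) (rep y)"
definition "sgn x = inverse (norm x) *\<^sub>R (x :: 'a bop)"
definition [code del]:
  "(uniformity :: ('a bop \<times> 'a bop) filter) = (INF e\<in>{0 <..}. principal {(x, y). dist x y < e})"
definition [code del]:
  "open (U :: 'a bop set) \<longleftrightarrow> (\<forall>x\<in>U. eventually (\<lambda>(x', y). x' = x \<longrightarrow> y \<in> U) uniformity)"

lemma rep_simps [simp]:
  "rep (0 :: 'a bop) = 0" "rep (1 :: 'a bop) = id_blinfun"
  "rep (x + y) = rep x + rep (y :: 'a bop)" "rep (x - y) = rep x - rep y" "rep (- x) = - rep x"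
  "rep (r *\<^sub>R x) = r *\<^sub>R rep x" "rep (x * y) = rep x o\<^sub>L rep y" "rep (star x) = adj (rep x)"
  by (simp_all add: zero_bop_def one_bop_def plus_bop_def minus_bop_def uminus_bop_def scaleR_bop_def
      times_bop_def star_bop_def bop_inverse bounded_ops_closed adj_bounded_ops rep)

lemma cinner_star: "cinner (rep x \<xi>) \<eta> = cinner \<xi> (rep (star x) \<eta>)"
  for x :: "'a bop" by (simp add: cinner_adj rep)

lemma bop_eqI: "(\<And>\<xi>. rep x \<xi> = rep y \<xi>) \<Longrightarrow> x = y" for x y :: "'a bop"
  by (metis rep_inject blinfun_eqI)

lemma star_eqI: "(\<And>\<xi> \<eta>. cinner (rep x \<xi>) \<eta> = cinner \<xi> (rep y \<eta>)) \<Longrightarrow> star x = y" for x y :: "'a bop"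
  by (rule bop_eqI, rule cinner_eqI) (metis cinner_star)

instance
proof
  fix x y z :: "'a bop" and r s :: real
  show "dist x y = norm (x - y)" by (simp add: dist_bop_def norm_bop_def dist_norm)
  show "x + y + z = x + (y + z)" "x + y = y + x" "0 + x = x" "- x + x = 0" "x - y = x + - y"
    by (simp_all flip: rep_inject)
  show "r *\<^sub>R (x + y) = r *\<^sub>R x + r *\<^sub>R y" "(r + s) *\<^sub>R x = r *\<^sub>R x + s *\<^sub>R x" "r *\<^sub>R s *\<^sub>R x = (r * s) *\<^sub>R x"
    "1 *\<^sub>R x = x"
    by (simp_all add: algebra_simps flip: rep_inject)
  show "sgn x = inverse (norm x) *\<^sub>R x" by (rule sgn_bop_def)
  show "uniformity = (INF e\<in>{0 <..}. principal {(x, y :: 'a bop). dist x y < e})" by (rule uniformity_bop_def)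
  show "open U \<longleftrightarrow> (\<forall>x\<in>U. eventually (\<lambda>(x', y). x' = x \<longrightarrow> y \<in> U) uniformity)" for U :: "'a bop set"
    by (rule open_bop_def)
  show "norm x = 0 \<longleftrightarrow> x = 0" by (simp add: norm_bop_def flip: rep_inject)
  show "norm (x + y) \<le> norm x + norm y" by (simp add: norm_bop_def norm_triangle_ineq)
  show "norm (r *\<^sub>R x) = \<bar>r\<bar> * norm x" by (simp add: norm_bop_def)
  show "x * y * z = x * (y * z)"
    by (rule bop_eqI) simp
  show "(x + y) * z = x * z + y * z" "x * (y + z) = x * y + x * z"
    by (rule bop_eqI, simp add: blinfun.add_left blinfun.add_right)+
  show "r *\<^sub>R x * y = r *\<^sub>R (x * y)" "x * r *\<^sub>R y = r *\<^sub>R (x * y)"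
    by (rule bop_eqI, simp add: blinfun.scaleR_left blinfun.scaleR_right)+
  show "norm (x * y) \<le> norm x * norm y" by (simp add: norm_bop_def norm_blinfun_compose)
  show "1 * x = x" "x * 1 = x" by (rule bop_eqI, simp)+
  show "star (star x) = x"
    by (rule star_eqI) (metis cinner_commute cinner_star)
  show "star (x + y) = star x + star y"
    by (rule star_eqI) (simp add: cinner_simps cinner_star blinfun.add_left del: rep_simps(8))
  show "star (x * y) = star y * star x"
    by (rule star_eqI) (simp add: cinner_star del: rep_simps(8))
  show "star (r *\<^sub>R x) = r *\<^sub>R star x"
    by (rule star_eqI) (simp add: cinner_simps cinner_star blinfun.scaleR_left del: rep_simps(8))
qed

end

text \<open>Unfolding to \<open>adj\<close> would take \<open>star\<close> out of reach of its
  algebraic rules.\<close>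

declare rep_simps(8) [simp del]

lemma cinner_star': "cinner \<xi> (rep x \<eta>) = cinner (rep (star x) \<xi>) \<eta>"
  by (metis cinner_star star_star)

lemma rep_scaleC: "rep x (c *\<^sub>C \<xi>) = c *\<^sub>C rep x \<xi>"
  using rep[of x] by (simp add: bounded_ops_def)

lemmas rep_linear = blinfun.add_right blinfun.diff_right blinfun.scaleR_right blinfun.minus_right
  blinfun.zero_right

instance bop :: (chilbert_space) banach
proof
  fix X :: "nat \<Rightarrow> 'a bop" assume "Cauchy X"
  then have "Cauchy (\<lambda>n. rep (X n))" by (simp add: Cauchy_def dist_bop_def)
  then obtain L where L: "(\<lambda>n. rep (X n)) \<longlonglongrightarrow> L"
    using Cauchy_convergent_iff convergent_def by blast
  have app: "(\<lambda>n. rep (X n) \<xi>) \<longlonglongrightarrow> L \<xi>" for \<xi>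
    by (rule blinfun.tendsto[OF L tendsto_const])
  have "L \<in> bounded_ops"
    unfolding bounded_ops_def
  proof (intro CollectI allI)
    fix c \<xi>
    have "(\<lambda>n. c *\<^sub>C rep (X n) \<xi>) \<longlonglongrightarrow> c *\<^sub>C L \<xi>"
      by (rule bounded_linear.tendsto[OF bounded_linear_scaleC app])
    then show "L (c *\<^sub>C \<xi>) = c *\<^sub>C L \<xi>"
      using app[of "c *\<^sub>C \<xi>"] LIMSEQ_unique by (simp add: rep_scaleC) blast
  qed
  then have "X \<longlonglongrightarrow> bop L"
    using L by (simp add: tendsto_iff dist_bop_def bop_inverse)
  then show "convergent X" by (auto simp: convergent_def)
qed

definition sc :: "complex \<Rightarrow> 'h::chilbert_space bop"
  where "sc c = bop (scalar_op c)"

lemma rep_sc [simp]: "rep (sc c) = scalar_op c"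
  by (simp add: sc_def bop_inverse bounded_ops_closed)

lemma sc_commute: "sc c * x = x * sc c"
  by (rule bop_eqI) (simp add: rep_scaleC)

lemma star_sc [simp]: "star (sc c) = sc (cnj c)"
  by (rule star_eqI) (simp add: cinner_scaleC_left cinner_scaleC_right)

lemma sc_add: "sc (c + d) = sc c + sc d"
  by (rule bop_eqI) (simp add: scaleC_add_left blinfun.add_left)

lemma sc_mult: "sc (c * d) = sc c * sc d"
  by (rule bop_eqI) (simp add: scaleC_scaleC)

lemma sc_of_real: "sc (of_real r) = r *\<^sub>R 1"
  by (rule bop_eqI) (simp add: scaleC_of_real blinfun.scaleR_left)

lemma sc_eq: "sc c = Re c *\<^sub>R 1 + Im c *\<^sub>R sc \<i>"
proof -
  have "c = of_real (Re c) + of_real (Im c) * \<i>" by (simp add: complex_eq_iff)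
  then have "sc c = sc (of_real (Re c)) + sc (of_real (Im c)) * sc \<i>"
    by (metis sc_add sc_mult)
  then show ?thesis unfolding sc_of_real by simp
qed

lemma norm_rep_le: "norm (rep x \<xi>) \<le> norm x * norm \<xi>"
  by (simp add: norm_bop_def norm_blinfun)

lemma norm_bop_le: "0 \<le> C \<Longrightarrow> (\<And>\<xi>. norm (rep x \<xi>) \<le> C * norm \<xi>) \<Longrightarrow> norm x \<le> C"
  unfolding norm_bop_def by (rule norm_blinfun_bound) auto

definition form :: "'h::chilbert_space bop \<Rightarrow> 'h \<Rightarrow> real"
  where "form x \<xi> = Re (cinner (rep x \<xi>) \<xi>)"

lemma form_simps [simp]:
  "form (x + y) \<xi> = form x \<xi> + form y \<xi>" "form (x - y) \<xi> = form x \<xi> - form y \<xi>"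
  "form (- x) \<xi> = - form x \<xi>" "form (r *\<^sub>R x) \<xi> = r * form x \<xi>"
  "form 1 \<xi> = (norm \<xi>)\<^sup>2" "form 0 \<xi> = 0"
  by (simp_all add: form_def cinner_simps blinfun.add_left blinfun.diff_left blinfun.minus_left
      blinfun.scaleR_left norm_sq_cinner)

lemma form_conj: "form (star y * x * y) \<xi> = form x (rep y \<xi>)"
  by (simp add: form_def cinner_star')

lemma form_star_mult: "form (star x * x) \<xi> = (norm (rep x \<xi>))\<^sup>2"
  by (simp add: form_def cinner_star' norm_sq_cinner)

lemma form_le: "form x \<xi> \<le> norm x * (norm \<xi>)\<^sup>2"
proof -
  have "form x \<xi> \<le> norm (rep x \<xi>) * norm \<xi>"
    using Re_cinner_cauchy_schwarz[of "rep x \<xi>" \<xi>] by (simp add: form_def)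
  also have "\<dots> \<le> (norm x * norm \<xi>) * norm \<xi>" by (intro mult_right_mono norm_rep_le) simp
  finally show ?thesis by (simp add: power2_eq_square mult.assoc)
qed

lemma form_eqI:
  assumes sa: "star x = x" "star y = y" and eq: "\<And>\<xi>. form x \<xi> = form y \<xi>"
  shows "x = y"
proof -
  define z where "z = x - y"
  have z: "star z = z" "\<And>\<xi>. form z \<xi> = 0" using sa eq by (simp_all add: z_def)
  have "Re (cinner (rep z \<xi>) \<eta>) = 0" for \<xi> \<eta>
  proof -
    have "form z (\<xi> + \<eta>) = form z \<xi> + form z \<eta> + Re (cinner (rep z \<xi>) \<eta>) + Re (cinner (rep z \<eta>) \<xi>)"
      by (simp add: form_def rep_linear cinner_simps)
    moreover have "Re (cinner (rep z \<eta>) \<xi>) = Re (cinner (rep z \<xi>) \<eta>)"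
      using cinner_star[of z \<eta> \<xi>] z(1) Re_cinner_commute[of \<eta> "rep z \<xi>"] by simp
    ultimately show ?thesis using z(2) by simp
  qed
  then have "rep z \<xi> = 0" for \<xi> by (intro cinner_eqI) (simp add: Re_cinner_commute)
  then have "z = 0" by (intro bop_eqI) simp
  then show ?thesis by (simp add: z_def)
qed

lemma real_square_le_cancel: "x * x \<le> c * x \<Longrightarrow> 0 \<le> c \<Longrightarrow> x \<le> (c :: real)"
  by (cases "x \<le> 0") auto

text \<open>Polarisation bounds the bilinear form by the quadratic one; testing it at multiples of
  the image of the vector gives the norm.\<close>

lemma norm_self_adjoint_le:
  assumes sa: "star x = x" and le: "\<And>\<xi>. \<bar>form x \<xi>\<bar> \<le> C * (norm \<xi>)\<^sup>2" and C: "0 \<le> C"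
  shows "norm x \<le> C"
proof (rule norm_bop_le[OF C])
  fix \<xi>
  have pol: "4 * Re (cinner (rep x \<xi>) \<eta>) \<le> 2 * C * ((norm \<xi>)\<^sup>2 + (norm \<eta>)\<^sup>2)" for \<eta>
  proof -
    have s: "Re (cinner (rep x \<eta>) \<xi>) = Re (cinner (rep x \<xi>) \<eta>)"
      using cinner_star[of x \<eta> \<xi>] sa Re_cinner_commute[of \<eta> "rep x \<xi>"] by simp
    have "form x (\<xi> + \<eta>) - form x (\<xi> - \<eta>) = 4 * Re (cinner (rep x \<xi>) \<eta>)"
      using s by (simp add: form_def rep_linear cinner_simps)
    moreover have "form x (\<xi> + \<eta>) - form x (\<xi> - \<eta>) \<le> C * ((norm (\<xi> + \<eta>))\<^sup>2 + (norm (\<xi> - \<eta>))\<^sup>2)"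
      unfolding distrib_left using le[of "\<xi> + \<eta>"] le[of "\<xi> - \<eta>"] by linarith
    moreover have "(norm (\<xi> + \<eta>))\<^sup>2 + (norm (\<xi> - \<eta>))\<^sup>2 = 2 * ((norm \<xi>)\<^sup>2 + (norm \<eta>)\<^sup>2)"
      unfolding norm_sq_cinner by (simp add: cinner_simps)
    then have "C * ((norm (\<xi> + \<eta>))\<^sup>2 + (norm (\<xi> - \<eta>))\<^sup>2) = 2 * C * ((norm \<xi>)\<^sup>2 + (norm \<eta>)\<^sup>2)"
      by (simp only:)
    ultimately show ?thesis by linarith
  qed
  have "(Re (cinner (rep x \<xi>) (rep x \<xi>)))\<^sup>2 \<le> (C * (norm \<xi>)\<^sup>2) * (C * (norm (rep x \<xi>))\<^sup>2)"
  proof (rule quadratic_nonneg_imp)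
    fix t :: real
    have "4 * (- t * Re (cinner (rep x \<xi>) (rep x \<xi>))) \<le>
        2 * C * ((norm \<xi>)\<^sup>2 + (t * norm (rep x \<xi>))\<^sup>2)"
      using pol[of "(- t) *\<^sub>R rep x \<xi>"] by (simp add: cinner_simps power_mult_distrib)
    then show "0 \<le> C * (norm \<xi>)\<^sup>2 + 2 * t * Re (cinner (rep x \<xi>) (rep x \<xi>)) +
        t\<^sup>2 * (C * (norm (rep x \<xi>))\<^sup>2)"
      by (simp add: algebra_simps power_mult_distrib)
  qed (use C in simp)
  then have "((norm (rep x \<xi>))\<^sup>2)\<^sup>2 \<le> (C * norm \<xi> * norm (rep x \<xi>))\<^sup>2"
    unfolding norm_sq_cinner[symmetric] by (simp only: power2_eq_square mult_ac)
  then have "(norm (rep x \<xi>))\<^sup>2 \<le> C * norm \<xi> * norm (rep x \<xi>)"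
    by (rule power2_le_imp_le) (use C in simp)
  then have "norm (rep x \<xi>) * norm (rep x \<xi>) \<le> (C * norm \<xi>) * norm (rep x \<xi>)"
    by (simp only: power2_eq_square)
  then show "norm (rep x \<xi>) \<le> C * norm \<xi>"
    by (rule real_square_le_cancel) (use C in simp)
qed

subsection \<open>Positive operators\<close>

text \<open>Self-adjointness is demanded separately, because \<open>form\<close> is only a real part
  and does not detect the skew part.\<close>

definition posop :: "'h::chilbert_space bop \<Rightarrow> bool"
  where "posop x \<longleftrightarrow> star x = x \<and> (\<forall>\<xi>. 0 \<le> form x \<xi>)"

lemma posopD: "posop x \<Longrightarrow> star x = x" "posop x \<Longrightarrow> 0 \<le> form x \<xi>"
  by (auto simp: posop_def)

lemma posop_add: "posop x \<Longrightarrow> posop y \<Longrightarrow> posop (x + y)"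
  by (simp add: posop_def)

lemma posop_scaleR: "posop x \<Longrightarrow> 0 \<le> r \<Longrightarrow> posop (r *\<^sub>R x)"
  by (simp add: posop_def)

lemma posop_one: "posop 1"
  by (simp add: posop_def)

lemma posop_zero: "posop 0"
  by (simp add: posop_def)

lemma posop_conj: "posop x \<Longrightarrow> posop (star y * x * y)"
  unfolding posop_def form_conj by (simp add: mult.assoc)

lemma posop_star_mult: "posop (star x * x)"
  by (simp add: posop_def form_star_mult)

lemma posop_bound: "star x = x \<Longrightarrow> norm x \<le> c \<Longrightarrow> posop (c *\<^sub>R 1 - x)"
proof -
  assume x: "star x = x" "norm x \<le> c"
  have "form x \<xi> \<le> c * (norm \<xi>)\<^sup>2" for \<xi>
    using form_le[of x \<xi>] mult_right_mono[OF x(2), of "(norm \<xi>)\<^sup>2"] by simp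
  then show ?thesis using x by (simp add: posop_def)
qed

lemma posop_norm_le:
  assumes "posop x" "posop (c *\<^sub>R 1 - x)" "0 \<le> c" shows "norm x \<le> c"
proof (rule norm_self_adjoint_le)
  show "\<bar>form x \<xi>\<bar> \<le> c * (norm \<xi>)\<^sup>2" for \<xi>
    using posopD(2)[OF assms(1), of \<xi>] posopD(2)[OF assms(2), of \<xi>] by simp
qed (use assms in \<open>simp_all add: posopD\<close>)

lemma norm_le_posop: "posop ((C\<^sup>2) *\<^sub>R 1 - star x * x) \<Longrightarrow> 0 \<le> C \<Longrightarrow> norm x \<le> C"
proof (rule norm_bop_le)
  fix \<xi> assume p: "posop ((C\<^sup>2) *\<^sub>R 1 - star x * x)" and C: "0 \<le> C"
  have "(norm (rep x \<xi>))\<^sup>2 \<le> (C * norm \<xi>)\<^sup>2"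
    using posopD(2)[OF p, of \<xi>] by (simp add: form_star_mult power_mult_distrib)
  then show "norm (rep x \<xi>) \<le> C * norm \<xi>" by (rule power2_le_imp_le) (use C in simp)
qed

lemma posop_norm_sq: "posop ((norm x)\<^sup>2 *\<^sub>R 1 - star x * x)"
proof -
  have "(norm (rep x \<xi>))\<^sup>2 \<le> (norm x)\<^sup>2 * (norm \<xi>)\<^sup>2" for \<xi>
    using power_mono[OF norm_rep_le[of x \<xi>], of 2] by (simp add: power_mult_distrib)
  then show ?thesis by (simp add: posop_def form_star_mult)
qed

lemma norm_star_bop: "norm (star x) = norm (x :: 'h::chilbert_space bop)"
proof -
  have le: "norm (star x) \<le> norm x" for x :: "'h bop"
  proof (rule norm_bop_le)
    fix \<xi>
    have "(norm (rep (star x) \<xi>))\<^sup>2 = Re (cinner (rep x (rep (star x) \<xi>)) \<xi>)"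
      by (simp add: norm_sq_cinner cinner_star)
    also have "\<dots> \<le> norm (rep x (rep (star x) \<xi>)) * norm \<xi>"
      using Re_cinner_cauchy_schwarz[of "rep x (rep (star x) \<xi>)" \<xi>] by simp
    also have "\<dots> \<le> (norm x * norm (rep (star x) \<xi>)) * norm \<xi>"
      by (intro mult_right_mono norm_rep_le) simp
    finally have "norm (rep (star x) \<xi>) * norm (rep (star x) \<xi>) \<le> (norm x * norm \<xi>) * norm (rep (star x) \<xi>)"
      by (simp only: power2_eq_square mult_ac)
    then show "norm (rep (star x) \<xi>) \<le> norm x * norm \<xi>"
      by (rule real_square_le_cancel) simp
  qed simp
  show ?thesis using le[of x] le[of "star x"] by simp
qed

subsection \<open>Square roots and inverses\<close>

primrec sqrt_seq :: "real \<Rightarrow> nat \<Rightarrow> real" where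
  "sqrt_seq a 0 = 0"
| "sqrt_seq a (Suc n) = (a + (sqrt_seq a n)\<^sup>2) / 2"

lemma sqrt_seq_one: "0 \<le> sqrt_seq 1 n" "sqrt_seq 1 n \<le> 1" "sqrt_seq 1 n \<le> sqrt_seq 1 (Suc n)"
proof -
  show 0: "0 \<le> sqrt_seq 1 n" for n by (induction n) auto
  show 1: "sqrt_seq 1 n \<le> 1"
  proof (induction n)
    case (Suc n)
    then have "(sqrt_seq 1 n)\<^sup>2 \<le> 1" using 0 by (simp add: power_le_one)
    then show ?case by simp
  qed simp
  show "sqrt_seq 1 n \<le> sqrt_seq 1 (Suc n)"
    using zero_le_power2[of "sqrt_seq 1 n - 1"] by (simp add: power2_eq_square algebra_simps)
qed

text \<open>
  The iteration \<open>b \<mapsto> (a + b\<^sup>2) / 2\<close> for \<open>a = 1 - p\<close> converges to \<open>1 - \<surd>p\<close>; in norm it is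
  majorised by the scalar iteration for \<open>a = 1\<close>.
\<close>

primrec sqrt_iter :: "'a::real_normed_algebra \<Rightarrow> nat \<Rightarrow> 'a" where
  "sqrt_iter a 0 = 0"
| "sqrt_iter a (Suc n) = (1/2) *\<^sub>R (a + sqrt_iter a n * sqrt_iter a n)"

lemma sqrt_exists_unit:
  fixes p :: "'h::chilbert_space bop"
  assumes sa: "star p = p" and p: "norm (1 - p) \<le> 1"
  shows "\<exists>r. posop r \<and> r * r = p \<and> (\<forall>c. c * p = p * c \<longrightarrow> c * r = r * c)"
proof -
  define a where "a = 1 - p"
  define B where "B = sqrt_iter a"
  have B0: "B 0 = 0" and BS: "B (Suc n) = (1/2) *\<^sub>R (a + B n * B n)" for n by (simp_all add: B_def)
  have comm: "c * B n = B n * c" if "c * a = a * c" for c n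
  proof (induction n)
    case (Suc n)
    have "c * (B n * B n) = B n * B n * c" using Suc by (metis mult.assoc)
    then show ?case using that by (simp add: BS distrib_left distrib_right)
  qed (simp add: B0)
  have Ba: "B n * a = a * B n" for n using comm[of a n] by simp
  have BB: "B n * B m = B m * B n" for n m using comm[OF Ba] by simp
  have Bsa: "star (B n) = B n" for n by (induction n) (simp_all add: B0 BS a_def sa)
  have a1: "norm a \<le> 1" using p by (simp add: a_def)
  have bound: "norm (B n) \<le> sqrt_seq 1 n" for n
  proof (induction n)
    case (Suc n)
    have "norm (a + B n * B n) \<le> norm a + norm (B n) * norm (B n)"
      by (meson norm_triangle_ineq norm_mult_ineq add_left_mono order_trans)
    also have "\<dots> \<le> 1 + sqrt_seq 1 n * sqrt_seq 1 n"
      using Suc a1 sqrt_seq_one(1)[of n] by (intro add_mono mult_mono) auto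
    finally show ?case by (simp add: BS power2_eq_square)
  qed (simp add: B0)
  \<comment> \<open>The iterates commute, so a difference of squares factorises and its norm is
    bounded by the corresponding factors of the scalar iteration.\<close>
  have step: "norm (B (Suc n) - B n) \<le> sqrt_seq 1 (Suc n) - sqrt_seq 1 n" for n
  proof (induction n)
    case 0
    then show ?case using a1 by (simp add: BS B0)
  next
    case (Suc n)
    have "B (Suc (Suc n)) - B (Suc n) = (1/2) *\<^sub>R (B (Suc n) * B (Suc n) - B n * B n)"
      unfolding BS[of "Suc n"] by (subst (3) BS) (simp add: algebra_simps)
    also have "B (Suc n) * B (Suc n) - B n * B n = (B (Suc n) + B n) * (B (Suc n) - B n)"
      using BB[of "Suc n" n] by (simp add: algebra_simps)
    finally have "norm (B (Suc (Suc n)) - B (Suc n)) \<le>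
        (1/2) * (norm (B (Suc n) + B n) * norm (B (Suc n) - B n))"
      by (simp add: norm_mult_ineq)
    also have "\<dots> \<le> (1/2) * ((sqrt_seq 1 (Suc n) + sqrt_seq 1 n) * (sqrt_seq 1 (Suc n) - sqrt_seq 1 n))"
      using Suc bound[of n] bound[of "Suc n"] norm_triangle_ineq[of "B (Suc n)" "B n"]
      by (intro mult_left_mono mult_mono) (auto intro: order_trans[OF _ add_mono] add_nonneg_nonneg
          order_trans[OF norm_ge_zero])
    also have "\<dots> = sqrt_seq 1 (Suc (Suc n)) - sqrt_seq 1 (Suc n)"
      by (simp add: power2_eq_square field_simps)
    finally show ?case .
  qed
  have far: "norm (B m - B n) \<le> sqrt_seq 1 m - sqrt_seq 1 n" if "n \<le> m" for n m
    using that
  proof (induction m rule: dec_induct)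
    case (step m)
    then show ?case
      using \<open>norm (B (Suc m) - B m) \<le> _\<close> norm_triangle_ineq[of "B (Suc m) - B m" "B m - B n"] by simp
  qed simp
  have "incseq (sqrt_seq 1)" using sqrt_seq_one(3) by (rule incseq_SucI)
  then have "convergent (sqrt_seq 1)"
    using incseq_convergent[of "sqrt_seq 1" 1] sqrt_seq_one(2) convergent_def by metis
  then have cs: "Cauchy (sqrt_seq 1)" by (rule convergent_Cauchy)
  have "Cauchy B"
  proof (rule metric_CauchyI)
    fix e :: real assume "e > 0"
    then obtain k where k: "\<And>m n. m \<ge> k \<Longrightarrow> n \<ge> k \<Longrightarrow> dist (sqrt_seq 1 m) (sqrt_seq 1 n) < e"
      using metric_CauchyD[OF cs] by blast
    have "dist (B m) (B n) < e" if "m \<ge> k" "n \<ge> k" for m n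
      using far[of n m] far[of m n] k[OF that]
      by (cases "n \<le> m") (auto simp: dist_norm norm_minus_commute)
    then show "\<exists>k. \<forall>m\<ge>k. \<forall>n\<ge>k. dist (B m) (B n) < e" by blast
  qed
  then obtain b where b: "B \<longlonglongrightarrow> b" using Cauchy_convergent_iff convergent_def by blast
  have "(\<lambda>n. (1/2) *\<^sub>R (a + B n * B n)) \<longlonglongrightarrow> (1/2) *\<^sub>R (a + b * b)" by (intro tendsto_intros b)
  moreover have "(\<lambda>n. (1/2) *\<^sub>R (a + B n * B n)) \<longlonglongrightarrow> b" using LIMSEQ_Suc[OF b] by (simp add: BS)
  ultimately have fix_b: "b = (1/2) *\<^sub>R (a + b * b)" using LIMSEQ_unique by blast
  have b1: "norm b \<le> 1"
    by (rule LIMSEQ_le_const2[OF tendsto_norm[OF b]]) (use bound sqrt_seq_one(2) in \<open>meson order_trans\<close>)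
  have star_lin: "bounded_linear (star :: 'h bop \<Rightarrow> 'h bop)"
    by (rule bounded_linear_intro[where K = 1]) (simp_all add: norm_star_bop)
  have bsa: "star b = b"
    using LIMSEQ_unique[OF bounded_linear.tendsto[OF star_lin b], of b] b by (simp add: Bsa)
  have "2 *\<^sub>R b = a + b * b" by (subst fix_b) simp
  then have "(1 - b) * (1 - b) = p"
    by (simp add: algebra_simps a_def scaleR_2)
  moreover have "posop (1 - b)" using posop_bound[OF bsa b1] by simp
  moreover have "c * (1 - b) = (1 - b) * c" if c: "c * p = p * c" for c
  proof -
    have "c * a = a * c" using c by (simp add: a_def algebra_simps)
    then have cB: "c * B n = B n * c" for n by (rule comm)
    have "(\<lambda>n. c * B n) \<longlonglongrightarrow> c * b" "(\<lambda>n. B n * c) \<longlonglongrightarrow> b * c" by (intro tendsto_intros b)+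
    then have "c * b = b * c" using LIMSEQ_unique cB by auto
    then show ?thesis by (simp add: algebra_simps)
  qed
  ultimately show ?thesis by blast
qed

text \<open>Dividing by \<open>norm p + 1\<close> puts the operator between 0 and 1, where the
  iteration applies.\<close>

lemma posop_sqrt:
  assumes p: "posop p"
  obtains r where "posop r" "r * r = p" "\<And>c. c * p = p * c \<Longrightarrow> c * r = r * c"
proof -
  define k where "k = norm p + 1"
  have k: "0 < k" "norm p \<le> k" by (auto simp: k_def add_nonneg_pos)
  let ?q = "(1 / k) *\<^sub>R p"
  have q: "star ?q = ?q" using posopD(1)[OF p] by simp
  have "norm (1 - ?q) \<le> 1"
  proof (rule posop_norm_le)
    have "1 - ?q = (1 / k) *\<^sub>R (k *\<^sub>R 1 - p)" using k by (simp add: scaleR_diff_right)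
    then show "posop (1 - ?q)"
      using posop_scaleR[OF posop_bound[OF posopD(1)[OF p] k(2)], of "1 / k"] k by simp
    show "posop (1 *\<^sub>R 1 - (1 - ?q))" using posop_scaleR[OF p, of "1 / k"] k by simp
  qed simp
  then obtain r where r: "posop r" "r * r = ?q" "\<And>c. c * ?q = ?q * c \<Longrightarrow> c * r = r * c"
    using sqrt_exists_unit[OF q] by blast
  show thesis
  proof
    show "posop (sqrt k *\<^sub>R r)" using posop_scaleR[OF r(1)] k by simp
    show "sqrt k *\<^sub>R r * sqrt k *\<^sub>R r = p" using r(2) k by simp
    show "c * sqrt k *\<^sub>R r = sqrt k *\<^sub>R r * c" if "c * p = p * c" for c using r(3)[of c] that by simp
  qed
qed

lemma posop_commuting_product:
  assumes "posop a" "posop b" "a * b = b * a" shows "posop (a * b)"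
proof -
  obtain h where h: "posop h" "h * h = b" "\<And>c. c * b = b * c \<Longrightarrow> c * h = h * c"
    using posop_sqrt[OF assms(2)] by metis
  have "a * b = h * a * h" using h(2) h(3)[OF assms(3)] by (metis mult.assoc)
  then show ?thesis using posop_conj[OF assms(1), of h] posopD(1)[OF h(1)] by simp
qed

text \<open>After scaling by \<open>k\<close>, the operator differs from 1 by some \<open>z\<close>
  with norm at most \<open>1 - e / k\<close>; the inverse is the fixed point of \<open>x\<close>
  mapped to \<open>1 + z * x\<close>.\<close>

lemma posop_inverse:
  fixes m :: "'h::chilbert_space bop"
  assumes m: "posop m" and e: "0 < e"
  obtains h where "posop h" "h * (m + e *\<^sub>R 1) = 1" "(m + e *\<^sub>R 1) * h = 1"
    "\<And>c. c * m = m * c \<Longrightarrow> c * h = h * c"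
proof -
  define k where "k = norm m + e"
  have k: "0 < k" using e by (simp add: k_def add_nonneg_pos)
  define z where "z = 1 - (1 / k) *\<^sub>R (m + e *\<^sub>R 1)"
  have "e \<le> k" by (simp add: k_def)
  have zsa: "star z = z" using posopD(1)[OF m] by (simp add: z_def)
  have "norm z \<le> 1 - e / k"
  proof (rule norm_self_adjoint_le[OF zsa])
    show "0 \<le> 1 - e / k" using k \<open>e \<le> k\<close> by simp
    fix \<xi>
    have f: "form z \<xi> = (norm \<xi>)\<^sup>2 - (form m \<xi> + e * (norm \<xi>)\<^sup>2) / k"
      by (simp add: z_def algebra_simps add_divide_distrib)
    have "form m \<xi> + e * (norm \<xi>)\<^sup>2 \<le> k * (norm \<xi>)\<^sup>2"
      using form_le[of m \<xi>] by (simp add: k_def algebra_simps)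
    then have "0 \<le> form z \<xi>" unfolding f using k by (simp add: field_simps)
    moreover have "form z \<xi> \<le> (1 - e / k) * (norm \<xi>)\<^sup>2"
      unfolding f using k posopD(2)[OF m, of \<xi>] by (simp add: field_simps)
    ultimately show "\<bar>form z \<xi>\<bar> \<le> (1 - e / k) * (norm \<xi>)\<^sup>2" by simp
  qed
  moreover have "1 - e / k < 1" using e k by simp
  ultimately have z1: "norm z < 1" by linarith
  have "dist (1 + z * x) (1 + z * y) \<le> norm z * dist x y" for x y
    by (simp add: dist_norm norm_mult_ineq flip: right_diff_distrib)
  then have "\<exists>!x. 1 + z * x = x" using z1 by (intro banach_fix_type[of "norm z"]) auto
  then obtain x where "1 + z * x = x" by blast
  then have x: "(1 - z) * x = 1" by (simp add: algebra_simps)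
  have x': "star x * (1 - z) = 1" using arg_cong[OF x, of star] zsa by simp
  have xsa: "star x = x"
  proof -
    have "star x = star x * ((1 - z) * x)" using x by simp
    also have "\<dots> = x" using x' by (simp flip: mult.assoc)
    finally show ?thesis .
  qed
  have zm: "1 - z = (1 / k) *\<^sub>R (m + e *\<^sub>R 1)" by (simp add: z_def)
  define h where "h = (1 / k) *\<^sub>R x"
  have h1: "(m + e *\<^sub>R 1) * h = 1" using x by (simp add: h_def zm)
  have h2: "h * (m + e *\<^sub>R 1) = 1" using x' by (simp add: h_def zm xsa)
  have hsa: "star h = h" by (simp add: h_def xsa)
  have "h = star h * (m + e *\<^sub>R 1) * h" using h2 hsa by simp
  then have "posop h"
    using posop_conj[OF posop_add[OF m posop_scaleR[OF posop_one, of e]], of h] e by simp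
  moreover have "c * h = h * c" if "c * m = m * c" for c
  proof -
    have "h * (c * (m + e *\<^sub>R 1)) * h = h * ((m + e *\<^sub>R 1) * c) * h"
      using that by (simp add: distrib_left distrib_right)
    then have "h * c * ((m + e *\<^sub>R 1) * h) = (h * (m + e *\<^sub>R 1)) * c * h" by (simp only: mult.assoc)
    then show ?thesis by (simp add: h1 h2)
  qed
  ultimately show thesis using that h1 h2 by blast
qed

lemma posop_resolvent_le:
  assumes m: "posop m" and h: "posop h" "(m + e *\<^sub>R 1) * h = 1" "h * (m + e *\<^sub>R 1) = 1" and e: "0 < e"
  shows "posop (m * h)" "posop (1 - m * h)" "m * h = 1 - e *\<^sub>R h" "norm (m * h) \<le> 1"
proof -
  show eq: "m * h = 1 - e *\<^sub>R h" using h(2) by (simp add: distrib_right algebra_simps)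
  have "h * m = 1 - e *\<^sub>R h" using h(3) by (simp add: distrib_left algebra_simps)
  then have "m * h = h * m" using eq by simp
  then show p: "posop (m * h)" using posop_commuting_product m h by blast
  show q: "posop (1 - m * h)" using posop_scaleR[OF h(1), of e] e by (simp add: eq)
  show "norm (m * h) \<le> 1" using posop_norm_le[OF p, of 1] q by simp
qed

lemma norm_square_self_adjoint: "star x = x \<Longrightarrow> norm (x * x) = (norm x)\<^sup>2" for x :: "'h::chilbert_space bop"
proof (rule antisym)
  assume x: "star x = x"
  show "norm (x * x) \<le> (norm x)\<^sup>2" by (simp add: power2_eq_square norm_mult_ineq)
  have "posop ((sqrt (norm (x * x)))\<^sup>2 *\<^sub>R 1 - star x * x)"
    using posop_bound[of "x * x" "norm (x * x)"] x by simp
  then have "norm x \<le> sqrt (norm (x * x))" by (rule norm_le_posop) simp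
  then show "(norm x)\<^sup>2 \<le> norm (x * x)" using real_le_rsqrt by (metis norm_ge_zero real_sqrt_le_iff real_sqrt_unique)
qed

text \<open>The modulus is the square root of \<open>x * x\<close>. That it dominates
  \<open>x\<close> and \<open>- x\<close> is shown for any self-adjoint \<open>y\<close> with the
  same square that commutes with it.\<close>

lemma abs_exists:
  fixes x :: "'h::chilbert_space bop"
  assumes x: "star x = x"
  obtains a where "posop a" "a * a = x * x" "\<And>c. c * (x * x) = x * x * c \<Longrightarrow> c * a = a * c"
    "posop (a - x)" "posop (a + x)"
proof -
  have "posop (x * x)" using posop_star_mult[of x] x by simp
  then obtain a where a: "posop a" "a * a = x * x" "\<And>c. c * (x * x) = x * x * c \<Longrightarrow> c * a = a * c"
    using posop_sqrt by metis
  have xa: "x * a = a * x" using a(3)[of x] by (simp add: mult.assoc)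
  have le: "form y \<xi> \<le> form a \<xi>" if y: "star y = y" "y * y = a * a" "y * a = a * y" for y \<xi>
  proof -
    have "form y \<xi> \<le> form a \<xi> + e * (norm \<xi>)\<^sup>2" if e: "0 < e" for e
    proof -
      obtain h where h: "posop h" "h * (a + e *\<^sub>R 1) = 1" "(a + e *\<^sub>R 1) * h = 1"
        "\<And>c. c * a = a * c \<Longrightarrow> c * h = h * c" using posop_inverse[OF a(1) e] by metis
      have yh: "y * h = h * y" using h(4) y(3) by simp
      have ah: "a * h = h * a" using h(4) by simp
      \<comment> \<open>A regularised sign of \<open>y\<close>: its square is that of
        \<open>a * h\<close>, so its norm is at most 1, and \<open>1 - k\<close> times
        \<open>a + e\<close> is a product of commuting positive operators.\<close>
      define k where "k = y * h"
      have ksa: "star k = k" using y(1) posopD(1)[OF h(1)] yh by (simp add: k_def)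
      have "k * k = (a * h) * (a * h)"
      proof -
        have "k * k = y * y * (h * h)" using yh by (simp add: k_def mult.assoc) (metis mult.assoc)
        also have "\<dots> = (a * h) * (a * h)" unfolding y(2) using ah by (metis mult.assoc)
        finally show ?thesis .
      qed
      then have "(norm k)\<^sup>2 \<le> 1 * 1"
        using norm_square_self_adjoint[OF ksa] norm_mult_ineq[of "a * h" "a * h"]
          posop_resolvent_le(4)[OF a(1) h(1,3,2) e]
        by (metis mult_mono norm_ge_zero order_trans zero_le_one)
      then have "norm k \<le> 1" using power2_le_imp_le[of "norm k" 1] by simp
      then have pk: "posop (1 - k)" using posop_bound[OF ksa, of 1] by simp
      have ky: "k * (a + e *\<^sub>R 1) = y" using h(2) by (simp add: k_def mult.assoc)
      have "posop (a + e *\<^sub>R 1)" using posop_add[OF a(1) posop_scaleR[OF posop_one, of e]] e by simp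
      then have "posop ((1 - k) * (a + e *\<^sub>R 1))"
      proof (rule posop_commuting_product[OF pk])
        have "k * a = a * k" unfolding k_def using y(3) ah by (metis mult.assoc)
        then show "(1 - k) * (a + e *\<^sub>R 1) = (a + e *\<^sub>R 1) * (1 - k)" by (simp add: algebra_simps)
      qed
      also have "(1 - k) * (a + e *\<^sub>R 1) = a + e *\<^sub>R 1 - y" using ky by (simp add: left_diff_distrib)
      finally show ?thesis using posopD(2)[of "a + e *\<^sub>R 1 - y" \<xi>] by simp
    qed
    then show ?thesis
    proof (cases "norm \<xi> = 0")
      case True
      then show ?thesis by (simp add: form_def)
    next
      case False
      then have n: "0 < (norm \<xi>)\<^sup>2" by simp
      show ?thesis
      proof (rule field_le_epsilon)
        fix d :: real assume "0 < d"
        then show "form y \<xi> \<le> form a \<xi> + d"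
          using \<open>\<And>e. 0 < e \<Longrightarrow> form y \<xi> \<le> form a \<xi> + e * (norm \<xi>)\<^sup>2\<close>[of "d / (norm \<xi>)\<^sup>2"] n by simp
      qed
    qed
  qed
  have "form x \<xi> \<le> form a \<xi>" "form (- x) \<xi> \<le> form a \<xi>" for \<xi>
    by (rule le; simp add: x a(2) xa)+
  then have "posop (a - x)" "posop (a + x)"
    unfolding posop_def using x posopD(1)[OF a(1)] by (simp_all add: le_diff_eq) (smt (verit))
  with a show thesis using that by blast
qed

section \<open>Strong limits\<close>

lemma posop_norm_form: "posop d \<Longrightarrow> (norm (rep d \<xi>))\<^sup>2 \<le> norm d * form d \<xi>"
proof -
  assume d: "posop d"
  obtain r where r: "posop r" "r * r = d" using posop_sqrt[OF d] by metis
  have sa: "star r = r" by (rule posopD[OF r(1)])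
  have "(norm (rep d \<xi>))\<^sup>2 \<le> (norm r * norm (rep r \<xi>))\<^sup>2"
    by (rule power_mono) (use norm_rep_le[of r "rep r \<xi>"] in \<open>simp_all flip: r(2)\<close>)
  also have "\<dots> = (norm r)\<^sup>2 * (norm (rep r \<xi>))\<^sup>2" by (rule power_mult_distrib)
  also have "\<dots> = norm d * form d \<xi>"
    using norm_square_self_adjoint[OF sa] form_star_mult[of r \<xi>] sa r(2) by simp
  finally show ?thesis .
qed

definition slim :: "(nat \<Rightarrow> 'h::chilbert_space bop) \<Rightarrow> 'h bop \<Rightarrow> bool"
  where "slim X x \<longleftrightarrow> (\<forall>\<xi>. (\<lambda>n. rep (X n) \<xi>) \<longlonglongrightarrow> rep x \<xi>)"

lemma slim_const: "slim (\<lambda>_. x) x"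
  by (simp add: slim_def)

lemma slim_diff: "slim X x \<Longrightarrow> slim Y y \<Longrightarrow> slim (\<lambda>n. X n - Y n) (x - y)"
  by (auto simp: slim_def blinfun.diff_left intro: tendsto_diff)

lemma slim_scaleR: "slim X x \<Longrightarrow> slim (\<lambda>n. r *\<^sub>R X n) (r *\<^sub>R x)"
  by (auto simp: slim_def blinfun.scaleR_left intro: tendsto_intros)

lemma slim_form: assumes "slim X x" shows "(\<lambda>n. form (X n) \<xi>) \<longlonglongrightarrow> form x \<xi>"
proof -
  have "bounded_linear (\<lambda>\<eta>. Re (cinner \<eta> \<xi>))"
  proof (rule bounded_linear_intro[where K = "norm \<xi>"])
    show "norm (Re (cinner \<eta> \<xi>)) \<le> norm \<eta> * norm \<xi>" for \<eta>
      using Re_cinner_cauchy_schwarz[of \<eta> \<xi>] by simp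
  qed (simp_all add: cinner_simps)
  then show ?thesis
    unfolding form_def by (rule bounded_linear.tendsto) (use assms in \<open>simp add: slim_def\<close>)
qed

lemma slim_star_eq:
  assumes x: "slim X x" and sa: "\<And>n. star (X n) = X n" shows "star x = x"
proof (rule star_eqI)
  fix \<xi> \<eta>
  have bl: "bounded_linear (\<lambda>\<zeta>. Re (cinner \<zeta> \<rho>))" for \<rho> :: 'a
  proof (rule bounded_linear_intro[where K = "norm \<rho>"])
    show "norm (Re (cinner \<zeta> \<rho>)) \<le> norm \<zeta> * norm \<rho>" for \<zeta>
      using Re_cinner_cauchy_schwarz[of \<zeta> \<rho>] by simp
  qed (simp_all add: cinner_simps)
  have re: "Re (cinner (rep x \<xi>) \<eta>) = Re (cinner \<xi> (rep x \<eta>))" for \<xi> \<eta>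
  proof (rule LIMSEQ_unique)
    show "(\<lambda>n. Re (cinner (rep (X n) \<xi>) \<eta>)) \<longlonglongrightarrow> Re (cinner (rep x \<xi>) \<eta>)"
      by (rule bounded_linear.tendsto[OF bl]) (use x in \<open>simp add: slim_def\<close>)
    have "(\<lambda>n. Re (cinner (rep (X n) \<eta>) \<xi>)) \<longlonglongrightarrow> Re (cinner (rep x \<eta>) \<xi>)"
      by (rule bounded_linear.tendsto[OF bl]) (use x in \<open>simp add: slim_def\<close>)
    moreover have "Re (cinner (rep (X n) \<eta>) \<xi>) = Re (cinner (rep (X n) \<xi>) \<eta>)" for n
      using cinner_star[of "X n" \<eta> \<xi>] sa[of n] Re_cinner_commute[of \<eta> "rep (X n) \<xi>"] by simp
    ultimately show "(\<lambda>n. Re (cinner (rep (X n) \<xi>) \<eta>)) \<longlonglongrightarrow> Re (cinner \<xi> (rep x \<eta>))"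
      using Re_cinner_commute[of "rep x \<eta>" \<xi>] by simp
  qed
  show "cinner (rep x \<xi>) \<eta> = cinner \<xi> (rep x \<eta>)"
  proof (rule complex_eqI[OF re])
    show "Im (cinner (rep x \<xi>) \<eta>) = Im (cinner \<xi> (rep x \<eta>))"
      using re[of "\<i> *\<^sub>C \<xi>" \<eta>] by (simp add: rep_scaleC Re_ii_scaleC)
  qed
qed

lemma slim_posop:
  assumes "slim X x" "\<And>n. n \<ge> k \<Longrightarrow> posop (X n)" shows "posop x"
proof -
  have s: "slim (\<lambda>n. X (n + k)) x"
    using assms(1) unfolding slim_def by (auto intro: LIMSEQ_ignore_initial_segment)
  have "star x = x" by (rule slim_star_eq[OF s]) (use assms(2) in \<open>simp add: posopD\<close>)
  moreover have "0 \<le> form x \<xi>" for \<xi>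
    by (rule LIMSEQ_le_const[OF slim_form[OF s]]) (use assms(2) in \<open>auto simp: posopD\<close>)
  ultimately show ?thesis by (simp add: posop_def)
qed

lemma slim_commute:
  assumes "slim X x" "\<And>n. c * X n = X n * c" shows "c * x = x * c"
proof (rule bop_eqI)
  fix \<xi>
  have "(\<lambda>n. rep c (rep (X n) \<xi>)) \<longlonglongrightarrow> rep c (rep x \<xi>)"
    using assms(1) unfolding slim_def
    by (intro bounded_linear.tendsto[OF blinfun.bounded_linear_right]) blast
  moreover have "(\<lambda>n. rep (X n) (rep c \<xi>)) \<longlonglongrightarrow> rep x (rep c \<xi>)"
    using assms(1) unfolding slim_def by blast
  moreover have "rep c (rep (X n) \<xi>) = rep (X n) (rep c \<xi>)" for n
    using arg_cong[OF assms(2)[of n], of "\<lambda>y. rep y \<xi>"] by simp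
  ultimately show "rep (c * x) \<xi> = rep (x * c) \<xi>" using LIMSEQ_unique by simp
qed

lemma slim_exists:
  fixes X :: "nat \<Rightarrow> 'h::chilbert_space bop"
  assumes C: "\<And>n. norm (X n) \<le> C" and conv: "\<And>\<xi>. Cauchy (\<lambda>n. rep (X n) \<xi>)"
  obtains x where "slim X x" "norm x \<le> C"
proof -
  have C0: "0 \<le> C" using C[of 0] norm_ge_zero order_trans by blast
  obtain f where f: "\<And>\<xi>. (\<lambda>n. rep (X n) \<xi>) \<longlonglongrightarrow> f \<xi>"
  proof -
    have "\<forall>\<xi>. \<exists>l. (\<lambda>n. rep (X n) \<xi>) \<longlonglongrightarrow> l"
      using conv unfolding Cauchy_convergent_iff convergent_def by blast
    from choice[OF this] show thesis using that by blast
  qed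
  have bound: "norm (f \<xi>) \<le> C * norm \<xi>" for \<xi>
  proof (rule LIMSEQ_le_const2[OF tendsto_norm[OF f]])
    have "norm (rep (X n) \<xi>) \<le> C * norm \<xi>" for n
      using norm_rep_le[of "X n" \<xi>] mult_right_mono[OF C, of "norm \<xi>" n] by simp
    then show "\<exists>N. \<forall>n\<ge>N. norm (rep (X n) \<xi>) \<le> C * norm \<xi>" by blast
  qed
  have "f (\<xi> + \<eta>) = f \<xi> + f \<eta>" for \<xi> \<eta>
    by (rule LIMSEQ_unique[OF f[of "\<xi> + \<eta>"]]) (use tendsto_add[OF f[of \<xi>] f[of \<eta>]] in \<open>simp add: rep_linear\<close>)
  moreover have fC: "f (c *\<^sub>C \<xi>) = c *\<^sub>C f \<xi>" for c \<xi>
    by (rule LIMSEQ_unique[OF f[of "c *\<^sub>C \<xi>"]])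
      (use bounded_linear.tendsto[OF bounded_linear_scaleC f[of \<xi>], of c] in \<open>simp add: rep_scaleC\<close>)
  ultimately have "bounded_linear f"
    using bound by (intro bounded_linear_intro[where K = C]) (auto simp: mult.commute simp flip: scaleC_of_real)
  then have app: "blinfun_apply (Blinfun f) = f" by (rule bounded_linear_Blinfun_apply)
  then have r: "rep (bop (Blinfun f)) = Blinfun f"
    using fC by (simp add: bop_inverse bounded_ops_def)
  show thesis
  proof
    show "slim X (bop (Blinfun f))" using f by (simp add: slim_def r app)
    show "norm (bop (Blinfun f)) \<le> C" by (rule norm_bop_le) (use C0 bound in \<open>simp_all add: r app\<close>)
  qed
qed

lemma posop_trans: "posop (y - x) \<Longrightarrow> posop (z - y) \<Longrightarrow> posop (z - x)"
  using posop_add[of "y - x" "z - y"] by simp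

lemma monotone_posop:
  assumes "\<And>n. posop (X (Suc n) - X n)" "n \<le> m" shows "posop (X m - X n)"
  using assms(2)
proof (induction m rule: dec_induct)
  case base
  then show ?case by (simp add: posop_zero)
next
  case (step m)
  then show ?case using posop_trans[OF _ assms(1)[of m]] by blast
qed

text \<open>\<open>posop_norm_form\<close> turns convergence of the bounded monotone quadratic forms
  into convergence of vectors.\<close>

lemma monotone_slim:
  fixes X :: "nat \<Rightarrow> 'h::chilbert_space bop"
  assumes C: "\<And>n. norm (X n) \<le> C" and mono: "\<And>n. posop (X (Suc n) - X n)"
  obtains x where "slim X x" "norm x \<le> C" "\<And>n. posop (x - X n)"
proof -
  have C0: "0 \<le> C" using C[of 0] norm_ge_zero order_trans by blast
  have "Cauchy (\<lambda>n. rep (X n) \<xi>)" for \<xi>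
  proof -
    have inc: "incseq (\<lambda>n. form (X n) \<xi>)"
      using posopD(2)[OF mono] by (intro incseq_SucI) simp
    have "form (X n) \<xi> \<le> C * (norm \<xi>)\<^sup>2" for n
      using form_le[of "X n" \<xi>] mult_right_mono[OF C, of "(norm \<xi>)\<^sup>2" n] by simp
    then have "convergent (\<lambda>n. form (X n) \<xi>)"
      using incseq_convergent[OF inc] convergent_def by metis
    then have cf: "Cauchy (\<lambda>n. form (X n) \<xi>)" by (rule convergent_Cauchy)
    have le: "(norm (rep (X m) \<xi> - rep (X n) \<xi>))\<^sup>2 \<le> (2 * C) * (form (X m) \<xi> - form (X n) \<xi>)"
      if "n \<le> m" for n m
    proof -
      have p: "posop (X m - X n)" using monotone_posop[of X] mono that by blast
      have "norm (X m - X n) \<le> 2 * C"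
        using norm_triangle_ineq4[of "X m" "X n"] C[of m] C[of n] by linarith
      then have "norm (X m - X n) * form (X m - X n) \<xi> \<le> (2 * C) * form (X m - X n) \<xi>"
        using posopD(2)[OF p] by (intro mult_right_mono) auto
      then show ?thesis using posop_norm_form[OF p, of \<xi>] by (simp add: blinfun.diff_left)
    qed
    show ?thesis
    proof (rule metric_CauchyI)
      fix e :: real assume e: "0 < e"
      define e' where "e' = e\<^sup>2 / (2 * C + 1)"
      have "0 < e'" using e C0 by (simp add: e'_def)
      then obtain k where k: "\<And>m n. m \<ge> k \<Longrightarrow> n \<ge> k \<Longrightarrow> dist (form (X m) \<xi>) (form (X n) \<xi>) < e'"
        using metric_CauchyD[OF cf] by blast
      have *: "dist (rep (X m) \<xi>) (rep (X n) \<xi>) < e" if "m \<ge> k" "n \<ge> k" "n \<le> m" for m n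
      proof -
        have "form (X m) \<xi> - form (X n) \<xi> \<le> e'" using k[OF that(1,2)] by (simp add: dist_real_def)
        then have "(norm (rep (X m) \<xi> - rep (X n) \<xi>))\<^sup>2 \<le> (2 * C) * e'"
          using le[OF that(3)] C0 by (meson mult_left_mono order_trans zero_le_mult_iff zero_le_numeral)
        also have "\<dots> < (2 * C + 1) * e'" using \<open>0 < e'\<close> by (simp add: distrib_right)
        also have "\<dots> = e\<^sup>2" using C0 by (simp add: e'_def)
        finally show ?thesis using e unfolding dist_norm by (rule power2_less_imp_less[OF _ less_imp_le])
      qed
      have "dist (rep (X m) \<xi>) (rep (X n) \<xi>) < e" if "m \<ge> k" "n \<ge> k" for m n
        using *[of m n] *[of n m] that by (metis dist_commute nle_le)
      then show "\<exists>k. \<forall>m\<ge>k. \<forall>n\<ge>k. dist (rep (X m) \<xi>) (rep (X n) \<xi>) < e" by blast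
    qed
  qed
  then obtain x where x: "slim X x" "norm x \<le> C" by (rule slim_exists[of X C, OF C])
  have "posop (x - X n)" for n
  proof (rule slim_posop)
    show "slim (\<lambda>m. X m - X n) (x - X n)" by (rule slim_diff[OF x(1) slim_const])
    show "posop (X m - X n)" if "n \<le> m" for m using monotone_posop[of X] mono that by blast
  qed
  with x show thesis using that by blast
qed

subsection \<open>The resolvent at \<open>-1\<close>\<close>

text \<open>
  The map \<open>t \<mapsto> t / (1 + t)\<close> is operator monotone; it turns a sequence of positive operators of
  bounded trace into one that is bounded in norm.
\<close>

definition resolvent :: "'h::chilbert_space bop \<Rightarrow> 'h bop"
  where "resolvent t = (SOME h. posop h \<and> h * (t + 1) = 1 \<and> (t + 1) * h = 1 \<and>
    (\<forall>c. c * t = t * c \<longrightarrow> c * h = h * c))"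

definition cutoff :: "'h::chilbert_space bop \<Rightarrow> 'h bop"
  where "cutoff t = 1 - resolvent t"

lemma resolvent:
  assumes t: "posop t"
  shows "posop (resolvent t)" "resolvent t * (t + 1) = 1" "(t + 1) * resolvent t = 1"
    "\<And>c. c * t = t * c \<Longrightarrow> c * resolvent t = resolvent t * c"
proof -
  have "\<exists>h. posop h \<and> h * (t + 1) = 1 \<and> (t + 1) * h = 1 \<and> (\<forall>c. c * t = t * c \<longrightarrow> c * h = h * c)"
    by (rule posop_inverse[OF t, of 1]) auto
  then have "posop (resolvent t) \<and> resolvent t * (t + 1) = 1 \<and> (t + 1) * resolvent t = 1 \<and>
      (\<forall>c. c * t = t * c \<longrightarrow> c * resolvent t = resolvent t * c)"
    unfolding resolvent_def by (rule someI_ex)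
  then show "posop (resolvent t)" "resolvent t * (t + 1) = 1" "(t + 1) * resolvent t = 1"
    "\<And>c. c * t = t * c \<Longrightarrow> c * resolvent t = resolvent t * c" by blast+
qed

lemma
  assumes t: "posop t"
  shows posop_cutoff: "posop (cutoff t)" and cutoff_le: "posop (t - cutoff t)" and le_cutoff: "posop ((norm t + 1) *\<^sub>R cutoff t - t)"
    and cutoff_commute: "c * t = t * c \<Longrightarrow> c * cutoff t = cutoff t * c"
    and norm_cutoff: "norm (cutoff t) \<le> 1"
proof -
  note h = resolvent[OF t]
  have eq: "cutoff t = t * resolvent t"
    using h(3) by (simp add: cutoff_def distrib_right algebra_simps)
  show cm: "c * t = t * c \<Longrightarrow> c * cutoff t = cutoff t * c" for c
    using h(4)[of c] by (simp add: cutoff_def algebra_simps)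
  show p: "posop (cutoff t)"
    unfolding eq by (rule posop_commuting_product[OF t h(1)]) (use h(4)[of t] in simp)
  have q: "posop (1 - cutoff t)" using h(1) by (simp add: cutoff_def)
  have tc: "t * cutoff t = cutoff t * t" using cm[of t] by simp
  have "t - cutoff t = t * cutoff t"
    using eq by (simp add: cutoff_def algebra_simps)
  then show "posop (t - cutoff t)" using posop_commuting_product[OF t p tc] by simp
  have "cutoff t + t * cutoff t = t"
    using \<open>t - cutoff t = t * cutoff t\<close> by (simp add: algebra_simps)
  then have "(norm t + 1) *\<^sub>R cutoff t - t = (norm t *\<^sub>R 1 - t) * cutoff t"
    by (simp add: algebra_simps)
  moreover have "posop ((norm t *\<^sub>R 1 - t) * cutoff t)"
    by (rule posop_commuting_product[OF posop_bound[OF posopD(1)[OF t] order_refl] p])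
      (simp add: algebra_simps tc)
  ultimately show "posop ((norm t + 1) *\<^sub>R cutoff t - t)" by simp
  show "norm (cutoff t) \<le> 1" using posop_norm_le[OF p, of 1] q by simp
qed

text \<open>With \<open>g\<close> and \<open>h\<close> the resolvents of \<open>s\<close> and
  \<open>t\<close>, the difference \<open>g - h\<close> is written as a sum of two conjugates of
  positive operators, built from \<open>s + 1\<close> and \<open>t - s\<close>.\<close>

lemma cutoff_mono:
  assumes s: "posop s" and st: "posop (t - s)"
  shows "posop (cutoff t - cutoff s)"
proof -
  have t: "posop t" using posop_add[OF s st] by simp
  define g h where "g = resolvent s" and "h = resolvent t"
  note g = resolvent[OF s, folded g_def] and h = resolvent[OF t, folded h_def]
  have "posop (star (g - h) * (s + 1) * (g - h) + star h * (t - s) * h)"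
    by (intro posop_add posop_conj st posop_add s posop_one)
  moreover have "star (g - h) * (s + 1) * (g - h) + star h * (t - s) * h = g - h"
  proof -
    have "star (g - h) * (s + 1) * (g - h) + star h * (t - s) * h =
        (g * (s + 1)) * g - (g * (s + 1)) * h - h * ((s + 1) * g) + h * (s + 1) * h +
        h * ((t + 1) * h) - h * (s + 1) * h"
      using posopD(1)[OF g(1)] posopD(1)[OF h(1)] by (simp add: algebra_simps)
    also have "\<dots> = g - h" unfolding g(2,3) h(3) by simp
    finally show ?thesis .
  qed
  ultimately show ?thesis by (simp add: cutoff_def g_def h_def)
qed

section \<open>Von Neumann algebras with a trace\<close>

text \<open>The double commutant is stated elementwise. Square roots, resolvents and strong limits
  then stay in \<open>A\<close>, because each commutes with whatever commutes with its data.\<close>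

locale vn_algebra =
  fixes A :: "'h::chilbert_space bop set"
  assumes one_A: "1 \<in> A" and add_A: "x \<in> A \<Longrightarrow> y \<in> A \<Longrightarrow> x + y \<in> A"
    and mult_A: "x \<in> A \<Longrightarrow> y \<in> A \<Longrightarrow> x * y \<in> A" and sc_A: "x \<in> A \<Longrightarrow> sc c * x \<in> A"
    and star_A: "x \<in> A \<Longrightarrow> star x \<in> A"
    and bicommutant: "(\<And>c. (\<And>a. a \<in> A \<Longrightarrow> c * a = a * c) \<Longrightarrow> c * x = x * c) \<Longrightarrow> x \<in> A"
begin

lemma scaleR_A: "x \<in> A \<Longrightarrow> r *\<^sub>R x \<in> A"
  using sc_A[of x "of_real r"] by (simp add: sc_of_real)

lemma minus_A: "x \<in> A \<Longrightarrow> - x \<in> A"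
  using scaleR_A[of x "-1"] by simp

lemma diff_A: "x \<in> A \<Longrightarrow> y \<in> A \<Longrightarrow> x - y \<in> A"
  using add_A[of x "- y"] minus_A[of y] by simp

lemma zero_A: "0 \<in> A"
  using scaleR_A[OF one_A, of 0] by simp

lemma sum_A: "(\<And>i. i \<in> I \<Longrightarrow> f i \<in> A) \<Longrightarrow> sum f I \<in> A"
  by (induction I rule: infinite_finite_induct) (auto intro: zero_A add_A)

lemma sc_in_A: "sc c \<in> A"
  using sc_A[OF one_A, of c] by simp

lemmas A_closed = one_A zero_A add_A mult_A sc_A star_A scaleR_A minus_A diff_A sc_in_A

lemma commuting_A: "y \<in> A \<Longrightarrow> (\<And>c. c * y = y * c \<Longrightarrow> c * x = x * c) \<Longrightarrow> x \<in> A"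
  by (rule bicommutant) blast

lemma slim_A: "slim X x \<Longrightarrow> (\<And>n. X n \<in> A) \<Longrightarrow> x \<in> A"
  by (rule bicommutant) (auto intro: slim_commute)

lemma cutoff_A: "t \<in> A \<Longrightarrow> posop t \<Longrightarrow> cutoff t \<in> A"
  by (rule commuting_A[of t]) (auto intro: cutoff_commute)

end

locale vn_trace = vn_algebra +
  fixes tr :: "'h::chilbert_space bop \<Rightarrow> real"
  assumes tr_add: "x \<in> A \<Longrightarrow> y \<in> A \<Longrightarrow> tr (x + y) = tr x + tr y"
    and tr_scaleR: "x \<in> A \<Longrightarrow> tr (r *\<^sub>R x) = r * tr x"
    and tr_commute: "x \<in> A \<Longrightarrow> y \<in> A \<Longrightarrow> tr (x * y) = tr (y * x)"
    and tr_star: "x \<in> A \<Longrightarrow> tr (star x) = tr x"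
    and tr_one: "tr 1 = 1"
    and tr_pos: "x \<in> A \<Longrightarrow> 0 \<le> tr (star x * x)"
    and tr_faithful: "x \<in> A \<Longrightarrow> tr (star x * x) = 0 \<Longrightarrow> x = 0"
    and tr_normal: "(\<And>n. X n \<in> A) \<Longrightarrow> (\<And>n. star (X n) = X n) \<Longrightarrow> (\<And>n. posop (X (Suc n) - X n)) \<Longrightarrow>
      slim X x \<Longrightarrow> (\<lambda>n. tr (X n)) \<longlonglongrightarrow> tr x"
begin

lemma tr_minus: "x \<in> A \<Longrightarrow> tr (- x) = - tr x"
  using tr_scaleR[of x "-1"] by simp

lemma tr_diff: "x \<in> A \<Longrightarrow> y \<in> A \<Longrightarrow> tr (x - y) = tr x - tr y"
  using tr_add[of x "- y"] tr_minus[of y] minus_A[of y] by simp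

lemma tr_zero: "tr 0 = 0"
  using tr_scaleR[OF one_A, of 0] by simp

lemma tr_posop: "x \<in> A \<Longrightarrow> posop x \<Longrightarrow> 0 \<le> tr x"
proof -
  assume x: "x \<in> A" "posop x"
  obtain r where r: "posop r" "r * r = x" "\<And>c. c * x = x * c \<Longrightarrow> c * r = r * c"
    by (erule posop_sqrt[OF x(2)])
  have "r \<in> A" using commuting_A[OF x(1)] r(3) by blast
  then show ?thesis using tr_pos[of r] r(2) posopD(1)[OF r(1)] by simp
qed

lemma tr_mono: "x \<in> A \<Longrightarrow> y \<in> A \<Longrightarrow> posop (y - x) \<Longrightarrow> tr x \<le> tr y"
  using tr_posop[of "y - x"] diff_A tr_diff by simp

lemma posop_tr_zero: "x \<in> A \<Longrightarrow> posop x \<Longrightarrow> tr x \<le> 0 \<Longrightarrow> x = 0"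
proof -
  assume x: "x \<in> A" "posop x" "tr x \<le> 0"
  obtain r where r: "posop r" "r * r = x" "\<And>c. c * x = x * c \<Longrightarrow> c * r = r * c"
    by (erule posop_sqrt[OF x(2)])
  have "r \<in> A" using commuting_A[OF x(1)] r(3) by blast
  then show ?thesis
    using tr_pos[of r] tr_faithful[of r] r(2) x(3) posopD(1)[OF r(1)] by simp
qed

lemma pos_neg_parts:
  assumes x: "x \<in> A" "star x = x"
  obtains p n where "p \<in> A" "n \<in> A" "posop p" "posop n" "x = p - n" "p * n = 0" "n * p = 0"
    "norm p \<le> norm x"
proof -
  obtain a where a: "posop a" "a * a = x * x" "\<And>c. c * (x * x) = x * x * c \<Longrightarrow> c * a = a * c"
    "posop (a - x)" "posop (a + x)" by (erule abs_exists[OF x(2)])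
  have aA: "a \<in> A" by (rule commuting_A[OF mult_A[OF x(1) x(1)]]) (rule a(3))
  have xa: "x * a = a * x" using a(3)[of x] by (simp add: mult.assoc)
  have na: "norm a = norm x"
    using norm_square_self_adjoint[OF x(2)] norm_square_self_adjoint[OF posopD(1)[OF a(1)]] a(2) by simp
  let ?p = "(1/2) *\<^sub>R (a + x)" and ?n = "(1/2) *\<^sub>R (a - x)"
  show thesis
  proof
    show "?p \<in> A" "?n \<in> A" by (intro A_closed x aA)+
    show "posop ?p" "posop ?n" by (intro posop_scaleR a(4,5); simp)+
    show "x = ?p - ?n" by (simp flip: scaleR_diff_right add: scaleR_2[symmetric])
    show "?p * ?n = 0" "?n * ?p = 0" using a(2) xa by (simp_all add: algebra_simps)
    show "norm ?p \<le> norm x" using norm_triangle_ineq[of a x] na by simp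
  qed
qed

text \<open>Test with the negative part \<open>n\<close> of \<open>x\<close>: the value is minus the
  trace of \<open>n * n * n\<close>, so the cube of \<open>n\<close> vanishes and with it
  \<open>n\<close>.\<close>

lemma posop_trI:
  assumes x: "x \<in> A" "star x = x" and nonneg: "\<And>z. z \<in> A \<Longrightarrow> 0 \<le> tr (star z * (x * z))"
  shows "posop x"
proof -
  obtain p n where pn: "p \<in> A" "n \<in> A" "posop p" "posop n" "x = p - n" "p * n = 0"
    by (rule pos_neg_parts[OF x]) blast
  have sn: "star n = n" by (rule posopD(1)[OF pn(4)])
  have "x * n = - (n * n)" unfolding pn(5) left_diff_distrib pn(6) by simp
  then have "star n * (x * n) = - (n * n * n)" using sn by (simp add: mult.assoc)
  moreover have nn: "posop (n * n * n)" using posop_conj[OF pn(4), of n] sn by simp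
  ultimately have "tr (n * n * n) \<le> 0"
    using nonneg[OF pn(2)] tr_minus[of "n * n * n"] mult_A pn(2) by simp
  then have n3: "n * n * n = 0" using posop_tr_zero[OF _ nn] mult_A pn(2) by blast
  have "(norm (n * n))\<^sup>2 = norm (n * n * (n * n))"
    by (rule norm_square_self_adjoint[symmetric]) (simp add: sn)
  also have "n * n * (n * n) = 0" using n3 by (simp flip: mult.assoc)
  finally have "n * n = 0" by simp
  then have "n = 0" using norm_square_self_adjoint[OF sn] by simp
  then show ?thesis using pn by simp
qed

lemma parallelogram_le: "posop (2 *\<^sub>R (star x * x) + 2 *\<^sub>R (star y * y) - star (x + y) * (x + y))"
proof -
  have "2 *\<^sub>R (star x * x) + 2 *\<^sub>R (star y * y) - star (x + y) * (x + y) = star (x - y) * (x - y)"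
    by (simp add: algebra_simps scaleR_2)
  then show ?thesis using posop_star_mult[of "x - y"] by simp
qed

text \<open>A trace norm Cauchy sequence need not converge strongly, but a fast subsequence does.
  Its increments are dominated by positive operators of small trace but uncontrolled norm;
  \<open>cutoff\<close> makes them bounded, so their monotone limits exist and tend strongly to
  0.\<close>

theorem ball_complete:
  fixes X :: "nat \<Rightarrow> 'h bop"
  assumes XA: "\<And>n. X n \<in> A" and C: "\<And>n. norm (X n) \<le> C"
    and cauchy: "\<And>e. 0 < e \<Longrightarrow> \<exists>k. \<forall>m\<ge>k. \<forall>n\<ge>k. tr (star (X m - X n) * (X m - X n)) \<le> e"
  shows "\<exists>x\<in>A. norm x \<le> C \<and> (\<lambda>n. tr (star (X n - x) * (X n - x))) \<longlonglongrightarrow> 0"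
proof -
  define q where "q x = tr (star x * x)" for x
  have q0: "0 \<le> q x" if "x \<in> A" for x using that tr_pos by (simp add: q_def)
  have q_add: "q (x + y) \<le> 2 * q x + 2 * q y" if "x \<in> A" "y \<in> A" for x y
  proof -
    have "q (x + y) \<le> tr (2 *\<^sub>R (star x * x) + 2 *\<^sub>R (star y * y))"
      unfolding q_def by (rule tr_mono[OF _ _ parallelogram_le]) (intro A_closed that)+
    also have "\<dots> = 2 * q x + 2 * q y"
      unfolding q_def using that by (simp add: tr_add tr_scaleR A_closed)
    finally show ?thesis .
  qed
  have C0: "0 \<le> C" using C[of 0] norm_ge_zero order_trans by blast
  \<comment> \<open>The rate 1/8 beats the weights \<open>2 ^ Suc k\<close> in \<open>a\<close>
    below, leaving traces of order \<open>(1/4) ^ k\<close>.\<close>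
  obtain K where K: "\<And>k m n. m \<ge> K k \<Longrightarrow> n \<ge> K k \<Longrightarrow> q (X m - X n) \<le> (1/8) ^ k"
  proof -
    have "\<exists>K. \<forall>m\<ge>K. \<forall>n\<ge>K. q (X m - X n) \<le> (1/8) ^ k" for k
      using cauchy[of "(1/8) ^ k"] by (simp add: q_def)
    then show thesis using that by metis
  qed
  define \<sigma> where "\<sigma> k = (\<Sum>i\<le>k. K i)" for k
  have \<sigma>: "K k \<le> \<sigma> k" "\<sigma> k \<le> \<sigma> (Suc k)" for k
    by (auto simp: \<sigma>_def intro: member_le_sum)
  define Y where "Y k = X (\<sigma> k)" for k
  have YA: "Y k \<in> A" and YC: "norm (Y k) \<le> C" for k using XA C by (simp_all add: Y_def)
  define a where "a k = 2 ^ Suc k *\<^sub>R (star (Y (Suc k) - Y k) * (Y (Suc k) - Y k))" for k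
  have aA: "a k \<in> A" for k unfolding a_def by (intro A_closed YA)
  have ap: "posop (a k)" for k unfolding a_def by (intro posop_scaleR posop_star_mult) simp
  have atr: "tr (a k) \<le> 2 * (1/4) ^ k" for k
  proof -
    have "q (Y (Suc k) - Y k) \<le> (1/8) ^ k"
      unfolding Y_def by (rule K) (use \<sigma>[of k] in auto)
    moreover have "tr (a k) = 2 * 2 ^ k * q (Y (Suc k) - Y k)"
      using YA by (simp add: a_def q_def tr_scaleR A_closed)
    moreover have "2 * 2 ^ k * (1/8 :: real) ^ k = 2 * (1/4) ^ k"
      by (simp flip: power_mult_distrib)
    ultimately show ?thesis by (metis mult_left_mono zero_le_mult_iff zero_le_numeral zero_le_power)
  qed
  define T where "T N p = (\<Sum>k\<in>{N..<p}. a k)" for N p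
  have TA: "T N p \<in> A" for N p unfolding T_def by (intro sum_A aA)
  have Tp: "posop (T N p)" for N p
    unfolding T_def by (induction p) (auto simp: posop_zero atLeastLessThanSuc intro: posop_add ap)
  have T_left: "T N p = a N + T (Suc N) p" if "N < p" for N p
    using that by (simp add: T_def sum.atLeast_Suc_lessThan)
  have T_right: "posop (T N (Suc p) - T N p)" for N p
    by (auto simp: T_def atLeastLessThanSuc posop_zero ap)
  have T_left': "posop (T N p - T (Suc N) p)" for N p
  proof (cases "N < p")
    case True
    then show ?thesis using T_left[OF True] ap by simp
  qed (simp add: T_def posop_zero)
  have Ttr: "tr (T N p) \<le> 3 * (1/4) ^ N" for N p
  proof (cases "N \<le> p")
    case True
    then show ?thesis
    proof (induction N rule: inc_induct)
      case base
      then show ?case by (simp add: T_def tr_zero)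
    next
      case (step N)
      have "tr (T N p) \<le> 2 * (1/4) ^ N + 3 * (1/4) ^ Suc N"
        using step atr[of N] T_left[of N p] aA TA by (simp add: tr_add)
      moreover have "(0 :: real) \<le> (1/4) ^ N" by simp
      ultimately show ?case unfolding power_Suc by linarith
    qed
  qed (simp add: T_def tr_zero)
  \<comment> \<open>Each use of the parallelogram inequality costs a factor 2; the growing weights
    in \<open>a\<close> pay for it.\<close>
  have dominate: "posop (T N p - star (Y N - Y p) * (Y N - Y p))" if "N \<le> p" for N p
  proof -
    have "posop (T N p - 2 ^ N *\<^sub>R (star (Y N - Y p) * (Y N - Y p)))"
      using that
    proof (induction N rule: inc_induct)
      case base
      then show ?case by (simp add: T_def posop_zero)
    next
      case (step N)
      define d e f where "d = star (Y N - Y (Suc N)) * (Y N - Y (Suc N))"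
        and "e = star (Y (Suc N) - Y p) * (Y (Suc N) - Y p)" and "f = star (Y N - Y p) * (Y N - Y p)"
      have "posop (2 *\<^sub>R d + 2 *\<^sub>R e - f)"
        using parallelogram_le[of "Y N - Y (Suc N)" "Y (Suc N) - Y p"] by (simp add: d_def e_def f_def)
      then have "posop (2 ^ N *\<^sub>R (2 *\<^sub>R d + 2 *\<^sub>R e - f))" by (rule posop_scaleR) simp
      then have "posop (2 ^ N *\<^sub>R (2 *\<^sub>R d + 2 *\<^sub>R e - f) + (T (Suc N) p - 2 ^ Suc N *\<^sub>R e))"
        using step.IH unfolding e_def by (rule posop_add)
      moreover have "a N = (2 * 2 ^ N) *\<^sub>R d" by (simp add: a_def d_def algebra_simps)
      then have "2 ^ N *\<^sub>R (2 *\<^sub>R d + 2 *\<^sub>R e - f) + (T (Suc N) p - 2 ^ Suc N *\<^sub>R e) = T N p - 2 ^ N *\<^sub>R f"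
        using T_left[OF step.hyps(2)] by (simp add: scaleR_diff_right scaleR_add_right mult.commute)
      ultimately show ?case unfolding f_def by metis
    qed
    moreover have "posop (2 ^ N *\<^sub>R (star (Y N - Y p) * (Y N - Y p)) - star (Y N - Y p) * (Y N - Y p))"
      using posop_scaleR[OF posop_star_mult[of "Y N - Y p"], of "2 ^ N - 1"] by (simp add: scaleR_diff_left)
    ultimately show ?thesis by (metis posop_trans)
  qed
  have cA: "cutoff (T N p) \<in> A" for N p by (rule cutoff_A[OF TA Tp])
  have "\<exists>b. slim (\<lambda>p. cutoff (T N p)) b \<and> norm b \<le> 1 \<and> (\<forall>p. posop (b - cutoff (T N p)))" for N
    by (rule monotone_slim[of "\<lambda>p. cutoff (T N p)" 1])
      (auto intro: norm_cutoff Tp cutoff_mono T_right)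
  then obtain b where b: "\<And>N. slim (\<lambda>p. cutoff (T N p)) (b N)" "\<And>N. norm (b N) \<le> 1"
    "\<And>N p. posop (b N - cutoff (T N p))" by metis
  have bA: "b N \<in> A" for N by (rule slim_A[OF b(1) cA])
  have bp: "posop (b N)" for N by (rule slim_posop[OF b(1)]) (rule posop_cutoff[OF Tp])
  have btr: "tr (b N) \<le> 3 * (1/4) ^ N" for N
  proof (rule LIMSEQ_le_const2)
    show "(\<lambda>p. tr (cutoff (T N p))) \<longlonglongrightarrow> tr (b N)"
      by (rule tr_normal[OF cA _ _ b(1)]) (auto intro: posopD posop_cutoff Tp cutoff_mono T_right)
    have "tr (cutoff (T N p)) \<le> 3 * (1/4) ^ N" for p
      using tr_mono[OF cA TA cutoff_le[OF Tp]] Ttr order_trans by blast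
    then show "\<exists>M. \<forall>p\<ge>M. tr (cutoff (T N p)) \<le> 3 * (1/4) ^ N" by blast
  qed
  have bdec: "posop (b N - b (Suc N))" for N
    by (rule slim_posop[OF slim_diff[OF b(1) b(1)]]) (rule cutoff_mono[OF Tp T_left'])
  obtain g where g: "slim (\<lambda>N. - b N) g" "\<And>N. posop (g - - b N)"
  proof (rule monotone_slim[of "\<lambda>N. - b N" 1])
    show "norm (- b N) \<le> 1" for N using b(2) by simp
    show "posop (- b (Suc N) - - b N)" for N using bdec by simp
  qed (use that in blast)
  have "posop (- g)"
    using slim_posop[OF slim_scaleR[OF g(1), of "-1"]] bp by simp
  moreover have gA: "- g \<in> A" by (intro minus_A slim_A[OF g(1)] bA)
  moreover have "tr (- g) \<le> 0"
  proof (rule LIMSEQ_le_const)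
    show "(\<lambda>N. 3 * (1/4) ^ N :: real) \<longlonglongrightarrow> 0" by (intro tendsto_mult_right_zero LIMSEQ_power_zero) simp
    have "tr (- g) \<le> 3 * (1/4) ^ N" for N
      using tr_mono[OF gA bA[of N]] g(2)[of N] btr[of N] by (simp add: add.commute)
    then show "\<exists>M. \<forall>N\<ge>M. tr (- g) \<le> 3 * (1/4) ^ N" by blast
  qed
  ultimately have "g = 0" using posop_tr_zero by fastforce
  then have "slim b 0" using slim_scaleR[OF g(1), of "-1"] by simp
  then have form_b: "(\<lambda>N. form (b N) \<xi>) \<longlonglongrightarrow> 0" for \<xi> using slim_form by fastforce
  define R where "R = (2 * C)\<^sup>2 + 1"
  have R: "0 < R" unfolding R_def using zero_le_power2[of "2 * C"] by linarith
  \<comment> \<open>For bounded \<open>t\<close> the cutoff loses only the factor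
    \<open>norm t + 1\<close>, and \<open>R\<close> covers this factor for all differences in the
    ball of radius \<open>C\<close>.\<close>
  have bound: "posop (R *\<^sub>R b N - star (Y N - Y p) * (Y N - Y p))" if "N \<le> p" for N p
  proof -
    define t where "t = star (Y N - Y p) * (Y N - Y p)"
    have t: "posop t" unfolding t_def by (rule posop_star_mult)
    have "norm (Y N - Y p) \<le> 2 * C"
      using norm_triangle_ineq4[of "Y N" "Y p"] YC[of N] YC[of p] by linarith
    then have "norm (Y N - Y p) * norm (Y N - Y p) \<le> (2 * C) * (2 * C)" using C0 by (intro mult_mono) auto
    then have "norm t \<le> (2 * C) * (2 * C)"
      unfolding t_def using norm_mult_ineq[of "star (Y N - Y p)" "Y N - Y p", unfolded norm_star_bop]
      by (rule order_trans[rotated])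
    then have "norm t + 1 \<le> R" by (simp add: R_def power2_eq_square)
    then have "posop ((R - (norm t + 1)) *\<^sub>R cutoff t)"
      by (intro posop_scaleR posop_cutoff t) simp
    then have "posop (R *\<^sub>R cutoff t - t)"
      using posop_add[OF le_cutoff[OF t]] by (fastforce simp: algebra_simps)
    moreover have "posop (R *\<^sub>R b N - R *\<^sub>R cutoff t)"
      using posop_scaleR[OF posop_trans[OF cutoff_mono[OF t dominate[OF that, folded t_def]] b(3)], of R] R
      by (simp add: scaleR_diff_right)
    ultimately show ?thesis unfolding t_def by (rule posop_trans)
  qed
  have vec: "(norm (rep (Y N) \<xi> - rep (Y p) \<xi>))\<^sup>2 \<le> R * form (b N) \<xi>" if "N \<le> p" for N p \<xi>
    using posopD(2)[OF bound[OF that], of \<xi>] unfolding form_simps form_star_mult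
    by (simp add: blinfun.diff_left)
  have "Cauchy (\<lambda>n. rep (Y n) \<xi>)" for \<xi>
  proof (rule metric_CauchyI)
    fix e :: real assume e: "0 < e"
    have "(\<lambda>N. R * form (b N) \<xi>) \<longlonglongrightarrow> 0" by (rule tendsto_mult_right_zero[OF form_b])
    then obtain N where "\<forall>n\<ge>N. norm (R * form (b n) \<xi> - 0) < (e / 2)\<^sup>2"
      using e LIMSEQ_D[of _ 0 "(e / 2)\<^sup>2"] by (metis half_gt_zero zero_less_power)
    then have N: "R * form (b N) \<xi> < (e / 2)\<^sup>2" by (simp add: abs_less_iff)
    have *: "norm (rep (Y N) \<xi> - rep (Y p) \<xi>) < e / 2" if "N \<le> p" for p
      by (rule power2_less_imp_less[OF order.strict_trans1[OF vec[OF that] N]]) (use e in simp)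
    have "dist (rep (Y m) \<xi>) (rep (Y n) \<xi>) < e" if "N \<le> m" "N \<le> n" for m n
      using *[OF that(1)] *[OF that(2)] norm_triangle_ineq4[of "rep (Y N) \<xi> - rep (Y n) \<xi>" "rep (Y N) \<xi> - rep (Y m) \<xi>"]
      by (simp add: dist_norm)
    then show "\<exists>N. \<forall>m\<ge>N. \<forall>n\<ge>N. dist (rep (Y m) \<xi>) (rep (Y n) \<xi>) < e" by blast
  qed
  then obtain x where x: "slim Y x" "norm x \<le> C" by (rule slim_exists[of Y C, OF YC])
  have xA: "x \<in> A" by (rule slim_A[OF x(1) YA])
  have qx: "q (Y N - x) \<le> R * (3 * (1/4) ^ N)" for N
  proof -
    have "posop (R *\<^sub>R b N - star (Y N - x) * (Y N - x))"
      unfolding posop_def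
    proof (intro conjI allI)
      show "star (R *\<^sub>R b N - star (Y N - x) * (Y N - x)) = R *\<^sub>R b N - star (Y N - x) * (Y N - x)"
        using posopD(1)[OF bp[of N]] by simp
      fix \<xi>
      have "(\<lambda>p. (norm (rep (Y N) \<xi> - rep (Y p) \<xi>))\<^sup>2) \<longlonglongrightarrow> (norm (rep (Y N) \<xi> - rep x \<xi>))\<^sup>2"
        by (intro tendsto_power tendsto_norm tendsto_diff tendsto_const) (use x(1) in \<open>simp add: slim_def\<close>)
      then have "(norm (rep (Y N) \<xi> - rep x \<xi>))\<^sup>2 \<le> R * form (b N) \<xi>"
        by (rule LIMSEQ_le_const2) (use vec in blast)
      then show "0 \<le> form (R *\<^sub>R b N - star (Y N - x) * (Y N - x)) \<xi>"
        unfolding form_simps form_star_mult by (simp add: blinfun.diff_left)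
    qed
    then have "q (Y N - x) \<le> tr (R *\<^sub>R b N)"
      unfolding q_def by (intro tr_mono A_closed YA xA bA)
    also have "\<dots> \<le> R * (3 * (1/4) ^ N)" unfolding tr_scaleR[OF bA]
      by (rule mult_left_mono[OF btr]) (use R in simp)
    finally show ?thesis .
  qed
  have "(\<lambda>n. q (X n - x)) \<longlonglongrightarrow> 0"
  proof (rule LIMSEQ_I)
    fix e :: real assume e: "0 < e"
    have "(\<lambda>k. 2 * (1/8) ^ k + 2 * (R * (3 * (1/4) ^ k)) :: real) \<longlonglongrightarrow> 2 * 0 + 2 * (R * (3 * 0))"
      by (intro tendsto_intros LIMSEQ_power_zero) simp_all
    then obtain k where "\<forall>i\<ge>k. norm (2 * (1/8) ^ i + 2 * (R * (3 * (1/4) ^ i)) - 0 :: real) < e"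
      using LIMSEQ_D[of _ "0 :: real", OF _ e] by fastforce
    then have k: "2 * (1/8) ^ k + 2 * (R * (3 * (1/4) ^ k)) < e" by (simp add: abs_less_iff)
    have "norm (q (X n - x) - 0) < e" if "\<sigma> k \<le> n" for n
    proof -
      have "q (X n - Y k) \<le> (1/8) ^ k" unfolding Y_def by (rule K) (use that \<sigma>(1)[of k] in auto)
      moreover have "q (X n - x) \<le> 2 * q (X n - Y k) + 2 * q (Y k - x)"
        using q_add[of "X n - Y k" "Y k - x"] XA YA xA diff_A by simp
      ultimately have "q (X n - x) < e" using qx[of k] k by linarith
      then show ?thesis using q0[of "X n - x"] XA xA diff_A by simp
    qed
    then show "\<exists>N. \<forall>n\<ge>N. norm (q (X n - x) - 0) < e" by blast
  qed
  then show ?thesis using xA x(2) by (auto simp: q_def)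
qed

end

section \<open>Conditional expectations\<close>

lemma sc_minus: "sc (- c) = - sc c"
proof -
  have "sc (- c) = sc (of_real (- 1)) * sc c" by (simp flip: sc_mult)
  then show ?thesis unfolding sc_of_real by simp
qed

lemma sc_ii: "sc \<i> * sc \<i> = - 1"
proof -
  have "sc \<i> * sc \<i> = sc (of_real (- 1))" by (simp flip: sc_mult)
  then show ?thesis unfolding sc_of_real by simp
qed

lemma half_one: "(1/2) *\<^sub>R x + (1/2) *\<^sub>R x = (x :: 'a::real_vector)"
  by (simp flip: scaleR_add_left)

lemma (in vn_algebra) self_adjoint_parts:
  assumes x: "x \<in> A"
  obtains a b where "a \<in> A" "b \<in> A" "star a = a" "star b = b" "x = a + sc \<i> * b"
proof
  let ?a = "(1/2) *\<^sub>R (x + star x)" and ?b = "- sc \<i> * ((1/2) *\<^sub>R (x - star x))"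
  show "?a \<in> A" "?b \<in> A" by (intro A_closed x)+
  show "star ?a = ?a" by (simp add: add.commute)
  show "star ?b = ?b"
    using sc_commute[of \<i> x] sc_commute[of \<i> "star x"] by (simp add: sc_minus algebra_simps)
  have "sc \<i> * ?b = (1/2) *\<^sub>R (x - star x)"
    by (simp add: sc_ii flip: mult.assoc) (simp flip: scaleR_minus_right)
  then show "x = ?a + sc \<i> * ?b" using half_one[of x] by (simp add: algebra_simps)
qed

sublocale vn_trace \<subseteq> T: tracial A tr
proof
  fix x y :: "'h bop" and r :: real
  show "1 \<in> A" by (rule one_A)
  show "x \<in> A \<Longrightarrow> y \<in> A \<Longrightarrow> x + y \<in> A" by (rule add_A)
  show "x \<in> A \<Longrightarrow> y \<in> A \<Longrightarrow> x * y \<in> A" by (rule mult_A)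
  show "x \<in> A \<Longrightarrow> r *\<^sub>R x \<in> A" by (rule scaleR_A)
  show "x \<in> A \<Longrightarrow> star x \<in> A" by (rule star_A)
  show "x \<in> A \<Longrightarrow> y \<in> A \<Longrightarrow> tr (x + y) = tr x + tr y" by (rule tr_add)
  show "x \<in> A \<Longrightarrow> tr (r *\<^sub>R x) = r * tr x" by (rule tr_scaleR)
  show "x \<in> A \<Longrightarrow> y \<in> A \<Longrightarrow> tr (x * y) = tr (y * x)" by (rule tr_commute)
  show "x \<in> A \<Longrightarrow> tr (star x) = tr x" by (rule tr_star)
  show "tr 1 = 1" by (rule tr_one)
  show "x \<in> A \<Longrightarrow> 0 \<le> tr (star x * x)" by (rule tr_pos)
  show "x \<in> A \<Longrightarrow> tr (star x * x) = 0 \<Longrightarrow> x = 0" by (rule tr_faithful)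
  show "tr (star (x * y) * (x * y)) \<le> (norm x)\<^sup>2 * tr (star y * y)" if x: "x \<in> A" and y: "y \<in> A"
  proof -
    have "posop (star y * ((norm x)\<^sup>2 *\<^sub>R 1 - star x * x) * y)"
      by (intro posop_conj posop_norm_sq)
    then have "0 \<le> tr (star y * ((norm x)\<^sup>2 *\<^sub>R 1 - star x * x) * y)"
      by (rule tr_posop[rotated]) (intro A_closed x y)
    also have "star y * ((norm x)\<^sup>2 *\<^sub>R 1 - star x * x) * y =
        (norm x)\<^sup>2 *\<^sub>R (star y * y) - star (x * y) * (x * y)"
      by (simp add: algebra_simps)
    also have "tr \<dots> = (norm x)\<^sup>2 * tr (star y * y) - tr (star (x * y) * (x * y))"
      using x y by (subst tr_diff) (simp_all only: A_closed tr_scaleR)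
    finally show ?thesis by simp
  qed
  show "norm x \<le> C" if x: "x \<in> A" and C: "0 \<le> C"
    and le: "\<And>y. y \<in> A \<Longrightarrow> tr (star (x * y) * (x * y)) \<le> C\<^sup>2 * tr (star y * y)" for C
  proof (rule norm_le_posop[OF _ C], rule posop_trI)
    show "C\<^sup>2 *\<^sub>R 1 - star x * x \<in> A" by (intro A_closed x)
    fix z assume z: "z \<in> A"
    have "star z * ((C\<^sup>2 *\<^sub>R 1 - star x * x) * z) = C\<^sup>2 *\<^sub>R (star z * z) - star (x * z) * (x * z)"
      by (simp add: algebra_simps)
    also have "tr \<dots> = C\<^sup>2 * tr (star z * z) - tr (star (x * z) * (x * z))"
      using x z by (subst tr_diff) (simp_all only: A_closed tr_scaleR)
    finally show "0 \<le> tr (star z * ((C\<^sup>2 *\<^sub>R 1 - star x * x) * z))" using le[OF z] by simp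
  qed simp
  show "\<exists>x\<in>A. norm x \<le> C \<and> (\<lambda>n. tr (star (X n - x) * (X n - x))) \<longlonglongrightarrow> 0"
    if "\<And>n. X n \<in> A" "\<And>n. norm (X n) \<le> C"
      "\<And>e. e > 0 \<Longrightarrow> \<exists>k. \<forall>m\<ge>k. \<forall>n\<ge>k. tr (star (X m - X n) * (X m - X n)) \<le> e" for X C
    by (rule ball_complete[OF that])
qed

locale vn_pair = vn_trace A tr + S: vn_algebra B
  for A :: "'h::chilbert_space bop set" and tr and B +
  assumes B_A: "x \<in> B \<Longrightarrow> x \<in> A"
begin

sublocale S: vn_trace B tr
proof
  fix x y :: "'h bop" and r :: real
  show "x \<in> B \<Longrightarrow> y \<in> B \<Longrightarrow> tr (x + y) = tr x + tr y" by (intro tr_add B_A)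
  show "x \<in> B \<Longrightarrow> tr (r *\<^sub>R x) = r * tr x" by (intro tr_scaleR B_A)
  show "x \<in> B \<Longrightarrow> y \<in> B \<Longrightarrow> tr (x * y) = tr (y * x)" by (intro tr_commute B_A)
  show "x \<in> B \<Longrightarrow> tr (star x) = tr x" by (intro tr_star B_A)
  show "tr 1 = 1" by (rule tr_one)
  show "x \<in> B \<Longrightarrow> 0 \<le> tr (star x * x)" by (intro tr_pos B_A)
  show "x \<in> B \<Longrightarrow> tr (star x * x) = 0 \<Longrightarrow> x = 0" by (intro tr_faithful B_A)
  show "(\<lambda>n. tr (X n)) \<longlonglongrightarrow> tr x"
    if "\<And>n. X n \<in> B" "\<And>n. star (X n) = X n" "\<And>n. posop (X (Suc n) - X n)" "slim X x" for X x
    using that by (intro tr_normal B_A) auto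
qed

text \<open>\<open>B\<close> is itself a tracial von Neumann algebra, so its own complete balls
  contain a limit, and trace norm limits are unique.\<close>

lemma conv2_closed:
  assumes X: "\<And>n. X n \<in> B" "\<And>n. norm (X n) \<le> C" and x: "T.conv2 X x"
  shows "x \<in> B"
proof -
  have XA: "X n \<in> A" "x \<in> A" for n using x by (auto simp: T.conv2_def)
  have "\<exists>k. \<forall>m\<ge>k. \<forall>n\<ge>k. T.n2 (X m - X n) \<le> e" if e: "0 < e" for e
  proof -
    have "(\<lambda>n. T.n2 (X n - x)) \<longlonglongrightarrow> 0" using x by (simp add: T.conv2_def)
    then obtain k where k: "\<And>n. n \<ge> k \<Longrightarrow> norm (T.n2 (X n - x) - 0) < e / 2"
      using LIMSEQ_D[of _ 0 "e / 2"] e by (metis half_gt_zero)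
    have "T.n2 (X m - X n) \<le> e" if "m \<ge> k" "n \<ge> k" for m n
      using T.n2_triangle3[OF XA(1)[of m] XA(2) XA(1)[of n]] T.n2_minus_commute[OF XA(2) XA(1)[of n]]
        k[OF that(1)] k[OF that(2)] by simp
    then show ?thesis by blast
  qed
  then obtain y where y: "S.T.conv2 X y" by (rule S.T.conv2_complete[OF X])
  then have "T.conv2 X y" by (auto simp: T.conv2_def S.T.conv2_def B_A)
  then have "x = y" using T.conv2_unique x by blast
  then show ?thesis using y by (simp add: S.T.conv2_def)
qed

text \<open>Dropping the negative part \<open>n\<close> removes a nonnegative square and the inner
  product of \<open>x\<close> with \<open>n\<close>, nonnegative as both are positive.\<close>

lemma positive_part_closer:
  assumes x: "x \<in> A" "posop x" and c: "c \<in> B" "star c = c"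
  obtains p n where "p \<in> B" "posop p" "n \<in> B" "posop n" "c = p - n" "p * n = 0" "n * p = 0"
    "T.ip (x - p) (x - p) \<le> T.ip (x - c) (x - c)"
proof -
  obtain p n where pn: "p \<in> B" "n \<in> B" "posop p" "posop n" "c = p - n" "p * n = 0" "n * p = 0"
    by (rule S.pos_neg_parts[OF c]) blast
  have A: "p \<in> A" "n \<in> A" using pn B_A by auto
  obtain r where r: "posop r" "r * r = n" "\<And>c. c * n = n * c \<Longrightarrow> c * r = r * c"
    by (erule posop_sqrt[OF pn(4)])
  have rA: "r \<in> A" by (rule commuting_A[OF A(2)]) (rule r(3))
  have "0 \<le> tr (star r * x * r)"
    by (intro tr_posop posop_conj x A_closed rA)
  also have "star r * x * r = r * (x * r)" using posopD(1)[OF r(1)] by (simp add: mult.assoc)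
  also have "tr \<dots> = tr (x * r * r)" by (intro tr_commute mult_A x rA)
  also have "x * r * r = x * n" using r(2) by (simp only: mult.assoc)
  also have "tr \<dots> = T.ip x n"
    unfolding T.ip_def posopD(1)[OF pn(4)] by (rule tr_commute[OF x(1) A(2)])
  finally have xn: "0 \<le> T.ip x n" .
  have "T.ip (d + n) (d + n) = T.ip d d + 2 * T.ip d n + T.ip n n" if "d \<in> A" for d
    using A that T.ip_commute[of n d] by simp
  moreover have "x - c = (x - p) + n" using pn(5) by simp
  ultimately have "T.ip (x - c) (x - c) = T.ip (x - p) (x - p) + 2 * T.ip (x - p) n + T.ip n n"
    using A x(1) diff_A by metis
  moreover have "T.ip (x - p) n = T.ip x n"
    using A x(1) pn(7) posopD(1)[OF pn(4)] by (simp add: T.ip_def right_diff_distrib)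
  moreover have "0 \<le> T.ip n n" using A by simp
  ultimately have "T.ip (x - p) (x - p) \<le> T.ip (x - c) (x - c)" using xn by linarith
  with pn show thesis using that by blast
qed

text \<open>The positive part is taken twice, for \<open>c\<close> and then for 1 minus the result.
  The second one, \<open>q\<close>, is at most 1 because \<open>q * q - q * q * q\<close> is a
  conjugate of the positive \<open>p\<close>.\<close>

lemma truncation_closer:
  assumes x: "x \<in> A" "posop x" "posop (1 - x)" and c: "c \<in> B" "star c = c"
  shows "\<exists>b\<in>B. posop b \<and> posop (1 - b) \<and> T.ip (x - b) (x - b) \<le> T.ip (x - c) (x - c)"
proof -
  obtain p where p: "p \<in> B" "posop p" "T.ip (x - p) (x - p) \<le> T.ip (x - c) (x - c)"
    by (rule positive_part_closer[OF x(1,2) c]) blast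
  have "1 - x \<in> A" "1 - p \<in> B" "star (1 - p) = 1 - p"
    using x(1) p posopD(1)[OF p(2)] by (auto intro: diff_A one_A S.diff_A S.one_A)
  then obtain q n where q: "q \<in> B" "posop q" "posop n" "1 - p = q - n" "q * n = 0" "n * q = 0"
    "T.ip (1 - x - q) (1 - x - q) \<le> T.ip (1 - x - (1 - p)) (1 - x - (1 - p))"
    by (rule positive_part_closer[OF _ x(3)]) blast
  have sq: "star q = q" by (rule posopD(1)[OF q(2)])
  have "q * (1 - p) * q = q * q * q" using q(4,5) by (simp add: right_diff_distrib)
  then have "q * q - q * q * q = star q * p * q" using sq by (simp add: algebra_simps)
  then have le: "posop (q * q - q * q * q)" using posop_conj[OF p(2), of q] by simp
  have "posop (q * q * q)" using posop_conj[OF q(2), of q] sq by simp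
  moreover have "posop (norm (q * q) *\<^sub>R 1 - q * q * q)"
    using posop_add[OF le posop_bound[of "q * q" "norm (q * q)"]] sq by simp
  ultimately have "norm (q * q * q) \<le> norm (q * q)" by (rule posop_norm_le) simp
  moreover have "(norm (q * q))\<^sup>2 \<le> norm (q * q * q) * norm q"
    using norm_square_self_adjoint[of "q * q"] norm_mult_ineq[of "q * q * q" q] sq by (simp add: mult.assoc)
  moreover have nq: "norm (q * q) = (norm q)\<^sup>2" by (rule norm_square_self_adjoint[OF sq])
  ultimately have "((norm q)\<^sup>2)\<^sup>2 \<le> (norm q)\<^sup>2 * norm q"
    by (metis mult_right_mono norm_ge_zero order_trans)
  then have "norm q \<le> 1"
    by (cases "norm q = 0") (auto simp: power2_eq_square)
  then have "posop (1 - q)" using posop_bound[OF sq, of 1] by simp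
  moreover have "x - (1 - q) = - (1 - x - q)" "1 - x - (1 - p) = - (x - p)" by simp_all
  then have "T.ip (x - (1 - q)) (x - (1 - q)) \<le> T.ip (x - c) (x - c)"
    using q(7) p(1,3) q(1) x(1) B_A by (simp only: T.ip_minus_left T.ip_minus_right A_closed)
  ultimately show ?thesis using q(1,2) by (intro bexI[of _ "1 - q"]) (auto intro: S.diff_A S.one_A)
qed

text \<open>For self-adjoint \<open>d\<close> and \<open>b\<close> the trace of \<open>d * b\<close>
  is real, so the real inner product of \<open>d\<close> with \<i> times \<open>b\<close> vanishes
  by itself.\<close>

lemma ip_zero_complex:
  assumes d: "d \<in> A" "star d = d" and orth: "\<And>c. c \<in> B \<Longrightarrow> star c = c \<Longrightarrow> T.ip d c = 0" and y: "y \<in> B"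
  shows "T.ip d y = 0"
proof -
  obtain a b where ab: "a \<in> B" "b \<in> B" and sa: "star a = a" and sb: "star b = b"
    and ydec: "y = a + sc \<i> * b" by (rule S.self_adjoint_parts[OF y])
  have m: "sc (- \<i>) = - sc \<i>" by (rule sc_minus)
  have "T.ip d (sc \<i> * b) = 0"
  proof -
    have bA: "b \<in> A" using ab B_A by blast
    have "T.ip d (sc \<i> * b) = tr (b * sc (- \<i>) * d)" by (simp add: T.ip_def sb)
    also have "b * sc (- \<i>) * d = sc (- \<i>) * (b * d)" by (simp only: sc_commute[of "- \<i>" b, symmetric] mult.assoc)
    also have "tr \<dots> = - tr (sc \<i> * (b * d))" using bA d(1) by (simp add: m sc_in_A tr_minus mult_A)
    finally have 1: "T.ip d (sc \<i> * b) = - tr (sc \<i> * (b * d))" .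
    have "tr (sc \<i> * (b * d)) = tr (star (sc \<i> * (b * d)))"
      using bA d(1) by (intro tr_star[symmetric] A_closed)
    also have "star (sc \<i> * (b * d)) = - (d * (sc \<i> * b))"
      by (simp add: sb d(2) m mult.assoc sc_commute[of \<i> b])
    also have "tr \<dots> = - tr (d * (sc \<i> * b))" using bA d(1) by (intro tr_minus A_closed)
    also have "tr (d * (sc \<i> * b)) = tr (sc \<i> * b * d)" using bA d(1) by (intro tr_commute A_closed)
    finally show ?thesis using 1 by (simp add: mult.assoc)
  qed
  moreover have "T.ip d y = T.ip d a + T.ip d (sc \<i> * b)"
    using ydec d(1) ab B_A by (metis T.ip_add_right sc_A)
  ultimately show ?thesis using orth[OF ab(1) sa] by simp
qed

text \<open>Nearest points in \<open>B\<close> might be unbounded. Minimising only between 0 and 1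
  keeps the limit in a ball, and \<open>truncation_closer\<close> shows that the minimum is that
  over all self-adjoint elements of \<open>B\<close>, which gives orthogonality.\<close>

lemma expectation_exists_unit:
  assumes x: "x \<in> A" "posop x" "posop (1 - x)"
  shows "\<exists>e\<in>B. \<forall>y\<in>B. T.ip e y = T.ip x y"
proof -
  define C where "C = {b \<in> B. posop b \<and> posop (1 - b)}"
  define q where "q b = T.ip (x - b) (x - b)" for b
  define d where "d b c = T.ip (b - c) (b - c)" for b c
  have CB: "b \<in> B" "b \<in> A" "star b = b" "norm b \<le> 1" if "b \<in> C" for b
    using that B_A posopD(1)[of b] posop_norm_le[of b 1] by (auto simp: C_def)
  obtain X m where X: "\<And>n. X n \<in> C" "\<And>n. q (X n) \<le> m + 1 / real (Suc n)" "\<And>y. y \<in> C \<Longrightarrow> m \<le> q y"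
    "\<And>y z. y \<in> C \<Longrightarrow> z \<in> C \<Longrightarrow> d y z \<le> 2 * (q y - m) + 2 * (q z - m)"
  proof (rule minimising_sequence[of C q d])
    have "0 \<in> C" using S.zero_A by (simp add: C_def posop_zero posop_one)
    then show "C \<noteq> {}" by blast
    show "0 \<le> q b" if "b \<in> C" for b unfolding q_def by (intro T.ip_nonneg diff_A x CB[OF that])
    fix b c assume bc: "b \<in> C" "c \<in> C"
    have "q ((1/2) *\<^sub>R (b + c)) = (q b + q c) / 2 - d b c / 4"
      using CB[OF bc(1)] CB[OF bc(2)] x(1) T.ip_commute[of b c] T.ip_commute[of b x] T.ip_commute[of c x]
      by (simp add: q_def d_def field_simps)
    moreover have "(1/2) *\<^sub>R (b + c) \<in> C"
    proof -
      have "1 - (1/2) *\<^sub>R (b + c) = (1/2) *\<^sub>R ((1 - b) + (1 - c))"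
        by (simp add: algebra_simps scaleR_2[symmetric])
      then show ?thesis using bc by (auto simp: C_def intro!: S.A_closed posop_scaleR posop_add)
    qed
    ultimately show "\<exists>z\<in>C. q z \<le> (q b + q c) / 2 - d b c / 4" by (metis order_refl)
  qed (use that in blast)
  have low: "m \<le> q c" if c: "c \<in> B" "star c = c" for c
  proof -
    obtain b where "b \<in> C" "q b \<le> q c"
      using truncation_closer[OF x c] unfolding C_def q_def by blast
    then show ?thesis using X(3) order_trans by blast
  qed
  have "\<exists>k. \<forall>i\<ge>k. \<forall>n\<ge>k. T.n2 (X i - X n) \<le> e" if e: "0 < e" for e
  proof -
    obtain k where k: "4 / e\<^sup>2 < real k" using reals_Archimedean2 by blast
    have "T.n2 (X i - X n) \<le> e" if "i \<ge> k" "n \<ge> k" for i n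
    proof (rule power2_le_imp_le)
      have "real (Suc i) > 4 / e\<^sup>2" "real (Suc n) > 4 / e\<^sup>2" using k that by linarith+
      then have "1 / real (Suc i) < e\<^sup>2 / 4" "1 / real (Suc n) < e\<^sup>2 / 4"
        using e by (simp_all add: field_simps)
      then have "q (X i) \<le> m + e\<^sup>2 / 4" "q (X n) \<le> m + e\<^sup>2 / 4"
        by (meson X(2) add_left_mono less_imp_le order_trans)+
      then have "d (X i) (X n) \<le> e\<^sup>2" using X(4)[OF X(1)[of i] X(1)[of n]] by argo
      then show "(T.n2 (X i - X n))\<^sup>2 \<le> e\<^sup>2" using CB[OF X(1)] by (simp add: T.n2_sq d_def)
    qed (use e in simp)
    then show ?thesis by blast
  qed
  then obtain e where e: "T.conv2 X e" by (rule T.conv2_complete[OF CB(2,4)[OF X(1)]])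
  have eA: "e \<in> A" using e by (simp add: T.conv2_def)
  have eB: "e \<in> B" by (rule conv2_closed[OF CB(1,4)[OF X(1)] e])
  have es: "star e = e"
    using T.conv2_star[OF e] CB(3)[OF X(1)] T.conv2_unique[of X "star e" e] e by simp
  have orth: "T.ip (x - e) c = 0" if c: "c \<in> B" "star c = c" for c
  proof -
    have cA: "c \<in> A" using c B_A by blast
    have lim: "(\<lambda>n. T.ip (X n) c) \<longlonglongrightarrow> T.ip e c" by (rule T.conv2_ip[OF e cA])
    have "0 \<le> 0 + 2 * t * T.ip (x - e) c + t\<^sup>2 * T.ip c c" for t
    proof (rule LIMSEQ_le_const)
      have "(\<lambda>n. 1 / real (Suc n) + 2 * t * (T.ip x c - T.ip (X n) c) + t\<^sup>2 * T.ip c c) \<longlonglongrightarrow>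
          0 + 2 * t * (T.ip x c - T.ip e c) + t\<^sup>2 * T.ip c c"
        by (intro tendsto_intros lim LIMSEQ_Suc[OF lim_1_over_n])
      then show "(\<lambda>n. 1 / real (Suc n) + 2 * t * (T.ip x c - T.ip (X n) c) + t\<^sup>2 * T.ip c c) \<longlonglongrightarrow>
          0 + 2 * t * T.ip (x - e) c + t\<^sup>2 * T.ip c c" using x(1) eA cA by simp
      have "0 \<le> 1 / real (Suc n) + 2 * t * (T.ip x c - T.ip (X n) c) + t\<^sup>2 * T.ip c c" for n
      proof -
        have B: "X n - t *\<^sub>R c \<in> B" using CB[OF X(1)] c by (intro S.A_closed)
        have "m \<le> q (X n - t *\<^sub>R c)" by (rule low[OF B]) (simp add: CB[OF X(1)] c)
        also have "\<dots> = q (X n) + 2 * t * (T.ip x c - T.ip (X n) c) + t\<^sup>2 * T.ip c c"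
          using CB[OF X(1)[of n]] x(1) cA T.ip_commute[of "X n" c] T.ip_commute[of x c]
          by (simp add: q_def algebra_simps power2_eq_square)
        finally show ?thesis using X(2)[of n] by linarith
      qed
      then show "\<exists>N. \<forall>n\<ge>N. 0 \<le> 1 / real (Suc n) + 2 * t * (T.ip x c - T.ip (X n) c) + t\<^sup>2 * T.ip c c"
        by blast
    qed
    then have "(T.ip (x - e) c)\<^sup>2 \<le> 0 * T.ip c c" by (rule quadratic_nonneg_imp) (use cA in simp)
    then show ?thesis by simp
  qed
  have "T.ip e y = T.ip x y" if "y \<in> B" for y
  proof -
    have "T.ip (x - e) y = 0"
      by (rule ip_zero_complex[OF _ _ orth that]) (use x eA es posopD(1)[OF x(2)] in \<open>auto intro: diff_A\<close>)
    then show ?thesis using x(1) eA B_A[OF that] by simp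
  qed
  then show ?thesis using eB by blast
qed

lemma expectation_exists:
  assumes x: "x \<in> A"
  shows "\<exists>e\<in>B. \<forall>y\<in>B. T.ip e y = T.ip x y"
proof -
  have sa: "\<exists>e\<in>B. \<forall>y\<in>B. T.ip e y = T.ip a y" if a: "a \<in> A" "star a = a" for a
  proof -
    define k where "k = norm a + 1"
    have k: "0 < k" "norm a \<le> k" "norm (- a) \<le> k" by (auto simp: k_def add_nonneg_pos)
    define b where "b = (1 / 2) *\<^sub>R 1 + (1 / (2 * k)) *\<^sub>R a"
    have b: "b \<in> A" unfolding b_def by (intro A_closed a)
    have "1 - b = (1 / (2 * k)) *\<^sub>R (k *\<^sub>R 1 - a)"
      using k half_one[of "1 :: 'h bop"] by (simp add: b_def scaleR_diff_right algebra_simps)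
    then have "posop (1 - b)" using posop_scaleR[OF posop_bound[OF a(2) k(2)], of "1 / (2 * k)"] k by simp
    moreover have "b = (1 / (2 * k)) *\<^sub>R (k *\<^sub>R 1 - - a)"
      using k by (simp add: b_def scaleR_add_right)
    then have "posop b"
      using posop_scaleR[OF posop_bound[OF _ k(3)], of "1 / (2 * k)"] k a(2) by simp
    ultimately obtain f where f: "f \<in> B" "\<And>y. y \<in> B \<Longrightarrow> T.ip f y = T.ip b y"
      using expectation_exists_unit[OF b] by blast
    have ab: "a = (2 * k) *\<^sub>R b - k *\<^sub>R 1" using k by (simp add: b_def scaleR_add_right)
    have "T.ip ((2 * k) *\<^sub>R f - k *\<^sub>R 1) y = T.ip a y" if "y \<in> B" for y
      unfolding ab using f(1) b B_A that f(2)[OF that] by simp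
    then show ?thesis by (intro bexI[of _ "(2 * k) *\<^sub>R f - k *\<^sub>R 1"]) (auto intro!: S.A_closed f(1))
  qed
  obtain a b where ab: "a \<in> A" "b \<in> A" and "star a = a" "star b = b"
    and xdec: "x = a + sc \<i> * b" by (rule self_adjoint_parts[OF x])
  then obtain e f where ef: "e \<in> B" "\<And>y. y \<in> B \<Longrightarrow> T.ip e y = T.ip a y"
    "f \<in> B" "\<And>y. y \<in> B \<Longrightarrow> T.ip f y = T.ip b y"
    using sa by metis
  have A: "e \<in> A" "f \<in> A" using ef B_A by auto
  have "T.ip (e + sc \<i> * f) y = T.ip x y" if y: "y \<in> B" for y
  proof -
    have yA: "y \<in> A" using y B_A by blast
    have "T.ip (sc \<i> * f) y = T.ip f (star (sc \<i>) * y)" using A yA by (intro T.ip_mult_left sc_in_A)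
    also have "\<dots> = T.ip b (star (sc \<i>) * y)" using y by (intro ef S.A_closed S.star_A)
    also have "\<dots> = T.ip (sc \<i> * b) y" using ab yA by (intro T.ip_mult_left[symmetric] sc_in_A)
    finally show ?thesis unfolding xdec using A ab yA sc_A ef(2)[OF y] by simp
  qed
  then show ?thesis by (intro bexI[of _ "e + sc \<i> * f"]) (auto intro!: S.A_closed ef)
qed

definition E :: "'h bop \<Rightarrow> 'h bop"
  where "E x = (SOME e. e \<in> B \<and> (\<forall>y\<in>B. T.ip e y = T.ip x y))"

lemma E_B: "x \<in> A \<Longrightarrow> E x \<in> B" and E_ip: "x \<in> A \<Longrightarrow> y \<in> B \<Longrightarrow> T.ip (E x) y = T.ip x y"
proof -
  have *: "E x \<in> B \<and> (\<forall>y\<in>B. T.ip (E x) y = T.ip x y)" if "x \<in> A" for x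
    unfolding E_def by (rule someI_ex) (use expectation_exists[OF that] in blast)
  show "x \<in> A \<Longrightarrow> E x \<in> B" "x \<in> A \<Longrightarrow> y \<in> B \<Longrightarrow> T.ip (E x) y = T.ip x y" using * by auto
qed

lemma E_A: "x \<in> A \<Longrightarrow> E x \<in> A"
  by (rule B_A[OF E_B])

lemma E_unique:
  assumes x: "x \<in> A" and e: "e \<in> B" "\<And>y. y \<in> B \<Longrightarrow> T.ip e y = T.ip x y"
  shows "E x = e"
proof (rule S.T.ip_eqI[OF E_B[OF x] e(1)])
  show "T.ip (E x) y = T.ip e y" if "y \<in> B" for y using e(2)[OF that] E_ip[OF x that] by simp
qed

lemma E_id: "x \<in> B \<Longrightarrow> E x = x"
  by (rule E_unique[OF B_A]) simp_all

lemma E_add: assumes x: "x \<in> A" and y: "y \<in> A" shows "E (x + y) = E x + E y"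
proof (rule E_unique)
  show "x + y \<in> A" "E x + E y \<in> B" by (intro add_A S.add_A E_B x y)+
  show "T.ip (E x + E y) z = T.ip (x + y) z" if z: "z \<in> B" for z
    using E_ip[OF x z] E_ip[OF y z] E_A[OF x] E_A[OF y] x y B_A[OF z] by simp
qed

lemma E_bimodule: "x \<in> A \<Longrightarrow> a \<in> B \<Longrightarrow> b \<in> B \<Longrightarrow> E (a * x * b) = a * E x * b"
proof (rule E_unique)
  assume x: "x \<in> A" and ab: "a \<in> B" "b \<in> B"
  show "a * x * b \<in> A" "a * E x * b \<in> B"
    by (intro mult_A S.mult_A E_B x ab B_A[OF ab(1)] B_A[OF ab(2)])+
  fix y assume y: "y \<in> B"
  have *: "T.ip (a * z * b) y = T.ip z (star a * (y * star b))" if "z \<in> A" for z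
    using T.ip_mult_right[of "a * z" b y] T.ip_mult_left[of a z "y * star b"]
      that B_A[OF ab(1)] B_A[OF ab(2)] B_A[OF y] by simp
  show "T.ip (a * E x * b) y = T.ip (a * x * b) y"
    unfolding *[OF x] *[OF E_A[OF x]] by (intro E_ip x S.A_closed S.star_A ab y)
qed

lemma E_sc: "x \<in> A \<Longrightarrow> E (sc c * x) = sc c * E x"
  using E_bimodule[of x "sc c" 1] S.sc_in_A S.one_A by simp

lemma E_star: "x \<in> A \<Longrightarrow> E (star x) = star (E x)"
proof (rule E_unique)
  assume x: "x \<in> A"
  show "star x \<in> A" "star (E x) \<in> B" using x by (auto intro: star_A S.star_A E_B)
  show "T.ip (star (E x)) y = T.ip (star x) y" if y: "y \<in> B" for y
    using T.ip_star[of "E x" "star y"] T.ip_star[of x "star y"] E_ip[OF x S.star_A[OF y]]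
      x y B_A E_A by simp
qed

lemma E_tr: "x \<in> A \<Longrightarrow> tr (E x) = tr x"
  using E_ip[of x 1] S.one_A by (simp add: T.ip_def)

lemma E_tr_mult: "x \<in> A \<Longrightarrow> y \<in> B \<Longrightarrow> tr (star y * E x) = tr (star y * x)"
  using E_ip[of x y] by (simp add: T.ip_def)

lemma E_conj_tr: "x \<in> A \<Longrightarrow> z \<in> B \<Longrightarrow> tr (star z * (E x * z)) = tr (star z * (x * z))"
  using E_tr[of "star z * x * z"] E_bimodule[of x "star z" z] B_A
  by (simp add: mult.assoc A_closed S.star_A)

lemma E_posop: "x \<in> A \<Longrightarrow> posop x \<Longrightarrow> posop (E x)"
proof (rule S.posop_trI)
  assume x: "x \<in> A" "posop x"
  show "E x \<in> B" by (rule E_B[OF x(1)])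
  show "star (E x) = E x" using E_star[OF x(1)] posopD(1)[OF x(2)] by simp
  fix z assume z: "z \<in> B"
  have "0 \<le> tr (star z * x * z)" by (intro tr_posop posop_conj x A_closed B_A[OF z])
  then show "0 \<le> tr (star z * (E x * z))" by (simp add: E_conj_tr[OF x(1) z] mult.assoc)
qed

lemma E_minus: "x \<in> A \<Longrightarrow> E (- x) = - E x"
  using E_bimodule[of x "- 1" 1] S.minus_A[OF S.one_A] S.one_A by simp

lemma E_diff: "x \<in> A \<Longrightarrow> y \<in> A \<Longrightarrow> E (x - y) = E x - E y"
  using E_add[of x "- y"] E_minus[of y] minus_A[of y] by simp

end

subsection \<open>Suprema\<close>

definition directed :: "'h::chilbert_space bop set \<Rightarrow> 'h bop set \<Rightarrow> bool"
  where "directed A D \<longleftrightarrow> D \<noteq> {} \<and> (\<forall>x\<in>D. x \<in> A \<and> star x = x) \<and>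
    (\<forall>x\<in>D. \<forall>y\<in>D. \<exists>z\<in>D. posop (z - x) \<and> posop (z - y))"

definition op_sup :: "'h::chilbert_space bop set \<Rightarrow> 'h bop set \<Rightarrow> 'h bop \<Rightarrow> bool"
  where "op_sup A D s \<longleftrightarrow> s \<in> A \<and> star s = s \<and> (\<forall>x\<in>D. posop (s - x)) \<and>
    (\<forall>t\<in>A. star t = t \<longrightarrow> (\<forall>x\<in>D. posop (t - x)) \<longrightarrow> posop (t - s))"

lemma (in vn_algebra) slim_op_sup:
  assumes X: "\<And>n. X n \<in> A" "\<And>n. star (X n) = X n" "\<And>n. posop (X (Suc n) - X n)" and x: "slim X x"
  shows "directed A (range X)" "op_sup A (range X) x"
proof -
  have mono: "n \<le> m \<Longrightarrow> posop (X m - X n)" for m n using monotone_posop[of X] X(3) by blast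
  have "\<exists>z\<in>range X. posop (z - X n) \<and> posop (z - X m)" for n m
    using mono[of n "max n m"] mono[of m "max n m"] by auto
  then show "directed A (range X)" using X by (auto simp: directed_def)
  have "posop (x - X n)" for n
    by (rule slim_posop[OF slim_diff[OF x slim_const]]) (rule mono)
  moreover have "posop (t - x)" if "\<And>n. posop (t - X n)" for t
    by (rule slim_posop[OF slim_diff[OF slim_const x]]) (rule that)
  ultimately show "op_sup A (range X) x"
    using slim_A[OF x X(1)] slim_star_eq[OF x X(2)] by (auto simp: op_sup_def)
qed

lemma (in vn_algebra) op_sup_conj:
  assumes D: "directed A D" and s: "op_sup A D s"
    and w: "w \<in> A" "v \<in> A" "star w = w" "star v = v" "v * w = 1" "w * v = 1"
  shows "directed A ((\<lambda>x. w * x * w) ` D)" "op_sup A ((\<lambda>x. w * x * w) ` D) (w * s * w)"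
proof -
  have c: "posop (w * z * w - w * x * w)" if "posop (z - x)" for x z
    using posop_conj[OF that, of w] w(3) by (simp add: algebra_simps)
  have DA: "x \<in> A \<and> star x = x" if "x \<in> D" for x using D that by (auto simp: directed_def)
  have "\<exists>z\<in>D. posop (w * z * w - w * x * w) \<and> posop (w * z * w - w * y * w)" if "x \<in> D" "y \<in> D" for x y
    using D that c unfolding directed_def by metis
  then show "directed A ((\<lambda>x. w * x * w) ` D)"
    using D DA w by (auto simp: directed_def mult.assoc intro!: mult_A)
  have sA: "s \<in> A" "star s = s" "\<And>x. x \<in> D \<Longrightarrow> posop (s - x)"
    "\<And>t. t \<in> A \<Longrightarrow> star t = t \<Longrightarrow> (\<And>x. x \<in> D \<Longrightarrow> posop (t - x)) \<Longrightarrow> posop (t - s)"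
    using s by (auto simp: op_sup_def)
  have cancel: "v * (w * x * w) * v = x" "w * (v * x * v) * w = x" for x
    using w(5,6) by (metis mult.assoc mult_1_left mult_1_right)+
  have "posop (t - w * s * w)" if t: "t \<in> A" "star t = t" "\<And>x. x \<in> D \<Longrightarrow> posop (t - w * x * w)" for t
  proof -
    have "posop (v * t * v - s)"
    proof (rule sA(4))
      show "v * t * v \<in> A" "star (v * t * v) = v * t * v" using t w by (auto intro: mult_A simp: mult.assoc)
      fix x assume "x \<in> D"
      have "star v * (t - w * x * w) * v = v * t * v - v * (w * x * w) * v"
        using w(4) by (simp add: algebra_simps)
      then show "posop (v * t * v - x)" using posop_conj[OF t(3)[OF \<open>x \<in> D\<close>], of v] cancel(1)[of x] by simp
    qed
    then show ?thesis using c[of "v * t * v" s] cancel(2)[of t] by simp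
  qed
  then show "op_sup A ((\<lambda>x. w * x * w) ` D) (w * s * w)"
    using sA w c by (auto simp: op_sup_def mult.assoc intro!: mult_A)
qed

text \<open>
  The upper bound is tested against \<open>w * _ * w\<close> with \<open>w\<close> invertible, because only then does
  conjugation by \<open>w\<close> preserve suprema; a general positive \<open>k\<close> is reached as the limit of \<open>k + e\<close>.
\<close>

lemma (in vn_pair) E_op_sup:
  assumes normal: "\<And>D s. directed A D \<Longrightarrow> op_sup A D s \<Longrightarrow> tr s = (SUP x\<in>D. tr x)"
    and D: "directed A D" and s: "op_sup A D s"
  shows "op_sup B (E ` D) (E s)"
proof -
  have sA: "s \<in> A" "star s = s" "\<And>x. x \<in> D \<Longrightarrow> posop (s - x)" using s by (auto simp: op_sup_def)
  have DA: "x \<in> A" "star x = x" if "x \<in> D" for x using D that by (auto simp: directed_def)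
  have "posop (t - E s)" if t: "t \<in> B" "star t = t" "\<And>x. x \<in> D \<Longrightarrow> posop (t - E x)" for t
  proof (rule S.posop_trI)
    show "t - E s \<in> B" "star (t - E s) = t - E s"
      using t E_B[OF sA(1)] E_star[OF sA(1)] sA(2) by (auto intro: S.diff_A)
    fix z assume z: "z \<in> B"
    define k where "k = z * star z"
    have k: "k \<in> B" "posop k" unfolding k_def using z posop_star_mult[of "star z"]
      by (auto intro: S.mult_A S.star_A)
    have d: "t - E s \<in> A" using t(1) E_A[OF sA(1)] B_A by (intro diff_A) auto
    have pos: "0 \<le> tr (k * (t - E s)) + e * tr (t - E s)" if e: "0 < e" for e
    proof -
      have kp: "posop (k + e *\<^sub>R 1)" using k e by (intro posop_add posop_scaleR posop_one) auto
      obtain w where w: "posop w" "w * w = k + e *\<^sub>R 1" "\<And>c. c * (k + e *\<^sub>R 1) = (k + e *\<^sub>R 1) * c \<Longrightarrow> c * w = w * c"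
        by (erule posop_sqrt[OF kp])
      obtain h where h: "posop h" "h * (k + e *\<^sub>R 1) = 1" "(k + e *\<^sub>R 1) * h = 1" "\<And>c. c * k = k * c \<Longrightarrow> c * h = h * c"
        by (erule posop_inverse[OF k(2) e])
      have wB: "w \<in> B"
      proof (rule S.commuting_A[of "k + e *\<^sub>R 1"])
        show "k + e *\<^sub>R 1 \<in> B" by (intro S.add_A S.scaleR_A S.one_A k)
      qed (rule w(3))
      have hB: "h \<in> B" by (rule S.commuting_A[OF k(1)]) (rule h(4))
      have "w * (k + e *\<^sub>R 1) = (k + e *\<^sub>R 1) * w" unfolding w(2)[symmetric] by (rule mult.assoc[symmetric])
      then have "w * k = k * w" by (simp add: distrib_left distrib_right)
      then have wh: "w * h = h * w" by (rule h(4))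
      have sw: "star w = w" and sh: "star h = h" by (rule posopD(1)[OF w(1)], rule posopD(1)[OF h(1)])
      have inv2: "w * (w * h) = 1" using h(3) unfolding w(2)[symmetric] by (simp only: mult.assoc)
      have inv1: "(w * h) * w = 1" using h(2) unfolding w(2)[symmetric] wh by (simp only: mult.assoc)
      have inv3: "star (w * h) = w * h" unfolding star_mult sw sh by (rule wh[symmetric])
      have wA: "w \<in> A" "w * h \<in> A" using wB hB B_A mult_A by auto
      note dir = op_sup_conj[OF D s wA sw inv3 inv1 inv2]
      have "tr (w * s * w) = (SUP x\<in>(\<lambda>x. w * x * w) ` D. tr x)" by (rule normal[OF dir])
      also have "\<dots> \<le> tr (w * t * w)"
      proof (rule cSUP_least)
        show "(\<lambda>x. w * x * w) ` D \<noteq> {}" using D by (simp add: directed_def)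
        fix y assume "y \<in> (\<lambda>x. w * x * w) ` D"
        then obtain x where x: "x \<in> D" "y = w * x * w" by blast
        have "tr y = tr (star w * (E x * w))"
          using E_conj_tr[OF DA(1)[OF x(1)] wB] sw x(2) by (simp add: mult.assoc)
        also have "\<dots> \<le> tr (w * t * w)"
        proof (rule tr_mono)
          show "star w * (E x * w) \<in> A" "w * t * w \<in> A"
            using wA E_A[OF DA(1)[OF x(1)]] B_A[OF t(1)] sw by (auto intro!: mult_A)
          have "star w * (t - E x) * w = w * t * w - star w * (E x * w)" by (simp add: sw algebra_simps)
          then show "posop (w * t * w - star w * (E x * w))" using posop_conj[OF t(3)[OF x(1)], of w] by simp
        qed
        finally show "tr y \<le> tr (w * t * w)" .
      qed
      finally have "tr (w * s * w) \<le> tr (w * t * w)" .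
      moreover have "tr (w * s * w) = tr (w * E s * w)"
        using E_conj_tr[OF sA(1) wB] sw by (simp add: mult.assoc)
      moreover have "tr (w * t * w) - tr (w * E s * w) = tr (w * (t - E s) * w)"
        using wA t(1) B_A E_A[OF sA(1)] tr_diff[of "w * t * w" "w * E s * w"] mult_A
        by (simp add: right_diff_distrib left_diff_distrib)
      moreover have "tr (w * (t - E s) * w) = tr (w * w * (t - E s))"
        using tr_commute[of "w * (t - E s)" w] wA d mult_A by (simp add: mult.assoc)
      moreover have "tr (w * w * (t - E s)) = tr (k * (t - E s)) + e * tr (t - E s)"
        using d k(1) B_A unfolding w(2) by (simp add: distrib_right tr_add tr_scaleR mult_A scaleR_A)
      ultimately show ?thesis by linarith
    qed
    have "0 \<le> tr (k * (t - E s))"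
    proof (rule field_le_epsilon)
      fix e :: real assume e: "0 < e"
      define f where "f = e / (\<bar>tr (t - E s)\<bar> + 1)"
      have "0 < f" using e by (simp add: f_def)
      moreover have "f * tr (t - E s) \<le> e"
      proof -
        have "f * tr (t - E s) \<le> f * (\<bar>tr (t - E s)\<bar> + 1)" using \<open>0 < f\<close> by (intro mult_left_mono) auto
        also have "\<dots> = e" by (simp add: f_def)
        finally show ?thesis .
      qed
      ultimately show "0 \<le> tr (k * (t - E s)) + e" using pos[of f] by linarith
    qed
    also have "tr (k * (t - E s)) = tr (star z * ((t - E s) * z))"
      using tr_commute[of z "star z * (t - E s)"] z B_A d
        by (simp add: k_def mult.assoc A_closed)
    finally show "0 \<le> tr (star z * ((t - E s) * z))" .
  qed
  moreover have "posop (E s - E x)" if "x \<in> D" for x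
    using E_posop[OF diff_A[OF sA(1) DA(1)[OF that]] sA(3)[OF that]] E_diff[OF sA(1) DA(1)[OF that]] by simp
  ultimately show ?thesis
    using E_B[OF sA(1)] E_star[OF sA(1)] sA(2) by (auto simp: op_sup_def)
qed

section \<open>Unitaries and irreducibility\<close>

context vn_algebra
begin

lemma posop_sqrt_A:
  assumes "p \<in> A" "posop p"
  obtains r where "r \<in> A" "posop r" "r * r = p" "\<And>c. c * p = p * c \<Longrightarrow> c * r = r * c"
proof (rule posop_sqrt[OF assms(2)])
  fix r assume r: "posop r" "r * r = p" "\<And>c. c * p = p * c \<Longrightarrow> c * r = r * c"
  have "r \<in> A" by (rule commuting_A[OF assms(1)]) (rule r(3))
  then show thesis using r by (rule that)
qed

text \<open>A self-adjoint contraction \<open>c\<close> is the real part of the unitary \<open>c + \<i> \<surd>(1 - c\<^sup>2)\<close>.\<close>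

lemma self_adjoint_unitary:
  assumes a: "a \<in> A" "star a = a"
  obtains w r where "w \<in> A" "star w * w = 1" "w * star w = 1" "a = r *\<^sub>R (w + star w)"
    "\<And>c. c * a = a * c \<Longrightarrow> c * w = w * c"
proof -
  define k where "k = norm a + 1"
  have k: "0 < k" by (simp add: k_def add_nonneg_pos)
  define c where "c = (1 / k) *\<^sub>R a"
  have c: "c \<in> A" "star c = c" using a by (simp_all add: c_def scaleR_A)
  have "norm c \<le> 1" using k by (simp add: c_def k_def)
  then have p: "posop (1 - c * c)" using posop_norm_sq[of c] c(2) posop_add[OF posop_norm_sq[of c] posop_scaleR[OF posop_one, of "1 - (norm c)\<^sup>2"]]
    by (simp add: power_le_one scaleR_diff_left)
  have m: "1 - c * c \<in> A" by (intro A_closed c)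
  obtain s where s: "s \<in> A" "posop s" "s * s = 1 - c * c"
    "\<And>d. d * (1 - c * c) = (1 - c * c) * d \<Longrightarrow> d * s = s * d"
    by (erule posop_sqrt_A[OF m p])
  have ss: "star s = s" by (rule posopD(1)[OF s(2)])
  have cs: "c * s = s * c" by (rule s(4)) (simp add: algebra_simps)
  define w where "w = c + sc \<i> * s"
  have sw: "star w = c - sc \<i> * s" by (simp add: w_def c(2) ss sc_minus sc_commute)
  have "sc \<i> * s * (sc \<i> * s) = (sc \<i> * sc \<i>) * (s * s)" by (metis mult.assoc sc_commute)
  then have iss: "sc \<i> * s * (sc \<i> * s) = c * c - 1" by (simp add: sc_ii s(3))
  have ics: "c * (sc \<i> * s) = sc \<i> * s * c" by (metis cs mult.assoc sc_commute)
  show thesis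
  proof
    show "w \<in> A" unfolding w_def by (intro A_closed c s)
    show "star w * w = 1" "w * star w = 1"
      unfolding sw by (simp_all add: w_def algebra_simps iss[unfolded mult.assoc] ics[unfolded mult.assoc])
    show "a = (k / 2) *\<^sub>R (w + star w)" using k unfolding sw by (simp add: w_def c_def flip: scaleR_2)
    fix d assume "d * a = a * d"
    then have dc: "d * c = c * d" by (simp add: c_def)
    have "d * (1 - c * c) = (1 - c * c) * d"
      by (simp add: right_diff_distrib left_diff_distrib mult.assoc dc flip: mult.assoc[of d c c])
    then have "d * s = s * d" by (rule s(4))
    then show "d * w = w * d" by (simp add: w_def distrib_left distrib_right dc mult.assoc) (metis mult.assoc sc_commute)
  qed
qed

text \<open>The span is real, so the skew part is handled by \<open>sa\<close> with \<i> as the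
  unitary \<open>v\<close>.\<close>

lemma span_unitaries:
  assumes x: "x \<in> A" shows "x \<in> span {w \<in> A. star w * w = 1 \<and> w * star w = 1}"
proof -
  let ?U = "{w \<in> A. star w * w = 1 \<and> w * star w = 1}"
  have sa: "v * a \<in> span ?U" if a: "a \<in> A" "star a = a" and v: "v \<in> ?U" for a v
  proof -
    obtain w r where w: "w \<in> A" "star w * w = 1" "w * star w = 1" "a = r *\<^sub>R (w + star w)"
      by (rule self_adjoint_unitary[OF a]) blast
    have vw: "v * z \<in> ?U" if z: "z \<in> ?U" for z
    proof -
      have "star v * (v * z) = z" "z * (star z * star v) = star v"
        using v z by (simp_all flip: mult.assoc)
      then show ?thesis using v z by (auto intro: mult_A simp: mult.assoc)
    qed
    have "v * a = r *\<^sub>R (v * w + v * star w)" using w(4) by (simp add: distrib_left)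
    also have "\<dots> \<in> span ?U"
      by (intro span_scale span_add span_base vw) (use w star_A in auto)
    finally show ?thesis .
  qed
  obtain a b where ab: "a \<in> A" "b \<in> A" "star a = a" "star b = b" "x = a + sc \<i> * b"
    by (rule self_adjoint_parts[OF x])
  have "1 * a + sc \<i> * b \<in> span ?U"
    by (intro span_add sa ab) (auto simp: one_A sc_in_A sc_minus sc_ii)
  then show ?thesis using ab(5) by simp
qed

lemma conj_vn_algebra:
  assumes u: "star u * u = 1" "u * star u = 1"
  shows "vn_algebra {x. star u * x * u \<in> A}"
proof
  show "1 \<in> {x. star u * x * u \<in> A}" using u one_A by simp
  fix x y c
  show "x + y \<in> {x. star u * x * u \<in> A}" if "x \<in> {x. star u * x * u \<in> A}" "y \<in> {x. star u * x * u \<in> A}"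
    using that add_A by (simp add: distrib_left distrib_right)
  show "x * y \<in> {x. star u * x * u \<in> A}" if xy: "x \<in> {x. star u * x * u \<in> A}" "y \<in> {x. star u * x * u \<in> A}"
  proof -
    have "star u * (x * y) * u = star u * x * (u * star u) * y * u" using u by (simp add: mult.assoc)
    also have "\<dots> = (star u * x * u) * (star u * y * u)" by (simp only: mult.assoc)
    finally show ?thesis using xy mult_A by simp
  qed
  show "sc c * x \<in> {x. star u * x * u \<in> A}" if "x \<in> {x. star u * x * u \<in> A}"
  proof -
    have "star u * (sc c * x) * u = sc c * (star u * x * u)" by (metis mult.assoc sc_commute)
    then show ?thesis using that sc_A by simp
  qed
  show "star x \<in> {x. star u * x * u \<in> A}" if "x \<in> {x. star u * x * u \<in> A}"
    using that star_A[of "star u * x * u"] by (simp add: mult.assoc)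
  assume bic: "\<And>c. (\<And>a. a \<in> {x. star u * x * u \<in> A} \<Longrightarrow> c * a = a * c) \<Longrightarrow> c * x = x * c"
  have cancel: "star u * (u * z) = z" "u * (star u * z) = z" for z
    using u by (simp_all flip: mult.assoc)
  have "star u * x * u \<in> A"
  proof (rule bicommutant)
    fix d assume d: "\<And>a. a \<in> A \<Longrightarrow> d * a = a * d"
    have "(u * d * star u) * x = x * (u * d * star u)"
    proof (rule bic)
      fix a assume "a \<in> {x. star u * x * u \<in> A}"
      then have "d * (star u * a * u) = star u * a * u * d" using d by blast
      then have "u * (d * (star u * a * u)) * star u = u * (star u * a * u * d) * star u" by simp
      then show "(u * d * star u) * a = a * (u * d * star u)" using u cancel by (simp add: mult.assoc)
    qed
    then have "star u * ((u * d * star u) * x) * u = star u * (x * (u * d * star u)) * u" by simp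
    then show "d * (star u * x * u) = star u * x * u * d" using u cancel by (simp add: mult.assoc)
  qed
  then show "x \<in> {x. star u * x * u \<in> A}" by simp
qed

end

context vn_pair
begin

lemma E_closest:
  assumes x: "x \<in> A" and b: "b \<in> B" shows "T.n2 (x - E x) \<le> T.n2 (x - b)"
proof (rule power2_le_imp_le)
  define d where "d = E x - b"
  have d: "d \<in> B" unfolding d_def by (intro S.diff_A E_B x b)
  note A = x E_A[OF x] B_A[OF d] B_A[OF b]
  have o: "T.ip (x - E x) d = 0" using E_ip[OF x d] A by simp
  have "T.ip ((x - E x) + d) ((x - E x) + d) = T.ip (x - E x) (x - E x) + 2 * T.ip (x - E x) d + T.ip d d"
    using A T.ip_commute[of d "x - E x"] diff_A[OF A(1,2)] by (simp del: T.ip_diff_left T.ip_diff_right)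
  moreover have "(x - E x) + d = x - b" by (simp add: d_def)
  ultimately have "T.ip (x - b) (x - b) = T.ip (x - E x) (x - E x) + T.ip d d" using o by simp
  then show "(T.n2 (x - E x))\<^sup>2 \<le> (T.n2 (x - b))\<^sup>2"
    using T.ip_nonneg[OF A(3)] T.n2_sq[OF diff_A[OF A(1,2)]] T.n2_sq[OF diff_A[OF A(1,4)]] by linarith
  show "0 \<le> T.n2 (x - b)" using diff_A[OF A(1,4)] by simp
qed

text \<open>A self-adjoint element commuting with \<open>B\<close> is a multiple of the real part of
  a unitary that also commutes with \<open>B\<close>. By \<open>sing\<close> this unitary lies in
  \<open>B\<close>, hence in its centre.\<close>

lemma irreducible_inclusionI:
  assumes sing: "\<And>v. v \<in> A \<Longrightarrow> star v * v = 1 \<Longrightarrow> v * star v = 1 \<Longrightarrow>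
      (\<And>n. n \<in> B \<Longrightarrow> v * n = n * v) \<Longrightarrow> v \<in> B"
    and centre: "\<And>z. z \<in> B \<Longrightarrow> (\<And>n. n \<in> B \<Longrightarrow> z * n = n * z) \<Longrightarrow> \<exists>c. z = sc c"
  shows "irreducible_inclusion A tr B E (sc \<i>)"
proof
  fix x y m :: "'h bop" and r e :: real
  show "x \<in> B \<Longrightarrow> x \<in> A" by (rule B_A)
  show "1 \<in> B" by (rule S.one_A)
  show "x \<in> B \<Longrightarrow> y \<in> B \<Longrightarrow> x + y \<in> B" by (rule S.add_A)
  show "x \<in> B \<Longrightarrow> y \<in> B \<Longrightarrow> x * y \<in> B" by (rule S.mult_A)
  show "x \<in> B \<Longrightarrow> r *\<^sub>R x \<in> B" by (rule S.scaleR_A)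
  show "x \<in> B \<Longrightarrow> star x \<in> B" by (rule S.star_A)
  show "\<exists>h\<in>B. star h = h \<and> h * h = m \<and> (\<forall>z\<in>A. 0 \<le> tr (star z * (h * z))) \<and>
      (\<forall>c. c * m = m * c \<longrightarrow> c * h = h * c)"
    if m: "m \<in> B" "star m = m" "\<And>z. z \<in> B \<Longrightarrow> 0 \<le> tr (star z * (m * z))"
  proof (rule S.posop_sqrt_A[OF m(1) S.posop_trI[OF m]])
    fix h assume h: "h \<in> B" "posop h" "h * h = m" "\<And>c. c * m = m * c \<Longrightarrow> c * h = h * c"
    have "0 \<le> tr (star z * (h * z))" if z: "z \<in> A" for z
    proof -
      have "0 \<le> tr (star z * h * z)" by (intro tr_posop posop_conj h(2) mult_A star_A z B_A[OF h(1)])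
      then show ?thesis by (simp only: mult.assoc)
    qed
    then show ?thesis using h(1,3,4) posopD(1)[OF h(2)] by blast
  qed
  show "\<exists>h\<in>B. h * (m + e *\<^sub>R 1) = 1 \<and> (m + e *\<^sub>R 1) * h = 1"
    if m: "m \<in> B" "star m = m" "\<And>z. z \<in> B \<Longrightarrow> 0 \<le> tr (star z * (m * z))" and e: "0 < e"
  proof (rule posop_inverse[OF S.posop_trI[OF m] e])
    fix h assume h: "h * (m + e *\<^sub>R 1) = 1" "(m + e *\<^sub>R 1) * h = 1" "\<And>c. c * m = m * c \<Longrightarrow> c * h = h * c"
    have "h \<in> B" by (rule S.commuting_A[OF m(1)]) (rule h(3))
    then show ?thesis using h(1,2) by blast
  qed
  show "x \<in> B \<Longrightarrow> x \<in> span {w \<in> B. star w * w = 1 \<and> w * star w = 1}" by (rule S.span_unitaries)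
  show "sc \<i> \<in> B" by (rule S.sc_in_A)
  show "star (sc \<i>) = - sc \<i>" by (simp add: sc_minus)
  show "sc \<i> * sc \<i> = - 1" by (rule sc_ii)
  show "sc \<i> * x = x * sc \<i>" by (rule sc_commute)
  show "x \<in> A \<Longrightarrow> E x \<in> B" by (rule E_B)
  show "x \<in> A \<Longrightarrow> y \<in> B \<Longrightarrow> tr (star y * E x) = tr (star y * x)" by (rule E_tr_mult)
  show "\<exists>c d. x = c *\<^sub>R 1 + d *\<^sub>R sc \<i>" if x: "x \<in> A" "\<And>y. y \<in> B \<Longrightarrow> y * x = x * y"
  proof -
    have sa: "\<exists>c. a = sc c" if a: "a \<in> A" "star a = a" "\<And>y. y \<in> B \<Longrightarrow> y * a = a * y" for a
    proof (rule self_adjoint_unitary[OF a(1,2)])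
      fix w r assume w: "w \<in> A" "star w * w = 1" "w * star w = 1" "a = r *\<^sub>R (w + star w)"
        "\<And>c. c * a = a * c \<Longrightarrow> c * w = w * c"
      have comm: "w * y = y * w" if "y \<in> B" for y using w(5)[OF a(3)[OF that]] by simp
      have "w \<in> B" by (rule sing[OF w(1-3)]) (rule comm)
      then obtain c where "w = sc c" using centre comm by blast
      then have "a = sc (of_real r) * (sc c + sc (cnj c))" using w(4) by (simp add: sc_of_real)
      then show ?thesis by (metis sc_add sc_mult)
    qed
    obtain a b where ab: "a \<in> A" "b \<in> A" "star a = a" "star b = b" "x = a + sc \<i> * b"
      by (rule self_adjoint_parts[OF x(1)])
    have comm: "y * a = a * y" "y * b = b * y" if y: "y \<in> B" for y
    proof -
      have sx: "star x = a - sc \<i> * b" using ab sc_commute[of \<i> b] by (simp add: sc_minus)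
      have "y * x = x * y" by (rule x(2)[OF y])
      moreover have "y * star x = star x * y" using arg_cong[OF x(2)[OF S.star_A[OF y]], of star] by simp
      ultimately have "y * (x + star x) = (x + star x) * y" "y * (x - star x) = (x - star x) * y"
        by (simp_all only: distrib_left distrib_right left_diff_distrib right_diff_distrib)
      moreover have "x + star x = 2 *\<^sub>R a" "x - star x = 2 *\<^sub>R (sc \<i> * b)"
        using sx ab(5) by (simp_all add: scaleR_2)
      ultimately have 1: "y * a = a * y" "y * (sc \<i> * b) = sc \<i> * b * y" by simp_all
      show "y * a = a * y" by (rule 1)
      have "sc \<i> * (sc \<i> * (y * b)) = sc \<i> * (sc \<i> * (b * y))"
        using 1(2) by (metis mult.assoc sc_commute)
      then show "y * b = b * y" by (simp add: sc_ii flip: mult.assoc)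
    qed
    obtain c d where "a = sc c" "b = sc d" using sa[OF ab(1,3) comm(1)] sa[OF ab(2,4) comm(2)] by blast
    then have "x = sc (c + \<i> * d)" using ab(5) by (simp add: sc_add sc_mult)
    then show ?thesis using sc_eq by blast
  qed
qed

end

section \<open>Translation to the given definitions and conclusion\<close>

section \<open>Algebras of operators\<close>

definition ops :: "('h::chilbert_space \<Rightarrow>\<^sub>L 'h) set \<Rightarrow> 'h bop set"
  where "ops M = {x. rep x \<in> M}"

lemma mem_ops [simp]: "x \<in> ops M \<longleftrightarrow> rep x \<in> M"
  by (simp add: ops_def)

lemma rep_bop: "M \<subseteq> bounded_ops \<Longrightarrow> x \<in> M \<Longrightarrow> rep (bop x) = x"
  by (simp add: bop_inverse subsetD)

lemma rep_star: "rep (star x) = adj (rep x)"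
  by (rule rep_simps(8))

text \<open>A real quadratic form on a complex space forces self-adjointness: the form of \<i> times
  the skew part vanishes.\<close>

lemma nonneg_op_iff: "nonneg_op (rep z) \<longleftrightarrow> posop z"
proof -
  have im: "2 * Im (cinner (rep z \<xi>) \<xi>) = - form (sc \<i> * (z - star z)) \<xi>" for \<xi>
  proof -
    have "cinner (rep (star z) \<xi>) \<xi> = cnj (cinner (rep z \<xi>) \<xi>)"
      using cinner_star'[of \<xi> z \<xi>] cinner_commute by metis
    then show ?thesis by (simp add: form_def cinner_scaleC_left cinner_diff_left blinfun.diff_left)
  qed
  have sa: "star z = z" if "\<And>\<xi>. Im (cinner (rep z \<xi>) \<xi>) = 0"
  proof -
    have "sc \<i> * (z - star z) = 0"
    proof (rule form_eqI)
      show "star (sc \<i> * (z - star z)) = sc \<i> * (z - star z)"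
        using sc_commute[of \<i> z] sc_commute[of \<i> "star z"] by (simp add: sc_minus algebra_simps)
      show "form (sc \<i> * (z - star z)) \<xi> = form 0 \<xi>" for \<xi> using im[of \<xi>] that[of \<xi>] by simp
    qed simp
    then have "sc \<i> * (sc \<i> * (z - star z)) = 0" by simp
    then show ?thesis by (simp add: sc_ii flip: mult.assoc)
  qed
  show ?thesis
  proof
    assume "nonneg_op (rep z)"
    then show "posop z" using sa by (simp add: nonneg_op_def posop_def form_def)
  next
    assume z: "posop z"
    have "form (sc \<i> * (z - star z)) \<xi> = 0" for \<xi> using posopD(1)[OF z] by (simp add: form_def)
    then show "nonneg_op (rep z)"
      using im posopD(2)[OF z] rep[of z] by (simp add: nonneg_op_def form_def)
  qed
qed

lemma op_le_iff: "op_le (rep x) (rep y) \<longleftrightarrow> posop (y - x)"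
  unfolding op_le_def nonneg_op_iff[symmetric] by simp

lemma vn_algebra_ops:
  assumes M: "von_neumann_algebra M" shows "vn_algebra (ops M)"
proof
  note M' = M[unfolded von_neumann_algebra_def]
  show "1 \<in> ops M" using M' by simp
  fix x y :: "'a bop" and c
  show "x \<in> ops M \<Longrightarrow> y \<in> ops M \<Longrightarrow> x + y \<in> ops M" "x \<in> ops M \<Longrightarrow> y \<in> ops M \<Longrightarrow> x * y \<in> ops M"
    "x \<in> ops M \<Longrightarrow> sc c * x \<in> ops M" "x \<in> ops M \<Longrightarrow> star x \<in> ops M"
    using M' by (simp_all add: rep_star)
  assume bic: "\<And>c. (\<And>a. a \<in> ops M \<Longrightarrow> c * a = a * c) \<Longrightarrow> c * x = x * c"
  have "rep x o\<^sub>L T = T o\<^sub>L rep x" if T: "T \<in> commutant M" for T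
  proof -
    have r: "rep (bop T) = T" using T by (simp add: commutant_def bop_inverse)
    have "bop T * x = x * bop T"
    proof (rule bic)
      fix a assume "a \<in> ops M"
      then show "bop T * a = a * bop T" using T by (simp add: commutant_def r flip: rep_inject)
    qed
    then show ?thesis using r by (metis rep_simps(7))
  qed
  then have "rep x \<in> commutant (commutant M)" using rep[of x] by (simp add: commutant_def)
  then show "x \<in> ops M" using M' by simp
qed

lemma directed_rep: "directed (ops M) D \<longleftrightarrow> directed_in M (rep ` D)"
  unfolding directed_def directed_in_def self_adjoints_def
  by (auto simp: op_le_iff rep_star[symmetric] rep_inject)

lemma op_sup_rep:
  assumes M: "M \<subseteq> bounded_ops"
  shows "op_sup (ops M) D s \<longleftrightarrow> is_op_sup M (rep ` D) (rep s)"
proof -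
  have "(\<forall>t\<in>self_adjoints M. P t) \<longleftrightarrow> (\<forall>t\<in>ops M. star t = t \<longrightarrow> P (rep t))" for P
  proof
    assume *: "\<forall>t\<in>ops M. star t = t \<longrightarrow> P (rep t)"
    show "\<forall>t\<in>self_adjoints M. P t"
    proof
      fix t assume "t \<in> self_adjoints M"
      then have t: "t \<in> M" "adj t = t" "rep (bop t) = t" using M rep_bop by (auto simp: self_adjoints_def)
      then have "star (bop t) = bop t" by (metis rep_star rep_inject)
      then show "P t" using * t by (metis mem_ops)
    qed
  qed (auto simp: self_adjoints_def rep_star[symmetric])
  then show ?thesis
    unfolding op_sup_def is_op_sup_def
    by (auto simp: op_le_iff self_adjoints_def rep_star[symmetric] rep_inject)
qed

lemma (in vn_algebra) vn_traceI:
  fixes \<tau> :: "('h \<Rightarrow>\<^sub>L 'h) \<Rightarrow> complex"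
  assumes \<tau>: "normal_faithful_tracial_state M \<tau>" and M: "M \<subseteq> bounded_ops" and A: "A = ops M"
  shows "vn_trace A (\<lambda>x. Re (\<tau> (rep x)))"
    and "directed A D \<Longrightarrow> op_sup A D s \<Longrightarrow> Re (\<tau> (rep s)) = (SUP x\<in>D. Re (\<tau> (rep x)))"
proof -
  define tr where "tr x = Re (\<tau> (rep x))" for x
  note \<tau>' = \<tau>[unfolded normal_faithful_tracial_state_def]
  have MA: "rep x \<in> M" if "x \<in> A" for x using that A by simp
  have add: "\<tau> (rep (x + y)) = \<tau> (rep x) + \<tau> (rep y)" if "x \<in> A" "y \<in> A" for x y
    using \<tau>' MA that by simp
  have scl: "\<tau> (rep (sc c * x)) = c * \<tau> (rep x)" if "x \<in> A" for c x
    using \<tau>' MA that by simp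
  have comm: "\<tau> (rep (x * y)) = \<tau> (rep (y * x))" if "x \<in> A" "y \<in> A" for x y
    using \<tau>' MA that by simp
  have pos: "Im (\<tau> (rep (star x * x))) = 0" "0 \<le> Re (\<tau> (rep (star x * x)))" if "x \<in> A" for x
    using \<tau>' MA[OF that] by (auto simp: rep_star)
  have one: "\<tau> (rep 1) = 1" using \<tau>' by simp
  have faithful: "x = 0" if "x \<in> A" "\<tau> (rep (star x * x)) = 0" for x
    using \<tau>' MA[OF that(1)] that(2) by (auto simp: rep_star simp flip: rep_inject)
  have normal: "Re (\<tau> (rep s)) = (SUP x\<in>D. Re (\<tau> (rep x)))" if "directed A D" "op_sup A D s" for D s
  proof -
    have "directed_in M (rep ` D)" "is_op_sup M (rep ` D) (rep s)"
      using that directed_rep op_sup_rep[OF M] by (auto simp: A)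
    then have "Re (\<tau> (rep s)) = (SUP x\<in>rep ` D. Re (\<tau> x))" using \<tau>' by blast
    then show ?thesis by (simp add: image_image)
  qed
  show "directed A D \<Longrightarrow> op_sup A D s \<Longrightarrow> Re (\<tau> (rep s)) = (SUP x\<in>D. Re (\<tau> (rep x)))" by (rule normal)
  have diff: "tr (x - y) = tr x - tr y" if "x \<in> A" "y \<in> A" for x y
    using add[of "x - y" y] that diff_A by (simp add: tr_def)
  have posop: "0 \<le> tr x" if "x \<in> A" "posop x" for x
    by (rule posop_sqrt_A[OF that]) (use pos(2) posopD(1) in \<open>metis tr_def\<close>)
  have "vn_trace A tr"
  proof
    fix x y :: "'h bop" and r :: real
    show "x \<in> A \<Longrightarrow> y \<in> A \<Longrightarrow> tr (x + y) = tr x + tr y" by (simp add: tr_def add del: rep_simps)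
    show "x \<in> A \<Longrightarrow> tr (r *\<^sub>R x) = r * tr x"
      using scl[of x "of_real r"] by (simp add: tr_def sc_of_real del: rep_simps)
    show "x \<in> A \<Longrightarrow> y \<in> A \<Longrightarrow> tr (x * y) = tr (y * x)" unfolding tr_def by (simp only: comm)
    show "tr 1 = 1" unfolding tr_def one by simp
    show "x \<in> A \<Longrightarrow> 0 \<le> tr (star x * x)" unfolding tr_def by (rule pos)
    show "x \<in> A \<Longrightarrow> tr (star x * x) = 0 \<Longrightarrow> x = 0"
      unfolding tr_def using pos(1) by (intro faithful) (auto intro: complex_eqI)
    show "tr (star x) = tr x" if x: "x \<in> A"
    proof -
      have sx: "star x \<in> A" by (rule star_A[OF x])
      \<comment> \<open>Hermitian symmetry is not among the properties of the state. It follows from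
        reality of the state on \<open>star y * y\<close> and \<open>star x * x\<close>, with
        \<open>y\<close> equal to 1 plus \<i> times \<open>x\<close>.\<close>
      let ?y = "1 + sc \<i> * x"
      have y: "?y \<in> A" by (intro A_closed x)
      have "star ?y * ?y = 1 + (sc \<i> * x + (- sc \<i> * star x + star x * x))"
      proof -
        have "star ?y = 1 - sc \<i> * star x" using sc_commute[of \<i> "star x"] by (simp add: sc_minus)
        moreover have "sc \<i> * star x * (sc \<i> * x) = - (star x * x)"
        proof -
          have "sc \<i> * star x * (sc \<i> * x) = sc \<i> * sc \<i> * (star x * x)" by (metis mult.assoc sc_commute)
          then show ?thesis by (simp add: sc_ii)
        qed
        moreover have "(1 - k) * (1 + l) = 1 + (l + (- k - k * l))" for k l :: "'h bop"
          by (simp add: algebra_simps)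
        ultimately show ?thesis by simp
      qed
      moreover have "- sc \<i> * star x = sc (- \<i>) * star x" by (simp add: sc_minus)
      ultimately have "\<tau> (rep (star ?y * ?y)) =
          1 + (\<i> * \<tau> (rep x) + (- \<i> * \<tau> (rep (star x)) + \<tau> (rep (star x * x))))"
        using x sx by (simp only: add scl one A_closed)
      then show ?thesis using pos(1)[OF y] pos(1)[OF x] by (simp add: tr_def)
    qed
    show "(\<lambda>n. tr (X n)) \<longlonglongrightarrow> tr x"
      if X: "\<And>n. X n \<in> A" "\<And>n. star (X n) = X n" "\<And>n. posop (X (Suc n) - X n)" and x: "slim X x" for X x
    proof -
      have xA: "x \<in> A" by (rule slim_A[OF x X(1)])
      note dir = slim_op_sup[OF X x]
      have "tr (X n) \<le> tr x" for n
        using posop[of "x - X n"] diff[OF xA X(1)] diff_A[OF xA X(1)] dir(2) by (auto simp: op_sup_def)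
      then have bdd: "bdd_above (range (\<lambda>n. tr (X n)))" by (intro bdd_aboveI2)
      have inc: "incseq (\<lambda>n. tr (X n))"
        using posop[OF diff_A[OF X(1) X(1)] X(3)] diff[OF X(1) X(1)] by (intro incseq_SucI) (metis diff_ge_0_iff_ge)
      have "tr x = (SUP n. tr (X n))"
        using normal[OF dir] by (simp add: tr_def image_image)
      then show ?thesis using LIMSEQ_incseq_SUP[OF bdd inc] by simp
    qed
  qed
  then show "vn_trace A (\<lambda>x. Re (\<tau> (rep x)))" unfolding tr_def .
qed

text \<open>\<open>cond_exp\<close> is a definite description, so existence and uniqueness are both
  due. Bimodularity and trace invariance already force the inner products that characterise
  \<open>E\<close>.\<close>

theorem (in vn_pair) cond_exp_eq:
  fixes \<tau> :: "('h \<Rightarrow>\<^sub>L 'h) \<Rightarrow> complex"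
  assumes \<tau>: "normal_faithful_tracial_state M \<tau>" and M: "M \<subseteq> bounded_ops"
    and A: "A = ops M" and tr: "tr = (\<lambda>x. Re (\<tau> (rep x)))" and B: "B = ops Q"
    and normal: "\<And>D s. directed A D \<Longrightarrow> op_sup A D s \<Longrightarrow> tr s = (SUP x\<in>D. tr x)"
    and Q: "Q \<subseteq> M" and x: "x \<in> A"
  shows "cond_exp M \<tau> Q (rep x) = rep (E x)"
proof -
  define F where "F = restrict (\<lambda>x. rep (E (bop x))) M"
  note \<tau>' = \<tau>[unfolded normal_faithful_tracial_state_def]
  have F: "F (rep x) = rep (E x)" if "x \<in> A" for x
    using that by (simp add: F_def A rep_inverse)
  have lift: "\<exists>y\<in>A. x = rep y" if "x \<in> M" for x
    using rep_bop[OF M that] that by (intro bexI[of _ "bop x"]) (auto simp: A)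
  have liftB: "\<exists>y\<in>B. x = rep y" if "x \<in> Q" for x
    using rep_bop[OF M] that Q by (intro bexI[of _ "bop x"]) (auto simp: B)
  have im: "Im (\<tau> (rep x)) = - tr (sc \<i> * x)" if "x \<in> A" for x
    using \<tau>' that by (simp add: tr A)
  have unique: "G = F" if G: "is_cond_exp M \<tau> Q G" for G
  proof (rule PiE_ext[of _ M "\<lambda>_. Q"])
    have G1: "G \<in> M \<rightarrow>\<^sub>E Q" and G2: "\<forall>x\<in>M. \<forall>a\<in>Q. \<forall>b\<in>Q. G (a o\<^sub>L x o\<^sub>L b) = a o\<^sub>L G x o\<^sub>L b"
      and G3: "\<forall>x\<in>M. \<tau> (G x) = \<tau> x"
      using G unfolding is_cond_exp_def by - (elim conjE, assumption)+
    show "G \<in> M \<rightarrow>\<^sub>E Q" by (rule G1)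
    show "F \<in> M \<rightarrow>\<^sub>E Q"
      using E_B lift F by (fastforce simp: F_def A B)
    fix z assume z: "z \<in> M"
    then obtain x where x: "x \<in> A" "z = rep x" using lift by blast
    obtain e where e: "e \<in> B" "G z = rep e" using liftB[OF PiE_mem[OF G1 z]] by blast
    have "E x = e"
    proof (rule E_unique[OF x(1) e(1)])
      fix y assume y: "y \<in> B"
      have yQ: "rep (star y) \<in> Q" using S.star_A[OF y] by (simp add: B)
      have idQ: "id_blinfun \<in> Q" using S.one_A by (simp add: B)
      have M2: "rep (star y * x) \<in> M" using mult_A[OF star_A[OF B_A[OF y]] x(1)] by (simp only: A mem_ops)
      have "G (rep (star y) o\<^sub>L z o\<^sub>L id_blinfun) = rep (star y) o\<^sub>L G z o\<^sub>L id_blinfun"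
        using G2 z yQ idQ by blast
      moreover have "r o\<^sub>L id_blinfun = r" for r :: "'h \<Rightarrow>\<^sub>L 'h" by (rule blinfun_eqI) simp
      ultimately have "G (rep (star y * x)) = rep (star y * e)" using e(2) x(2) by simp
      moreover have "\<tau> (G (rep (star y * x))) = \<tau> (rep (star y * x))" using G3 M2 by blast
      ultimately show "T.ip e y = T.ip x y" unfolding T.ip_def by (simp add: tr)
    qed
    then show "G z = F z" using e F[OF x(1)] x(2) by simp
  qed
  have "is_cond_exp M \<tau> Q F"
    unfolding is_cond_exp_def
  proof (intro conjI ballI allI impI)
    show "F \<in> M \<rightarrow>\<^sub>E Q" using E_B lift F by (fastforce simp: F_def A B)
    fix x assume "x \<in> M"
    then obtain x' where x': "x' \<in> A" "x = rep x'" using lift by blast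
    show "F (scalar_op c o\<^sub>L x) = scalar_op c o\<^sub>L F x" for c
      using F[OF sc_A[OF x'(1)], of c] F[OF x'(1)] E_sc[OF x'(1)] x'(2) by simp
    have sx: "star x' * x' \<in> A" "adj x o\<^sub>L x = rep (star x' * x')"
      using x' star_A mult_A by (auto simp: rep_star)
    show "nonneg_op (F (adj x o\<^sub>L x))"
      unfolding sx(2) F[OF sx(1)] nonneg_op_iff by (rule E_posop[OF sx(1) posop_star_mult])
    show "x = 0" if "F (adj x o\<^sub>L x) = 0"
    proof -
      have "E (star x' * x') = 0" using that F[OF sx(1)] sx(2) by (simp flip: rep_inject)
      then have "tr (star x' * x') = 0" using E_tr[OF sx(1)] tr_zero by simp
      then show ?thesis using tr_faithful[OF x'(1)] x'(2) by simp
    qed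
    show "\<tau> (F x) = \<tau> x"
    proof (rule complex_eqI)
      show "Re (\<tau> (F x)) = Re (\<tau> x)" using E_tr[OF x'(1)] F[OF x'(1)] x'(2) by (simp add: tr)
      show "Im (\<tau> (F x)) = Im (\<tau> x)"
        using E_tr[OF sc_A[OF x'(1)], of \<i>] F[OF x'(1)] x'(2) im[OF x'(1)] im[OF E_A[OF x'(1)]] E_sc[OF x'(1)]
        by simp
    qed
    show "F (x + y) = F x + F y" if y: "y \<in> M" for y
    proof -
      obtain y' where y': "y' \<in> A" "y = rep y'" using lift[OF y] by blast
      show ?thesis using F[OF add_A[OF x'(1) y'(1)]] F[OF x'(1)] F[OF y'(1)] E_add[OF x'(1) y'(1)] x'(2) y'(2)
        by simp
    qed
    show "F (a o\<^sub>L x o\<^sub>L b) = a o\<^sub>L F x o\<^sub>L b" if ab: "a \<in> Q" "b \<in> Q" for a b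
    proof -
      obtain a' b' where ab: "a' \<in> B" "a = rep a'" "b' \<in> B" "b = rep b'"
        using liftB[OF ab(1)] liftB[OF ab(2)] by blast
      have "a' * x' * b' \<in> A" by (intro mult_A B_A ab x')
      from F[OF this] show ?thesis using F[OF x'(1)] E_bimodule[OF x'(1) ab(1,3)] ab(2,4) x'(2) by simp
    qed
  next
    fix b assume "b \<in> Q"
    then obtain b' where "b' \<in> B" "b = rep b'" using liftB by blast
    then show "F b = b" using F[OF B_A] E_id by simp
  next
    fix D s assume D: "directed_in M D" and s: "is_op_sup M D s"
    define D' where "D' = {x. rep x \<in> D}"
    have "D \<subseteq> M" "s \<in> M" using D s by (auto simp: directed_in_def is_op_sup_def self_adjoints_def)
    then obtain s' where s': "s' \<in> A" "s = rep s'" using lift by blast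
    have D': "D = rep ` D'" using lift \<open>D \<subseteq> M\<close> by (fastforce simp: D'_def)
    have DA: "D' \<subseteq> A" using \<open>D \<subseteq> M\<close> by (auto simp: D'_def A)
    have "op_sup B (E ` D') (E s')"
    proof (rule E_op_sup[OF normal])
      show "directed A D'" "op_sup A D' s'"
        using D s D' s' directed_rep op_sup_rep[OF M] by (auto simp: A)
    qed
    then have "is_op_sup Q (rep ` E ` D') (rep (E s'))"
      using op_sup_rep Q M unfolding B by blast
    moreover have "rep ` E ` D' = F ` D" unfolding D' image_image
      by (rule image_cong) (use F DA in auto)
    ultimately show "is_op_sup Q (F ` D) (F s)" using F[OF s'(1)] s'(2) by simp
  qed
  then have "cond_exp M \<tau> Q = F"
    unfolding cond_exp_def using unique by (rule the_equality)
  then show ?thesis using F[OF x] by simp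
qed

theorem corollary3p5:
  fixes M N :: "('h::chilbert_space \<Rightarrow>\<^sub>L 'h) set"
    and \<tau> :: "('h \<Rightarrow>\<^sub>L 'h) \<Rightarrow> complex"
  assumes "II1_factor M"
    and "normal_faithful_tracial_state M \<tau>"
    and "subfactor N M"
    and "singular M N"
  shows "strongly_singular M \<tau> (1/13) N"
proof -
  have vM: "von_neumann_algebra M" and vN: "von_neumann_algebra N" and NM: "N \<subseteq> M" and fN: "factor N"
    using assms(3) by (auto simp: subfactor_def von_neumann_subalgebra_def)
  have Mb: "M \<subseteq> bounded_ops" using vM by (simp add: von_neumann_algebra_def)
  define tr where "tr x = Re (\<tau> (rep x))" for x
  interpret A: vn_algebra "ops M" by (rule vn_algebra_ops[OF vM])
  have tr: "tr = (\<lambda>x. Re (\<tau> (rep x)))" by (simp add: tr_def fun_eq_iff)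
  note trace = A.vn_traceI[OF assms(2) Mb refl, folded tr_def]
  interpret A: vn_trace "ops M" tr using trace(1) unfolding tr .
  interpret B: vn_algebra "ops N" by (rule vn_algebra_ops[OF vN])
  interpret P: vn_pair "ops M" tr "ops N"
    by unfold_locales (use NM in auto)
  have normal: "tr s = (SUP x\<in>D. tr x)" if "directed (ops M) D" "op_sup (ops M) D s" for D s
    by (rule trace(2)[OF that])
  have EN: "cond_exp M \<tau> N (rep x) = rep (P.E x)" if "x \<in> ops M" for x
    by (rule P.cond_exp_eq[OF assms(2) Mb refl tr refl normal NM that])
  have norm2: "norm2 \<tau> (rep x) = A.T.n2 x" for x
    by (simp add: norm2_def A.T.n2_def A.T.ip_def tr_def rep_star)
  have unit: "rep v \<in> unitaries M" if "v \<in> ops M" "star v * v = 1" "v * star v = 1" for v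
    using that unfolding unitaries_def mem_Collect_eq mem_ops by (metis rep_simps(2,7) rep_star)
  \<comment> \<open>Both inclusions are needed because singularity speaks of equality of
    \<open>N\<close> with its conjugate.\<close>
  have sing: "v \<in> ops N" if v: "v \<in> ops M" "star v * v = 1" "v * star v = 1"
    "\<And>n. n \<in> ops N \<Longrightarrow> v * n * star v \<in> ops N" "\<And>n. n \<in> ops N \<Longrightarrow> star v * n * v \<in> ops N" for v
  proof -
    have lift: "\<exists>y\<in>ops N. x = rep y" if "x \<in> N" for x
      using rep_bop[OF Mb, of x] that NM by (intro bexI[of _ "bop x"]) auto
    have "unitary_conj (rep v) N = N"
    proof
      show "unitary_conj (rep v) N \<subseteq> N"
        unfolding unitary_conj_def
      proof (rule image_subsetI)
        fix x assume "x \<in> N"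
        then obtain y where y: "y \<in> ops N" "x = rep y" using lift by blast
        then show "rep v o\<^sub>L x o\<^sub>L adj (rep v) \<in> N" using v(4)[OF y(1)] by (simp add: rep_star)
      qed
      show "N \<subseteq> unitary_conj (rep v) N"
      proof
        fix x assume "x \<in> N"
        then obtain y where y: "y \<in> ops N" "x = rep y" using lift by blast
        have "v * (star v * y * v) * star v = (v * star v) * y * (v * star v)" by (simp only: mult.assoc)
        then have "y = v * (star v * y * v) * star v" using v(3) by simp
        then have "x = rep v o\<^sub>L rep (star v * y * v) o\<^sub>L adj (rep v)" using y(2) by (metis rep_simps(7) rep_star)
        then show "x \<in> unitary_conj (rep v) N" using v(5)[OF y(1)] unfolding unitary_conj_def by auto
      qed
    qed
    then show ?thesis using assms(4) unit[OF v(1-3)] by (simp add: singular_def)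
  qed
  interpret I: irreducible_inclusion "ops M" tr "ops N" P.E "sc \<i>"
  proof (rule P.irreducible_inclusionI)
    show "v \<in> ops N" if v: "v \<in> ops M" "star v * v = 1" "v * star v = 1"
      "\<And>n. n \<in> ops N \<Longrightarrow> v * n = n * v" for v
    proof (rule sing[OF v(1-3)])
      fix n assume n: "n \<in> ops N"
      have "v * n * star v = n * (v * star v)" using v(4)[OF n] by (simp only: mult.assoc)
      then show "v * n * star v \<in> ops N" using v(3) n by simp
      have "star v * n * v = star v * v * n" using v(4)[OF n] by (simp only: mult.assoc)
      then show "star v * n * v \<in> ops N" using v(2) n by simp
    qed
    show "\<exists>c. z = sc c" if z: "z \<in> ops N" "\<And>n. n \<in> ops N \<Longrightarrow> z * n = n * z" for z
    proof -
      have "rep z o\<^sub>L x = x o\<^sub>L rep z" if x: "x \<in> N" for x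
        using z(2)[of "bop x"] rep_bop[OF Mb] x NM by (metis mem_ops rep_simps(7) subsetD)
      then have "rep z \<in> N \<inter> commutant N" using z(1) rep[of z] by (simp add: commutant_def)
      then obtain c where "rep z = scalar_op c" using fN by (auto simp: factor_def)
      then show ?thesis by (metis rep_inject rep_sc)
    qed
  qed
  show ?thesis
    unfolding strongly_singular_def
  proof (intro conjI ballI)
    fix v assume v: "v \<in> unitaries M"
    define u where "u = bop v"
    have vu: "v = rep u" using v rep_bop[OF Mb] by (simp add: u_def unitaries_def)
    have u: "u \<in> ops M" "star u * u = 1" "u * star u = 1"
      using v by (simp_all add: unitaries_def vu rep_star flip: rep_inject)
    define Q where "Q = unitary_conj v N"
    have Qmem: "rep x \<in> Q \<longleftrightarrow> star u * x * u \<in> ops N" for x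
    proof
      assume "rep x \<in> Q"
      then obtain n where n: "n \<in> N" "rep x = v o\<^sub>L n o\<^sub>L adj v" by (auto simp: Q_def unitary_conj_def)
      have "rep (bop n) = n" using n(1) NM rep_bop[OF Mb] by blast
      then have "rep x = rep (u * bop n * star u)" using n(2) by (simp add: vu rep_star)
      then have "x = u * bop n * star u" by (simp only: rep_inject)
      then have "star u * x * u = (star u * u) * bop n * (star u * u)" by (simp only: mult.assoc)
      then show "star u * x * u \<in> ops N" using u(2) n(1) \<open>rep (bop n) = n\<close> by simp
    next
      assume *: "star u * x * u \<in> ops N"
      have "u * (star u * x * u) * star u = (u * star u) * x * (u * star u)" by (simp only: mult.assoc)
      then have "x = u * (star u * x * u) * star u" using u(3) by simp
      then have "rep x = v o\<^sub>L rep (star u * x * u) o\<^sub>L adj v" by (metis vu rep_simps(7) rep_star)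
      then show "rep x \<in> Q" using * unfolding Q_def unitary_conj_def by auto
    qed
    then have opsQ: "ops Q = {x. star u * x * u \<in> ops N}" by (auto simp: ops_def)
    interpret Q: vn_algebra "ops Q" unfolding opsQ by (rule B.conj_vn_algebra[OF u(2,3)])
    have QM': "x \<in> ops M" if "x \<in> ops Q" for x
    proof -
      have "u * (star u * x * u) * star u = (u * star u) * x * (u * star u)" by (simp only: mult.assoc)
      then have "x = u * (star u * x * u) * star u" unfolding u(3) mult_1_left mult_1_right by (rule sym)
      moreover have "u * (star u * x * u) * star u \<in> ops M"
        by (intro A.mult_A A.star_A u P.B_A) (use that opsQ in blast)
      ultimately show ?thesis by metis
    qed
    interpret R: vn_pair "ops M" tr "ops Q" by unfold_locales (rule QM')
    have QM: "Q \<subseteq> M"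
    proof
      fix x assume x: "x \<in> Q"
      then obtain n where n: "n \<in> N" "x = v o\<^sub>L n o\<^sub>L adj v" by (auto simp: Q_def unitary_conj_def)
      have "rep (bop n) = n" using n(1) NM rep_bop[OF Mb] by blast
      then have "x = rep (u * bop n * star u)" using n(2) by (simp add: vu rep_star)
      then show "x \<in> M" using QM' x by (metis mem_ops)
    qed
    have EQ: "cond_exp M \<tau> Q (rep x) = rep (R.E x)" if "x \<in> ops M" for x
      by (rule R.cond_exp_eq[OF assms(2) Mb refl tr refl normal QM that])
    define L where "L = norm_inf2 M \<tau> (\<lambda>x. cond_exp M \<tau> N x - cond_exp M \<tau> Q x)"
    have L: "ereal (A.T.n2 (P.E x - R.E x)) \<le> L" if x: "x \<in> ops M" "norm x \<le> 1" for x
    proof -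
      have "cond_exp M \<tau> N (rep x) - cond_exp M \<tau> Q (rep x) = rep (P.E x - R.E x)"
        using EN[OF x(1)] EQ[OF x(1)] by simp
      then have "A.T.n2 (P.E x - R.E x) = norm2 \<tau> (cond_exp M \<tau> N (rep x) - cond_exp M \<tau> Q (rep x))"
        using norm2 by metis
      moreover have "rep x \<in> {x \<in> M. norm x \<le> 1}" using x by (simp add: norm_bop_def)
      ultimately show ?thesis unfolding L_def norm_inf2_def by (intro SUP_upper2[of "rep x"]) simp_all
    qed
    define d where "d = A.T.n2 (u - P.E u)"
    have uE: "u - P.E u \<in> ops M" by (intro A.diff_A u P.E_A)
    have d0: "0 \<le> d" unfolding d_def using uE by simp
    have uu: "A.T.unitary u" by (rule A.T.unitaryI[OF u(2,3)])
    have "A.T.n2 u = 1" using A.T.n2_unitary_left[OF u(1) uu A.one_A] A.T.n2_one by simp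
    then have d1: "d \<le> 1" using P.E_closest[OF u(1) B.zero_A] by (simp add: d_def)
    have "ereal (d / 13) \<le> L"
    proof (rule ccontr)
      assume "\<not> ereal (d / 13) \<le> L"
      then have Ld: "L < ereal (d / 13)" by simp
      have small: "A.T.n2 (P.E x - R.E x) \<le> d / 13" if "x \<in> ops M" "norm x \<le> 1" for x
        using order.strict_trans1[OF L[OF that] Ld] by simp
      have unorm: "norm w \<le> 1" if "w \<in> ops M" "star w * w = 1" "w * star w = 1" for w
        by (rule A.T.norm_unitary_le[OF that(1) A.T.unitaryI[OF that(2,3)]])
      have "d \<le> d / 13"
        unfolding d_def
      proof (rule I.singular_distance[OF _ u(1) uu])
        show "0 \<le> A.T.n2 (u - P.E u) / 13" "A.T.n2 (u - P.E u) / 13 \<le> 1 / 13"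
          using d0 d1 by (simp_all add: d_def)
        show "v \<in> ops N" if "v \<in> ops M" "A.T.unitary v" "\<And>n. n \<in> ops N \<Longrightarrow> v * n * star v \<in> ops N"
          "\<And>n. n \<in> ops N \<Longrightarrow> star v * n * v \<in> ops N" for v
          by (rule sing[OF that(1) A.T.unitary_simps(1,2)[OF that(2)] that(3,4)])
        fix w assume w: "w \<in> I.Uni"
        then have wN: "w \<in> ops N" and ww: "star w * w = 1" "w * star w = 1"
          unfolding I.Uni_eq by blast+
        have wM: "w \<in> ops M" by (rule P.B_A[OF wN])
        \<comment> \<open>This conjugate is fixed by the expectation onto \<open>Q\<close>, so its
          distance to \<open>N\<close> is a value of the difference of the two expectations.\<close>
        have "u * w * star u \<in> ops Q"
        proof -
          have "star u * (u * w * star u) * u = (star u * u) * w * (star u * u)" by (simp only: mult.assoc)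
          then have "star u * (u * w * star u) * u = w" unfolding u(2) mult_1_left mult_1_right .
          then show ?thesis unfolding opsQ using wN by (metis mem_Collect_eq)
        qed
        then have "R.E (u * w * star u) = u * w * star u" by (rule R.E_id)
        moreover have x: "u * w * star u \<in> ops M" by (intro A.mult_A A.star_A u wM)
        moreover have "A.T.unitary (u * w * star u)"
          by (intro A.T.unitary_mult A.T.unitary_star uu A.T.unitaryI ww)
        then have "norm (u * w * star u) \<le> 1" by (rule A.T.norm_unitary_le[OF x])
        ultimately show "A.T.n2 (u * w * star u - P.E (u * w * star u)) \<le> A.T.n2 (u - P.E u) / 13"
          using small[OF x] A.T.n2_minus_commute[OF x P.E_A[OF x]] by (simp add: d_def)
        have x': "star u * w * u \<in> ops M" by (intro A.mult_A A.star_A u wM)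
        have RE: "R.E w \<in> ops M" by (rule R.E_A[OF wM])
        \<comment> \<open>Conjugation by \<open>star u\<close> carries \<open>Q\<close> to
          \<open>N\<close>, so the distance of \<open>star u * w * u\<close> to \<open>N\<close> is
          at most that of \<open>w\<close> to \<open>Q\<close>; for \<open>w\<close> in
          \<open>N\<close> this is again a value of the difference.\<close>
        have "star u * R.E w * u \<in> ops N" using R.E_B[OF wM] opsQ by blast
        then have "A.T.n2 (star u * w * u - P.E (star u * w * u)) \<le>
            A.T.n2 (star u * w * u - star u * R.E w * u)" by (rule P.E_closest[OF x'])
        also have "star u * w * u - star u * R.E w * u = star u * (w - R.E w) * u"
          by (simp add: right_diff_distrib left_diff_distrib)
        also have "A.T.n2 \<dots> = A.T.n2 (w - R.E w)"
          using uu u(1) wM RE A.diff_A[OF wM RE] A.star_A[OF u(1)]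
          by (simp only: A.T.n2_unitary_right A.T.n2_unitary_left A.T.unitary_star A.mult_A)
        also have "\<dots> \<le> A.T.n2 (u - P.E u) / 13"
          using small[OF wM unorm[OF wM ww]] P.E_id[OF wN] by (simp add: d_def)
        finally show "A.T.n2 (star u * w * u - P.E (star u * w * u)) \<le> A.T.n2 (u - P.E u) / 13" .
      qed
      \<comment> \<open>The bound \<open>d \<le> d / 13\<close> alone does not exclude
        \<open>d = 0\<close>; nonnegativity of \<open>L\<close> does.\<close>
      moreover have "0 \<le> L"
        using L[of 0] A.zero_A P.E_id[OF B.zero_A] R.E_id[OF Q.zero_A] by (simp add: zero_ereal_def)
      then have "0 < ereal (d / 13)" using Ld by (rule order.strict_trans1)
      ultimately show False by simp
    qed
    moreover have "norm2 \<tau> (v - cond_exp M \<tau> N v) = d"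
      using norm2[of "u - P.E u"] EN[OF u(1)] by (simp add: d_def vu)
    ultimately show "ereal (1 / 13 * norm2 \<tau> (v - cond_exp M \<tau> N v)) \<le>
        norm_inf2 M \<tau> (\<lambda>x. cond_exp M \<tau> N x - cond_exp M \<tau> (unitary_conj v N) x)"
      by (simp add: L_def Q_def)
  qed simp_all
qed

end
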